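(* Let $m\geq2$ and let $\Omega\subseteq\mathbb{R}^m$ be a non-empty open set. If $1<p\leq 1^*=\frac{m}{m-1}$ and $\Omega$ satisfies the $(p,1)$-Poincaré inequality, then the operator $$\mathrm{div}:C_0(\Omega;\mathbb{R}^m)\to BV_{p,\mathrm{cst}}(\Omega)[\mathcal{W}_{p,TV}]^*$$ is surjective. In particular, if $f\in L_{q,\#}(\Omega)$, where $q$ is the Hölder conjugate exponent of $p$, and $\varepsilon>0$, then there exists $v\in C_0(\Omega;\mathbb{R}^m)$ such that $\mathrm{div}\,v=f$ and $\|v\|_\infty\leq(1+\varepsilon)\cdot\|f\|_{L_q}$.
   Context: $\mathcal{L}^m$ is Lebesgue measure. $C_0(\Omega;\mathbb{R}^m)$ is the space of continuous vector fields on $\Omega$ vanishing at infinity (for each $\varepsilon>0$, $|v|_2<\varepsilon$ off a compact subset of $\Omega$), normed by $\|v\|_\infty=\sup_x|v(x)|_2$. $BV_p(\Omega)$ is the space of $u\in L_p(\Omega)$ whose distributional partial derivatives are signed Borel measures $D_1u,\dots,D_mu$ on $\Omega$; $\|Du\|(\Omega)=\sup\{\int_\Omega u\,\mathrm{div}\,v\,d\mathcal{L}^m:v\in C_c^\infty(\Omega;\mathbb{R}^m),\|v\|_\infty\leq1\}$ is the total variation. $BV_{p,\mathrm{cst}}(\Omega)$ is the quotient of $BV_p(\Omega)$ by its subspace of a.e. constant functions (so it equals $BV_p(\Omega)$ if $\mathcal{L}^m(\Omega)=\infty$), with elements denoted $[u]$; $L_{p,\mathrm{cst}}(\Omega)$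 is likewise the quotient of $L_p(\Omega)$ by its a.e. constant members. $L_{q,\#}(\Omega)=\{f\in L_q(\Omega):\int_\Omega f\,d\mathcal{L}^m=0\}$ if $\mathcal{L}^m(\Omega)<\infty$, and $L_{q,\#}(\Omega)=L_q(\Omega)$ if $\mathcal{L}^m(\Omega)=\infty$. $\Omega$ satisfies the $(p,1)$-Poincaré inequality if there is a constant $c_p(\Omega)>0$ such that for every $u\in C^\infty(\Omega)\cap L_p(\Omega)$ there is $y\in\mathbb{R}$ with $\|u-y\mathbf{1}_\Omega\|_{L_p(\Omega)}\leq c_p(\Omega)\|\nabla u\|_{L_1(\Omega)}$. $\mathcal{W}_{p,TV}$ is the localized locally convex topology on $BV_{p,\mathrm{cst}}(\Omega)$ associated with the restriction of the weak topology $\sigma(L_{p,\mathrm{cst}}(\Omega),L_{q,\#}(\Omega))$ and the sets $C_k=\{[u]:\|Du\|(\Omega)\leq k\}$, $k\in\mathbb{N}$: its closed sets are exactly those whose intersection with each $C_k$ is closed for the weak topology. A linear form $F:BV_{p,\mathrm{cst}}(\Omega)\to\mathbb{R}$ is $\mathcal{W}_{p,TV}$-continuous, i.e. belongs to $BV_{p,\mathrm{cst}}(\Omega)[\mathcal{W}_{p,TV}]^*$, if and only if for every $\varepsilon>0$ there is a finite set $E\subset L_{q,\#}(\Omega)$ such that $|\langle[u],F\rangle|\leq\max_{f\in E}|\int_\Omega uf\,d\mathcal{L}^m|+\varepsilon\|Du\|(\Omega)$ for all $[u]$. The operator is $\langle[u],\mathrm{div}\,v\rangle=-\sum_{i=1}^m\int_\Omega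 v_i\,d(D_iu)$, and $f\in L_{q,\#}(\Omega)$ is identified with the linear form $[u]\mapsto\int_\Omega uf\,d\mathcal{L}^m$.
   Formalization: The printed bound is false on large balls; it is proved with the Poincaré constant included, ‖v‖_∞ ≤ (1+ε)·c·‖f‖_{L_q}, for every constant c admissible in the (p,1)-Poincaré inequality. *)

theory Defs
  imports "HOL-Analysis.Analysis"
begin

section \<open>Smooth functions and test functions\<close>

definition partial_deriv :: "'n \<Rightarrow> (real^'n \<Rightarrow> real) \<Rightarrow> real^'n \<Rightarrow> real" where
  "partial_deriv i f x = frechet_derivative f (at x) (axis i 1)"

primrec iter_partial_deriv :: "'n list \<Rightarrow> (real^'n \<Rightarrow> real) \<Rightarrow> real^'n \<Rightarrow> real" where
  "iter_partial_deriv [] f = f"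
| "iter_partial_deriv (i # is) f = partial_deriv i (iter_partial_deriv is f)"

text \<open>Used for open \<open>U\<close> only: all iterated partial derivatives are differentiable, hence also
  continuous, at every point of \<open>U\<close>.\<close>

definition smooth_fun_on :: "(real^'n) set \<Rightarrow> (real^'n \<Rightarrow> real) \<Rightarrow> bool" where
  "smooth_fun_on U f \<longleftrightarrow> (\<forall>is. \<forall>x\<in>U. iter_partial_deriv is f differentiable (at x))"

definition grad :: "(real^'n \<Rightarrow> real) \<Rightarrow> real^'n \<Rightarrow> real^'n" where
  "grad f x = (\<chi> i. partial_deriv i f x)"

text \<open>Elements of \<open>C\<^sub>c\<^sup>\<infinity>(\<Omega>)\<close> are represented by their extensions by zero to the whole space.\<close>

definition test_functions :: "(real^'n) set \<Rightarrow> (real^'n \<Rightarrow> real) set" where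
  "test_functions \<Omega> = {\<phi>. smooth_fun_on UNIV \<phi> \<and>
     (\<exists>K. compact K \<and> K \<subseteq> \<Omega> \<and> (\<forall>x. x \<notin> K \<longrightarrow> \<phi> x = 0))}"

definition test_fields :: "(real^'n) set \<Rightarrow> (real^'n \<Rightarrow> real^'n) set" where
  "test_fields \<Omega> = {v. \<forall>i. (\<lambda>x. v x $ i) \<in> test_functions \<Omega>}"

definition classical_div :: "(real^'n \<Rightarrow> real^'n) \<Rightarrow> real^'n \<Rightarrow> real" where
  "classical_div v x = (\<Sum>i\<in>UNIV. partial_deriv i (\<lambda>y. v y $ i) x)"

section \<open>Continuous vector fields vanishing at infinity\<close>

definition C0_fields :: "(real^'n) set \<Rightarrow> (real^'n \<Rightarrow> real^'n) set" where
  "C0_fields \<Omega> = {v. continuous_on \<Omega> v \<and>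
     (\<forall>\<epsilon>>0. \<exists>K. compact K \<and> K \<subseteq> \<Omega> \<and> (\<forall>x\<in>\<Omega> - K. norm (v x) < \<epsilon>))}"

definition sup_norm :: "(real^'n) set \<Rightarrow> (real^'n \<Rightarrow> real^'n) \<Rightarrow> real" where
  "sup_norm \<Omega> v = (SUP x\<in>\<Omega>. norm (v x))"

section \<open>Lebesgue spaces\<close>

text \<open>Members of these spaces are functions, not classes; only their values on \<open>\<Omega>\<close> matter.
  Classes enter with \<open>cst_class\<close> below.\<close>

definition Lp_space :: "real \<Rightarrow> (real^'n) set \<Rightarrow> (real^'n \<Rightarrow> real) set" where
  "Lp_space p \<Omega> = {u \<in> borel_measurable (lebesgue_on \<Omega>).
     integrable (lebesgue_on \<Omega>) (\<lambda>x. \<bar>u x\<bar> powr p)}"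

definition Lp_norm :: "real \<Rightarrow> (real^'n) set \<Rightarrow> (real^'n \<Rightarrow> real) \<Rightarrow> real" where
  "Lp_norm p \<Omega> u = (\<integral>x. \<bar>u x\<bar> powr p \<partial>lebesgue_on \<Omega>) powr (1 / p)"

definition Lq_sharp :: "real \<Rightarrow> (real^'n) set \<Rightarrow> (real^'n \<Rightarrow> real) set" where
  "Lq_sharp q \<Omega> = {f \<in> Lp_space q \<Omega>.
     emeasure lebesgue \<Omega> < \<infinity> \<longrightarrow> (\<integral>x. f x \<partial>lebesgue_on \<Omega>) = 0}"

text \<open>The inequality \<open>\<parallel>u - y\<parallel>\<^sub>p \<le> c \<parallel>\<nabla>u\<parallel>\<^sub>1\<close> in the extended half-line. Requiring
  \<open>u - y \<in> L\<^sub>p\<close> loses nothing: if the right-hand side is infinite, \<open>y = 0\<close> is admissible.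
  The constant \<open>c\<close> is kept as a parameter because \<open>c \<parallel>f\<parallel>\<^sub>q\<close> bounds the norm of \<open>f\<close> as a linear
  form on \<open>BV_cst\<close>: on large balls (if \<open>p < m / (m - 1)\<close>) there are \<open>f\<close> for which no
  solution \<open>v\<close> of \<open>div v = f\<close> satisfies \<open>\<parallel>v\<parallel>\<^sub>\<infinity> \<le> (1 + \<epsilon>) \<parallel>f\<parallel>\<^sub>q\<close>.\<close>

definition poincare_ineq :: "real \<Rightarrow> (real^'n) set \<Rightarrow> real \<Rightarrow> bool" where
  "poincare_ineq p \<Omega> c \<longleftrightarrow> c > 0 \<and>
     (\<forall>u\<in>Lp_space p \<Omega>. smooth_fun_on \<Omega> u \<longrightarrow>
       (\<exists>y. (\<lambda>x. u x - y) \<in> Lp_space p \<Omega> \<and>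
         ennreal (Lp_norm p \<Omega> (\<lambda>x. u x - y))
           \<le> ennreal c * (\<integral>\<^sup>+x. ennreal (norm (grad u x)) \<partial>lebesgue_on \<Omega>)))"

section \<open>Signed measures\<close>

definition borel_subsets :: "(real^'n) set \<Rightarrow> (real^'n) set set" where
  "borel_subsets \<Omega> = sets (restrict_space borel \<Omega>)"

definition signed_borel_measure :: "(real^'n) set \<Rightarrow> ((real^'n) set \<Rightarrow> real) \<Rightarrow> bool" where
  "signed_borel_measure \<Omega> \<nu> \<longleftrightarrow> \<nu> {} = 0 \<and>
     (\<forall>A::nat \<Rightarrow> (real^'n) set. range A \<subseteq> borel_subsets \<Omega> \<longrightarrow> disjoint_family A \<longrightarrow>
        (\<lambda>i. \<nu> (A i)) sums \<nu> (\<Union>i. A i))"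

text \<open>The positive variation \<open>\<nu>\<^sup>+(A) = sup {\<nu>(B) | B \<subseteq> A}\<close>; note that \<open>ennreal\<close> truncates negative
  reals to \<open>0\<close>. The negative variation of \<open>\<nu>\<close> is the positive variation of \<open>-\<nu>\<close>.\<close>

definition pos_variation :: "(real^'n) set \<Rightarrow> ((real^'n) set \<Rightarrow> real) \<Rightarrow> (real^'n) measure" where
  "pos_variation \<Omega> \<nu> = measure_of \<Omega> (borel_subsets \<Omega>)
     (\<lambda>A. SUP B\<in>{B \<in> borel_subsets \<Omega>. B \<subseteq> A}. ennreal (\<nu> B))"

definition signed_integral ::
    "(real^'n) set \<Rightarrow> ((real^'n) set \<Rightarrow> real) \<Rightarrow> (real^'n \<Rightarrow> real) \<Rightarrow> real" where
  "signed_integral \<Omega> \<nu> g =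
     (\<integral>x. g x \<partial>pos_variation \<Omega> \<nu>) - (\<integral>x. g x \<partial>pos_variation \<Omega> (\<lambda>A. - \<nu> A))"

section \<open>Functions of bounded variation\<close>

definition is_weak_partial ::
    "(real^'n) set \<Rightarrow> 'n \<Rightarrow> (real^'n \<Rightarrow> real) \<Rightarrow> ((real^'n) set \<Rightarrow> real) \<Rightarrow> bool" where
  "is_weak_partial \<Omega> i u \<nu> \<longleftrightarrow> signed_borel_measure \<Omega> \<nu> \<and>
     (\<forall>\<phi>\<in>test_functions \<Omega>.
        (\<integral>x. u x * partial_deriv i \<phi> x \<partial>lebesgue_on \<Omega>) = - signed_integral \<Omega> \<nu> \<phi>)"

definition BV_space :: "real \<Rightarrow> (real^'n) set \<Rightarrow> (real^'n \<Rightarrow> real) set" where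
  "BV_space p \<Omega> = {u \<in> Lp_space p \<Omega>. \<forall>i. \<exists>\<nu>. is_weak_partial \<Omega> i u \<nu>}"

text \<open>The choice is unique on \<open>borel_subsets \<Omega>\<close>, the only sets that matter.\<close>

definition weak_partial ::
    "(real^'n) set \<Rightarrow> 'n \<Rightarrow> (real^'n \<Rightarrow> real) \<Rightarrow> (real^'n) set \<Rightarrow> real" where
  "weak_partial \<Omega> i u = (SOME \<nu>. is_weak_partial \<Omega> i u \<nu>)"

definition total_variation :: "(real^'n) set \<Rightarrow> (real^'n \<Rightarrow> real) \<Rightarrow> ereal" where
  "total_variation \<Omega> u =
     (SUP v\<in>{v \<in> test_fields \<Omega>. sup_norm \<Omega> v \<le> 1}.
        ereal (\<integral>x. u x * classical_div v x \<partial>lebesgue_on \<Omega>))"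

section \<open>Quotients by the almost everywhere constant functions\<close>

text \<open>If \<open>\<Omega>\<close> has infinite measure, then \<open>c = 0\<close> is forced, as \<open>w - u \<in> L\<^sub>p\<close>. Members of
  \<open>BV_cst\<close> are also members of \<open>Lp_cst\<close>: \<open>BV_space\<close> is a union of such classes.\<close>

definition cst_class :: "real \<Rightarrow> (real^'n) set \<Rightarrow> (real^'n \<Rightarrow> real) \<Rightarrow> (real^'n \<Rightarrow> real) set" where
  "cst_class p \<Omega> u = {w \<in> Lp_space p \<Omega>. \<exists>c. AE x in lebesgue_on \<Omega>. w x = u x + c}"

definition Lp_cst :: "real \<Rightarrow> (real^'n) set \<Rightarrow> (real^'n \<Rightarrow> real) set set" where
  "Lp_cst p \<Omega> = cst_class p \<Omega> ` Lp_space p \<Omega>"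

definition BV_cst :: "real \<Rightarrow> (real^'n) set \<Rightarrow> (real^'n \<Rightarrow> real) set set" where
  "BV_cst p \<Omega> = cst_class p \<Omega> ` BV_space p \<Omega>"

definition representative :: "(real^'n \<Rightarrow> real) set \<Rightarrow> real^'n \<Rightarrow> real" where
  "representative X = (SOME u. u \<in> X)"

definition pairing :: "(real^'n) set \<Rightarrow> (real^'n \<Rightarrow> real) set \<Rightarrow> (real^'n \<Rightarrow> real) \<Rightarrow> real" where
  "pairing \<Omega> X f = (\<integral>x. representative X x * f x \<partial>lebesgue_on \<Omega>)"

section \<open>The localized topology and its dual\<close>

definition weak_top :: "real \<Rightarrow> real \<Rightarrow> (real^'n) set \<Rightarrow> (real^'n \<Rightarrow> real) set topology" where
  "weak_top p q \<Omega> = topology_generated_by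
     {{X \<in> Lp_cst p \<Omega>. pairing \<Omega> X f \<in> V} | f V. f \<in> Lq_sharp q \<Omega> \<and> open V}"

definition weak_BV_top :: "real \<Rightarrow> real \<Rightarrow> (real^'n) set \<Rightarrow> (real^'n \<Rightarrow> real) set topology" where
  "weak_BV_top p q \<Omega> = subtopology (weak_top p q \<Omega>) (BV_cst p \<Omega>)"

definition TV_ball :: "real \<Rightarrow> (real^'n) set \<Rightarrow> nat \<Rightarrow> (real^'n \<Rightarrow> real) set set" where
  "TV_ball p \<Omega> k = cst_class p \<Omega> ` {u \<in> BV_space p \<Omega>. total_variation \<Omega> u \<le> ereal (real k)}"

text \<open>Specified through closed sets, see \<open>closedin_W_top\<close>. The empty set is open because the sets
  \<open>TV_ball p \<Omega> k\<close> are weakly closed (\<open>closedin_TV_ball\<close>), by lower semicontinuity of the total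
  variation.\<close>

definition W_top :: "real \<Rightarrow> real \<Rightarrow> (real^'n) set \<Rightarrow> (real^'n \<Rightarrow> real) set topology" where
  "W_top p q \<Omega> = topology (\<lambda>U. U \<subseteq> BV_cst p \<Omega> \<and>
     (\<forall>k. closedin (weak_BV_top p q \<Omega>) ((BV_cst p \<Omega> - U) \<inter> TV_ball p \<Omega> k)))"

lemma test_function_partial_deriv:
  assumes "\<phi> \<in> test_functions \<Omega>"
  obtains K M where "compact K" "K \<subseteq> \<Omega>" "\<And>x. x \<notin> K \<Longrightarrow> \<phi> x = 0"
    "\<And>x. x \<notin> K \<Longrightarrow> partial_deriv i \<phi> x = 0"
    "\<And>x. \<bar>partial_deriv i \<phi> x\<bar> \<le> M"
    "continuous_on UNIV \<phi>" "continuous_on UNIV (partial_deriv i \<phi>)"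
    "\<And>x. (\<phi> has_derivative frechet_derivative \<phi> (at x)) (at x)"
proof -
  obtain K where sm: "smooth_fun_on UNIV \<phi>" and K: "compact K" "K \<subseteq> \<Omega>"
    and 0: "\<And>x. x \<notin> K \<Longrightarrow> \<phi> x = 0"
    using assms by (auto simp: test_functions_def)
  have d: "\<phi> differentiable (at x)" "partial_deriv i \<phi> differentiable (at x)" for x
    using sm[unfolded smooth_fun_on_def, rule_format, of x "[]"]
      sm[unfolded smooth_fun_on_def, rule_format, of x "[i]"] by auto
  have c: "continuous_on UNIV \<phi>" "continuous_on UNIV (partial_deriv i \<phi>)"
    by (simp_all add: continuous_at_imp_continuous_on differentiable_imp_continuous_within d)
  have hd: "(\<phi> has_derivative frechet_derivative \<phi> (at x)) (at x)" for x
    using d(1)[of x] unfolding frechet_derivative_works .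
  have z: "partial_deriv i \<phi> x = 0" if "x \<notin> K" for x
  proof -
    have "open (- K)" by (rule open_Compl[OF compact_imp_closed[OF K(1)]])
    then have "(\<phi> has_derivative (\<lambda>_. 0)) (at x)"
      by (rule has_derivative_transform_within_open[OF has_derivative_const]) (use that 0 in auto)
    then have "frechet_derivative \<phi> (at x) = (\<lambda>_. 0)"
      by (rule frechet_derivative_at[symmetric])
    then show ?thesis by (simp add: partial_deriv_def)
  qed
  have "bounded (partial_deriv i \<phi> ` K)"
    by (rule compact_imp_bounded, rule compact_continuous_image[OF continuous_on_subset[OF c(2)] K(1)])
       simp
  then obtain M where M: "\<And>x. x \<in> K \<Longrightarrow> \<bar>partial_deriv i \<phi> x\<bar> \<le> M"
    by (auto simp: bounded_iff)
  have bd: "\<bar>partial_deriv i \<phi> x\<bar> \<le> \<bar>M\<bar>" for x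
    using M[of x] z[of x] by (cases "x \<in> K") auto
  show thesis by (rule that[OF K 0 z bd c hd])
qed

lemma integral_partial_deriv_test_function:
  fixes \<Omega> :: "(real^'n) set"
  assumes "\<phi> \<in> test_functions \<Omega>"
  shows "(\<integral>x. partial_deriv i \<phi> x \<partial>lborel) = 0"
proof -
  obtain K M where K: "compact K" and 0: "\<And>x. x \<notin> K \<Longrightarrow> \<phi> x = 0"
    and M: "\<And>x. \<bar>partial_deriv i \<phi> x\<bar> \<le> M"
    and c: "continuous_on UNIV \<phi>" "continuous_on UNIV (partial_deriv i \<phi>)"
    and hd: "\<And>x. (\<phi> has_derivative frechet_derivative \<phi> (at x)) (at x)"
    using test_function_partial_deriv[OF assms, of i] by metis
  have meas: "\<phi> \<in> borel_measurable borel" "partial_deriv i \<phi> \<in> borel_measurable borel"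
    using c by (auto intro: borel_measurable_continuous_onI)
  define e :: "real^'n" where "e = axis i 1"
  have ne: "norm e = 1" by (simp add: e_def)
  have lin: "((\<lambda>s. \<phi> (x + s *\<^sub>R e)) has_real_derivative partial_deriv i \<phi> (x + s *\<^sub>R e)) (at s)" for x s
  proof -
    have "((\<lambda>s. \<phi> (x + s *\<^sub>R e)) has_derivative
        (\<lambda>h. frechet_derivative \<phi> (at (x + s *\<^sub>R e)) (h *\<^sub>R e))) (at s)"
      by (rule has_derivative_compose[OF _ hd, of "\<lambda>s. x + s *\<^sub>R e" "\<lambda>h. h *\<^sub>R e"])
         (auto intro!: derivative_eq_intros)
    moreover have "frechet_derivative \<phi> (at (x + s *\<^sub>R e)) (h *\<^sub>R e)
        = partial_deriv i \<phi> (x + s *\<^sub>R e) * h" for h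
      using linear_cmul[OF has_derivative_linear[OF hd]] by (simp add: partial_deriv_def e_def)
    ultimately show ?thesis by (simp add: has_field_derivative_def)
  qed
  obtain R where R: "\<And>x. x \<in> K \<Longrightarrow> norm x \<le> R"
    using K compact_imp_bounded bounded_iff by metis
  define t where "t n = inverse (real (Suc n))" for n
  have t: "0 < t n" "t n \<le> 1" for n by (auto simp: t_def divide_simps)
  define D where "D n x = (\<phi> (x + t n *\<^sub>R e) - \<phi> x) / t n" for n x
  have int: "integrable lborel \<phi>"
  proof -
    have "integrable lborel (\<lambda>x. indicator K x *\<^sub>R \<phi> x)"
      by (rule borel_integrable_compact[OF K])
         (use c continuous_on_subset in blast)
    moreover have "(\<lambda>x. indicator K x *\<^sub>R \<phi> x) = \<phi>"
      using 0 by (intro ext) (auto simp: indicator_def)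
    ultimately show ?thesis by simp
  qed
  have shift: "integrable lborel (\<lambda>x. \<phi> (x + a))" "(\<integral>x. \<phi> (x + a) \<partial>lborel) = (\<integral>x. \<phi> x \<partial>lborel)"
    for a
  proof -
    have "integrable (distr lborel borel ((+) a)) \<phi>" "integral\<^sup>L (distr lborel borel ((+) a)) \<phi>
        = (\<integral>x. \<phi> x \<partial>lborel)"
      using int by (simp_all add: lborel_distr_plus)
    then show "integrable lborel (\<lambda>x. \<phi> (x + a))"
      "(\<integral>x. \<phi> (x + a) \<partial>lborel) = (\<integral>x. \<phi> x \<partial>lborel)"
      using meas by (simp_all add: integrable_distr_eq integral_distr add.commute)
  qed
  have D0: "(\<integral>x. D n x \<partial>lborel) = 0" for n
    unfolding D_def using shift int by simp
  have lim: "(\<lambda>n. D n x) \<longlonglongrightarrow> partial_deriv i \<phi> x" for x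
  proof -
    have "((\<lambda>h. (\<phi> (x + h *\<^sub>R e) - \<phi> x) / h) \<longlongrightarrow> partial_deriv i \<phi> x) (at 0)"
      using lin[of x 0] by (simp add: DERIV_def)
    moreover have "filterlim t (at 0) sequentially"
      unfolding t_def using LIMSEQ_inverse_real_of_nat by (auto simp: filterlim_at)
    ultimately show ?thesis unfolding D_def by (rule filterlim_compose)
  qed
  have bd: "norm (D n x) \<le> M * indicator (cball 0 (R + 1)) x" for n x
  proof (cases "x \<in> cball 0 (R + 1)")
    case True
    obtain s where "\<phi> (x + t n *\<^sub>R e) - \<phi> (x + 0 *\<^sub>R e) = (t n - 0) * partial_deriv i \<phi> (x + s *\<^sub>R e)"
      using MVT2[OF t(1)[of n], of "\<lambda>s. \<phi> (x + s *\<^sub>R e)" "\<lambda>s. partial_deriv i \<phi> (x + s *\<^sub>R e)"] lin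
      by blast
    then have "D n x = partial_deriv i \<phi> (x + s *\<^sub>R e)"
      using t(1)[of n] by (simp add: D_def)
    then show ?thesis using M True by simp
  next
    case False
    then have n: "norm x > R + 1" by (simp add: dist_norm)
    have "norm x \<le> norm (x + t n *\<^sub>R e) + t n"
      using norm_triangle_ineq4[of "x + t n *\<^sub>R e" "t n *\<^sub>R e"] t(1)[of n] ne by simp
    then have "x \<notin> K" "x + t n *\<^sub>R e \<notin> K" using n R[of x] R[of "x + t n *\<^sub>R e"] t(2)[of n] by auto
    then show ?thesis using 0 False by (simp add: D_def)
  qed
  have "(\<lambda>n. \<integral>x. D n x \<partial>lborel) \<longlonglongrightarrow> (\<integral>x. partial_deriv i \<phi> x \<partial>lborel)"
  proof (rule integral_dominated_convergence[where w = "\<lambda>x. M * indicator (cball 0 (R + 1)) x"])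
    show "integrable lborel (\<lambda>x. M * indicator (cball 0 (R + 1)) x :: real)"
      by (auto intro!: integrable_mult_right integrable_real_indicator emeasure_bounded_finite)
    note [measurable] = meas
    show "partial_deriv i \<phi> \<in> borel_measurable lborel" by measurable
    show "D n \<in> borel_measurable lborel" for n unfolding D_def by measurable
    show "AE x in lborel. (\<lambda>n. D n x) \<longlonglongrightarrow> partial_deriv i \<phi> x" by (intro AE_I2 lim)
    show "AE x in lborel. norm (D n x) \<le> M * indicator (cball 0 (R + 1)) x" for n
      by (intro AE_I2 bd)
  qed
  then show ?thesis by (simp add: D0 LIMSEQ_const_iff)
qed

lemma classical_div_test_field:
  fixes \<Omega> :: "(real^'n) set"
  assumes "open \<Omega>" "v \<in> test_fields \<Omega>"
  obtains K M where "compact K" "K \<subseteq> \<Omega>" "\<And>x. \<bar>classical_div v x\<bar> \<le> M * indicator K x" "0 \<le> M"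
    "classical_div v \<in> borel_measurable (lebesgue_on \<Omega>)"
    "integrable (lebesgue_on \<Omega>) (classical_div v)"
    "(\<integral>x. classical_div v x \<partial>lebesgue_on \<Omega>) = 0"
proof -
  have tf: "(\<lambda>x. v x $ i) \<in> test_functions \<Omega>" for i using assms by (auto simp: test_fields_def)
  have "\<exists>K M. compact K \<and> K \<subseteq> \<Omega> \<and> (\<forall>x. x \<notin> K \<longrightarrow> partial_deriv i (\<lambda>x. v x $ i) x = 0) \<and>
      (\<forall>x. \<bar>partial_deriv i (\<lambda>x. v x $ i) x\<bar> \<le> M) \<and>
      continuous_on UNIV (partial_deriv i (\<lambda>x. v x $ i))" for i
    by (rule test_function_partial_deriv[OF tf[of i], of i]) blast
  then obtain K M where K: "\<And>i. compact (K i)" "\<And>i. K i \<subseteq> \<Omega>"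
    "\<And>i x. x \<notin> K i \<Longrightarrow> partial_deriv i (\<lambda>x. v x $ i) x = 0"
    and M: "\<And>i x. \<bar>partial_deriv i (\<lambda>x. v x $ i) x\<bar> \<le> M i"
    and c: "\<And>i. continuous_on UNIV (partial_deriv i (\<lambda>x. v x $ i))"
    by metis
  define L where "L = (\<Union>i. K i)"
  have L: "compact L" "L \<subseteq> \<Omega>" using K by (auto simp: L_def)
  have Lout: "partial_deriv i (\<lambda>x. v x $ i) x = 0" if "x \<notin> L" for i x
    using that K(3) by (auto simp: L_def)
  have M0: "0 \<le> M i" for i using M[of i undefined] by linarith
  have bd: "\<bar>classical_div v x\<bar> \<le> (\<Sum>i\<in>UNIV. M i) * indicator L x" for x
  proof (cases "x \<in> L")
    case True
    then show ?thesis
      by (auto simp: classical_div_def intro!: order_trans[OF sum_abs] sum_mono M)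
  qed (simp add: classical_div_def Lout)
  have i: "integrable lborel (partial_deriv i (\<lambda>x. v x $ i))" for i
  proof -
    have "integrable lborel (\<lambda>x. indicator L x *\<^sub>R partial_deriv i (\<lambda>x. v x $ i) x)"
      by (rule borel_integrable_compact[OF L(1)]) (use c continuous_on_subset in blast)
    moreover have "(\<lambda>x. indicator L x *\<^sub>R partial_deriv i (\<lambda>x. v x $ i) x)
        = partial_deriv i (\<lambda>x. v x $ i)"
      using Lout by (intro ext) (auto simp: indicator_def)
    ultimately show ?thesis by simp
  qed
  have cd: "integrable lborel (classical_div v)" "(\<integral>x. classical_div v x \<partial>lborel) = 0"
    unfolding classical_div_def
    using i integral_partial_deriv_test_function[OF tf] by auto
  then have le: "integrable lebesgue (classical_div v)" "(\<integral>x. classical_div v x \<partial>lebesgue) = 0"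
    by (auto simp: integrable_completion integral_completion borel_measurable_integrable)
  have \<Omega>: "\<Omega> \<inter> space lebesgue \<in> sets lebesgue" using assms(1) by auto
  have eq: "(\<lambda>x. indicator \<Omega> x *\<^sub>R classical_div v x) = classical_div v"
  proof
    fix x show "indicator \<Omega> x *\<^sub>R classical_div v x = classical_div v x"
      using bd[of x] L(2) by (cases "x \<in> L") auto
  qed
  have int: "integrable (lebesgue_on \<Omega>) (classical_div v)"
    "(\<integral>x. classical_div v x \<partial>lebesgue_on \<Omega>) = 0"
    using le by (simp_all add: integrable_restrict_space[OF \<Omega>] integral_restrict_space[OF \<Omega>]
        eq del: real_scaleR_def)
  have S0: "0 \<le> (\<Sum>i\<in>UNIV. M i)" using M0 by (rule sum_nonneg)
  show thesis
    by (rule that) (fact L bd S0 int borel_measurable_integrable[OF int(1)])+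
qed

lemma classical_div_in_Lq_sharp:
  fixes \<Omega> :: "(real^'n) set"
  assumes "open \<Omega>" "v \<in> test_fields \<Omega>" "0 < q"
  shows "classical_div v \<in> Lq_sharp q \<Omega>"
proof -
  obtain K M where K: "compact K" "K \<subseteq> \<Omega>" "\<And>x. \<bar>classical_div v x\<bar> \<le> M * indicator K x" "0 \<le> M"
    and m [measurable]: "classical_div v \<in> borel_measurable (lebesgue_on \<Omega>)"
    and z: "(\<integral>x. classical_div v x \<partial>lebesgue_on \<Omega>) = 0"
    using classical_div_test_field[OF assms(1,2)] by metis
  have "integrable lborel (indicator K :: _ \<Rightarrow> real)"
    using K(1) by (auto intro!: integrable_real_indicator emeasure_compact_finite
        simp: compact_imp_closed)
  then have "integrable lebesgue (indicator K :: _ \<Rightarrow> real)"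
    by (simp add: integrable_completion borel_measurable_integrable)
  moreover have "(\<lambda>x. indicator \<Omega> x *\<^sub>R indicator K x) = (indicator K :: _ \<Rightarrow> real)"
    using K(2) by (intro ext) (auto simp: indicator_def)
  ultimately have i: "integrable (lebesgue_on \<Omega>) (indicator K :: _ \<Rightarrow> real)"
    using assms(1) by (simp add: integrable_restrict_space)
  have "integrable (lebesgue_on \<Omega>) (\<lambda>x. \<bar>classical_div v x\<bar> powr q)"
  proof (rule Bochner_Integration.integrable_bound[where f = "\<lambda>x. M powr q * indicator K x"])
    show "integrable (lebesgue_on \<Omega>) (\<lambda>x. M powr q * indicator K x :: real)" using i by simp
    have "\<bar>classical_div v x\<bar> powr q \<le> M powr q * indicator K x" for x
      using K(3)[of x] assms(3) by (cases "x \<in> K") (auto intro: powr_mono2)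
    then show "AE x in lebesgue_on \<Omega>. norm (\<bar>classical_div v x\<bar> powr q)
        \<le> norm (M powr q * indicator K x :: real)" by auto
  qed measurable
  then show ?thesis using m z by (simp add: Lq_sharp_def Lp_space_def)
qed

lemma pairing_classical_div:
  fixes \<Omega> :: "(real^'n) set"
  assumes "open \<Omega>" "v \<in> test_fields \<Omega>" "1 \<le> p" "u \<in> Lp_space p \<Omega>"
  shows "pairing \<Omega> (cst_class p \<Omega> u) (classical_div v)
    = (\<integral>x. u x * classical_div v x \<partial>lebesgue_on \<Omega>)"
proof -
  obtain K M where K: "\<And>x. \<bar>classical_div v x\<bar> \<le> M * indicator K x" "0 \<le> M"
    and m [measurable]: "classical_div v \<in> borel_measurable (lebesgue_on \<Omega>)"
    and g: "integrable (lebesgue_on \<Omega>) (classical_div v)"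
    and z: "(\<integral>x. classical_div v x \<partial>lebesgue_on \<Omega>) = 0"
    using classical_div_test_field[OF assms(1,2)] by metis
  have [measurable]: "u \<in> borel_measurable (lebesgue_on \<Omega>)"
    using assms(4) by (simp add: Lp_space_def)
  have up: "integrable (lebesgue_on \<Omega>) (\<lambda>x. \<bar>u x\<bar> powr p)"
    using assms(4) by (simp add: Lp_space_def)
  have ug: "integrable (lebesgue_on \<Omega>) (\<lambda>x. u x * classical_div v x)"
  proof (rule Bochner_Integration.integrable_bound[where
      f = "\<lambda>x. \<bar>classical_div v x\<bar> + M * \<bar>u x\<bar> powr p"])
    have "\<bar>u x * classical_div v x\<bar> \<le> \<bar>classical_div v x\<bar> + M * \<bar>u x\<bar> powr p" for x
    proof (cases "\<bar>u x\<bar> \<le> 1")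
      case True
      then have "\<bar>u x * classical_div v x\<bar> \<le> 1 * \<bar>classical_div v x\<bar>"
        unfolding abs_mult by (intro mult_right_mono) auto
      then show ?thesis using K(2) by (simp add: add_increasing2)
    next
      case False
      then have "\<bar>u x\<bar> \<le> \<bar>u x\<bar> powr p"
        using powr_mono[of 1 p "\<bar>u x\<bar>"] assms(3) by simp
      moreover have "\<bar>classical_div v x\<bar> \<le> M"
        using K(1)[of x] K(2) by (cases "x \<in> K") auto
      ultimately have "\<bar>u x * classical_div v x\<bar> \<le> \<bar>u x\<bar> powr p * M"
        unfolding abs_mult by (intro mult_mono) auto
      then show ?thesis by (simp add: mult.commute)
    qed
    then show "AE x in lebesgue_on \<Omega>. norm (u x * classical_div v x)
        \<le> norm (\<bar>classical_div v x\<bar> + M * \<bar>u x\<bar> powr p)"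
      using K(2) by (auto intro: order_trans)
  qed (use g up in auto)
  define w where "w = representative (cst_class p \<Omega> u)"
  have "u \<in> cst_class p \<Omega> u"
    using assms(4) by (auto simp: cst_class_def intro!: exI[of _ 0])
  then have "w \<in> cst_class p \<Omega> u" unfolding w_def representative_def by (rule someI[of "\<lambda>u'. u' \<in> cst_class p \<Omega> u"])
  then obtain c where w: "w \<in> Lp_space p \<Omega>" "AE x in lebesgue_on \<Omega>. w x = u x + c"
    by (auto simp: cst_class_def)
  have [measurable]: "w \<in> borel_measurable (lebesgue_on \<Omega>)"
    using w by (simp add: Lp_space_def)
  have "(\<integral>x. w x * classical_div v x \<partial>lebesgue_on \<Omega>)
      = (\<integral>x. u x * classical_div v x + c * classical_div v x \<partial>lebesgue_on \<Omega>)"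
    using w(2) by (intro integral_cong_AE) (auto simp: algebra_simps)
  also have "\<dots> = (\<integral>x. u x * classical_div v x \<partial>lebesgue_on \<Omega>)"
    using ug g z by simp
  finally show ?thesis by (simp add: pairing_def w_def)
qed

lemma closedin_TV_ball:
  fixes \<Omega> :: "(real^'n) set"
  assumes "open \<Omega>" "1 \<le> p" "0 < q"
  shows "closedin (weak_BV_top p q \<Omega>) (TV_ball p \<Omega> k)"
proof -
  define T where "T = {v \<in> test_fields \<Omega>. sup_norm \<Omega> v \<le> 1}"
  define H where "H v = {X \<in> Lp_cst p \<Omega>. pairing \<Omega> X (classical_div v) \<in> {real k<..}}"
    for v :: "real^'n \<Rightarrow> real^'n"
  have H: "openin (weak_top p q \<Omega>) (H v)" if "v \<in> T" for v
    unfolding weak_top_def H_def using that classical_div_in_Lq_sharp[OF assms(1) _ assms(3)]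
    by (intro topology_generated_by_Basis) (auto simp: T_def intro!: exI[of _ "classical_div v"])
  have sub: "BV_cst p \<Omega> \<subseteq> Lp_cst p \<Omega>" by (auto simp: BV_cst_def Lp_cst_def BV_space_def)
  have zero: "(\<lambda>_. 0) \<in> Lq_sharp q \<Omega>" by (simp add: Lq_sharp_def Lp_space_def)
  have "{X \<in> Lp_cst p \<Omega>. pairing \<Omega> X (\<lambda>_. 0) \<in> UNIV}
      \<in> {{X \<in> Lp_cst p \<Omega>. pairing \<Omega> X f \<in> V} | f V. f \<in> Lq_sharp q \<Omega> \<and> open V}"
    using zero open_UNIV by blast
  then have "openin (weak_top p q \<Omega>) {X \<in> Lp_cst p \<Omega>. pairing \<Omega> X (\<lambda>_. 0) \<in> UNIV}"
    unfolding weak_top_def by (rule topology_generated_by_Basis)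
  then have "openin (weak_top p q \<Omega>) (Lp_cst p \<Omega>)" by simp
  then have top: "topspace (weak_BV_top p q \<Omega>) = BV_cst p \<Omega>"
    using sub openin_subset unfolding weak_BV_top_def topspace_subtopology by blast
  have bound: "total_variation \<Omega> u \<le> ereal (real k) \<longleftrightarrow>
      (\<forall>v\<in>T. pairing \<Omega> (cst_class p \<Omega> u) (classical_div v) \<le> real k)" if "u \<in> BV_space p \<Omega>" for u
    using that pairing_classical_div[OF assms(1) _ assms(2)]
    by (auto simp: total_variation_def T_def SUP_le_iff BV_space_def)
  have "TV_ball p \<Omega> k = BV_cst p \<Omega> - (\<Union>v\<in>T. H v)"
  proof (intro set_eqI iffI)
    fix X assume "X \<in> TV_ball p \<Omega> k"
    then obtain u where u: "u \<in> BV_space p \<Omega>" "X = cst_class p \<Omega> u"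
      "total_variation \<Omega> u \<le> ereal (real k)" by (auto simp: TV_ball_def)
    then show "X \<in> BV_cst p \<Omega> - (\<Union>v\<in>T. H v)"
      using bound[OF u(1)] by (fastforce simp: BV_cst_def H_def)
  next
    fix X assume X: "X \<in> BV_cst p \<Omega> - (\<Union>v\<in>T. H v)"
    then obtain u where u: "u \<in> BV_space p \<Omega>" "X = cst_class p \<Omega> u" by (auto simp: BV_cst_def)
    have "\<forall>v\<in>T. pairing \<Omega> X (classical_div v) \<le> real k"
      using X sub by (force simp: H_def)
    then show "X \<in> TV_ball p \<Omega> k" using bound[OF u(1)] u by (auto simp: TV_ball_def)
  qed
  also have "\<dots> = topspace (weak_BV_top p q \<Omega>) - ((\<Union>v\<in>T. H v) \<inter> BV_cst p \<Omega>)"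
    using top by auto
  finally have *: "TV_ball p \<Omega> k = topspace (weak_BV_top p q \<Omega>) - ((\<Union>v\<in>T. H v) \<inter> BV_cst p \<Omega>)" .
  have "openin (weak_top p q \<Omega>) (\<Union>v\<in>T. H v)" using H by (intro openin_Union) auto
  then have "openin (weak_BV_top p q \<Omega>) ((\<Union>v\<in>T. H v) \<inter> BV_cst p \<Omega>)"
    unfolding weak_BV_top_def by (rule openin_subtopology_Int)
  then show ?thesis unfolding * by blast
qed

lemma openin_W_top:
  fixes \<Omega> :: "(real^'n) set"
  assumes "open \<Omega>" "1 \<le> p" "0 < q"
  shows "openin (W_top p q \<Omega>) U \<longleftrightarrow> U \<subseteq> BV_cst p \<Omega> \<and>
     (\<forall>k. closedin (weak_BV_top p q \<Omega>) ((BV_cst p \<Omega> - U) \<inter> TV_ball p \<Omega> k))"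
proof -
  let ?B = "BV_cst p \<Omega>" and ?W = "weak_BV_top p q \<Omega>"
  let ?P = "\<lambda>U. U \<subseteq> ?B \<and> (\<forall>k. closedin ?W ((?B - U) \<inter> TV_ball p \<Omega> k))"
  have sub: "TV_ball p \<Omega> k \<subseteq> ?B" for k by (auto simp: TV_ball_def BV_cst_def)
  have "istopology ?P"
    unfolding istopology_def
  proof (intro conjI allI impI)
    fix S T k assume S: "?P S" and T: "?P T"
    show "S \<inter> T \<subseteq> ?B" using S by blast
    have "(?B - S \<inter> T) \<inter> TV_ball p \<Omega> k
        = (?B - S) \<inter> TV_ball p \<Omega> k \<union> (?B - T) \<inter> TV_ball p \<Omega> k" by blast
    then show "closedin ?W ((?B - S \<inter> T) \<inter> TV_ball p \<Omega> k)" using S T by (simp add: closedin_Un)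
  next
    fix \<K> k assume \<K>: "Ball \<K> ?P"
    show "\<Union>\<K> \<subseteq> ?B" using \<K> by blast
    have "(?B - \<Union>\<K>) \<inter> TV_ball p \<Omega> k
        = \<Inter>(insert (TV_ball p \<Omega> k) ((\<lambda>S. (?B - S) \<inter> TV_ball p \<Omega> k) ` \<K>))"
      using sub[of k] by auto
    moreover have "closedin ?W C"
      if C: "C \<in> insert (TV_ball p \<Omega> k) ((\<lambda>S. (?B - S) \<inter> TV_ball p \<Omega> k) ` \<K>)" for C
    proof -
      consider "C = TV_ball p \<Omega> k" | S where "S \<in> \<K>" "C = (?B - S) \<inter> TV_ball p \<Omega> k"
        using C by blast
      then show ?thesis using \<K> closedin_TV_ball[OF assms] by cases auto
    qed
    ultimately show "closedin ?W ((?B - \<Union>\<K>) \<inter> TV_ball p \<Omega> k)"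
      by (metis closedin_Inter insert_not_empty)
  qed
  then show ?thesis unfolding W_top_def by (simp add: topology_inverse')
qed

lemma closedin_W_top:
  fixes \<Omega> :: "(real^'n) set"
  assumes "open \<Omega>" "1 \<le> p" "0 < q"
  shows "closedin (W_top p q \<Omega>) S \<longleftrightarrow> S \<subseteq> BV_cst p \<Omega> \<and>
     (\<forall>k. closedin (weak_BV_top p q \<Omega>) (S \<inter> TV_ball p \<Omega> k))"
proof -
  have "openin (W_top p q \<Omega>) (BV_cst p \<Omega>)"
    using openin_W_top[OF assms, of "BV_cst p \<Omega>"] by simp
  then have "topspace (W_top p q \<Omega>) = BV_cst p \<Omega>"
    using openin_W_top[OF assms] openin_subset openin_topspace by (metis subset_antisym)
  then show ?thesis
    by (auto simp: closedin_def[of "W_top p q \<Omega>"] openin_W_top[OF assms] double_diff)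
qed

definition linear_form_on_BV_cst ::
    "real \<Rightarrow> (real^'n) set \<Rightarrow> ((real^'n \<Rightarrow> real) set \<Rightarrow> real) \<Rightarrow> bool" where
  "linear_form_on_BV_cst p \<Omega> F \<longleftrightarrow>
     (\<forall>u\<in>BV_space p \<Omega>. \<forall>w\<in>BV_space p \<Omega>. \<forall>a b.
        F (cst_class p \<Omega> (\<lambda>x. a * u x + b * w x))
          = a * F (cst_class p \<Omega> u) + b * F (cst_class p \<Omega> w))"

text \<open>Forms on \<open>BV_cst p \<Omega>\<close> are normalized to be \<open>undefined\<close> elsewhere, so that equality of
  forms is equality of functions.\<close>

definition W_dual :: "real \<Rightarrow> real \<Rightarrow> (real^'n) set \<Rightarrow> ((real^'n \<Rightarrow> real) set \<Rightarrow> real) set" where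
  "W_dual p q \<Omega> = {F \<in> extensional (BV_cst p \<Omega>).
     linear_form_on_BV_cst p \<Omega> F \<and> continuous_map (W_top p q \<Omega>) euclideanreal F}"

definition div_op ::
    "real \<Rightarrow> (real^'n) set \<Rightarrow> (real^'n \<Rightarrow> real^'n) \<Rightarrow> (real^'n \<Rightarrow> real) set \<Rightarrow> real" where
  "div_op p \<Omega> v = (\<lambda>X\<in>BV_cst p \<Omega>.
     - (\<Sum>i\<in>UNIV. signed_integral \<Omega> (weak_partial \<Omega> i (representative X)) (\<lambda>x. v x $ i)))"

definition form_of ::
    "real \<Rightarrow> (real^'n) set \<Rightarrow> (real^'n \<Rightarrow> real) \<Rightarrow> (real^'n \<Rightarrow> real) set \<Rightarrow> real" where
  "form_of p \<Omega> f = (\<lambda>X\<in>BV_cst p \<Omega>. pairing \<Omega> X f)"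

end

theory Submission
  imports Defs
begin

text \<open>Let \<open>K\<close> be the convex set of divergences of test fields bounded by \<open>M\<close>. If \<open>f \<in> L\<^sub>q\<close> satisfies
  \<open>\<bar>\<integral>u f\<bar> \<le> M \<parallel>Du\<parallel>\<close> for all \<open>u\<close>, then \<open>f\<close> lies in the \<open>L\<^sub>q\<close>-closure of \<open>K\<close>: a function
  \<open>u \<in> L\<^sub>p\<close> separating \<open>f\<close> from \<open>K\<close> would have total variation less than \<open>(\<integral>u f) / M\<close>. Since
  \<open>q \<ge> 2\<close>, the separating function comes from the nearest point projection onto \<open>K\<close> by Clarkson's
  inequality, and no duality theorem for Lebesgue spaces is needed.

  The Poincare inequality bounds the dual norm of \<open>f - div v\<close> by \<open>c \<parallel>f - div v\<parallel>\<^sub>q\<close>. It is assumed for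
  smooth functions only and is transferred to \<open>BV\<close> by the Meyers--Serrin approximation. The same
  approximation lets one test bounds on smooth functions, whose derivatives are measures with
  densities, and so avoids the Riesz representation theorem.

  By continuity a form in \<open>W_dual\<close> is dominated by finitely many elements of \<open>Lq_sharp\<close> and a small
  multiple of the total variation, hence is a limit of elements of \<open>Lq_sharp\<close> in the dual norm. Such
  limits are solved up to a small error by test fields, and the errors are removed by iteration; the
  fields converge uniformly, hence in \<open>C0_fields\<close>.\<close>

section \<open>Smooth functions\<close>

text \<open>The bound on \<open>p\<close> enters through the dimension: m >= 2 gives m / (m - 1) <=
  2, hence p <= 2 and q >= 2, the range in which an elementary form of Clarkson's inequality makes
  minimizing sequences Cauchy. The constant of the final estimate comes from the Poincare
  inequality: \<open>c * Lp_norm q \<Omega> f\<close> bounds the norm of \<open>f\<close> as a form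
  on functions modulo constants, normed by the total variation. Approximate solutions obey this
  bound up to an additive error, and the iteration keeps the sum of all errors below any prescribed
  e > 0. Choosing e proportional to the bound gives the factor 1 + \<epsilon>; a vanishing bound
  needs a separate argument. Two kinds of integrals meet: the definitions use
  \<open>lebesgue_on \<Omega>\<close>, whereas convolution and Fubini are carried out over
  \<open>lborel\<close>, for Borel functions that vanish off \<Omega>. Estimates by the total
  variation are stated for every real \<open>T\<close> above it, which avoids arithmetic in the
  extended reals and also covers functions not yet known to lie in \<open>BV_space\<close>.\<close>

definition smooth_upto :: "nat \<Rightarrow> (real^'n) set \<Rightarrow> (real^'n \<Rightarrow> real) \<Rightarrow> bool" where
  "smooth_upto n U f \<longleftrightarrow>
     (\<forall>is. length is \<le> n \<longrightarrow> (\<forall>x\<in>U. iter_partial_deriv is f differentiable (at x)))"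

lemma smooth_fun_on_iff_upto: "smooth_fun_on U f \<longleftrightarrow> (\<forall>n. smooth_upto n U f)"
  by (auto simp: smooth_fun_on_def smooth_upto_def)

lemma smooth_fun_onI: "(\<And>n. smooth_upto n U f) \<Longrightarrow> smooth_fun_on U f"
  by (simp add: smooth_fun_on_iff_upto)

lemma iter_partial_deriv_append:
  "iter_partial_deriv (is @ js) f = iter_partial_deriv is (iter_partial_deriv js f)"
  by (induction "is") auto

lemma smooth_upto_0: "smooth_upto 0 U f \<longleftrightarrow> (\<forall>x\<in>U. f differentiable (at x))"
  by (simp add: smooth_upto_def)

text \<open>An induction on the order has to peel off the innermost derivative, the last entry of
  the list, since the induction hypothesis then applies to \<open>partial_deriv i f\<close>. The
  recursion of \<open>iter_partial_deriv\<close> peels off the outermost one, hence the case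
  distinction from the right end.\<close>

lemma smooth_upto_Suc:
  "smooth_upto (Suc n) U f \<longleftrightarrow>
     (\<forall>x\<in>U. f differentiable (at x)) \<and> (\<forall>i. smooth_upto n U (partial_deriv i f))"
proof (intro iffI conjI allI ballI)
  fix x assume "smooth_upto (Suc n) U f" "x \<in> U"
  then show "f differentiable (at x)"
    unfolding smooth_upto_def by (metis iter_partial_deriv.simps(1) le0 list.size(3))
next
  fix i assume a: "smooth_upto (Suc n) U f"
  show "smooth_upto n U (partial_deriv i f)"
    unfolding smooth_upto_def
  proof (intro allI impI ballI)
    fix "is" :: "'a list" and x assume "length is \<le> n" "x \<in> U"
    then have "iter_partial_deriv (is @ [i]) f differentiable (at x)"
      using a unfolding smooth_upto_def by (metis Suc_le_mono length_append_singleton)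
    then show "iter_partial_deriv is (partial_deriv i f) differentiable (at x)"
      by (simp add: iter_partial_deriv_append)
  qed
next
  assume a: "(\<forall>x\<in>U. f differentiable (at x)) \<and> (\<forall>i. smooth_upto n U (partial_deriv i f))"
  show "smooth_upto (Suc n) U f"
    unfolding smooth_upto_def
  proof (intro allI impI ballI)
    fix "is" :: "'a list" and x assume l: "length is \<le> Suc n" "x \<in> U"
    show "iter_partial_deriv is f differentiable (at x)"
    proof (cases "is" rule: rev_cases)
      case Nil then show ?thesis using a l by auto
    next
      case (snoc js i)
      then show ?thesis using a l by (auto simp: iter_partial_deriv_append smooth_upto_def)
    qed
  qed
qed

lemma smooth_upto_SucD: "smooth_upto (Suc n) U f \<Longrightarrow> smooth_upto n U f"
  by (simp add: smooth_upto_def)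

lemma smooth_upto_differentiable: "smooth_upto n U f \<Longrightarrow> x \<in> U \<Longrightarrow> f differentiable (at x)"
  by (cases n) (auto simp: smooth_upto_0 smooth_upto_Suc)

lemma smooth_fun_on_differentiable: "smooth_fun_on U f \<Longrightarrow> x \<in> U \<Longrightarrow> f differentiable (at x)"
  using smooth_upto_differentiable smooth_fun_on_iff_upto by blast

lemma smooth_fun_on_partial_deriv: "smooth_fun_on U f \<Longrightarrow> smooth_fun_on U (partial_deriv i f)"
  unfolding smooth_fun_on_iff_upto using smooth_upto_Suc by blast

lemma smooth_fun_on_continuous: "smooth_fun_on U f \<Longrightarrow> continuous_on U f"
  by (meson continuous_at_imp_continuous_on differentiable_imp_continuous_within
      smooth_fun_on_differentiable)

lemma smooth_fun_on_mono: "smooth_fun_on U f \<Longrightarrow> V \<subseteq> U \<Longrightarrow> smooth_fun_on V f"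
  by (auto simp: smooth_fun_on_def)

lemma smooth_fun_on_Un: "smooth_fun_on U f \<Longrightarrow> smooth_fun_on V f \<Longrightarrow> smooth_fun_on (U \<union> V) f"
  by (auto simp: smooth_fun_on_def)

lemma smooth_fun_on_local:
  "(\<And>x. x \<in> U \<Longrightarrow> \<exists>V. x \<in> V \<and> smooth_fun_on V f) \<Longrightarrow> smooth_fun_on U f"
  unfolding smooth_fun_on_def by blast

lemma partial_deriv_eqI: "(f has_derivative D) (at x) \<Longrightarrow> partial_deriv i f x = D (axis i 1)"
  by (simp add: partial_deriv_def frechet_derivative_at[symmetric])

lemma differentiable_has_derivative_frechet:
  "f differentiable (at x) \<Longrightarrow> (f has_derivative frechet_derivative f (at x)) (at x)"
  using frechet_derivative_works by blast

lemma frechet_derivative_partial: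
  fixes f :: "real^'n \<Rightarrow> real"
  assumes "f differentiable (at x)"
  shows "frechet_derivative f (at x) h = (\<Sum>i\<in>UNIV. h $ i * partial_deriv i f x)"
proof -
  have l: "linear (frechet_derivative f (at x))"
    using assms linear_frechet_derivative by blast
  have "frechet_derivative f (at x) h = frechet_derivative f (at x) (\<Sum>i\<in>UNIV. (h $ i) *\<^sub>R axis i 1)"
    by (subst (1) basis_expansion[symmetric]) (simp add: scalar_mult_eq_scaleR)
  then show ?thesis using l by (simp add: linear_sum linear_cmul partial_deriv_def)
qed

lemma has_derivative_partial:
  fixes f :: "real^'n \<Rightarrow> real"
  assumes "f differentiable (at x)"
  shows "(f has_derivative (\<lambda>h. \<Sum>i\<in>UNIV. h $ i * partial_deriv i f x)) (at x)"
proof -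
  have "frechet_derivative f (at x) = (\<lambda>h. \<Sum>i\<in>UNIV. h $ i * partial_deriv i f x)"
    using frechet_derivative_partial[OF assms] by blast
  then show ?thesis using differentiable_has_derivative_frechet[OF assms] by simp
qed

text \<open>\<open>frechet_derivative\<close> is a choice among the derivatives at \<open>x\<close>.
  Functions that agree near \<open>x\<close> have the same derivatives there, so the choices
  coincide even where there is no derivative.\<close>

lemma partial_deriv_cong:
  assumes "open U" "x \<in> U" "\<And>y. y \<in> U \<Longrightarrow> f y = g y"
  shows "partial_deriv i f x = partial_deriv i g x"
proof -
  have "(f has_derivative D) (at x) \<longleftrightarrow> (g has_derivative D) (at x)" for D
    using assms has_derivative_transform_within_open[of f D x UNIV U g]
      has_derivative_transform_within_open[of g D x UNIV U f] by auto
  then show ?thesis by (simp add: partial_deriv_def frechet_derivative_def)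
qed

lemma differentiable_cong_open:
  assumes "open U" "x \<in> U" "\<And>y. y \<in> U \<Longrightarrow> f y = g y" "f differentiable (at x)"
  shows "g differentiable (at x)"
  using assms has_derivative_transform_within_open[of f _ x UNIV U g]
  by (auto simp: differentiable_def)

lemma smooth_upto_cong:
  assumes "open U" "\<And>y. y \<in> U \<Longrightarrow> f y = g y" "smooth_upto n U f"
  shows "smooth_upto n U g"
  using assms(2,3)
proof (induction n arbitrary: f g)
  case 0
  then show ?case using differentiable_cong_open[OF assms(1)] by (metis smooth_upto_0)
next
  case (Suc n)
  have "smooth_upto n U (partial_deriv i g)" for i
    by (rule Suc.IH[of "partial_deriv i f"])
      (use Suc.prems partial_deriv_cong[OF assms(1)] smooth_upto_Suc in blast)+
  then show ?case using Suc.prems differentiable_cong_open[OF assms(1)]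
    by (metis smooth_upto_Suc)
qed

lemma smooth_fun_on_cong:
  assumes "open U" "\<And>y. y \<in> U \<Longrightarrow> f y = g y" "smooth_fun_on U f"
  shows "smooth_fun_on U g"
  using assms smooth_upto_cong unfolding smooth_fun_on_iff_upto by blast

section \<open>Rules for partial derivatives and smoothness\<close>

lemma partial_deriv_const [simp]: "partial_deriv i (\<lambda>_. c) x = 0"
  using partial_deriv_eqI[OF has_derivative_const] .

lemma partial_deriv_add:
  assumes "f differentiable (at x)" "g differentiable (at x)"
  shows "partial_deriv i (\<lambda>x. f x + g x) x = partial_deriv i f x + partial_deriv i g x"
  using partial_deriv_eqI[OF has_derivative_add[OF assms[THEN differentiable_has_derivative_frechet]]]
  by (simp add: partial_deriv_def)

lemma partial_deriv_mult:
  assumes "f differentiable (at x)" "g differentiable (at x)"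
  shows "partial_deriv i (\<lambda>x. f x * g x) x = partial_deriv i f x * g x + f x * partial_deriv i g x"
  using partial_deriv_eqI[OF has_derivative_mult[OF assms[THEN differentiable_has_derivative_frechet]]]
  by (simp add: partial_deriv_def)

lemma partial_deriv_cmult:
  assumes "f differentiable (at x)"
  shows "partial_deriv i (\<lambda>x. c * f x) x = c * partial_deriv i f x"
  using partial_deriv_mult[OF differentiable_const assms, of i c] by simp

lemma partial_deriv_sum:
  assumes "finite A" "\<And>a. a \<in> A \<Longrightarrow> f a differentiable (at x)"
  shows "partial_deriv i (\<lambda>x. \<Sum>a\<in>A. f a x) x = (\<Sum>a\<in>A. partial_deriv i (f a) x)"
  using assms
proof (induction rule: finite_induct)
  case (insert a A)
  then have "partial_deriv i (\<lambda>x. f a x + (\<Sum>a\<in>A. f a x)) x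
      = partial_deriv i (f a) x + partial_deriv i (\<lambda>x. \<Sum>a\<in>A. f a x) x"
    by (intro partial_deriv_add) (auto intro!: differentiable_sum)
  then show ?case using insert by simp
qed simp

lemma smooth_upto_const: "smooth_upto n U (\<lambda>_. c)"
proof (induction n arbitrary: c)
  case (Suc n)
  have "partial_deriv i (\<lambda>_. c) = (\<lambda>_. 0)" for i :: 'a by (rule ext) simp
  then show ?case using Suc by (simp add: smooth_upto_Suc)
qed (simp add: smooth_upto_0)

lemma smooth_upto_add:
  assumes "open U" "smooth_upto n U f" "smooth_upto n U g"
  shows "smooth_upto n U (\<lambda>x. f x + g x)"
  using assms(2,3)
proof (induction n arbitrary: f g)
  case (Suc n)
  have "smooth_upto n U (partial_deriv i (\<lambda>x. f x + g x))" for i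
    by (rule smooth_upto_cong[OF assms(1), of "\<lambda>x. partial_deriv i f x + partial_deriv i g x"])
      (use Suc in \<open>auto simp: smooth_upto_Suc partial_deriv_add\<close>)
  then show ?case using Suc.prems by (auto simp: smooth_upto_Suc)
qed (auto simp: smooth_upto_0)

lemma smooth_upto_mult:
  assumes "open U" "smooth_upto n U f" "smooth_upto n U g"
  shows "smooth_upto n U (\<lambda>x. f x * g x)"
  using assms(2,3)
proof (induction n arbitrary: f g)
  case (Suc n)
  have "smooth_upto n U (partial_deriv i (\<lambda>x. f x * g x))" for i
  proof (rule smooth_upto_cong[OF assms(1)])
    show "smooth_upto n U (\<lambda>x. partial_deriv i f x * g x + f x * partial_deriv i g x)"
      using Suc.prems by (intro smooth_upto_add[OF assms(1)] Suc.IH)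
        (auto simp: smooth_upto_Suc intro: smooth_upto_SucD[OF Suc.prems(1)] smooth_upto_SucD[OF Suc.prems(2)])
    show "partial_deriv i f x * g x + f x * partial_deriv i g x = partial_deriv i (\<lambda>x. f x * g x) x"
      if "x \<in> U" for x
      using Suc.prems that by (simp add: smooth_upto_Suc partial_deriv_mult)
  qed
  then show ?case using Suc.prems by (auto simp: smooth_upto_Suc)
qed (auto simp: smooth_upto_0)

lemma smooth_upto_sum:
  assumes "open U" "finite A" "\<And>a. a \<in> A \<Longrightarrow> smooth_upto n U (f a)"
  shows "smooth_upto n U (\<lambda>x. \<Sum>a\<in>A. f a x)"
  using assms(2,3)
proof (induction rule: finite_induct)
  case (insert a A)
  then show ?case by (simp add: smooth_upto_add[OF assms(1)])
qed (simp add: smooth_upto_const)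

lemma partial_deriv_component: "partial_deriv i (\<lambda>x. x $ j) x = (if i = j then 1 else 0)"
proof -
  have "((\<lambda>x::real^'a. x $ j) has_derivative (\<lambda>h. h $ j)) (at x)"
    by (rule bounded_linear.has_derivative[OF bounded_linear_vec_nth has_derivative_ident])
  from partial_deriv_eqI[OF this] show ?thesis by (simp add: axis_def)
qed

lemma smooth_upto_component: "smooth_upto n U (\<lambda>x. x $ j)"
proof (cases n)
  case 0
  have "(\<lambda>x::real^'a. x $ j) differentiable (at x)" for x
    using bounded_linear_imp_differentiable[OF bounded_linear_vec_nth] .
  then show ?thesis using 0 by (simp add: smooth_upto_0)
next
  case (Suc k)
  have "(\<lambda>x::real^'a. x $ j) differentiable (at x)" for x
    using bounded_linear_imp_differentiable[OF bounded_linear_vec_nth] .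
  moreover have "partial_deriv i (\<lambda>x::real^'a. x $ j) = (\<lambda>_. if i = j then 1 else 0)" for i
    by (rule ext) (rule partial_deriv_component)
  ultimately show ?thesis using Suc by (simp add: smooth_upto_Suc smooth_upto_const)
qed

lemma smooth_fun_on_const [simp]: "smooth_fun_on U (\<lambda>_. c)"
  by (intro smooth_fun_onI smooth_upto_const)

lemma smooth_fun_on_component: "smooth_fun_on U (\<lambda>x. x $ j)"
  by (intro smooth_fun_onI smooth_upto_component)

lemma smooth_fun_on_add:
  "open U \<Longrightarrow> smooth_fun_on U f \<Longrightarrow> smooth_fun_on U g \<Longrightarrow> smooth_fun_on U (\<lambda>x. f x + g x)"
  by (simp add: smooth_fun_on_iff_upto smooth_upto_add)

lemma smooth_fun_on_mult:
  "open U \<Longrightarrow> smooth_fun_on U f \<Longrightarrow> smooth_fun_on U g \<Longrightarrow> smooth_fun_on U (\<lambda>x. f x * g x)"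
  by (simp add: smooth_fun_on_iff_upto smooth_upto_mult)

lemma smooth_fun_on_sum:
  "open U \<Longrightarrow> finite A \<Longrightarrow> (\<And>a. a \<in> A \<Longrightarrow> smooth_fun_on U (f a)) \<Longrightarrow>
    smooth_fun_on U (\<lambda>x. \<Sum>a\<in>A. f a x)"
  by (simp add: smooth_fun_on_iff_upto smooth_upto_sum)

section \<open>Composition with functions of one variable\<close>

lemma has_derivative_compose_real:
  fixes f :: "real^'n \<Rightarrow> real"
  assumes "f differentiable (at x)" "(g has_real_derivative g') (at (f x))"
  shows "((\<lambda>x. g (f x)) has_derivative (\<lambda>h. g' * frechet_derivative f (at x) h)) (at x)"
  by (rule has_derivative_compose[OF differentiable_has_derivative_frechet[OF assms(1)]
        assms(2)[unfolded has_field_derivative_def]])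

lemma partial_deriv_compose_real:
  fixes f :: "real^'n \<Rightarrow> real"
  assumes "f differentiable (at x)" "(g has_real_derivative g') (at (f x))"
  shows "partial_deriv i (\<lambda>x. g (f x)) x = g' * partial_deriv i f x"
  using partial_deriv_eqI[OF has_derivative_compose_real[OF assms]] by (simp add: partial_deriv_def)

text \<open>A family of functions of one variable that is closed under differentiation, up to linear
  combinations, can be composed with smooth functions.\<close>

lemma smooth_upto_compose:
  fixes f :: "real^'n \<Rightarrow> real" and g :: "'a \<Rightarrow> real \<Rightarrow> real"
  assumes U: "open U" and f: "smooth_fun_on U f"
    and g: "\<And>a t. t \<in> f ` U \<Longrightarrow> (g a has_real_derivative c a * g (\<alpha> a) t + d a * g (\<beta> a) t) (at t)"
  shows "smooth_upto n U (\<lambda>x. g a (f x))"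
proof (induction n arbitrary: a)
  case 0
  show ?case unfolding smooth_upto_0
    using has_derivative_compose_real[OF smooth_fun_on_differentiable[OF f] g]
    by (auto simp: differentiable_def)
next
  case (Suc n)
  have "smooth_upto n U (partial_deriv i (\<lambda>x. g a (f x)))" for i
  proof (rule smooth_upto_cong[OF U])
    show "smooth_upto n U (\<lambda>x. (c a * g (\<alpha> a) (f x) + d a * g (\<beta> a) (f x)) * partial_deriv i f x)"
      using smooth_fun_on_partial_deriv[OF f] Suc
      by (intro smooth_upto_mult smooth_upto_add U smooth_upto_const) (auto simp: smooth_fun_on_iff_upto)
    show "(c a * g (\<alpha> a) (f x) + d a * g (\<beta> a) (f x)) * partial_deriv i f x
      = partial_deriv i (\<lambda>x. g a (f x)) x" if "x \<in> U" for x
      using partial_deriv_compose_real[OF smooth_fun_on_differentiable[OF f that] g] that by simp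
  qed
  moreover have "(\<lambda>x. g a (f x)) differentiable (at x)" if "x \<in> U" for x
    using Suc that smooth_upto_differentiable by blast
  ultimately show ?case by (simp add: smooth_upto_Suc)
qed

text \<open>The powers of a positive argument form a family closed under differentiation up to
  factors. The exponent -1/2 later normalizes the gradient.\<close>

lemma smooth_fun_on_powr:
  fixes f :: "real^'n \<Rightarrow> real"
  assumes "open U" "smooth_fun_on U f" "\<And>x. x \<in> U \<Longrightarrow> 0 < f x"
  shows "smooth_fun_on U (\<lambda>x. f x powr a)"
proof (rule smooth_fun_onI)
  fix n
  show "smooth_upto n U (\<lambda>x. f x powr a)"
    by (rule smooth_upto_compose[OF assms(1,2), where g = "\<lambda>a t. t powr a" and c = "\<lambda>a. a"
          and \<alpha> = "\<lambda>a. a - 1" and \<beta> = "\<lambda>a. a" and d = "\<lambda>_. 0"])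
      (use assms(3) in \<open>auto intro!: derivative_eq_intros\<close>)
qed

text \<open>Differentiating exp(-1/t) produces powers of 1/t. The parameter \<open>k\<close> counts
  them and makes the family closed under differentiation up to linear combinations, as
  \<open>smooth_upto_compose\<close> requires; the mollifier uses \<open>k = 0\<close>.\<close>

definition flat_exp :: "nat \<Rightarrow> real \<Rightarrow> real" where
  "flat_exp k t = (if 0 < t then (1 / t) ^ k * exp (- (1 / t)) else 0)"

lemma flat_exp_pos: "0 < t \<Longrightarrow> 0 < flat_exp k t" and flat_exp_nonpos: "t \<le> 0 \<Longrightarrow> flat_exp k t = 0"
  and flat_exp_nonneg: "0 \<le> flat_exp k t"
  by (auto simp: flat_exp_def)

lemma flat_exp_tendsto_0: "(flat_exp k \<longlongrightarrow> 0) (at_right 0)"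
proof -
  have "((\<lambda>s::real. s ^ k / exp s) \<longlongrightarrow> 0) at_top" by (rule tendsto_power_div_exp_0)
  moreover have "filterlim (\<lambda>t::real. 1 / t) at_top (at_right 0)"
    using filterlim_inverse_at_top_right by (simp add: inverse_eq_divide)
  ultimately have "((\<lambda>t::real. (1 / t) ^ k / exp (1 / t)) \<longlongrightarrow> 0) (at_right 0)"
    by (rule filterlim_compose)
  then show ?thesis
    by (rule Lim_transform_eventually)
      (auto simp: eventually_at_filter flat_exp_def exp_minus divide_inverse)
qed

lemma flat_exp_deriv:
  "(flat_exp k has_real_derivative 1 * flat_exp (k + 2) t + (- real k) * flat_exp (k + 1) t) (at t)"
proof -
  consider "t > 0" | "t < 0" | "t = 0" by linarith
  then show ?thesis
  proof cases
    case 1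
    have "((\<lambda>t. (1 / t) ^ k * exp (- (1 / t))) has_real_derivative
        real k * (1 / t) ^ (k - 1) * (- 1 / t\<^sup>2) * exp (- (1 / t))
        + (1 / t) ^ k * (exp (- (1 / t)) * (1 / t\<^sup>2))) (at t)"
      using 1 by (auto intro!: derivative_eq_intros simp: power2_eq_square)
    also have "real k * (1 / t) ^ (k - 1) * (- 1 / t\<^sup>2) * exp (- (1 / t))
        + (1 / t) ^ k * (exp (- (1 / t)) * (1 / t\<^sup>2))
        = 1 * flat_exp (k + 2) t + (- real k) * flat_exp (k + 1) t"
      using 1 by (cases k) (simp_all add: flat_exp_def power2_eq_square algebra_simps add_divide_distrib diff_divide_distrib)
    finally have "((\<lambda>t. (1 / t) ^ k * exp (- (1 / t))) has_real_derivative
        1 * flat_exp (k + 2) t + (- real k) * flat_exp (k + 1) t) (at t)" .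
    then show ?thesis
      by (rule has_field_derivative_transform_within_open[where S = "{0<..}"])
        (use 1 in \<open>auto simp: flat_exp_def\<close>)
  next
    case 2
    have "((\<lambda>t. 0) has_real_derivative 1 * flat_exp (k + 2) t + (- real k) * flat_exp (k + 1) t) (at t)"
      using 2 by (simp add: flat_exp_def)
    then show ?thesis
      by (rule has_field_derivative_transform_within_open[where S = "{..<0}"])
        (use 2 in \<open>auto simp: flat_exp_def\<close>)
  next
    case 3
    \<comment> \<open>Division by \<open>h\<close> raises the power of 1/h by one, so the right
      difference quotient of \<open>flat_exp k\<close> at 0 is
      \<open>flat_exp (k + 1)\<close>.\<close>
    have "((\<lambda>h. (flat_exp k (0 + h) - flat_exp k 0) / h) \<longlongrightarrow> 0) (at_right 0)"
      by (rule Lim_transform_eventually[OF flat_exp_tendsto_0[of "k + 1"]])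
        (auto simp: eventually_at_filter flat_exp_def)
    moreover have "((\<lambda>h. (flat_exp k (0 + h) - flat_exp k 0) / h) \<longlongrightarrow> 0) (at_left 0)"
      by (rule Lim_transform_eventually[OF tendsto_const])
        (auto simp: eventually_at_filter flat_exp_def)
    ultimately have "((\<lambda>h. (flat_exp k (0 + h) - flat_exp k 0) / h) \<longlongrightarrow> 0) (at 0)"
      by (simp add: filterlim_split_at)
    then show ?thesis using 3 by (simp add: DERIV_def flat_exp_def)
  qed
qed

lemma smooth_fun_on_flat_exp:
  fixes f :: "real^'n \<Rightarrow> real"
  assumes "open U" "smooth_fun_on U f"
  shows "smooth_fun_on U (\<lambda>x. flat_exp k (f x))"
proof (rule smooth_fun_onI)
  fix n
  show "smooth_upto n U (\<lambda>x. flat_exp k (f x))"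
    by (rule smooth_upto_compose[OF assms, where g = flat_exp and c = "\<lambda>_. 1"
          and \<alpha> = "\<lambda>k. k + 2" and d = "\<lambda>k. - real k" and \<beta> = "\<lambda>k. k + 1"]) (rule flat_exp_deriv)
qed

section \<open>Algebra of test functions\<close>

lemma test_functionsD:
  assumes "\<phi> \<in> test_functions U"
  shows "smooth_fun_on UNIV \<phi>" "\<And>x. x \<notin> U \<Longrightarrow> \<phi> x = 0"
  using assms by (auto simp: test_functions_def)

lemma test_functions_mono: "\<phi> \<in> test_functions U \<Longrightarrow> U \<subseteq> V \<Longrightarrow> \<phi> \<in> test_functions V"
  unfolding test_functions_def by blast

lemma test_functions_partial_deriv:
  assumes "\<phi> \<in> test_functions U"
  shows "partial_deriv i \<phi> \<in> test_functions U"
proof -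
  obtain K where "compact K" "K \<subseteq> U" "\<And>x. x \<notin> K \<Longrightarrow> partial_deriv i \<phi> x = 0"
    using test_function_partial_deriv[OF assms, of i] by metis
  then show ?thesis using smooth_fun_on_partial_deriv[OF test_functionsD(1)[OF assms]]
    by (auto simp: test_functions_def)
qed

lemma test_functions_0: "(\<lambda>_. 0) \<in> test_functions U"
  by (auto simp: test_functions_def)

lemma test_functions_add:
  assumes "f \<in> test_functions U" "g \<in> test_functions U"
  shows "(\<lambda>x. f x + g x) \<in> test_functions U"
proof -
  obtain K L where "compact K" "K \<subseteq> U" "\<forall>x. x \<notin> K \<longrightarrow> f x = 0" "compact L" "L \<subseteq> U" "\<forall>x. x \<notin> L \<longrightarrow> g x = 0"
    using assms by (auto simp: test_functions_def)
  then have "compact (K \<union> L)" "K \<union> L \<subseteq> U" "\<forall>x. x \<notin> K \<union> L \<longrightarrow> f x + g x = 0" by auto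
  then show ?thesis using assms smooth_fun_on_add[OF open_UNIV] unfolding test_functions_def by blast
qed

text \<open>\<open>g\<close> is arbitrary outside \<open>U\<close>, but there the product is zero:
  \<open>U\<close> and the complement of a compact set carrying \<open>f\<close> are open and cover
  the space, and the product is smooth on each of them.\<close>

lemma test_functions_smooth_mult:
  assumes U: "open U" and g: "smooth_fun_on U g" and f: "f \<in> test_functions U"
  shows "(\<lambda>x. g x * f x) \<in> test_functions U"
proof -
  obtain K where K: "compact K" "K \<subseteq> U" "\<forall>x. x \<notin> K \<longrightarrow> f x = 0" and sf: "smooth_fun_on UNIV f"
    using f by (auto simp: test_functions_def)
  have o: "open (- K)" using compact_imp_closed[OF K(1)] by auto
  have "smooth_fun_on U (\<lambda>x. g x * f x)"
    using smooth_fun_on_mult[OF U g smooth_fun_on_mono[OF sf]] by simp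
  moreover have "smooth_fun_on (- K) (\<lambda>x. g x * f x)"
    by (rule smooth_fun_on_cong[OF o, of "\<lambda>_. 0"]) (use K in auto)
  ultimately have "smooth_fun_on (U \<union> - K) (\<lambda>x. g x * f x)" by (rule smooth_fun_on_Un)
  moreover have "U \<union> - K = UNIV" using K by auto
  ultimately show ?thesis using K by (auto simp: test_functions_def)
qed

lemma test_functions_cmult: "f \<in> test_functions U \<Longrightarrow> (\<lambda>x. c * f x) \<in> test_functions U"
  using smooth_fun_on_mult[OF open_UNIV smooth_fun_on_const, of f c]
  unfolding test_functions_def by auto

lemma test_functions_sum:
  "finite A \<Longrightarrow> (\<And>a. a \<in> A \<Longrightarrow> f a \<in> test_functions U) \<Longrightarrow> (\<lambda>x. \<Sum>a\<in>A. f a x) \<in> test_functions U"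
  by (induction rule: finite_induct) (auto intro: test_functions_0 test_functions_add)

section \<open>Convolution and mollifiers\<close>

lemma test_function_continuous: "\<phi> \<in> test_functions U \<Longrightarrow> continuous_on A \<phi>"
  using smooth_fun_on_continuous[OF test_functionsD(1)] continuous_on_subset by blast

lemma test_function_measurable:
  "\<phi> \<in> test_functions U \<Longrightarrow> \<phi> \<in> borel_measurable borel"
  using test_function_continuous by (rule borel_measurable_continuous_onI)

lemma test_function_bounded:
  assumes "\<phi> \<in> test_functions U"
  obtains M where "0 \<le> M" "\<And>x. \<bar>\<phi> x\<bar> \<le> M"
proof -
  obtain K where K: "compact K" "\<And>x. x \<notin> K \<Longrightarrow> \<phi> x = 0"
    using assms by (auto simp: test_functions_def)
  have "bounded (\<phi> ` K)"
    by (intro compact_imp_bounded compact_continuous_image test_function_continuous[OF assms] K)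
  then obtain M where M: "\<And>x. x \<in> K \<Longrightarrow> \<bar>\<phi> x\<bar> \<le> M" by (auto simp: bounded_iff)
  have "\<bar>\<phi> x\<bar> \<le> \<bar>M\<bar>" for x using M[of x] K(2)[of x] by (cases "x \<in> K") auto
  then show thesis using that[of "\<bar>M\<bar>"] by auto
qed

lemma integrable_compact_support:
  fixes f :: "'a::euclidean_space \<Rightarrow> real"
  assumes f: "continuous_on UNIV f" and K: "compact K" and 0: "\<And>x. x \<notin> K \<Longrightarrow> f x = 0"
  shows "integrable lborel f"
proof -
  have "integrable lborel (\<lambda>x. indicator K x *\<^sub>R f x)"
    by (rule borel_integrable_compact[OF K]) (use f continuous_on_subset in blast)
  moreover have "(\<lambda>x. indicator K x *\<^sub>R f x) = f"
    using 0 by (intro ext) (auto simp: indicator_def)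
  ultimately show ?thesis by simp
qed

lemma test_function_integrable: "\<phi> \<in> test_functions U \<Longrightarrow> integrable lborel \<phi>"
  using integrable_compact_support[OF test_function_continuous]
  unfolding test_functions_def by blast

lemma test_function_has_derivative:
  "\<phi> \<in> test_functions U \<Longrightarrow> (\<phi> has_derivative (\<lambda>h. \<Sum>i\<in>UNIV. h $ i * partial_deriv i \<phi> x)) (at x)"
  using has_derivative_partial smooth_fun_on_differentiable[OF test_functionsD(1)] by blast

lemma sum_component_mult_le:
  fixes h :: "real^'n" and a :: "'n \<Rightarrow> real"
  shows "\<bar>\<Sum>i\<in>UNIV. h $ i * a i\<bar> \<le> (\<Sum>i\<in>UNIV. \<bar>a i\<bar>) * norm h"
proof -
  have "\<bar>\<Sum>i\<in>UNIV. h $ i * a i\<bar> \<le> (\<Sum>i\<in>UNIV. \<bar>h $ i * a i\<bar>)" by (rule sum_abs)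
  also have "\<dots> \<le> (\<Sum>i\<in>UNIV. \<bar>a i\<bar> * norm h)"
    using component_le_norm_cart[of h] by (intro sum_mono) (subst mult.commute, auto simp: abs_mult intro!: mult_left_mono)
  finally show ?thesis by (simp add: sum_distrib_right)
qed

lemma test_function_lipschitz:
  fixes \<phi> :: "real^'n \<Rightarrow> real"
  assumes "\<phi> \<in> test_functions U"
  obtains L where "0 \<le> L" "\<And>x y. \<bar>\<phi> x - \<phi> y\<bar> \<le> L * norm (x - y)"
proof -
  have "\<forall>i. \<exists>M. 0 \<le> M \<and> (\<forall>x. \<bar>partial_deriv i \<phi> x\<bar> \<le> M)"
    using test_function_bounded[OF test_functions_partial_deriv[OF assms]] by metis
  then obtain M where M: "\<And>i. 0 \<le> M i" "\<And>i x. \<bar>partial_deriv i \<phi> x\<bar> \<le> M i" by metis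
  have "\<bar>\<phi> x - \<phi> y\<bar> \<le> (\<Sum>i\<in>UNIV. M i) * norm (x - y)" for x y
  proof -
    have "norm (\<phi> x - \<phi> y) \<le> (\<Sum>i\<in>UNIV. M i) * norm (x - y)"
    proof (rule differentiable_bound[where S = UNIV])
      show "(\<phi> has_derivative (\<lambda>h. \<Sum>i\<in>UNIV. h $ i * partial_deriv i \<phi> x)) (at x within UNIV)" for x
        using test_function_has_derivative[OF assms] .
      show "onorm (\<lambda>h. \<Sum>i\<in>UNIV. h $ i * partial_deriv i \<phi> x) \<le> (\<Sum>i\<in>UNIV. M i)" for x
      proof (rule onorm_le)
        fix h :: "real^'n"
        have "(\<Sum>i\<in>UNIV. \<bar>partial_deriv i \<phi> x\<bar>) * norm h \<le> (\<Sum>i\<in>UNIV. M i) * norm h"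
          by (intro mult_right_mono sum_mono M) auto
        then show "norm (\<Sum>i\<in>UNIV. h $ i * partial_deriv i \<phi> x) \<le> (\<Sum>i\<in>UNIV. M i) * norm h"
          using sum_component_mult_le[of h "\<lambda>i. partial_deriv i \<phi> x"] by simp
      qed
    qed auto
    then show ?thesis by simp
  qed
  then show thesis using that[of "\<Sum>i\<in>UNIV. M i"] M by (simp add: sum_nonneg)
qed

text \<open>The remainder is quadratic uniformly in \<open>x\<close>, because the gradient is
  Lipschitz. This uniformity is what permits differentiation under the convolution integral.\<close>

lemma test_function_taylor:
  fixes \<phi> :: "real^'n \<Rightarrow> real"
  assumes "\<phi> \<in> test_functions U"
  obtains C where "0 \<le> C"
    "\<And>x k. \<bar>\<phi> (x + k) - \<phi> x - (\<Sum>i\<in>UNIV. k $ i * partial_deriv i \<phi> x)\<bar> \<le> C * norm k ^ 2"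
proof -
  have "\<forall>i. \<exists>L. 0 \<le> L \<and> (\<forall>x y. \<bar>partial_deriv i \<phi> x - partial_deriv i \<phi> y\<bar> \<le> L * norm (x - y))"
    using test_function_lipschitz[OF test_functions_partial_deriv[OF assms]] by metis
  then obtain L where L: "\<And>i. 0 \<le> L i"
    "\<And>i x y. \<bar>partial_deriv i \<phi> x - partial_deriv i \<phi> y\<bar> \<le> L i * norm (x - y)" by metis
  define f' where "f' x h = (\<Sum>i\<in>UNIV. h $ i * partial_deriv i \<phi> x)" for x h :: "real^'n"
  have "\<bar>\<phi> (x + k) - \<phi> x - (\<Sum>i\<in>UNIV. k $ i * partial_deriv i \<phi> x)\<bar> \<le> (\<Sum>i\<in>UNIV. L i) * norm k ^ 2"
    for x k
  proof -
    \<comment> \<open>The linearization bound needs the gradient only on the segment from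
      \<open>x\<close> to \<open>x + k\<close>, where it differs from its value at \<open>x\<close>
      by at most a multiple of the norm of \<open>k\<close>.\<close>
    define S where "S = {x + t *\<^sub>R k | t. t \<in> {0..1}}"
    have "norm (\<phi> (x + k) - \<phi> x - f' x ((x + k) - x)) \<le> norm ((x + k) - x) * ((\<Sum>i\<in>UNIV. L i) * norm k)"
    proof (rule differentiable_bound_linearization[where S = S])
      show "x + t *\<^sub>R ((x + k) - x) \<in> S" if "t \<in> {0..1}" for t using that by (auto simp: S_def)
      show "(\<phi> has_derivative f' y) (at y within S)" for y
        unfolding f'_def by (rule has_derivative_at_withinI[OF test_function_has_derivative[OF assms]])
      show "x \<in> S" by (auto simp: S_def intro!: exI[of _ 0])
      fix y assume "y \<in> S"
      then obtain t where t: "0 \<le> t" "t \<le> 1" "y = x + t *\<^sub>R k" by (auto simp: S_def)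
      have yx: "norm (y - x) \<le> norm k" using t by (simp add: mult_left_le_one_le)
      show "onorm (f' y - f' x) \<le> (\<Sum>i\<in>UNIV. L i) * norm k"
      proof (rule onorm_le)
        fix h :: "real^'n"
        have "(f' y - f' x) h = (\<Sum>i\<in>UNIV. h $ i * (partial_deriv i \<phi> y - partial_deriv i \<phi> x))"
          by (simp add: f'_def sum_subtractf right_diff_distrib)
        then have "norm ((f' y - f' x) h)
            \<le> (\<Sum>i\<in>UNIV. \<bar>partial_deriv i \<phi> y - partial_deriv i \<phi> x\<bar>) * norm h"
          using sum_component_mult_le[of h] by simp
        also have "\<dots> \<le> (\<Sum>i\<in>UNIV. L i * norm k) * norm h"
          by (intro mult_right_mono sum_mono order_trans[OF L(2)] mult_left_mono yx L(1)) auto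
        finally show "norm ((f' y - f' x) h) \<le> (\<Sum>i\<in>UNIV. L i) * norm k * norm h"
          by (simp add: sum_distrib_right)
      qed
    qed
    then show ?thesis by (simp add: f'_def power2_eq_square mult_ac)
  qed
  then show thesis using that[of "\<Sum>i\<in>UNIV. L i"] L by (simp add: sum_nonneg)
qed

section \<open>Convolution with a test function\<close>

definition conv :: "('a::euclidean_space \<Rightarrow> real) \<Rightarrow> ('a \<Rightarrow> real) \<Rightarrow> 'a \<Rightarrow> real" where
  "conv \<phi> h x = (\<integral>y. \<phi> (x - y) * h y \<partial>lborel)"

lemma integrable_conv:
  assumes h: "integrable lborel h" and \<phi>: "\<phi> \<in> test_functions U"
  shows "integrable lborel (\<lambda>y. \<phi> (x - y) * h y)"
proof -
  obtain M where M: "\<And>x. \<bar>\<phi> x\<bar> \<le> M" "0 \<le> M" using test_function_bounded[OF \<phi>] by metis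
  note [measurable] = test_function_measurable[OF \<phi>] borel_measurable_integrable[OF h]
  show ?thesis
    by (rule Bochner_Integration.integrable_bound[where f = "\<lambda>y. M * h y"])
      (use M h in \<open>auto simp: abs_mult intro!: mult_right_mono\<close>)
qed

text \<open>Integrating the Taylor remainder against |h| bounds the error of the linear
  approximation by A |k|^2, where A is C times the L_1 norm of \<open>h\<close>; no limit is
  interchanged with an integral.\<close>

lemma conv_has_derivative:
  fixes \<phi> :: "real^'n \<Rightarrow> real"
  assumes h: "integrable lborel h" and \<phi>: "\<phi> \<in> test_functions U"
  shows "(conv \<phi> h has_derivative (\<lambda>k. \<Sum>i\<in>UNIV. k $ i * conv (partial_deriv i \<phi>) h x)) (at x)"
proof -
  obtain C where C: "0 \<le> C"
    "\<And>x k. \<bar>\<phi> (x + k) - \<phi> x - (\<Sum>i\<in>UNIV. k $ i * partial_deriv i \<phi> x)\<bar> \<le> C * norm k ^ 2"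
    using test_function_taylor[OF \<phi>] by metis
  define A where "A = C * (\<integral>y. \<bar>h y\<bar> \<partial>lborel)"
  have i: "integrable lborel (\<lambda>y. \<phi> (x - y) * h y)" for x by (rule integrable_conv[OF h \<phi>])
  have i': "integrable lborel (\<lambda>y. partial_deriv i \<phi> (x - y) * h y)" for x i
    by (rule integrable_conv[OF h test_functions_partial_deriv[OF \<phi>]])
  have bd: "\<bar>conv \<phi> h (x + k) - conv \<phi> h x - (\<Sum>i\<in>UNIV. k $ i * conv (partial_deriv i \<phi>) h x)\<bar>
      \<le> A * norm k ^ 2" for k
  proof -
    let ?R = "\<lambda>y. (\<phi> (x - y + k) - \<phi> (x - y) - (\<Sum>i\<in>UNIV. k $ i * partial_deriv i \<phi> (x - y))) * h y"
    have eq: "?R = (\<lambda>y. \<phi> (x + k - y) * h y - \<phi> (x - y) * h y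
        - (\<Sum>i\<in>UNIV. k $ i * (partial_deriv i \<phi> (x - y) * h y)))"
      by (auto simp: algebra_simps sum_distrib_left)
    have "integrable lborel ?R" unfolding eq using i i' by auto
    have "(\<integral>y. ?R y \<partial>lborel)
        = conv \<phi> h (x + k) - conv \<phi> h x - (\<Sum>i\<in>UNIV. k $ i * conv (partial_deriv i \<phi>) h x)"
      unfolding eq conv_def using i i' by simp
    moreover have "\<bar>\<integral>y. ?R y \<partial>lborel\<bar> \<le> (\<integral>y. C * norm k ^ 2 * \<bar>h y\<bar> \<partial>lborel)"
    proof -
      have "norm (integral\<^sup>L lborel ?R) \<le> (\<integral>y. C * norm k ^ 2 * \<bar>h y\<bar> \<partial>lborel)"
        by (rule Bochner_Integration.integral_norm_bound_integral)
          (use \<open>integrable lborel ?R\<close> h C(2) in \<open>auto simp: abs_mult intro!: mult_right_mono\<close>)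
      then show ?thesis by simp
    qed
    ultimately show ?thesis by (simp add: A_def mult_ac)
  qed
  have lin: "bounded_linear (\<lambda>k. \<Sum>i\<in>UNIV. k $ i * conv (partial_deriv i \<phi>) h x)"
    by (intro bounded_linear_sum bounded_linear_mult_const bounded_linear_vec_nth)
  have "((\<lambda>k. norm (conv \<phi> h (x + k) - conv \<phi> h x - (\<Sum>i\<in>UNIV. k $ i * conv (partial_deriv i \<phi>) h x))
      / norm k) \<longlongrightarrow> 0) (at 0)"
  proof (rule Lim_null_comparison)
    show "((\<lambda>k::real^'n. A * norm k) \<longlongrightarrow> 0) (at 0)"
      by (rule tendsto_eq_intros refl tendsto_norm_zero tendsto_ident_at | simp)+
    show "\<forall>\<^sub>F k in at 0. norm (norm (conv \<phi> h (x + k) - conv \<phi> h x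
        - (\<Sum>i\<in>UNIV. k $ i * conv (partial_deriv i \<phi>) h x)) / norm k) \<le> A * norm k"
      unfolding eventually_at_filter
      using bd by (auto simp: divide_le_eq power2_eq_square mult_ac)
  qed
  then show ?thesis using lin by (simp add: has_derivative_at)
qed

lemma partial_deriv_conv:
  fixes \<phi> :: "real^'n \<Rightarrow> real"
  assumes "integrable lborel h" "\<phi> \<in> test_functions U"
  shows "partial_deriv i (conv \<phi> h) = conv (partial_deriv i \<phi>) h"
proof
  fix x
  show "partial_deriv i (conv \<phi> h) x = conv (partial_deriv i \<phi>) h x"
    using partial_deriv_eqI[OF conv_has_derivative[OF assms], of i x] by (simp add: axis_def if_distrib[of "\<lambda>c. c * _"] cong: if_cong)
qed

lemma smooth_fun_on_conv:
  fixes \<phi> :: "real^'n \<Rightarrow> real"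
  assumes "integrable lborel h" "\<phi> \<in> test_functions U"
  shows "smooth_fun_on V (conv \<phi> h)"
proof (rule smooth_fun_onI)
  fix n show "smooth_upto n V (conv \<phi> h)"
    using assms(2)
  proof (induction n arbitrary: \<phi>)
    case 0
    then show ?case using conv_has_derivative[OF assms(1)] by (auto simp: smooth_upto_0 differentiable_def)
  next
    case (Suc n)
    have "conv \<phi> h differentiable (at x)" for x
      using conv_has_derivative[OF assms(1) Suc.prems] unfolding differentiable_def by blast
    moreover have "smooth_upto n V (partial_deriv i (conv \<phi> h))" for i
      unfolding partial_deriv_conv[OF assms(1) Suc.prems]
      by (rule Suc.IH[OF test_functions_partial_deriv[OF Suc.prems]])
    ultimately show ?case by (simp add: smooth_upto_Suc)
  qed
qed

lemma conv_eq_0: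
  assumes "\<And>y. h y \<noteq> 0 \<Longrightarrow> \<phi> (x - y) = 0"
  shows "conv \<phi> h x = 0"
proof -
  have "(\<lambda>y. \<phi> (x - y) * h y) = (\<lambda>_. 0)" using assms by (metis mult_eq_0_iff)
  then show ?thesis by (simp add: conv_def)
qed

lemma lborel_distr_reflect: "distr lborel borel (\<lambda>y. x - y) = (lborel :: 'a::euclidean_space measure)"
  using lborel_affine[of "-1" x] by (simp add: density_1)

lemma integral_lborel_reflect:
  fixes f :: "'a::euclidean_space \<Rightarrow> real"
  assumes "f \<in> borel_measurable borel"
  shows "(\<integral>y. f (x - y) \<partial>lborel) = (\<integral>y. f y \<partial>lborel)"
proof -
  have "(\<integral>y. f y \<partial>distr lborel borel (\<lambda>y. x - y)) = (\<integral>y. f (x - y) \<partial>lborel)"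
    using assms by (intro integral_distr) auto
  then show ?thesis by (simp add: lborel_distr_reflect)
qed

lemma conv_commute:
  fixes f g :: "'a::euclidean_space \<Rightarrow> real"
  assumes [measurable]: "f \<in> borel_measurable borel" "g \<in> borel_measurable borel"
  shows "conv f g = conv g f"
proof
  fix x
  have "(\<integral>y. f (x - (x - y)) * g (x - y) \<partial>lborel) = (\<integral>y. f (x - y) * g y \<partial>lborel)"
    by (rule integral_lborel_reflect) measurable
  then show "conv f g x = conv g f x" by (simp add: conv_def mult.commute)
qed

text \<open>Convolution is commutative, so the derivative may be put on either factor.\<close>

lemma conv_partial_deriv:
  fixes \<phi> g :: "real^'n \<Rightarrow> real"
  assumes "\<phi> \<in> test_functions U" "g \<in> test_functions V"
  shows "conv \<phi> (partial_deriv i g) = partial_deriv i (conv \<phi> g)"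
proof -
  note m = assms[THEN test_function_measurable] test_functions_partial_deriv[OF assms(2), THEN test_function_measurable]
  have "partial_deriv i (conv \<phi> g) = partial_deriv i (conv g \<phi>)" using conv_commute m by metis
  also have "\<dots> = conv (partial_deriv i g) \<phi>"
    by (rule partial_deriv_conv[OF test_function_integrable[OF assms(1)] assms(2)])
  also have "\<dots> = conv \<phi> (partial_deriv i g)" using conv_commute m by metis
  finally show ?thesis by simp
qed

text \<open>By Fubini, mollification with an even kernel is self-adjoint. This moves the mollifier
  from a localized piece of \<open>u\<close> onto the test function.\<close>

lemma integral_conv_swap:
  fixes \<phi> :: "real^'n \<Rightarrow> real"
  assumes f: "integrable lborel f" and g: "integrable lborel g"
    and \<phi>: "\<phi> \<in> test_functions U" and even: "\<And>x. \<phi> (- x) = \<phi> x"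
  shows "(\<integral>x. conv \<phi> f x * g x \<partial>lborel) = (\<integral>x. f x * conv \<phi> g x \<partial>lborel)"
proof -
  obtain M where M: "\<And>x. \<bar>\<phi> x\<bar> \<le> M" "0 \<le> M" using test_function_bounded[OF \<phi>] by metis
  note [measurable] = test_function_measurable[OF \<phi>] borel_measurable_integrable[OF f]
    borel_measurable_integrable[OF g]
  define F where "F x y = \<phi> (x - y) * f y * g x" for x y
  have "integrable (lborel \<Otimes>\<^sub>M lborel) (\<lambda>(x, y). g x * f y)"
    using f g by (intro lborel_pair.Fubini_integrable) (auto simp: abs_mult)
  then have "integrable (lborel \<Otimes>\<^sub>M lborel) (\<lambda>z. M * (case z of (x, y) \<Rightarrow> g x * f y))" by simp
  then have i: "integrable (lborel \<Otimes>\<^sub>M lborel) (case_prod F)"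
  proof (rule Bochner_Integration.integrable_bound)
    show "case_prod F \<in> borel_measurable (lborel \<Otimes>\<^sub>M lborel)"
      unfolding F_def by measurable
    have "\<bar>\<phi> (a - b)\<bar> * \<bar>g a * f b\<bar> \<le> M * \<bar>g a * f b\<bar>" for a b
      by (intro mult_right_mono M) auto
    then show "AE z in lborel \<Otimes>\<^sub>M lborel. norm (case_prod F z)
        \<le> norm (M * (case z of (x, y) \<Rightarrow> g x * f y))"
      using M(2) by (auto simp: F_def abs_mult mult_ac)
  qed
  have "(\<integral>x. conv \<phi> f x * g x \<partial>lborel) = (\<integral>x. (\<integral>y. F x y \<partial>lborel) \<partial>lborel)"
    by (simp add: conv_def F_def)
  also have "\<dots> = (\<integral>y. (\<integral>x. F x y \<partial>lborel) \<partial>lborel)"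
    using lborel_pair.Fubini_integral[OF i] by simp
  also have "\<dots> = (\<integral>y. f y * conv \<phi> g y \<partial>lborel)"
  proof (rule Bochner_Integration.integral_cong[OF refl])
    fix y
    have "\<phi> (x - y) = \<phi> (y - x)" for x using even[of "x - y"] by simp
    then have "F x y = f y * (\<phi> (y - x) * g x)" for x by (simp add: F_def mult_ac)
    then show "(\<integral>x. F x y \<partial>lborel) = f y * conv \<phi> g y" by (simp add: conv_def)
  qed
  finally show ?thesis .
qed

text \<open>The standard mollifier, supported in the closed ball of radius \<open>d\<close> and of
  integral 1. The argument d^2 - x . x is a polynomial, so smoothness at the origin is no
  issue.\<close>

definition moll :: "real \<Rightarrow> real^'n \<Rightarrow> real" where
  "moll d x = flat_exp 0 (d\<^sup>2 - x \<bullet> x) / (\<integral>y. flat_exp 0 (d\<^sup>2 - y \<bullet> y) \<partial>(lborel :: (real^'n) measure))"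

lemma flat_exp_inner_test_function:
  assumes "0 < d"
  shows "(\<lambda>x::real^'n. flat_exp 0 (d\<^sup>2 - x \<bullet> x)) \<in> test_functions UNIV"
proof -
  have "smooth_fun_on UNIV (\<lambda>x::real^'n. d\<^sup>2 + (-1) * (\<Sum>i\<in>UNIV. x $ i * x $ i))"
    by (intro smooth_fun_on_add smooth_fun_on_mult smooth_fun_on_sum smooth_fun_on_component) auto
  then have "smooth_fun_on UNIV (\<lambda>x::real^'n. d\<^sup>2 - x \<bullet> x)" by (simp add: inner_vec_def)
  then have "smooth_fun_on UNIV (\<lambda>x::real^'n. flat_exp 0 (d\<^sup>2 - x \<bullet> x))"
    by (rule smooth_fun_on_flat_exp[OF open_UNIV])
  moreover have "flat_exp 0 (d\<^sup>2 - x \<bullet> x) = 0" if "x \<notin> cball 0 d" for x :: "real^'n"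
  proof -
    have "d < norm x" using that by simp
    then have "d\<^sup>2 < (norm x)\<^sup>2" using assms by (intro power_strict_mono) auto
    then show ?thesis by (intro flat_exp_nonpos) (simp add: dot_square_norm)
  qed
  ultimately show ?thesis unfolding test_functions_def using compact_cball by blast
qed

text \<open>The integrand is nonnegative, and positive on a ball, which is not a null set.\<close>

lemma flat_exp_inner_integral_pos:
  assumes "0 < d"
  shows "0 < (\<integral>y. flat_exp 0 (d\<^sup>2 - y \<bullet> y) \<partial>(lborel :: (real^'n) measure))"
proof -
  let ?f = "\<lambda>y::real^'n. flat_exp 0 (d\<^sup>2 - y \<bullet> y)"
  have i: "integrable lborel ?f" by (rule test_function_integrable[OF flat_exp_inner_test_function[OF assms]])
  have "(\<integral>y. ?f y \<partial>lborel) \<noteq> 0"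
  proof
    assume "(\<integral>y. ?f y \<partial>lborel) = 0"
    then have "AE y in lborel. ?f y = 0"
      using integral_nonneg_eq_0_iff_AE[OF i] by (simp add: flat_exp_nonneg)
    moreover have "?f y \<noteq> 0" if "y \<in> ball 0 d" for y
    proof -
      have "(norm y)\<^sup>2 < d\<^sup>2" using that by (intro power_strict_mono) auto
      then have "0 < ?f y" by (intro flat_exp_pos) (simp add: dot_square_norm)
      then show ?thesis by simp
    qed
    ultimately have "AE y in lborel. y \<notin> ball (0::real^'n) d" by (elim eventually_mono) blast
    then have "ball (0::real^'n) d \<in> null_sets lborel" by (subst AE_iff_null_sets) auto
    then have "emeasure lborel (ball (0::real^'n) d) = 0" by blast
    moreover have "\<not> negligible (ball (0::real^'n) d)" using assms open_not_negligible[of "ball (0::real^'n) d"] by simp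
    ultimately show False
      by (simp add: negligible_iff_emeasure0)
  qed
  moreover have "0 \<le> (\<integral>y. ?f y \<partial>lborel)" by (simp add: flat_exp_nonneg)
  ultimately show ?thesis by simp
qed

lemma moll_test_function: "0 < d \<Longrightarrow> moll d \<in> test_functions UNIV"
  using test_functions_cmult[OF flat_exp_inner_test_function, of d
    "inverse (\<integral>y. flat_exp 0 (d\<^sup>2 - y \<bullet> y) \<partial>(lborel :: (real^'n) measure))"]
  unfolding moll_def[abs_def] divide_inverse by (subst mult.commute)

lemma moll_nonneg: "0 < d \<Longrightarrow> 0 \<le> moll d (x :: real^'n)"
  using flat_exp_inner_integral_pos[of d, where ?'n = 'n] by (auto simp: moll_def flat_exp_nonneg less_imp_le)

lemma moll_even: "moll d (- x) = moll d x" by (simp add: moll_def)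

lemma moll_eq_0: assumes "0 < d" "d \<le> norm x" shows "moll d x = 0"
proof -
  have "d\<^sup>2 \<le> (norm x)\<^sup>2" using assms by (intro power_mono) auto
  then show ?thesis by (simp add: moll_def dot_square_norm flat_exp_nonpos)
qed

lemma moll_integral: "0 < d \<Longrightarrow> (\<integral>y. moll d (y :: real^'n) \<partial>lborel) = 1"
  using flat_exp_inner_integral_pos[of d, where ?'n = 'n] by (simp add: moll_def)

lemma moll_measurable [measurable]: "0 < d \<Longrightarrow> moll d \<in> borel_measurable borel"
  by (rule test_function_measurable[OF moll_test_function])

lemma moll_integrable:
  assumes d: "0 < d"
  shows "integrable lborel (\<lambda>y. moll d (x - y))"
proof (rule integrable_compact_support)
  show "continuous_on UNIV (\<lambda>y. moll d (x - y))"
    by (rule continuous_on_compose2[OF test_function_continuous[OF moll_test_function[OF d], of UNIV]])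
      (auto intro!: continuous_intros)
  show "moll d (x - y) = 0" if "y \<notin> cball x d" for y
    using that by (intro moll_eq_0[OF d]) (simp add: dist_norm)
qed auto

lemma moll_integral_shift: "0 < d \<Longrightarrow> (\<integral>y. moll d (x - y) \<partial>lborel) = 1"
  using integral_lborel_reflect[of "moll d" x] moll_measurable moll_integral by simp

text \<open>The convolution is a mean of \<open>h\<close> for a probability density on the ball of
  radius \<open>d\<close> about \<open>x\<close>, so it inherits every bound on |h - a| valid there.
  With \<open>a = 0\<close> this gives sup bounds, with \<open>a = h x\<close> uniform
  approximation, with \<open>a\<close> and \<open>e\<close> equal to 1/2 the range of a
  cutoff.\<close>

lemma conv_moll_approx:
  assumes d: "0 < d" and h: "integrable lborel h" and e: "\<And>y. norm (x - y) < d \<Longrightarrow> \<bar>h y - a\<bar> \<le> e"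
  shows "\<bar>conv (moll d) h x - a\<bar> \<le> e"
proof -
  have i: "integrable lborel (\<lambda>y. moll d (x - y) * h y)"
    by (rule integrable_conv[OF h moll_test_function[OF d]])
  have i2: "integrable lborel (\<lambda>y. moll d (x - y) * c)" "(\<integral>y. moll d (x - y) * c \<partial>lborel) = c" for c
    using moll_integrable[OF d, of x] moll_integral_shift[OF d, of x] by simp_all
  have "conv (moll d) h x - a = (\<integral>y. moll d (x - y) * h y - moll d (x - y) * a \<partial>lborel)"
    unfolding conv_def by (subst Bochner_Integration.integral_diff[OF i i2(1)]) (simp only: i2(2))
  also have "\<bar>\<dots>\<bar> \<le> (\<integral>y. moll d (x - y) * e \<partial>lborel)"
  proof -
    have "norm (\<integral>y. moll d (x - y) * h y - moll d (x - y) * a \<partial>lborel) \<le> (\<integral>y. moll d (x - y) * e \<partial>lborel)"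
    proof (rule Bochner_Integration.integral_norm_bound_integral)
      fix y
      show "norm (moll d (x - y) * h y - moll d (x - y) * a) \<le> moll d (x - y) * e"
      proof (cases "norm (x - y) < d")
        case True
        have "norm (moll d (x - y) * (h y - a)) \<le> moll d (x - y) * e"
          using e[OF True] moll_nonneg[OF d, of "x - y"] by (simp add: abs_mult mult_left_mono)
        then show ?thesis by (simp only: right_diff_distrib)
      qed (use moll_eq_0[OF d, of "x - y"] in simp)
    qed (intro Bochner_Integration.integrable_diff i i2)+
    then show ?thesis unfolding real_norm_def .
  qed
  finally show ?thesis by (simp only: i2(2))
qed

section \<open>Inequalities for real powers\<close>

lemma powr_tangent_le:
  fixes a b r :: real
  assumes r: "1 \<le> r" and a: "0 \<le> a" and b: "0 \<le> b"
  shows "a powr r + r * a powr (r - 1) * (b - a) \<le> b powr r"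
proof -
  consider "a = 0" | "a > 0" "b = 0" | "a > 0" "b > 0" using a b by linarith
  then show ?thesis
  proof cases
    case 2
    have "a powr r = a powr (r - 1) * a" using 2 powr_add[of a "r - 1" 1] by simp
    moreover have "a powr (r - 1) * a * 1 \<le> a powr (r - 1) * a * r"
      using 2 r by (intro mult_left_mono) auto
    ultimately show ?thesis using 2 by (simp add: mult_ac)
  next
    case 3
    define t where "t = b / a"
    have t: "t > 0" "b = a * t" using 3 by (auto simp: t_def)
    \<comment> \<open>Young's inequality with weights 1/r and 1 - 1/r, applied to
      \<open>t powr r\<close> and 1, yields Bernoulli's inequality 1 + r (t - 1) <= t^r. Multiplied
      by \<open>a powr r\<close> this is the tangent estimate.\<close>
    have "(t powr r) powr (1/r) * 1 powr (1 - 1/r) \<le> (1/r) * t powr r + (1 - 1/r) * 1"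
      by (rule Youngs_inequality_0) (use r t in auto)
    then have "t \<le> (1/r) * t powr r + (1 - 1/r)" using r t by (simp add: powr_powr)
    then have "r * t \<le> r * ((1/r) * t powr r + (1 - 1/r))" using r by (intro mult_left_mono) auto
    then have "1 + r * (t - 1) \<le> t powr r" using r by (simp add: algebra_simps)
    then have "a powr r * (1 + r * (t - 1)) \<le> a powr r * t powr r" by (intro mult_left_mono) auto
    moreover have "a powr r = a powr (r - 1) * a" using 3 powr_add[of a "r - 1" 1] by simp
    ultimately show ?thesis using t 3 by (simp add: powr_mult algebra_simps)
  qed (use b in auto)
qed

text \<open>If B is the largest of the quotients |f i| / c i, the sum is at most B times the sum of
  the weights, hence at most B. With weights 2^-(n+1) this controls series in L_p without the
  triangle inequality for the norm.\<close>

lemma sum_abs_powr_le_max: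
  fixes f :: "'a \<Rightarrow> real"
  assumes "finite A" "0 < r" "\<And>i. i \<in> A \<Longrightarrow> 0 < c i" "(\<Sum>i\<in>A. c i) \<le> 1"
  shows "\<bar>\<Sum>i\<in>A. f i\<bar> powr r \<le> (\<Sum>i\<in>A. (\<bar>f i\<bar> / c i) powr r)"
proof (cases "A = {}")
  case False
  obtain j where j: "j \<in> A" "\<And>i. i \<in> A \<Longrightarrow> \<bar>f i\<bar> / c i \<le> \<bar>f j\<bar> / c j"
  proof -
    have "Max ((\<lambda>i. \<bar>f i\<bar> / c i) ` A) \<in> (\<lambda>i. \<bar>f i\<bar> / c i) ` A"
      using assms(1) False by (intro Max_in) auto
    then obtain j where "j \<in> A" "Max ((\<lambda>i. \<bar>f i\<bar> / c i) ` A) = \<bar>f j\<bar> / c j" by auto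
    then show ?thesis using that[of j] assms(1) Max_ge[of "(\<lambda>i. \<bar>f i\<bar> / c i) ` A"] by simp
  qed
  have "\<bar>\<Sum>i\<in>A. f i\<bar> \<le> (\<Sum>i\<in>A. \<bar>f i\<bar>)" by (rule sum_abs)
  also have "\<dots> \<le> (\<Sum>i\<in>A. (\<bar>f j\<bar> / c j) * c i)"
    using j(2) assms(3) by (intro sum_mono) (simp add: pos_divide_le_eq)
  also have "\<dots> = (\<bar>f j\<bar> / c j) * (\<Sum>i\<in>A. c i)" by (simp add: sum_distrib_left)
  also have "\<dots> \<le> (\<bar>f j\<bar> / c j) * 1"
    using assms(3)[OF j(1)] by (intro mult_left_mono assms(4)) auto
  finally have "\<bar>\<Sum>i\<in>A. f i\<bar> powr r \<le> (\<bar>f j\<bar> / c j) powr r"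
    using assms(2) by (intro powr_mono2) auto
  also have "\<dots> \<le> (\<Sum>i\<in>A. (\<bar>f i\<bar> / c i) powr r)"
    by (rule member_le_sum[OF j(1)]) (use assms in auto)
  finally show ?thesis .
qed (use assms in auto)

lemma abs_add_powr_le:
  fixes a b r :: real
  assumes "0 < r"
  shows "\<bar>a + b\<bar> powr r \<le> 2 powr r * (\<bar>a\<bar> powr r + \<bar>b\<bar> powr r)"
proof -
  have "\<bar>a + b\<bar> \<le> 2 * max \<bar>a\<bar> \<bar>b\<bar>" by linarith
  then have "\<bar>a + b\<bar> powr r \<le> (2 * max \<bar>a\<bar> \<bar>b\<bar>) powr r" using assms by (intro powr_mono2) auto
  also have "\<dots> = 2 powr r * max \<bar>a\<bar> \<bar>b\<bar> powr r" by (simp add: powr_mult)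
  also have "\<dots> \<le> 2 powr r * (\<bar>a\<bar> powr r + \<bar>b\<bar> powr r)"
    by (intro mult_left_mono) (auto simp: max_def)
  finally show ?thesis .
qed

section \<open>Mollification does not increase L_r norms\<close>

lemma conv_measurable [measurable]:
  fixes h :: "'a::euclidean_space \<Rightarrow> real"
  assumes [measurable]: "\<phi> \<in> borel_measurable borel" "h \<in> borel_measurable borel"
  shows "conv \<phi> h \<in> borel_measurable borel"
proof -
  have "(\<lambda>x. \<integral>y. \<phi> (x - y) * h y \<partial>lborel) \<in> borel_measurable borel"
    by (rule lborel.borel_measurable_lebesgue_integral) measurable
  then show ?thesis by (simp add: conv_def[abs_def])
qed

text \<open>Jensen's inequality for the probability density \<open>moll d (x - y)\<close>.\<close>

lemma conv_moll_powr_le: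
  assumes d: "0 < d" and r: "1 \<le> r" and h: "integrable lborel h"
  shows "ennreal (\<bar>conv (moll d) h x\<bar> powr r)
    \<le> (\<integral>\<^sup>+y. ennreal (moll d (x - y) * \<bar>h y\<bar> powr r) \<partial>lborel)"
proof (cases "(\<integral>\<^sup>+y. ennreal (moll d (x - y) * \<bar>h y\<bar> powr r) \<partial>lborel) = \<infinity>")
  case False
  note m [measurable] = moll_measurable[OF d] borel_measurable_integrable[OF h]
  have nn: "0 \<le> moll d (x - y)" for y by (rule moll_nonneg[OF d])
  define a where "a = (\<integral>y. moll d (x - y) * \<bar>h y\<bar> \<partial>lborel)"
  have i1: "integrable lborel (\<lambda>y. moll d (x - y) * \<bar>h y\<bar>)"
    using integrable_conv[OF integrable_abs[OF h] moll_test_function[OF d]] .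
  have i2: "integrable lborel (\<lambda>y. moll d (x - y) * c)" "(\<integral>y. moll d (x - y) * c \<partial>lborel) = c" for c
    using moll_integrable[OF d, of x] moll_integral_shift[OF d, of x] by simp_all
  have i3: "integrable lborel (\<lambda>y. moll d (x - y) * \<bar>h y\<bar> powr r)"
    using False by (intro integrableI_nonneg) (auto simp: nn less_top)
  have a0: "0 \<le> a" unfolding a_def by (intro integral_nonneg_AE) (auto simp: nn)
  have "\<bar>conv (moll d) h x\<bar> \<le> a"
  proof -
    have "norm (\<integral>y. moll d (x - y) * h y \<partial>lborel) \<le> a"
      unfolding a_def by (rule Bochner_Integration.integral_norm_bound_integral)
        (use i1 nn in \<open>auto simp: abs_mult intro: integrable_conv[OF h moll_test_function[OF d]]\<close>)
    then show ?thesis by (simp add: conv_def)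
  qed
  then have "\<bar>conv (moll d) h x\<bar> powr r \<le> a powr r" using r by (intro powr_mono2) auto
  \<comment> \<open>The tangent line of s^r at the mean \<open>a\<close> of |h|, evaluated at |h|
    and averaged, returns \<open>a powr r\<close>.\<close>
  also have "a powr r = (\<integral>y. moll d (x - y) * (a powr r - r * a powr (r - 1) * a)
      + (r * a powr (r - 1)) * (moll d (x - y) * \<bar>h y\<bar>) \<partial>lborel)"
    by (subst Bochner_Integration.integral_add[OF i2(1) integrable_mult_right[OF i1]])
      (subst i2(2), simp add: a_def[symmetric])
  also have "\<dots> \<le> (\<integral>y. moll d (x - y) * \<bar>h y\<bar> powr r \<partial>lborel)"
  proof (rule integral_mono)
    fix y
    have "moll d (x - y) * (a powr r + r * a powr (r - 1) * (\<bar>h y\<bar> - a)) \<le> moll d (x - y) * \<bar>h y\<bar> powr r"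
      by (intro mult_left_mono nn powr_tangent_le r a0) auto
    then show "moll d (x - y) * (a powr r - r * a powr (r - 1) * a)
      + (r * a powr (r - 1)) * (moll d (x - y) * \<bar>h y\<bar>) \<le> moll d (x - y) * \<bar>h y\<bar> powr r"
      by (simp add: algebra_simps)
  qed (intro Bochner_Integration.integrable_add i2 integrable_mult_right i1 i3)+
  finally show ?thesis
    by (subst nn_integral_eq_integral[OF i3]) (auto simp: nn intro!: ennreal_leI)
qed auto

text \<open>Jensen's inequality at each point is followed by Tonelli; by evenness the kernel has
  integral 1 in its other variable as well.\<close>

lemma conv_moll_Lr_bound:
  fixes h :: "real^'n \<Rightarrow> real"
  assumes d: "0 < d" and r: "1 \<le> r" and h: "integrable lborel h"
  shows "(\<integral>\<^sup>+x. ennreal (\<bar>conv (moll d) h x\<bar> powr r) \<partial>lborel) \<le> (\<integral>\<^sup>+x. ennreal (\<bar>h x\<bar> powr r) \<partial>lborel)"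
proof -
  note m [measurable] = moll_measurable[OF d] borel_measurable_integrable[OF h]
  have "(\<integral>\<^sup>+x. ennreal (\<bar>conv (moll d) h x\<bar> powr r) \<partial>lborel)
      \<le> (\<integral>\<^sup>+x. (\<integral>\<^sup>+y. ennreal (moll d (x - y) * \<bar>h y\<bar> powr r) \<partial>lborel) \<partial>lborel)"
    by (intro nn_integral_mono conv_moll_powr_le[OF d r h])
  also have "\<dots> = (\<integral>\<^sup>+y. (\<integral>\<^sup>+x. ennreal (moll d (x - y) * \<bar>h y\<bar> powr r) \<partial>lborel) \<partial>lborel)"
    by (rule lborel_pair.Fubini'[symmetric]) measurable
  also have "\<dots> = (\<integral>\<^sup>+y. ennreal (\<bar>h y\<bar> powr r) \<partial>lborel)"
  proof (rule nn_integral_cong)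
    fix y :: "real^'n"
    have "(\<integral>\<^sup>+x. ennreal (moll d (x - y)) \<partial>lborel) = (\<integral>\<^sup>+x. ennreal (moll d (y - x)) \<partial>lborel)"
      using moll_even[of d "_ - y"] by (intro nn_integral_cong) (metis minus_diff_eq)
    also have "\<dots> = ennreal 1"
      using nn_integral_eq_integral[OF moll_integrable[OF d, of y]] moll_integral_shift[OF d, of y]
      by (simp add: moll_nonneg[OF d])
    finally show "(\<integral>\<^sup>+x. ennreal (moll d (x - y) * \<bar>h y\<bar> powr r) \<partial>lborel) = ennreal (\<bar>h y\<bar> powr r)"
      by (simp add: ennreal_mult moll_nonneg[OF d] nn_integral_multc)
  qed
  finally show ?thesis .
qed

section \<open>Continuous functions of compact support are dense in L_r\<close>

lemma tendsto_powr_zero: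
  assumes "(f \<longlongrightarrow> (0::real)) F" "0 < r"
  shows "((\<lambda>x. \<bar>f x\<bar> powr r) \<longlongrightarrow> 0) F"
  using tendsto_powr'[OF tendsto_rabs[OF assms(1)] tendsto_const, of r] assms(2) by simp

text \<open>At each point the truncation of values and of the domain is eventually exact, and the
  error is dominated by |h|^r.\<close>

lemma Lr_clamp_tendsto:
  fixes h :: "'a::euclidean_space \<Rightarrow> real"
  assumes [measurable]: "h \<in> borel_measurable borel" and r: "0 < r"
    and i: "integrable lborel (\<lambda>x. \<bar>h x\<bar> powr r)"
  shows "(\<lambda>n. \<integral>x. \<bar>h x - indicator (cball 0 (real n)) x * max (- real n) (min (real n) (h x))\<bar> powr r \<partial>lborel)
    \<longlonglongrightarrow> 0"
proof -
  have [measurable]: "cball (0::'a) c \<in> sets borel" for c by simp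
  have "(\<lambda>n. \<integral>x. \<bar>h x - indicator (cball 0 (real n)) x * max (- real n) (min (real n) (h x))\<bar> powr r \<partial>lborel)
    \<longlonglongrightarrow> (\<integral>x. 0 \<partial>(lborel :: 'a measure))"
  proof (rule integral_dominated_convergence[where w = "\<lambda>x. \<bar>h x\<bar> powr r"])
    show "AE x in lborel. (\<lambda>n. \<bar>h x - indicator (cball 0 (real n)) x * max (- real n) (min (real n) (h x))\<bar> powr r)
        \<longlonglongrightarrow> 0"
    proof (rule AE_I2)
      fix x
      obtain N :: nat where N: "norm x + \<bar>h x\<bar> \<le> real N" using real_arch_simple by blast
      have "h x - indicator (cball 0 (real n)) x * max (- real n) (min (real n) (h x)) = 0" if "N \<le> n" for n
      proof -
        have "norm x \<le> real n" "\<bar>h x\<bar> \<le> real n"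
          using N that norm_ge_zero[of x] abs_ge_zero[of "h x"] of_nat_mono[OF that, where 'a = real] by linarith+
        then show ?thesis by (auto simp: max_def min_def)
      qed
      then have "(\<lambda>n. h x - indicator (cball 0 (real n)) x * max (- real n) (min (real n) (h x))) \<longlonglongrightarrow> 0"
        by (intro tendsto_eventually) (auto simp: eventually_sequentially)
      then show "(\<lambda>n. \<bar>h x - indicator (cball 0 (real n)) x * max (- real n) (min (real n) (h x))\<bar> powr r) \<longlonglongrightarrow> 0"
        using r by (rule tendsto_powr_zero)
    qed
    show "AE x in lborel. norm (\<bar>h x - indicator (cball 0 (real n)) x * max (- real n) (min (real n) (h x))\<bar> powr r)
        \<le> \<bar>h x\<bar> powr r" for n
      using r by (intro AE_I2) (auto intro!: powr_mono2 simp: indicator_def max_def min_def)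
  qed (use i in auto)
  then show ?thesis by simp
qed

text \<open>Measurability provides continuous functions converging to \<open>h\<close> almost
  everywhere. Clamping their values to [-N, N] and cutting them off outside a ball preserves the
  limit, because \<open>h\<close> obeys the same restrictions, and makes dominated convergence
  applicable.\<close>

lemma continuous_approx_bounded:
  fixes h :: "'a::euclidean_space \<Rightarrow> real"
  assumes hm: "h \<in> borel_measurable borel" and r: "0 < r" and e: "0 < e"
    and bd: "\<And>x. \<bar>h x\<bar> \<le> N" and supp: "\<And>x. N < norm x \<Longrightarrow> h x = 0"
  obtains g where "continuous_on UNIV g" "\<And>x. x \<notin> cball 0 (N + 1) \<Longrightarrow> g x = 0"
    "integrable lborel (\<lambda>x. \<bar>h x - g x\<bar> powr r)" "(\<integral>x. \<bar>h x - g x\<bar> powr r \<partial>lborel) < e"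
proof -
  have "h \<in> borel_measurable lebesgue" using hm by (intro measurable_completion) simp
  then have "h measurable_on UNIV" by (rule lebesgue_measurable_imp_measurable_on) simp
  then obtain Z f where Z: "negligible Z" and f: "\<And>n::nat. continuous_on UNIV (f n)"
    "\<And>x. x \<notin> Z \<Longrightarrow> (\<lambda>n. f n x) \<longlonglongrightarrow> h x"
    unfolding measurable_on_def by auto
  have N: "0 \<le> N" using bd[of 0] by linarith
  define \<psi> where "\<psi> x = max 0 (min 1 (N + 1 - norm x))" for x :: 'a
  define g where "g n x = \<psi> x * max (- N) (min N (f n x))" for n x
  have gc: "continuous_on UNIV (g n)" for n
    unfolding g_def \<psi>_def by (intro continuous_intros f)
  note [measurable] = hm borel_measurable_continuous_onI[OF gc]
  have g0: "g n x = 0" if "x \<notin> cball 0 (N + 1)" for n x using that by (simp add: g_def \<psi>_def)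
  have \<psi>: "0 \<le> \<psi> x" "\<psi> x \<le> 1" for x by (auto simp: \<psi>_def)
  have gb: "\<bar>g n x\<bar> \<le> N" for n x
  proof -
    have "\<psi> x * \<bar>max (- N) (min N (f n x))\<bar> \<le> 1 * N" using N \<psi>[of x] by (intro mult_mono) auto
    then show ?thesis using \<psi>[of x] by (simp add: g_def abs_mult)
  qed
  have wi: "integrable lborel (\<lambda>x::'a. (2 * N) powr r * indicator (cball 0 (N + 1)) x :: real)"
    by (intro integrable_mult_right) (auto intro!: integrable_real_indicator emeasure_bounded_finite)
  have le: "norm (\<bar>h x - g n x\<bar> powr r) \<le> (2 * N) powr r * indicator (cball 0 (N + 1)) x" for n x
  proof (cases "x \<in> cball 0 (N + 1)")
    case True
    have "\<bar>h x - g n x\<bar> \<le> 2 * N" using bd[of x] gb[of n x] by linarith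
    then show ?thesis using True r by (auto intro!: powr_mono2)
  next
    case False
    then show ?thesis using supp[of x] g0[of x n] by simp
  qed
  have lim: "(\<lambda>n. \<bar>h x - g n x\<bar> powr r) \<longlonglongrightarrow> 0" if "x \<notin> Z" for x
  proof -
    have "(\<lambda>n. g n x) \<longlonglongrightarrow> \<psi> x * max (- N) (min N (h x))"
      unfolding g_def by (intro tendsto_intros f that)
    also have "\<psi> x * max (- N) (min N (h x)) = h x"
    proof (cases "N < norm x")
      case False
      then show ?thesis using bd[of x] by (auto simp: \<psi>_def max_def min_def)
    qed (use supp N in auto)
    finally have "(\<lambda>n. h x - g n x) \<longlonglongrightarrow> 0" using tendsto_diff[OF tendsto_const, of "\<lambda>n. g n x" "h x" _ "h x"] by simp
    then show ?thesis using r by (rule tendsto_powr_zero)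
  qed
  have "AE x in lborel. (\<lambda>n. \<bar>h x - g n x\<bar> powr r) \<longlonglongrightarrow> 0"
  proof -
    have "Z \<in> null_sets lebesgue" using Z by (simp add: negligible_iff_null_sets)
    then have "AE x in lebesgue. x \<notin> Z" by (rule AE_not_in)
    then have "AE x in lborel. x \<notin> Z" by (simp add: AE_completion_iff)
    then show ?thesis using lim by (elim eventually_mono) blast
  qed
  then have "(\<lambda>n. \<integral>x. \<bar>h x - g n x\<bar> powr r \<partial>lborel) \<longlonglongrightarrow> (\<integral>x. 0 \<partial>(lborel :: 'a measure))"
    by (intro integral_dominated_convergence[OF _ _ wi]) (use le in auto)
  then have "\<forall>\<^sub>F n in sequentially. (\<integral>x. \<bar>h x - g n x\<bar> powr r \<partial>lborel) < e"
    using e by (intro order_tendstoD) auto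
  then obtain n where "(\<integral>x. \<bar>h x - g n x\<bar> powr r \<partial>lborel) < e"
    by (auto simp: eventually_sequentially)
  moreover have "integrable lborel (\<lambda>x. \<bar>h x - g n x\<bar> powr r)"
    by (rule Bochner_Integration.integrable_bound[OF wi]) (use le[of _ n] in auto)
  ultimately show thesis using that[OF gc g0] by blast
qed

lemma continuous_approx_Lr:
  fixes h :: "'a::euclidean_space \<Rightarrow> real"
  assumes hm [measurable]: "h \<in> borel_measurable borel" and r: "0 < r" and e: "0 < e"
    and i: "integrable lborel (\<lambda>x. \<bar>h x\<bar> powr r)"
  obtains g R where "continuous_on UNIV g" "0 < R" "\<And>x. x \<notin> cball 0 R \<Longrightarrow> g x = 0"
    "integrable lborel (\<lambda>x. \<bar>h x - g x\<bar> powr r)" "(\<integral>x. \<bar>h x - g x\<bar> powr r \<partial>lborel) < e"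
proof -
  \<comment> \<open>Two errors below \<open>e'\<close> enter through \<open>abs_add_powr_le\<close>,
    and \<open>2 powr r * (e' + e') = e\<close>.\<close>
  define e' where "e' = e / (2 * 2 powr r)"
  have e': "0 < e'" using e by (simp add: e'_def)
  define T where "T n x = indicator (cball 0 (real n)) x * max (- real n) (min (real n) (h x))" for n x
  have [measurable]: "cball (0::'a) c \<in> sets borel" for c by simp
  have [measurable]: "T n \<in> borel_measurable borel" for n unfolding T_def by measurable
  have "\<forall>\<^sub>F n in sequentially. (\<integral>x. \<bar>h x - T n x\<bar> powr r \<partial>lborel) < e'"
    using order_tendstoD(2)[OF Lr_clamp_tendsto[OF hm r i] e'] by (simp add: T_def)
  then obtain n where n: "(\<integral>x. \<bar>h x - T n x\<bar> powr r \<partial>lborel) < e'"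
    by (auto simp: eventually_sequentially)
  have iT: "integrable lborel (\<lambda>x. \<bar>h x - T n x\<bar> powr r)"
    by (rule Bochner_Integration.integrable_bound[OF i])
      (use r in \<open>auto intro!: powr_mono2 AE_I2 simp: T_def indicator_def max_def min_def\<close>)
  obtain g where g: "continuous_on UNIV g" "\<And>x. x \<notin> cball 0 (real n + 1) \<Longrightarrow> g x = 0"
    "integrable lborel (\<lambda>x. \<bar>T n x - g x\<bar> powr r)" "(\<integral>x. \<bar>T n x - g x\<bar> powr r \<partial>lborel) < e'"
  proof (rule continuous_approx_bounded[of "T n" r e' "real n"])
    show "\<bar>T n x\<bar> \<le> real n" for x by (auto simp: T_def indicator_def)
    show "real n < norm x \<Longrightarrow> T n x = 0" for x by (simp add: T_def)
  qed (use r e' in auto)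
  have [measurable]: "g \<in> borel_measurable borel" by (rule borel_measurable_continuous_onI[OF g(1)])
  have le: "\<bar>h x - g x\<bar> powr r \<le> 2 powr r * (\<bar>h x - T n x\<bar> powr r + \<bar>T n x - g x\<bar> powr r)" for x
    using abs_add_powr_le[OF r, of "h x - T n x" "T n x - g x"] by simp
  have ii: "integrable lborel (\<lambda>x. 2 powr r * (\<bar>h x - T n x\<bar> powr r + \<bar>T n x - g x\<bar> powr r))"
    by (intro integrable_mult_right Bochner_Integration.integrable_add iT g)
  have i3: "integrable lborel (\<lambda>x. \<bar>h x - g x\<bar> powr r)"
    by (rule Bochner_Integration.integrable_bound[OF ii]) (use le in auto)
  have "(\<integral>x. \<bar>h x - g x\<bar> powr r \<partial>lborel)
      \<le> (\<integral>x. 2 powr r * (\<bar>h x - T n x\<bar> powr r + \<bar>T n x - g x\<bar> powr r) \<partial>lborel)"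
    by (intro integral_mono i3 ii le)
  also have "\<dots> = 2 powr r * ((\<integral>x. \<bar>h x - T n x\<bar> powr r \<partial>lborel) + (\<integral>x. \<bar>T n x - g x\<bar> powr r \<partial>lborel))"
    using iT g(3) by simp
  also have "\<dots> < 2 powr r * (e' + e')"
    using n g(4) by (intro mult_strict_left_mono) auto
  also have "\<dots> = e" by (simp add: e'_def)
  finally show thesis using that[OF g(1) _ g(2) i3, of "real n + 1"] by simp
qed

section \<open>Convergence of mollifications\<close>

lemma conv_moll_continuous_approx:
  fixes g :: "real^'n \<Rightarrow> real"
  assumes gc: "continuous_on UNIV g" and g0: "\<And>x. x \<notin> cball 0 R \<Longrightarrow> g x = 0" and e: "0 < e"
  obtains d0 where "0 < d0" "\<And>d x. 0 < d \<Longrightarrow> d < d0 \<Longrightarrow> \<bar>conv (moll d) g x - g x\<bar> \<le> e"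
proof -
  have gi: "integrable lborel g" by (rule integrable_compact_support[OF gc compact_cball g0])
  have "uniformly_continuous_on (cball 0 (R + 1)) g"
    by (intro compact_uniformly_continuous compact_cball continuous_on_subset[OF gc]) auto
  then obtain \<delta> where \<delta>: "0 < \<delta>"
    "\<And>x y. x \<in> cball 0 (R + 1) \<Longrightarrow> y \<in> cball 0 (R + 1) \<Longrightarrow> dist x y < \<delta> \<Longrightarrow> dist (g x) (g y) < e"
    unfolding uniformly_continuous_on_def using e by metis
  have "\<bar>conv (moll d) g x - g x\<bar> \<le> e" if d: "0 < d" "d < min \<delta> 1" for d x
  proof (rule conv_moll_approx[OF d(1) gi])
    fix y assume y: "norm (x - y) < d"
    show "\<bar>g y - g x\<bar> \<le> e"
    proof (cases "x \<in> cball 0 (R + 1) \<and> y \<in> cball 0 (R + 1)")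
      case True
      then show ?thesis using \<delta>(2)[of y x] y d by (simp add: dist_norm norm_minus_commute)
    next
      case False
      \<comment> \<open>One of the points has norm above R + 1 and they are less than 1 apart, so
        both lie outside the ball that carries \<open>g\<close>.\<close>
      then have "norm x > R \<and> norm y > R"
        using y d norm_triangle_ineq2[of x y] norm_triangle_ineq2[of y x] by (auto simp: norm_minus_commute)
      then show ?thesis using g0[of x] g0[of y] e by simp
    qed
  qed
  then show thesis using that[of "min \<delta> 1"] \<delta>(1) by auto
qed

lemma conv_moll_Lr_approx:
  fixes h :: "real^'n \<Rightarrow> real"
  assumes hi: "integrable lborel h" and r: "1 \<le> r" and e: "0 < e"
    and i: "integrable lborel (\<lambda>x. \<bar>h x\<bar> powr r)"
  obtains d0 where "0 < d0" "\<And>d. 0 < d \<Longrightarrow> d < d0 \<Longrightarrow>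
     integrable lborel (\<lambda>x. \<bar>conv (moll d) h x - h x\<bar> powr r) \<and>
     (\<integral>x. \<bar>conv (moll d) h x - h x\<bar> powr r \<partial>lborel) < e"
proof -
  \<comment> \<open>The difference is split into three terms: the mollification of h - g, the error
    for the continuous \<open>g\<close>, and g - h. Two uses of \<open>abs_add_powr_le\<close> cost
    the factor \<open>A\<close>, and the three terms give at most 3 A e' < e.\<close>
  define A where "A = 2 powr r * 2 powr r"
  have A: "0 < A" by (simp add: A_def)
  define e' where "e' = e / (4 * A)"
  have e': "0 < e'" using e A by (simp add: e'_def)
  note [measurable] = borel_measurable_integrable[OF hi]
  obtain g R where g: "continuous_on UNIV g" and R: "0 < R" "\<And>x. x \<notin> cball 0 R \<Longrightarrow> g x = 0"
    and gi: "integrable lborel (\<lambda>x. \<bar>h x - g x\<bar> powr r)" "(\<integral>x. \<bar>h x - g x\<bar> powr r \<partial>lborel) < e'"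
    using continuous_approx_Lr[of h r e'] hi e' i r by auto
  have [measurable]: "g \<in> borel_measurable borel" by (rule borel_measurable_continuous_onI[OF g])
  have g1: "integrable lborel g" by (rule integrable_compact_support[OF g compact_cball R(2)])
  define B :: "(real^'n) set" where "B = cball 0 (R + 1)"
  have mB: "0 \<le> measure lborel B" "0 < measure lborel B + 1" by (simp_all add: add_nonneg_pos)
  \<comment> \<open>A uniform error \<open>s\<close> over \<open>B\<close>, which contains the
    supports of \<open>g\<close> and of its mollifications with radius below 1, contributes at most
    \<open>e'\<close> to the integral of the r-th power.\<close>
  define s where "s = (e' / (measure lborel B + 1)) powr (1 / r)"
  have s: "0 < s" "s powr r = e' / (measure lborel B + 1)" using e' mB r
    by (auto simp: s_def powr_powr)
  obtain d0 where d0: "0 < d0" "\<And>d x. 0 < d \<Longrightarrow> d < d0 \<Longrightarrow> \<bar>conv (moll d) g x - g x\<bar> \<le> s"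
    using conv_moll_continuous_approx[OF g R(2) s(1)] by metis
  have iB: "integrable lborel (\<lambda>x. s powr r * indicator B x :: real)"
    unfolding B_def by (intro integrable_mult_right) (auto intro!: integrable_real_indicator emeasure_bounded_finite)
  have "integrable lborel (\<lambda>x. \<bar>conv (moll d) h x - h x\<bar> powr r) \<and>
     (\<integral>x. \<bar>conv (moll d) h x - h x\<bar> powr r \<partial>lborel) < e" if d: "0 < d" "d < min d0 1" for d
  proof -
    note [measurable] = moll_measurable[OF d(1)]
    let ?k = "\<lambda>x. h x - g x"
    have ki: "integrable lborel ?k" using hi g1 by simp
    have "(\<integral>\<^sup>+x. ennreal (\<bar>conv (moll d) ?k x\<bar> powr r) \<partial>lborel) \<le> (\<integral>\<^sup>+x. ennreal (\<bar>?k x\<bar> powr r) \<partial>lborel)"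
      by (rule conv_moll_Lr_bound[OF d(1) r ki])
    also have "\<dots> = ennreal (\<integral>x. \<bar>?k x\<bar> powr r \<partial>lborel)" by (rule nn_integral_eq_integral[OF gi(1)]) auto
    finally have le1: "(\<integral>\<^sup>+x. ennreal (\<bar>conv (moll d) ?k x\<bar> powr r) \<partial>lborel) \<le> ennreal (\<integral>x. \<bar>?k x\<bar> powr r \<partial>lborel)" .
    have c1: "integrable lborel (\<lambda>x. \<bar>conv (moll d) ?k x\<bar> powr r)"
      by (rule integrableI_nonneg) (use le1 in \<open>auto intro: le_less_trans\<close>)
    have c2: "(\<integral>x. \<bar>conv (moll d) ?k x\<bar> powr r \<partial>lborel) \<le> (\<integral>x. \<bar>?k x\<bar> powr r \<partial>lborel)"
      using le1 nn_integral_eq_integral[OF c1] by simp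
    have ceq: "conv (moll d) h x - h x = conv (moll d) ?k x + ((conv (moll d) g x - g x) + (g x - h x))" for x
    proof -
      have "conv (moll d) ?k x = (\<integral>y. moll d (x - y) * h y - moll d (x - y) * g y \<partial>lborel)"
        unfolding conv_def by (intro Bochner_Integration.integral_cong) (auto simp: right_diff_distrib)
      also have "\<dots> = conv (moll d) h x - conv (moll d) g x"
        unfolding conv_def by (intro Bochner_Integration.integral_diff integrable_conv[OF _ moll_test_function[OF d(1)]] hi g1)
      finally show ?thesis by simp
    qed
    have g2: "\<bar>conv (moll d) g x - g x\<bar> powr r \<le> s powr r * indicator B x" for x
    proof (cases "x \<in> B")
      case True
      then show ?thesis using d0(2)[of d x] d r by (auto intro!: powr_mono2)
    next
      case False
      then have nx: "R + 1 < norm x" by (simp add: B_def)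
      have "conv (moll d) g x = 0"
      proof (rule conv_eq_0)
        fix y assume "g y \<noteq> 0"
        then have "norm y \<le> R" using R(2)[of y] by auto
        then have "d \<le> norm (x - y)" using norm_triangle_ineq2[of x y] nx d by linarith
        then show "moll d (x - y) = 0" by (rule moll_eq_0[OF d(1)])
      qed
      then show ?thesis using R(2)[of x] nx by simp
    qed
    let ?b = "\<lambda>x. 2 powr r * (\<bar>conv (moll d) ?k x\<bar> powr r + 2 powr r * (s powr r * indicator B x + \<bar>?k x\<bar> powr r))"
    have bnd: "\<bar>conv (moll d) h x - h x\<bar> powr r \<le> ?b x" for x
    proof -
      have r0: "0 < r" using r by simp
      have "\<bar>conv (moll d) g x - g x + (g x - h x)\<bar> powr r
          \<le> 2 powr r * (\<bar>conv (moll d) g x - g x\<bar> powr r + \<bar>g x - h x\<bar> powr r)"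
        by (rule abs_add_powr_le[OF r0])
      also have "\<dots> \<le> 2 powr r * (s powr r * indicator B x + \<bar>?k x\<bar> powr r)"
        using g2[of x] by (intro mult_left_mono add_mono) (auto simp: abs_minus_commute)
      finally have "\<bar>conv (moll d) g x - g x + (g x - h x)\<bar> powr r
          \<le> 2 powr r * (s powr r * indicator B x + \<bar>?k x\<bar> powr r)" .
      then have "2 powr r * (\<bar>conv (moll d) ?k x\<bar> powr r + \<bar>conv (moll d) g x - g x + (g x - h x)\<bar> powr r) \<le> ?b x"
        by (intro mult_left_mono add_left_mono) auto
      then show ?thesis unfolding ceq using abs_add_powr_le[OF r0] by (rule order_trans[rotated])
    qed
    have bi: "integrable lborel ?b"
      by (intro integrable_mult_right Bochner_Integration.integrable_add c1 iB gi)
    have i3: "integrable lborel (\<lambda>x. \<bar>conv (moll d) h x - h x\<bar> powr r)"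
      by (rule Bochner_Integration.integrable_bound[OF bi]) (use bnd in \<open>auto intro: order_trans\<close>)
    have "(\<integral>x. \<bar>conv (moll d) h x - h x\<bar> powr r \<partial>lborel) \<le> (\<integral>x. ?b x \<partial>lborel)"
      by (intro integral_mono i3 bi bnd)
    also have "\<dots> = 2 powr r * ((\<integral>x. \<bar>conv (moll d) ?k x\<bar> powr r \<partial>lborel)
        + 2 powr r * (s powr r * measure lborel B + (\<integral>x. \<bar>?k x\<bar> powr r \<partial>lborel)))"
    proof -
      have "(\<integral>x. s powr r * indicator B x \<partial>lborel) = s powr r * measure lborel B" by simp
      then show ?thesis
        using c1 iB gi(1) Bochner_Integration.integral_add[OF iB gi(1)]
          Bochner_Integration.integral_add[OF c1 integrable_mult_right[OF Bochner_Integration.integrable_add[OF iB gi(1)]]]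
        by simp
    qed
    also have "\<dots> \<le> 2 powr r * (2 powr r * e' + 2 powr r * (e' + e'))"
    proof -
      have "s powr r * measure lborel B \<le> e' * 1"
        unfolding s(2) using mB e' by (simp add: field_simps)
      moreover have "e' \<le> 2 powr r * e'" using e' r ge_one_powr_ge_zero[of 2 r] by simp
      ultimately show ?thesis using c2 gi(2) by (intro mult_left_mono add_mono) auto
    qed
    also have "\<dots> = 3 * A * e'" by (simp add: A_def)
    also have "\<dots> < e" using A e by (simp add: e'_def)
    finally show ?thesis using i3 by simp
  qed
  then show thesis using that[of "min d0 1"] d0(1) by auto
qed

section \<open>Smooth cutoff functions\<close>

lemma compact_UN_cball:
  fixes K :: "'a::euclidean_space set"
  assumes "compact K"
  shows "compact (\<Union>x\<in>K. cball x e)"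
proof -
  have "(\<Union>x\<in>K. cball x e) = {x + y | x y. x \<in> K \<and> y \<in> cball 0 e}"
  proof (intro set_eqI iffI)
    fix z assume "z \<in> (\<Union>x\<in>K. cball x e)"
    then obtain x where "x \<in> K" "dist x z \<le> e" by auto
    then show "z \<in> {x + y | x y. x \<in> K \<and> y \<in> cball 0 e}"
      by (intro CollectI exI[of _ x] exI[of _ "z - x"]) (auto simp: dist_norm norm_minus_commute)
  next
    fix z assume "z \<in> {x + y | x y. x \<in> K \<and> y \<in> cball 0 e}"
    then show "z \<in> (\<Union>x\<in>K. cball x e)" by (force simp: dist_norm)
  qed
  then show ?thesis using compact_sums[OF assms compact_cball[of 0 e]] by (simp only:)
qed

text \<open>The indicator of the d-neighbourhood of \<open>K\<close> is mollified with radius d =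
  e/2: the open d-balls about points of \<open>K\<close> lie inside this neighbourhood, and points
  farther than \<open>e\<close> from \<open>K\<close> are not reached by the kernel.\<close>

lemma smooth_cutoff:
  fixes K U :: "(real^'n) set"
  assumes K: "compact K" and U: "open U" "K \<subseteq> U"
  obtains \<kappa> where "\<kappa> \<in> test_functions U" "\<And>x. 0 \<le> \<kappa> x" "\<And>x. \<kappa> x \<le> 1" "\<And>x. x \<in> K \<Longrightarrow> \<kappa> x = 1"
proof -
  obtain e where e: "0 < e" "(\<Union>x\<in>K. cball x e) \<subseteq> U"
    using compact_subset_open_imp_cball_epsilon_subset[OF K U] by metis
  define d where "d = e / 2"
  have d: "0 < d" using e by (simp add: d_def)
  define B where "B = (\<Union>x\<in>K. cball x d)"
  have B: "compact B" unfolding B_def by (rule compact_UN_cball[OF K])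
  define h :: "real^'n \<Rightarrow> real" where "h = indicator B"
  have hi: "integrable lborel h" unfolding h_def
    using B by (intro integrable_real_indicator emeasure_compact_finite) (auto simp: compact_imp_closed)
  define \<kappa> where "\<kappa> = conv (moll d) h"
  have "\<kappa> x = 0" if "x \<notin> (\<Union>x\<in>K. cball x e)" for x
    unfolding \<kappa>_def
  proof (rule conv_eq_0)
    fix y assume "h y \<noteq> 0"
    then obtain z where z: "z \<in> K" "dist z y \<le> d" by (auto simp: h_def B_def indicator_def split: if_splits)
    then have "e < dist z x" using that by auto
    then have "d \<le> norm (x - y)" using z dist_triangle[of z x y] by (simp add: d_def dist_norm norm_minus_commute)
    then show "moll d (x - y) = 0" by (rule moll_eq_0[OF d])
  qed
  moreover have "smooth_fun_on UNIV \<kappa>"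
    unfolding \<kappa>_def by (rule smooth_fun_on_conv[OF hi moll_test_function[OF d]])
  ultimately have 1: "\<kappa> \<in> test_functions U"
    unfolding test_functions_def using compact_UN_cball[OF K, of e] e(2) by blast
  have "\<bar>\<kappa> x - 1/2\<bar> \<le> 1/2" for x
    unfolding \<kappa>_def by (rule conv_moll_approx[OF d hi]) (simp add: h_def indicator_def)
  then have 2: "0 \<le> \<kappa> x" "\<kappa> x \<le> 1" for x by (simp_all add: abs_le_iff field_simps)
  have "\<bar>\<kappa> x - 1\<bar> \<le> 0" if "x \<in> K" for x
    unfolding \<kappa>_def
  proof (rule conv_moll_approx[OF d hi])
    fix y assume "norm (x - y) < d"
    then have "y \<in> B" using that by (auto simp: B_def dist_norm intro!: bexI[of _ x])
    then show "\<bar>h y - 1\<bar> \<le> 0" by (simp add: h_def)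
  qed
  then have 3: "\<kappa> x = 1" if "x \<in> K" for x using that by fastforce
  show thesis by (rule that[OF 1 2 3])
qed

section \<open>Smooth approximation of functions of bounded variation\<close>

lemma integrable_mult_bounded:
  fixes f g :: "'a \<Rightarrow> real"
  assumes f: "integrable M f" and g: "g \<in> borel_measurable M" and b: "\<And>x. \<bar>g x\<bar> \<le> B"
  shows "integrable M (\<lambda>x. f x * g x)"
proof (rule Bochner_Integration.integrable_bound[where f = "\<lambda>x. B * f x"])
  have "\<bar>f x * g x\<bar> \<le> \<bar>B * f x\<bar>" for x
    using mult_left_mono[OF b[of x], of "\<bar>f x\<bar>"] b[of x] by (simp add: abs_mult mult.commute)
  then show "AE x in M. norm (f x * g x) \<le> norm (B * f x)" by simp
qed (use f g in auto)

text \<open>Where |u| <= 1 the product is dominated by the test function, elsewhere by a multiple of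
  |u|^p, since there |u| <= |u|^p.\<close>

lemma Lp_mult_test_integrable:
  fixes u :: "real^'n \<Rightarrow> real"
  assumes [measurable]: "u \<in> borel_measurable borel" and p: "1 \<le> p"
    and i: "integrable lborel (\<lambda>x. \<bar>u x\<bar> powr p)" and \<phi>: "\<phi> \<in> test_functions U"
  shows "integrable lborel (\<lambda>x. u x * \<phi> x)" "integrable lborel (\<lambda>x. \<bar>u x * \<phi> x\<bar> powr p)"
proof -
  obtain M where M: "0 \<le> M" "\<And>x. \<bar>\<phi> x\<bar> \<le> M" using test_function_bounded[OF \<phi>] by metis
  note [measurable] = test_function_measurable[OF \<phi>]
  show "integrable lborel (\<lambda>x. u x * \<phi> x)"
  proof (rule Bochner_Integration.integrable_bound[where f = "\<lambda>x. \<bar>\<phi> x\<bar> + M * \<bar>u x\<bar> powr p"])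
    have "\<bar>u x * \<phi> x\<bar> \<le> \<bar>\<phi> x\<bar> + M * \<bar>u x\<bar> powr p" for x
    proof (cases "\<bar>u x\<bar> \<le> 1")
      case True
      then have "\<bar>u x * \<phi> x\<bar> \<le> 1 * \<bar>\<phi> x\<bar>" unfolding abs_mult by (intro mult_right_mono) auto
      then show ?thesis using M(1) by (simp add: add_increasing2)
    next
      case False
      then have "\<bar>u x\<bar> \<le> \<bar>u x\<bar> powr p" using powr_mono[of 1 p "\<bar>u x\<bar>"] p by simp
      then have "\<bar>u x * \<phi> x\<bar> \<le> \<bar>u x\<bar> powr p * M"
        unfolding abs_mult by (intro mult_mono M) auto
      then show ?thesis by (simp add: mult.commute)
    qed
    then show "AE x in lborel. norm (u x * \<phi> x) \<le> norm (\<bar>\<phi> x\<bar> + M * \<bar>u x\<bar> powr p)"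
      unfolding real_norm_def by (intro AE_I2) (metis abs_ge_self order_trans)
  qed (use test_function_integrable[OF \<phi>] i in auto)
  show "integrable lborel (\<lambda>x. \<bar>u x * \<phi> x\<bar> powr p)"
  proof (rule Bochner_Integration.integrable_bound[where f = "\<lambda>x. M powr p * \<bar>u x\<bar> powr p"])
    have "\<bar>u x * \<phi> x\<bar> powr p \<le> M powr p * \<bar>u x\<bar> powr p" for x
      using M p by (subst mult.commute, auto simp: abs_mult powr_mult intro!: mult_right_mono powr_mono2)
    then show "AE x in lborel. norm (\<bar>u x * \<phi> x\<bar> powr p) \<le> norm (M powr p * \<bar>u x\<bar> powr p)" by auto
  qed (use i in auto)
qed

lemma conv_moll_bounded:
  assumes d: "0 < d" and h: "integrable lborel h" and b: "\<And>y. \<bar>h y\<bar> \<le> B"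
  shows "\<bar>conv (moll d) h x\<bar> \<le> B"
  using conv_moll_approx[OF d h, of x 0 B] b by simp

lemma partial_deriv_locally_const:
  assumes "open U" "x \<in> U" "\<And>y. y \<in> U \<Longrightarrow> f y = c"
  shows "partial_deriv i f x = 0"
  using partial_deriv_cong[OF assms(1,2), of f "\<lambda>_. c"] assms(3) by simp

text \<open>The identity behind the Meyers--Serrin estimate. The mollifier is moved onto \<phi>, and
  \<zeta> times a derivative is rewritten as the derivative of a product minus a term with the
  derivative of \<zeta>. Of the three resulting integrals the first tests \<open>u\<close> with a
  test function, the second is a mollification error, and the third cancels when the \<zeta> of a
  partition of unity are summed.\<close>

lemma integral_conv_moll_partial_deriv:
  fixes u \<zeta> \<phi> :: "real^'n \<Rightarrow> real"
  assumes d: "0 < d" and \<zeta>: "\<zeta> \<in> test_functions U" and \<phi>: "\<phi> \<in> test_functions V"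
    and i1: "integrable lborel (\<lambda>x. u x * \<zeta> x)" and i2: "integrable lborel (\<lambda>x. u x * partial_deriv i \<zeta> x)"
  shows "(\<integral>x. conv (moll d) (\<lambda>x. u x * \<zeta> x) x * partial_deriv i \<phi> x \<partial>lborel)
    = (\<integral>x. u x * partial_deriv i (\<lambda>x. \<zeta> x * conv (moll d) \<phi> x) x \<partial>lborel)
      - (\<integral>x. (conv (moll d) (\<lambda>x. u x * partial_deriv i \<zeta> x) x - u x * partial_deriv i \<zeta> x) * \<phi> x \<partial>lborel)
      - (\<integral>x. u x * partial_deriv i \<zeta> x * \<phi> x \<partial>lborel)"
    and "integrable lborel (\<lambda>x. u x * partial_deriv i (\<lambda>x. \<zeta> x * conv (moll d) \<phi> x) x)"
    and "integrable lborel (\<lambda>x. u x * partial_deriv i \<zeta> x * \<phi> x)"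
    and "integrable lborel (\<lambda>x. conv (moll d) (\<lambda>x. u x * \<zeta> x) x * partial_deriv i \<phi> x)"
proof -
  note mt = moll_test_function[OF d]
  note D\<phi> = test_functions_partial_deriv[OF \<phi>, of i]
  obtain M where M: "\<And>x. \<bar>\<phi> x\<bar> \<le> M" using test_function_bounded[OF \<phi>] by metis
  obtain M' where M': "\<And>x. \<bar>partial_deriv i \<phi> x\<bar> \<le> M'" using test_function_bounded[OF D\<phi>] by metis
  note phii = test_function_integrable[OF \<phi>] and Dphii = test_function_integrable[OF D\<phi>]
  note [measurable] = test_function_measurable[OF \<phi>] test_function_measurable[OF D\<phi>]
    moll_measurable[OF d] borel_measurable_integrable[OF i1] borel_measurable_integrable[OF i2]
  have cb: "\<bar>conv (moll d) \<phi> x\<bar> \<le> M" "\<bar>conv (moll d) (partial_deriv i \<phi>) x\<bar> \<le> M'" for x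
    using conv_moll_bounded[OF d phii M] conv_moll_bounded[OF d Dphii M'] by auto
  have j1: "integrable lborel (\<lambda>x. u x * \<zeta> x * conv (moll d) (partial_deriv i \<phi>) x)"
    by (rule integrable_mult_bounded[OF i1 _ cb(2)]) measurable
  have j2: "integrable lborel (\<lambda>x. u x * partial_deriv i \<zeta> x * conv (moll d) \<phi> x)"
    by (rule integrable_mult_bounded[OF i2 _ cb(1)]) measurable
  show j3: "integrable lborel (\<lambda>x. u x * partial_deriv i \<zeta> x * \<phi> x)"
    by (rule integrable_mult_bounded[OF i2 _ M]) measurable
  have eq: "u x * partial_deriv i (\<lambda>x. \<zeta> x * conv (moll d) \<phi> x) x
      = u x * partial_deriv i \<zeta> x * conv (moll d) \<phi> x + u x * \<zeta> x * conv (moll d) (partial_deriv i \<phi>) x" for x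
    unfolding conv_partial_deriv[OF mt \<phi>]
    using smooth_fun_on_differentiable[OF test_functionsD(1)[OF \<zeta>], of x]
      smooth_fun_on_differentiable[OF smooth_fun_on_conv[OF phii mt], of x UNIV]
    by (simp add: partial_deriv_mult algebra_simps)
  show j4: "integrable lborel (\<lambda>x. u x * partial_deriv i (\<lambda>x. \<zeta> x * conv (moll d) \<phi> x) x)"
    unfolding eq by (intro Bochner_Integration.integrable_add j1 j2)
  have c2: "integrable lborel (conv (moll d) (\<lambda>x. u x * partial_deriv i \<zeta> x))"
    and c1: "integrable lborel (conv (moll d) (\<lambda>x. u x * \<zeta> x))"
  proof -
    have "integrable lborel (conv (moll d) h)" if h: "integrable lborel h" for h :: "real^'n \<Rightarrow> real"
    proof -
      note [measurable] = borel_measurable_integrable[OF h]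
      have "(\<integral>\<^sup>+x. ennreal \<bar>conv (moll d) h x\<bar> \<partial>lborel) \<le> (\<integral>\<^sup>+x. ennreal \<bar>h x\<bar> \<partial>lborel)"
        using conv_moll_Lr_bound[OF d, of 1 h] h by simp
      also have "\<dots> < \<infinity>" using h by (simp add: integrable_iff_bounded)
      finally show ?thesis by (intro integrableI_bounded) auto
    qed
    then show "integrable lborel (conv (moll d) (\<lambda>x. u x * partial_deriv i \<zeta> x))"
      "integrable lborel (conv (moll d) (\<lambda>x. u x * \<zeta> x))" using i1 i2 by auto
  qed
  show "integrable lborel (\<lambda>x. conv (moll d) (\<lambda>x. u x * \<zeta> x) x * partial_deriv i \<phi> x)"
    by (rule integrable_mult_bounded[OF c1 _ M']) measurable
  have j5: "integrable lborel (\<lambda>x. conv (moll d) (\<lambda>x. u x * partial_deriv i \<zeta> x) x * \<phi> x)"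
    by (rule integrable_mult_bounded[OF c2 _ M]) measurable
  have "(\<integral>x. conv (moll d) (\<lambda>x. u x * \<zeta> x) x * partial_deriv i \<phi> x \<partial>lborel)
      = (\<integral>x. u x * \<zeta> x * conv (moll d) (partial_deriv i \<phi>) x \<partial>lborel)"
    by (rule integral_conv_swap[OF i1 Dphii mt moll_even])
  also have "\<dots> = (\<integral>x. u x * partial_deriv i (\<lambda>x. \<zeta> x * conv (moll d) \<phi> x) x \<partial>lborel)
      - (\<integral>x. u x * partial_deriv i \<zeta> x * conv (moll d) \<phi> x \<partial>lborel)"
    unfolding eq Bochner_Integration.integral_add[OF j2 j1] by simp
  also have "(\<integral>x. u x * partial_deriv i \<zeta> x * conv (moll d) \<phi> x \<partial>lborel)
      = (\<integral>x. conv (moll d) (\<lambda>x. u x * partial_deriv i \<zeta> x) x * \<phi> x \<partial>lborel)"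
    by (rule integral_conv_swap[OF i2 phii mt moll_even, symmetric])
  also have "\<dots> = (\<integral>x. (conv (moll d) (\<lambda>x. u x * partial_deriv i \<zeta> x) x - u x * partial_deriv i \<zeta> x) * \<phi> x \<partial>lborel)
      + (\<integral>x. u x * partial_deriv i \<zeta> x * \<phi> x \<partial>lborel)"
    unfolding left_diff_distrib Bochner_Integration.integral_diff[OF j5 j3] by simp
  finally show "(\<integral>x. conv (moll d) (\<lambda>x. u x * \<zeta> x) x * partial_deriv i \<phi> x \<partial>lborel)
    = (\<integral>x. u x * partial_deriv i (\<lambda>x. \<zeta> x * conv (moll d) \<phi> x) x \<partial>lborel)
      - (\<integral>x. (conv (moll d) (\<lambda>x. u x * partial_deriv i \<zeta> x) x - u x * partial_deriv i \<zeta> x) * \<phi> x \<partial>lborel)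
      - (\<integral>x. u x * partial_deriv i \<zeta> x * \<phi> x \<partial>lborel)" by simp
qed

text \<open>Bounding the components separately would lose a factor. Instead the field is tested in
  the direction of its own mean \<open>a\<close>: the scalar a . v is at most |a| B, and therefore
  so is its mean |a|^2.\<close>

lemma norm_conv_moll_field_le:
  fixes v :: "real^'n \<Rightarrow> real^'n"
  assumes d: "0 < d" and vi: "\<And>i. integrable lborel (\<lambda>y. v y $ i)" and b: "\<And>y. norm (v y) \<le> B"
  shows "norm (\<chi> i. conv (moll d) (\<lambda>y. v y $ i) x) \<le> B"
proof -
  define a where "a = (\<chi> i. conv (moll d) (\<lambda>y. v y $ i) x)"
  have B: "0 \<le> B" using b[of x] norm_ge_zero order_trans by blast
  have i: "integrable lborel (\<lambda>y. \<Sum>i\<in>UNIV. a $ i * v y $ i)" using vi by auto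
  have j: "integrable lborel (\<lambda>y. moll d (x - y) * (v y $ i))" for i
    by (rule integrable_conv[OF vi moll_test_function[OF d]])
  have "conv (moll d) (\<lambda>y. \<Sum>i\<in>UNIV. a $ i * v y $ i) x
      = (\<integral>y. (\<Sum>i\<in>UNIV. a $ i * (moll d (x - y) * (v y $ i))) \<partial>lborel)"
    unfolding conv_def by (intro Bochner_Integration.integral_cong) (auto simp: sum_distrib_left mult_ac)
  also have "\<dots> = (\<Sum>i\<in>UNIV. a $ i * a $ i)"
    using j by (simp add: a_def conv_def)
  finally have "(\<Sum>i\<in>UNIV. a $ i * a $ i) \<le> norm a * B"
    using conv_moll_bounded[OF d i, of "norm a * B" x]
      order_trans[OF Cauchy_Schwarz_ineq2 mult_left_mono[OF b]]
    by (auto simp: inner_vec_def abs_le_iff)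
  moreover have "norm a * norm a = (\<Sum>i\<in>UNIV. a $ i * a $ i)"
    using dot_square_norm[of a] by (simp add: inner_vec_def power2_eq_square)
  ultimately have "norm a * norm a \<le> norm a * B" by simp
  then show ?thesis using B unfolding a_def[symmetric] by (cases "a = 0") auto
qed

text \<open>From the second one on, each \<open>\<zeta> n\<close> is a difference of cutoffs for
  consecutive members of a compact exhaustion. The sums telescope to a single cutoff, and the
  differences are nonnegative because the later cutoff is 1 wherever the earlier one is
  nonzero.\<close>

lemma smooth_partition:
  fixes \<Omega> :: "(real^'n) set"
  assumes "open \<Omega>"
  obtains C \<zeta> where "\<And>n::nat. compact (C n)" "\<And>n. C n \<subseteq> interior (C (Suc n))" "\<And>n. C n \<subseteq> \<Omega>"
    "\<And>K. compact K \<Longrightarrow> K \<subseteq> \<Omega> \<Longrightarrow> \<exists>m. K \<subseteq> C m"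
    "\<And>n. \<zeta> n \<in> test_functions (interior (C (Suc n)))" "\<And>n x. 0 \<le> \<zeta> n x"
    "\<And>m n x. x \<in> C m \<Longrightarrow> m < n \<Longrightarrow> \<zeta> n x = 0"
    "\<And>N x. (\<Sum>n<N. \<zeta> n x) \<le> 1" "\<And>N m x. x \<in> C m \<Longrightarrow> m < N \<Longrightarrow> (\<Sum>n<N. \<zeta> n x) = 1"
proof -
  obtain C where C: "\<And>n::nat. compact (C n)" "\<And>n. C n \<subseteq> \<Omega>" "\<And>n. C n \<subseteq> interior (C (Suc n))"
    "\<And>K. compact K \<Longrightarrow> K \<subseteq> \<Omega> \<Longrightarrow> \<exists>N. \<forall>n\<ge>N. K \<subseteq> C n"
    using open_Union_compact_subsets[OF assms] by metis
  have "\<exists>\<kappa>. \<kappa> \<in> test_functions (interior (C (Suc n))) \<and> (\<forall>x. 0 \<le> \<kappa> x \<and> \<kappa> x \<le> 1) \<and> (\<forall>x\<in>C n. \<kappa> x = 1)" for n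
    using smooth_cutoff[OF C(1) open_interior C(3)] by metis
  then obtain \<kappa> where \<kappa>: "\<And>n. \<kappa> n \<in> test_functions (interior (C (Suc n)))"
    "\<And>n x. 0 \<le> \<kappa> n x" "\<And>n x. \<kappa> n x \<le> 1" "\<And>n x. x \<in> C n \<Longrightarrow> \<kappa> n x = 1"
    by metis
  have mono: "C m \<subseteq> C n" if "m \<le> n" for m n
    using that by (rule lift_Suc_mono_le[of C, rotated]) (use C(3) interior_subset in blast)
  define \<zeta> where "\<zeta> n x = (case n of 0 \<Rightarrow> \<kappa> 0 x | Suc k \<Rightarrow> \<kappa> (Suc k) x - \<kappa> k x)" for n x
  have tel: "(\<Sum>n<Suc N. \<zeta> n x) = \<kappa> N x" for N x
    by (induction N) (auto simp: \<zeta>_def)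
  have \<zeta>1: "\<zeta> n \<in> test_functions (interior (C (Suc n)))" for n
  proof (cases n)
    case (Suc k)
    have "interior (C (Suc k)) \<subseteq> interior (C (Suc n))" using mono[of "Suc k" "Suc n"] Suc by (intro interior_mono) auto
    then have "\<kappa> k \<in> test_functions (interior (C (Suc n)))" using test_functions_mono[OF \<kappa>(1)] by blast
    then have "(\<lambda>x. \<kappa> n x + (-1) * \<kappa> k x) \<in> test_functions (interior (C (Suc n)))"
      by (intro test_functions_add test_functions_cmult \<kappa>(1))
    moreover have "\<zeta> n = (\<lambda>x. \<kappa> n x + (-1) * \<kappa> k x)" using Suc by (auto simp: \<zeta>_def)
    ultimately show ?thesis by simp
  qed (use \<kappa>(1)[of 0] in \<open>simp add: \<zeta>_def[abs_def]\<close>)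
  have \<zeta>2: "0 \<le> \<zeta> n x" for n x
  proof (cases n)
    case (Suc k)
    show ?thesis
    proof (cases "x \<in> C (Suc k)")
      case True then show ?thesis using Suc \<kappa>(3,4) by (simp add: \<zeta>_def)
    next
      case False
      then have "\<kappa> k x = 0" using test_functionsD(2)[OF \<kappa>(1)] interior_subset by blast
      then show ?thesis using Suc \<kappa>(2) by (simp add: \<zeta>_def)
    qed
  qed (use \<kappa>(2) in \<open>simp add: \<zeta>_def\<close>)
  have \<zeta>3: "\<zeta> n x = 0" if xm: "x \<in> C m" and mn: "m < n" for m n x
  proof -
    obtain k where k: "n = Suc k" "m \<le> k" using mn by (cases n) auto
    then have "x \<in> C k" "x \<in> C (Suc k)" using mono[of m k] mono[of m "Suc k"] xm by auto
    then show ?thesis using \<kappa>(4) k by (simp add: \<zeta>_def)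
  qed
  have \<zeta>4: "(\<Sum>n<N. \<zeta> n x) \<le> 1" for N x using tel[of x] \<kappa>(3) by (cases N) auto
  have \<zeta>5: "(\<Sum>n<N. \<zeta> n x) = 1" if xm: "x \<in> C m" and mn: "m < N" for N m x
  proof -
    obtain k where k: "N = Suc k" "m \<le> k" using mn by (cases N) auto
    then show ?thesis using tel[of x k] \<kappa>(4)[of x k] mono[of m k] xm by auto
  qed
  have C5: "\<exists>m. K \<subseteq> C m" if "compact K" "K \<subseteq> \<Omega>" for K
    using C(4)[OF that] by blast
  show thesis by (rule that[OF C(1,3,2) C5 \<zeta>1 \<zeta>2 \<zeta>3 \<zeta>4 \<zeta>5])
qed

lemma test_fieldD: "v \<in> test_fields U \<Longrightarrow> (\<lambda>x. v x $ i) \<in> test_functions U"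
  by (simp add: test_fields_def)

lemma test_field_support:
  fixes v :: "real^'n \<Rightarrow> real^'n"
  assumes "v \<in> test_fields U"
  obtains K where "compact K" "K \<subseteq> U" "\<And>x i. x \<notin> K \<Longrightarrow> v x $ i = 0"
    "\<And>x i. x \<notin> K \<Longrightarrow> partial_deriv i (\<lambda>x. v x $ i) x = 0"
proof -
  have "\<exists>K. compact K \<and> K \<subseteq> U \<and> (\<forall>x. x \<notin> K \<longrightarrow> v x $ i = 0) \<and>
      (\<forall>x. x \<notin> K \<longrightarrow> partial_deriv i (\<lambda>x. v x $ i) x = 0)" for i
    using test_function_partial_deriv[OF test_fieldD[OF assms, of i], of i] by metis
  then obtain K where K: "\<And>i. compact (K i)" "\<And>i. K i \<subseteq> U" "\<And>i x. x \<notin> K i \<Longrightarrow> v x $ i = 0"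
    "\<And>i x. x \<notin> K i \<Longrightarrow> partial_deriv i (\<lambda>x. v x $ i) x = 0"
    by metis
  show thesis
    by (rule that[of "\<Union>i. K i"]) (use K in auto)
qed

lemma sum_half_powers: "(\<Sum>n<N. (1/2::real) ^ Suc n) = 1 - (1/2) ^ N"
  by (induction N) auto

text \<open>One radius has to meet finitely many requirements: mollification may enlarge the shell
  that carries \<open>h\<close> by at most one step of the exhaustion on either side, and all errors
  must stay below their tolerances. The index type of \<open>k\<close> is finite, so the minimum of
  the individual radii is positive.\<close>

lemma conv_moll_small_radius:
  fixes h :: "real^'n \<Rightarrow> real" and k :: "'n \<Rightarrow> real^'n \<Rightarrow> real"
  assumes C: "\<And>n::nat. compact (C n)" "\<And>n. C n \<subseteq> interior (C (Suc n))"
    and h1: "\<And>x. x \<notin> C (Suc n) \<Longrightarrow> h x = 0" and h2: "\<And>m x. x \<in> C m \<Longrightarrow> m < n \<Longrightarrow> h x = 0"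
    and p: "1 \<le> p" and hi: "integrable lborel h" "integrable lborel (\<lambda>x. \<bar>h x\<bar> powr p)"
    and ki: "\<And>i. integrable lborel (k i)" and e: "0 < e1" "0 < e2"
  obtains d where "0 < d" "\<And>x. x \<notin> C (n + 2) \<Longrightarrow> conv (moll d) h x = 0"
    "\<And>m x. x \<in> C m \<Longrightarrow> m + 2 \<le> n \<Longrightarrow> conv (moll d) h x = 0"
    "\<And>i. integrable lborel (\<lambda>x. \<bar>conv (moll d) (k i) x - k i x\<bar>)"
    "\<And>i. (\<integral>x. \<bar>conv (moll d) (k i) x - k i x\<bar> \<partial>lborel) < e1"
    "integrable lborel (\<lambda>x. \<bar>conv (moll d) h x - h x\<bar> powr p)"
    "(\<integral>x. \<bar>conv (moll d) h x - h x\<bar> powr p \<partial>lborel) < e2"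
proof -
  have mono: "C m \<subseteq> C n" if "m \<le> n" for m n
    using that by (rule lift_Suc_mono_le[of C, rotated]) (use C(2) interior_subset in blast)
  have nb: "\<exists>a>0. \<forall>x y. x \<in> C j \<longrightarrow> dist x y < a \<longrightarrow> y \<in> C (Suc j)" for j
  proof -
    obtain a where "a > 0" "(\<Union>x\<in>C j. cball x a) \<subseteq> interior (C (Suc j))"
      using compact_subset_open_imp_cball_epsilon_subset[OF C(1) open_interior C(2)] by metis
    then show ?thesis using interior_subset by (intro exI[of _ a]) fastforce
  qed
  obtain a1 where a1: "a1 > 0" "\<And>x y. x \<in> C (Suc n) \<Longrightarrow> dist x y < a1 \<Longrightarrow> y \<in> C (n + 2)"
    using nb[of "Suc n"] by auto
  \<comment> \<open>For n < 2 the truncated \<open>n - 2\<close> does no harm: \<open>a2\<close> is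
    applied only to points of \<open>C m\<close> with m + 2 <= n.\<close>
  obtain a2 where a2: "a2 > 0" "\<And>x y. x \<in> C (n - 2) \<Longrightarrow> dist x y < a2 \<Longrightarrow> y \<in> C (Suc (n - 2))"
    using nb[of "n - 2"] by auto
  have "\<exists>a>0. \<forall>d. 0 < d \<longrightarrow> d < a \<longrightarrow> integrable lborel (\<lambda>x. \<bar>conv (moll d) (k i) x - k i x\<bar>) \<and>
      (\<integral>x. \<bar>conv (moll d) (k i) x - k i x\<bar> \<partial>lborel) < e1" for i
    using conv_moll_Lr_approx[OF ki[of i], of 1 e1] ki[of i] e(1) by auto
  then have "\<exists>a3. \<forall>i. a3 i > 0 \<and> (\<forall>d. 0 < d \<longrightarrow> d < a3 i \<longrightarrow>
      integrable lborel (\<lambda>x. \<bar>conv (moll d) (k i) x - k i x\<bar>) \<and>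
      (\<integral>x. \<bar>conv (moll d) (k i) x - k i x\<bar> \<partial>lborel) < e1)"
    by (intro choice allI)
  then obtain a3 where a3: "\<And>i. a3 i > 0" "\<And>i d. 0 < d \<Longrightarrow> d < a3 i \<Longrightarrow>
      integrable lborel (\<lambda>x. \<bar>conv (moll d) (k i) x - k i x\<bar>) \<and>
      (\<integral>x. \<bar>conv (moll d) (k i) x - k i x\<bar> \<partial>lborel) < e1"
    by blast
  obtain a4 where a4: "a4 > 0" "\<And>d. 0 < d \<Longrightarrow> d < a4 \<Longrightarrow>
      integrable lborel (\<lambda>x. \<bar>conv (moll d) h x - h x\<bar> powr p) \<and>
      (\<integral>x. \<bar>conv (moll d) h x - h x\<bar> powr p \<partial>lborel) < e2"
    using conv_moll_Lr_approx[OF hi(1) p e(2) hi(2)] by blast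
  define d where "d = min (min a1 a2) (min a4 (Min (range a3))) / 2"
  have m3: "0 < Min (range a3)" using a3(1) by (subst Min_gr_iff) auto
  have d: "0 < d" using m3 a1(1) a2(1) a4(1) by (simp add: d_def)
  have l3: "d < a3 i" for i
  proof -
    have "Min (range a3) \<le> a3 i" by (intro Min_le) auto
    then show ?thesis using m3 a1(1) a2(1) a4(1) unfolding d_def by linarith
  qed
  have l: "d < a1" "d < a2" "d < a4" using m3 a1(1) a2(1) a4(1) unfolding d_def by linarith+
  have s1: "conv (moll d) h x = 0" if "x \<notin> C (n + 2)" for x
  proof (rule conv_eq_0)
    fix y assume "h y \<noteq> 0"
    then have "y \<in> C (Suc n)" using h1 by blast
    then have "\<not> dist y x < a1" using a1(2) that by blast
    then show "moll d (x - y) = 0" using l(1) by (intro moll_eq_0 d) (simp add: dist_norm norm_minus_commute)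
  qed
  have s2: "conv (moll d) h x = 0" if xm: "x \<in> C m" and mn: "m + 2 \<le> n" for m x
  proof (rule conv_eq_0)
    fix y assume "h y \<noteq> 0"
    moreover have "Suc (n - 2) < n" using mn by linarith
    ultimately have "y \<notin> C (Suc (n - 2))" using h2[of y "Suc (n - 2)"] by blast
    moreover have "x \<in> C (n - 2)" using mono[of m "n - 2"] xm diff_le_mono[OF mn, of 2] by auto
    ultimately have "\<not> dist x y < a2" using a2(2) by blast
    then show "moll d (x - y) = 0" using l(2) by (intro moll_eq_0 d) (simp add: dist_norm)
  qed
  show thesis
    by (rule that[OF d s1 s2]) (use a3(2)[OF d l3] a4(2)[OF d l(3)] in auto)
qed

text \<open>The Meyers--Serrin construction: the pieces \<open>u * \<zeta> n\<close> of \<open>u\<close> are mollified with radii that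
  shrink fast enough towards the boundary.\<close>

lemma smooth_approximation_borel:
  fixes \<Omega> :: "(real^'n) set"
  assumes \<Omega>: "open \<Omega>" and p: "1 \<le> p" and um [measurable]: "u \<in> borel_measurable borel"
    and u0: "\<And>x. x \<notin> \<Omega> \<Longrightarrow> u x = 0" and ui: "integrable lborel (\<lambda>x. \<bar>u x\<bar> powr p)"
    and TV: "\<And>v. v \<in> test_fields \<Omega> \<Longrightarrow> (\<And>x. norm (v x) \<le> 1) \<Longrightarrow> (\<integral>x. u x * classical_div v x \<partial>lborel) \<le> T"
    and e: "0 < e"
  obtains w where "smooth_fun_on \<Omega> w" "w \<in> borel_measurable borel" "\<And>x. x \<notin> \<Omega> \<Longrightarrow> w x = 0"
    "integrable lborel (\<lambda>x. \<bar>w x - u x\<bar> powr p)" "(\<integral>x. \<bar>w x - u x\<bar> powr p \<partial>lborel) \<le> e"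
    "\<And>v. v \<in> test_fields \<Omega> \<Longrightarrow> (\<And>x. norm (v x) \<le> 1) \<Longrightarrow> (\<integral>x. w x * classical_div v x \<partial>lborel) \<le> T + e"
proof -
  obtain C \<zeta> where C: "\<And>n::nat. compact (C n)" "\<And>n. C n \<subseteq> interior (C (Suc n))" "\<And>n. C n \<subseteq> \<Omega>"
    "\<And>K. compact K \<Longrightarrow> K \<subseteq> \<Omega> \<Longrightarrow> \<exists>m. K \<subseteq> C m"
    and \<zeta>: "\<And>n. \<zeta> n \<in> test_functions (interior (C (Suc n)))" "\<And>n x. 0 \<le> \<zeta> n x"
    "\<And>m n x. x \<in> C m \<Longrightarrow> m < n \<Longrightarrow> \<zeta> n x = 0"
    "\<And>N x. (\<Sum>n<N. \<zeta> n x) \<le> 1" "\<And>N m x. x \<in> C m \<Longrightarrow> m < N \<Longrightarrow> (\<Sum>n<N. \<zeta> n x) = 1"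
    using smooth_partition[OF \<Omega>] by metis
  define h where "h n x = u x * \<zeta> n x" for n x
  define k where "k n i x = u x * partial_deriv i (\<zeta> n) x" for n i x
  define c where "c n = (1/2::real) ^ Suc n" for n
  have c: "0 < c n" for n by (simp add: c_def)
  \<comment> \<open>The L_1 tolerances are shared among the coordinates, so that their sum over all
    \<open>n\<close> and \<open>i\<close> is at most \<open>e\<close>.\<close>
  define e1 where "e1 n = e * c n / real CARD('n)" for n
  \<comment> \<open>The factor \<open>c n powr p\<close> pays for the division by \<open>c n\<close>
    in \<open>sum_abs_powr_le_max\<close>; the remaining e * c n sums to at most
    \<open>e\<close>.\<close>
  define e2 where "e2 n = e * c n * c n powr p" for n
  have cp: "0 < c n powr p" for n using c[of n] by simp
  have e12: "0 < e1 n" "0 < e2 n" for n using e c cp by (auto simp: e1_def e2_def)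
  have hi: "integrable lborel (h n)" "integrable lborel (\<lambda>x. \<bar>h n x\<bar> powr p)" for n
    unfolding h_def using Lp_mult_test_integrable[OF um p ui \<zeta>(1)] by auto
  have ki: "integrable lborel (k n i)" for n i
    unfolding k_def using Lp_mult_test_integrable[OF um p ui test_functions_partial_deriv[OF \<zeta>(1)]] by auto
  have "\<exists>d>0. (\<forall>x. x \<notin> C (n + 2) \<longrightarrow> conv (moll d) (h n) x = 0) \<and>
    (\<forall>m x. x \<in> C m \<longrightarrow> m + 2 \<le> n \<longrightarrow> conv (moll d) (h n) x = 0) \<and>
    (\<forall>i. integrable lborel (\<lambda>x. \<bar>conv (moll d) (k n i) x - k n i x\<bar>) \<and>
      (\<integral>x. \<bar>conv (moll d) (k n i) x - k n i x\<bar> \<partial>lborel) < e1 n) \<and>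
    integrable lborel (\<lambda>x. \<bar>conv (moll d) (h n) x - h n x\<bar> powr p) \<and>
    (\<integral>x. \<bar>conv (moll d) (h n) x - h n x\<bar> powr p \<partial>lborel) < e2 n" for n
  proof -
    have z1: "h n x = 0" if "x \<notin> C (Suc n)" for x
      using test_functionsD(2)[OF \<zeta>(1), of x n] that interior_subset by (auto simp: h_def)
    have z2: "h n x = 0" if "x \<in> C m" "m < n" for m x
      using \<zeta>(3)[OF that] by (simp add: h_def)
    obtain d where "0 < d" "\<And>x. x \<notin> C (n + 2) \<Longrightarrow> conv (moll d) (h n) x = 0"
      "\<And>m x. x \<in> C m \<Longrightarrow> m + 2 \<le> n \<Longrightarrow> conv (moll d) (h n) x = 0"
      "\<And>i. integrable lborel (\<lambda>x. \<bar>conv (moll d) (k n i) x - k n i x\<bar>)"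
      "\<And>i. (\<integral>x. \<bar>conv (moll d) (k n i) x - k n i x\<bar> \<partial>lborel) < e1 n"
      "integrable lborel (\<lambda>x. \<bar>conv (moll d) (h n) x - h n x\<bar> powr p)"
      "(\<integral>x. \<bar>conv (moll d) (h n) x - h n x\<bar> powr p \<partial>lborel) < e2 n"
      by (rule conv_moll_small_radius[where C = C and n = n and h = "h n" and k = "k n",
            OF C(1,2) _ _ p hi ki e12(1)[of n] e12(2)[of n]]) (use z1 z2 in blast)+
    then show ?thesis by blast
  qed
  then have "\<exists>d. \<forall>n. d n > 0 \<and> (\<forall>x. x \<notin> C (n + 2) \<longrightarrow> conv (moll (d n)) (h n) x = 0) \<and>
    (\<forall>m x. x \<in> C m \<longrightarrow> m + 2 \<le> n \<longrightarrow> conv (moll (d n)) (h n) x = 0) \<and>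
    (\<forall>i. integrable lborel (\<lambda>x. \<bar>conv (moll (d n)) (k n i) x - k n i x\<bar>) \<and>
      (\<integral>x. \<bar>conv (moll (d n)) (k n i) x - k n i x\<bar> \<partial>lborel) < e1 n) \<and>
    integrable lborel (\<lambda>x. \<bar>conv (moll (d n)) (h n) x - h n x\<bar> powr p) \<and>
    (\<integral>x. \<bar>conv (moll (d n)) (h n) x - h n x\<bar> powr p \<partial>lborel) < e2 n"
    by (intro choice allI)
  then obtain d where d: "\<And>n. 0 < d n"
    and t1: "\<And>n x. x \<notin> C (n + 2) \<Longrightarrow> conv (moll (d n)) (h n) x = 0"
    and t2: "\<And>n m x. x \<in> C m \<Longrightarrow> m + 2 \<le> n \<Longrightarrow> conv (moll (d n)) (h n) x = 0"
    and t3: "\<And>n i. integrable lborel (\<lambda>x. \<bar>conv (moll (d n)) (k n i) x - k n i x\<bar>)"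
      "\<And>n i. (\<integral>x. \<bar>conv (moll (d n)) (k n i) x - k n i x\<bar> \<partial>lborel) < e1 n"
    and t4: "\<And>n. integrable lborel (\<lambda>x. \<bar>conv (moll (d n)) (h n) x - h n x\<bar> powr p)"
      "\<And>n. (\<integral>x. \<bar>conv (moll (d n)) (h n) x - h n x\<bar> powr p \<partial>lborel) < e2 n"
    by blast
  define t where "t n = conv (moll (d n)) (h n)" for n
  note mt = moll_test_function[OF d]
  note [measurable] = moll_measurable[OF d] borel_measurable_integrable[OF hi(1)] borel_measurable_integrable[OF ki]
  have tm [measurable]: "t n \<in> borel_measurable borel" for n unfolding t_def by measurable
  have ts: "smooth_fun_on V (t n)" for V n unfolding t_def by (rule smooth_fun_on_conv[OF hi(1) mt])
  define w where "w x = (\<Sum>n. t n x)" for x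
  \<comment> \<open>The series is locally finite: on \<open>C m\<close> all pieces from index m + 2
    on vanish.\<close>
  have wN: "w x = (\<Sum>n<N. t n x)" if "x \<in> C m" "m + 2 \<le> N" for x m N
    unfolding w_def by (rule suminf_finite) (use t2[OF that(1)] that(2) in \<open>auto simp: t_def\<close>)
  have uN: "u x = (\<Sum>n<N. h n x)" if "x \<in> C m" "m + 2 \<le> N" for x m N
    using \<zeta>(5)[OF that(1), of N] that(2) by (simp add: h_def sum_distrib_left[symmetric])
  have inC: "\<exists>m. x \<in> C m" if "x \<in> \<Omega>" for x
    using C(4)[of "{x}"] that by auto
  have w0: "w x = 0" if "x \<notin> \<Omega>" for x
  proof -
    have "t n x = 0" for n using t1[of x n] C(3) that by (auto simp: t_def)
    then show ?thesis by (simp add: w_def)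
  qed
  have wm [measurable]: "w \<in> borel_measurable borel" unfolding w_def by measurable
  have wsm: "smooth_fun_on \<Omega> w"
  proof (rule smooth_fun_on_local)
    fix x assume "x \<in> \<Omega>"
    then obtain m where m: "x \<in> C m" using inC by blast
    have "smooth_fun_on (interior (C (Suc m))) w"
    proof (rule smooth_fun_on_cong[OF open_interior])
      show "smooth_fun_on (interior (C (Suc m))) (\<lambda>x. \<Sum>n<Suc m + 2. t n x)"
        by (intro smooth_fun_on_sum ts) auto
      show "(\<Sum>n<Suc m + 2. t n y) = w y" if "y \<in> interior (C (Suc m))" for y
        using wN[of y "Suc m" "Suc m + 2"] that interior_subset by (metis subsetD order_refl)
    qed
    then show "\<exists>V. x \<in> V \<and> smooth_fun_on V w" using m C(2) by blast
  qed
  \<comment> \<open>On \<open>C m\<close> both \<open>w\<close> and \<open>u\<close> are finite sums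
    over the same indices, so w - u is a sum of mollification errors, to which the weighted bound
    applies.\<close>
  have wle: "ennreal (\<bar>w x - u x\<bar> powr p) \<le> (\<Sum>n. ennreal ((\<bar>t n x - h n x\<bar> / c n) powr p))" for x
  proof (cases "x \<in> \<Omega>")
    case True
    then obtain m where m: "x \<in> C m" using inC by blast
    have "w x - u x = (\<Sum>n<m + 2. t n x - h n x)"
      using wN[OF m, of "m + 2"] uN[OF m, of "m + 2"] by (simp add: sum_subtractf)
    then have "\<bar>w x - u x\<bar> powr p \<le> (\<Sum>n<m + 2. (\<bar>t n x - h n x\<bar> / c n) powr p)"
      using sum_abs_powr_le_max[of "{..<m + 2}" p c "\<lambda>n. t n x - h n x"] p c sum_half_powers[of "m + 2"]
      by (simp add: c_def)
    then have "ennreal (\<bar>w x - u x\<bar> powr p) \<le> ennreal (\<Sum>n<m + 2. (\<bar>t n x - h n x\<bar> / c n) powr p)"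
      by (rule ennreal_leI)
    also have "\<dots> = (\<Sum>n<m + 2. ennreal ((\<bar>t n x - h n x\<bar> / c n) powr p))" by (rule sum_ennreal[symmetric]) auto
    also have "\<dots> \<le> (\<Sum>n. ennreal ((\<bar>t n x - h n x\<bar> / c n) powr p))" by (rule sum_le_suminf) auto
    finally show ?thesis .
  qed (use w0 u0 p in simp)
  have "(\<integral>\<^sup>+x. ennreal (\<bar>w x - u x\<bar> powr p) \<partial>lborel)
      \<le> (\<integral>\<^sup>+x. (\<Sum>n. ennreal ((\<bar>t n x - h n x\<bar> / c n) powr p)) \<partial>lborel)"
    by (intro nn_integral_mono wle)
  also have "\<dots> = (\<Sum>n. (\<integral>\<^sup>+x. ennreal ((\<bar>t n x - h n x\<bar> / c n) powr p) \<partial>lborel))"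
    by (rule nn_integral_suminf) measurable
  also have "\<dots> \<le> ennreal e"
  proof (rule suminf_le_const[OF summableI])
    fix N
    have "(\<integral>\<^sup>+x. ennreal ((\<bar>t n x - h n x\<bar> / c n) powr p) \<partial>lborel) \<le> ennreal (e * c n)" for n
    proof -
      have eq: "(\<bar>t n x - h n x\<bar> / c n) powr p = (1 / c n powr p) * \<bar>t n x - h n x\<bar> powr p" for x
        using c[of n] by (simp add: powr_divide)
      have ii: "integrable lborel (\<lambda>x. (\<bar>t n x - h n x\<bar> / c n) powr p)"
        unfolding eq using t4(1)[of n] by (simp add: t_def)
      have "(\<integral>x. (\<bar>t n x - h n x\<bar> / c n) powr p \<partial>lborel) \<le> (1 / c n powr p) * e2 n"
        unfolding eq using t4[of n] c[of n] by (simp add: t_def divide_right_mono)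
      also have "\<dots> = e * c n" using c[of n] by (simp add: e2_def)
      finally show ?thesis by (subst nn_integral_eq_integral[OF ii]) (auto intro: ennreal_leI)
    qed
    then have "(\<Sum>n<N. \<integral>\<^sup>+x. ennreal ((\<bar>t n x - h n x\<bar> / c n) powr p) \<partial>lborel) \<le> (\<Sum>n<N. ennreal (e * c n))"
      by (intro sum_mono)
    also have "\<dots> = ennreal (\<Sum>n<N. e * c n)" using e c by (intro sum_ennreal) (auto intro: less_imp_le)
    also have "\<dots> \<le> ennreal (e * 1)"
    proof (rule ennreal_leI)
      have "(\<Sum>n<N. c n) \<le> 1" using sum_half_powers[of N] by (simp add: c_def)
      then show "(\<Sum>n<N. e * c n) \<le> e * 1" using e by (simp add: sum_distrib_left[symmetric] del: mult_1_right)
    qed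
    finally show "(\<Sum>n<N. \<integral>\<^sup>+x. ennreal ((\<bar>t n x - h n x\<bar> / c n) powr p) \<partial>lborel) \<le> ennreal e" by simp
  qed
  finally have wu: "(\<integral>\<^sup>+x. ennreal (\<bar>w x - u x\<bar> powr p) \<partial>lborel) \<le> ennreal e" .
  have wui: "integrable lborel (\<lambda>x. \<bar>w x - u x\<bar> powr p)"
    by (rule integrableI_nonneg) (use wu in \<open>auto intro: le_less_trans\<close>)
  have wue: "(\<integral>x. \<bar>w x - u x\<bar> powr p \<partial>lborel) \<le> e"
    using wu e nn_integral_eq_integral[OF wui] by simp
  have TVw: "(\<integral>x. w x * classical_div v x \<partial>lborel) \<le> T + e"
    if v: "v \<in> test_fields \<Omega>" and v1: "\<And>x. norm (v x) \<le> 1" for v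
  proof -
    obtain K where K: "compact K" "K \<subseteq> \<Omega>" "\<And>x i. x \<notin> K \<Longrightarrow> v x $ i = 0"
      "\<And>x i. x \<notin> K \<Longrightarrow> partial_deriv i (\<lambda>x. v x $ i) x = 0"
      using test_field_support[OF v] by metis
    obtain m where m: "K \<subseteq> C m" using C(4)[OF K(1,2)] by blast
    \<comment> \<open>Large enough that on \<open>C m\<close> the first \<open>N\<close> pieces make
      up \<open>w\<close>, and that the partition sums to 1 on \<open>C (Suc m)\<close>, which is a
      neighbourhood of \<open>K\<close>.\<close>
    define N where "N = m + 3"
    define \<phi> where "\<phi> i x = v x $ i" for i x
    define V where "V n i = (\<lambda>x. \<zeta> n x * conv (moll (d n)) (\<phi> i) x)" for n i
    have \<phi>t: "\<phi> i \<in> test_functions \<Omega>" for i unfolding \<phi>_def by (rule test_fieldD[OF v])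
    have v1': "\<bar>\<phi> i x\<bar> \<le> 1" for i x
      using component_le_norm_cart[of "v x" i] v1[of x] by (simp add: \<phi>_def)
    note I = integral_conv_moll_partial_deriv[OF d \<zeta>(1) \<phi>t hi(1)[unfolded h_def] ki[unfolded k_def], folded k_def h_def]
    have Vint: "integrable lborel (\<lambda>x. u x * partial_deriv i (V n i) x)" for n i
      unfolding V_def by (rule I(2))
    have kint: "integrable lborel (\<lambda>x. k n i x * \<phi> i x)" for n i using I(3) .
    have "w x * classical_div v x = (\<Sum>n<N. \<Sum>i\<in>UNIV. t n x * partial_deriv i (\<phi> i) x)" for x
    proof (cases "x \<in> K")
      case True
      have "w x = (\<Sum>n<N. t n x)" using wN[of x m N] m True by (auto simp: N_def)
      then show ?thesis by (simp add: classical_div_def \<phi>_def[abs_def] sum_product)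
    next
      case False
      then show ?thesis using K(4) by (simp add: classical_div_def \<phi>_def[abs_def])
    qed
    then have "(\<integral>x. w x * classical_div v x \<partial>lborel)
        = (\<Sum>n<N. \<Sum>i\<in>UNIV. \<integral>x. t n x * partial_deriv i (\<phi> i) x \<partial>lborel)"
      using I(4) by (simp add: t_def)
    also have "\<dots> = (\<Sum>n<N. \<Sum>i\<in>UNIV. (\<integral>x. u x * partial_deriv i (V n i) x \<partial>lborel)
        - (\<integral>x. (conv (moll (d n)) (k n i) x - k n i x) * \<phi> i x \<partial>lborel)
        - (\<integral>x. k n i x * \<phi> i x \<partial>lborel))"
      unfolding t_def V_def by (intro sum.cong refl I(1))
    also have "\<dots> = (\<Sum>n<N. \<Sum>i\<in>UNIV. \<integral>x. u x * partial_deriv i (V n i) x \<partial>lborel)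
        - (\<Sum>n<N. \<Sum>i\<in>UNIV. \<integral>x. (conv (moll (d n)) (k n i) x - k n i x) * \<phi> i x \<partial>lborel)
        - (\<Sum>n<N. \<Sum>i\<in>UNIV. \<integral>x. k n i x * \<phi> i x \<partial>lborel)"
      by (simp add: sum_subtractf)
    also have "\<dots> \<le> T + e - 0"
    proof (intro diff_mono)
      \<comment> \<open>The mollified fields, weighted by the \<zeta> n, add up to a test field that
        is again bounded by 1, since the partial sums of the partition are at most 1. Testing
        \<open>u\<close> with it bounds the first sum by \<open>T\<close>.\<close>
      define W where "W x = (\<chi> i. \<Sum>n<N. V n i x)" for x
      have Vt: "V n i \<in> test_functions \<Omega>" for n i
      proof -
        have "(\<lambda>x. conv (moll (d n)) (\<phi> i) x * \<zeta> n x) \<in> test_functions \<Omega>"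
          using C(3)[of "Suc n"] interior_subset[of "C (Suc n)"]
          by (intro test_functions_smooth_mult \<Omega> smooth_fun_on_conv[OF _ mt]
              test_function_integrable[OF \<phi>t] test_functions_mono[OF \<zeta>(1)]) auto
        then show ?thesis by (simp add: V_def mult.commute)
      qed
      have Wt: "W \<in> test_fields \<Omega>"
        by (auto simp: test_fields_def W_def intro!: test_functions_sum Vt)
      have Wn: "norm (W x) \<le> 1" for x
      proof -
        have "W x = (\<Sum>n<N. \<zeta> n x *\<^sub>R (\<chi> i. conv (moll (d n)) (\<lambda>y. v y $ i) x))"
          by (simp add: vec_eq_iff W_def V_def \<phi>_def[abs_def])
        also have "norm \<dots> \<le> (\<Sum>n<N. \<zeta> n x * 1)"
        proof (intro sum_norm_le)
          fix n
          have "norm (\<chi> i. conv (moll (d n)) (\<lambda>y. v y $ i) x) \<le> 1"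
            by (rule norm_conv_moll_field_le[OF d test_function_integrable[OF test_fieldD[OF v]] v1])
          then show "norm (\<zeta> n x *\<^sub>R (\<chi> i. conv (moll (d n)) (\<lambda>y. v y $ i) x)) \<le> \<zeta> n x * 1"
            using \<zeta>(2)[of n x] by (simp add: mult_left_le)
        qed
        finally show ?thesis using \<zeta>(4)[of x N] by simp
      qed
      have "classical_div W x = (\<Sum>n<N. \<Sum>i\<in>UNIV. partial_deriv i (V n i) x)" for x
      proof -
        have "partial_deriv i (\<lambda>x. \<Sum>n<N. V n i x) x = (\<Sum>n<N. partial_deriv i (V n i) x)" for i
          by (rule partial_deriv_sum) (auto intro: smooth_fun_on_differentiable[OF test_functionsD(1)[OF Vt]])
        then show ?thesis by (simp add: classical_div_def W_def sum.swap[of _ "{..<N}"])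
      qed
      then have "(\<integral>x. u x * classical_div W x \<partial>lborel) = (\<Sum>n<N. \<Sum>i\<in>UNIV. \<integral>x. u x * partial_deriv i (V n i) x \<partial>lborel)"
        using Vint by (simp add: sum_distrib_left)
      then have A: "(\<Sum>n<N. \<Sum>i\<in>UNIV. \<integral>x. u x * partial_deriv i (V n i) x \<partial>lborel) \<le> T"
        using TV[OF Wt Wn] by simp
      have "\<bar>\<integral>x. (conv (moll (d n)) (k n i) x - k n i x) * \<phi> i x \<partial>lborel\<bar> \<le> e1 n" for n i
      proof -
        have j: "integrable lborel (\<lambda>x. conv (moll (d n)) (k n i) x - k n i x)"
          using t3(1)[of n i] by (subst (asm) integrable_abs_iff) auto
        have fm: "\<phi> i \<in> borel_measurable lborel" using test_function_measurable[OF \<phi>t] by simp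
        have "norm (\<integral>x. (conv (moll (d n)) (k n i) x - k n i x) * \<phi> i x \<partial>lborel)
            \<le> (\<integral>x. \<bar>conv (moll (d n)) (k n i) x - k n i x\<bar> \<partial>lborel)"
        proof (rule Bochner_Integration.integral_norm_bound_integral[OF integrable_mult_bounded[OF j fm v1'] t3(1)])
          fix x
          show "norm ((conv (moll (d n)) (k n i) x - k n i x) * \<phi> i x) \<le> \<bar>conv (moll (d n)) (k n i) x - k n i x\<bar>"
            using v1'[of i x] by (simp add: abs_mult mult_left_le)
        qed
        then show ?thesis using t3(2)[of n i] by simp
      qed
      then have "\<bar>\<Sum>n<N. \<Sum>i\<in>UNIV. \<integral>x. (conv (moll (d n)) (k n i) x - k n i x) * \<phi> i x \<partial>lborel\<bar>
          \<le> (\<Sum>n<N. \<Sum>i\<in>(UNIV::'n set). e1 n)"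
        by (intro order_trans[OF sum_abs] sum_mono)
      also have "\<dots> = e * (\<Sum>n<N. c n)" by (simp add: e1_def sum_distrib_left)
      also have "\<dots> \<le> e * 1" using sum_half_powers[of N] e by (intro mult_left_mono) (auto simp: c_def)
      finally show "(\<Sum>n<N. \<Sum>i\<in>UNIV. \<integral>x. u x * partial_deriv i (V n i) x \<partial>lborel)
        - (\<Sum>n<N. \<Sum>i\<in>UNIV. \<integral>x. (conv (moll (d n)) (k n i) x - k n i x) * \<phi> i x \<partial>lborel) \<le> T + e"
        using A by simp
      \<comment> \<open>Near \<open>K\<close> the partition sums to the constant 1, so its
        derivatives cancel; off \<open>K\<close> the field vanishes.\<close>
      have "(\<Sum>n<N. \<Sum>i\<in>UNIV. k n i x * \<phi> i x) = 0" for x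
      proof (cases "x \<in> K")
        case True
        then have x: "x \<in> interior (C (Suc m))" using m C(2) by blast
        have "(\<Sum>n<N. partial_deriv i (\<zeta> n) x) = 0" for i
        proof -
          have "(\<Sum>n<N. partial_deriv i (\<zeta> n) x) = partial_deriv i (\<lambda>x. \<Sum>n<N. \<zeta> n x) x"
            by (rule partial_deriv_sum[symmetric]) (auto intro: smooth_fun_on_differentiable[OF test_functionsD(1)[OF \<zeta>(1)]])
          also have "\<dots> = 0"
          proof (rule partial_deriv_locally_const[OF open_interior x])
            fix y assume "y \<in> interior (C (Suc m))"
            then have "y \<in> C (Suc m)" using interior_subset by blast
            then show "(\<Sum>n<N. \<zeta> n y) = 1" by (rule \<zeta>(5)) (simp add: N_def)
          qed
          finally show ?thesis .
        qed
        then have "(\<Sum>i\<in>UNIV. (u x * \<phi> i x) * (\<Sum>n<N. partial_deriv i (\<zeta> n) x)) = 0" by simp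
        then show ?thesis by (subst sum.swap) (simp add: k_def sum_distrib_left mult_ac)
      qed (use K(3) in \<open>simp add: \<phi>_def\<close>)
      moreover have "(\<Sum>n<N. \<Sum>i\<in>UNIV. \<integral>x. k n i x * \<phi> i x \<partial>lborel)
          = (\<integral>x. (\<Sum>n<N. \<Sum>i\<in>UNIV. k n i x * \<phi> i x) \<partial>lborel)"
        using kint by simp
      ultimately show "0 \<le> (\<Sum>n<N. \<Sum>i\<in>UNIV. \<integral>x. k n i x * \<phi> i x \<partial>lborel)" by simp
    qed
    finally show ?thesis by simp
  qed
  show thesis by (rule that[OF wsm wm w0 wui wue TVw])
qed

section \<open>Separation in Lebesgue spaces\<close>

lemma powr_superadditive:
  fixes x y r :: real
  assumes "0 \<le> x" "0 \<le> y" "1 \<le> r"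
  shows "x powr r + y powr r \<le> (x + y) powr r"
proof -
  have split: "z powr r = z * z powr (r - 1)" if "0 \<le> z" for z :: real
    using that powr_add[of z 1 "r - 1"] by (cases "z = 0") auto
  have "x * x powr (r - 1) + y * y powr (r - 1) \<le> x * (x + y) powr (r - 1) + y * (x + y) powr (r - 1)"
    using assms by (intro add_mono mult_left_mono powr_mono2) auto
  then show ?thesis using assms split[of x] split[of y] split[of "x + y"] by (simp add: algebra_simps)
qed

text \<open>The tangent at the midpoint lies below the graph at both ends, and its linear terms
  cancel.\<close>

lemma powr_midpoint_le:
  fixes x y r :: real
  assumes "0 \<le> x" "0 \<le> y" "1 \<le> r"
  shows "((x + y) / 2) powr r \<le> (x powr r + y powr r) / 2"
proof -
  let ?m = "(x + y) / 2"
  have "?m powr r + r * ?m powr (r - 1) * (x - ?m) \<le> x powr r"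
    "?m powr r + r * ?m powr (r - 1) * (y - ?m) \<le> y powr r"
    using assms by (intro powr_tangent_le; simp)+
  then have "2 * ?m powr r + r * ?m powr (r - 1) * ((x - ?m) + (y - ?m)) \<le> x powr r + y powr r"
    by (simp only: distrib_left)
  moreover have "(x - ?m) + (y - ?m) = 0" by (simp add: field_simps)
  ultimately show ?thesis by simp
qed

text \<open>With s = q/2 >= 1, this combines superadditivity of t^s, the parallelogram identity for
  the squares, and midpoint convexity of t^s.\<close>

lemma Clarkson_inequality:
  fixes a b q :: real
  assumes q: "2 \<le> q"
  shows "\<bar>(a + b) / 2\<bar> powr q + \<bar>(a - b) / 2\<bar> powr q \<le> (\<bar>a\<bar> powr q + \<bar>b\<bar> powr q) / 2"
proof -
  have sq: "\<bar>z\<bar> powr q = (z\<^sup>2) powr (q / 2)" for z :: real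
  proof -
    have "\<bar>z\<bar> powr q = (\<bar>z\<bar> powr 2) powr (q / 2)" by (subst powr_powr) simp
    also have "\<bar>z\<bar> powr 2 = z\<^sup>2" by (cases "z = 0") (auto simp: powr_numeral)
    finally show ?thesis .
  qed
  have "\<bar>(a + b) / 2\<bar> powr q + \<bar>(a - b) / 2\<bar> powr q \<le> (((a + b) / 2)\<^sup>2 + ((a - b) / 2)\<^sup>2) powr (q / 2)"
    unfolding sq using q by (intro powr_superadditive) auto
  also have "((a + b) / 2)\<^sup>2 + ((a - b) / 2)\<^sup>2 = (a\<^sup>2 + b\<^sup>2) / 2" by (simp add: power2_eq_square field_simps)
  also have "\<dots> powr (q / 2) \<le> ((a\<^sup>2) powr (q / 2) + (b\<^sup>2) powr (q / 2)) / 2"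
    using q by (intro powr_midpoint_le) auto
  finally show ?thesis unfolding sq .
qed

text \<open>The function sgn(s) |s|^r; for r = q - 1 > 0 it is the derivative of |s|^q / q. The
  splitting into positive and negative parts makes continuity for r > 0 and measurability
  immediate.\<close>

definition signed_powr :: "real \<Rightarrow> real \<Rightarrow> real" where
  "signed_powr r s = (max 0 s) powr r - (max 0 (- s)) powr r"

lemma abs_signed_powr: "\<bar>signed_powr r s\<bar> = \<bar>s\<bar> powr r"
  by (auto simp: signed_powr_def max_def)

lemma signed_powr_mult_self: "signed_powr (q - 1) s * s = \<bar>s\<bar> powr q"
proof -
  have "\<bar>s\<bar> powr (q - 1) * \<bar>s\<bar> = \<bar>s\<bar> powr q"
    using powr_add[of "\<bar>s\<bar>" "q - 1" 1] by (cases "s = 0") auto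
  then show ?thesis by (auto simp: signed_powr_def max_def abs_if split: if_splits)
qed

lemma tendsto_signed_powr:
  assumes "0 < r" "(f \<longlongrightarrow> a) F"
  shows "((\<lambda>x. signed_powr r (f x)) \<longlongrightarrow> signed_powr r a) F"
  unfolding signed_powr_def using assms
  by (intro tendsto_diff tendsto_powr' tendsto_max tendsto_const tendsto_minus) auto

lemma signed_powr_measurable [measurable]: "signed_powr r \<in> borel_measurable borel"
  unfolding signed_powr_def[abs_def] by measurable

lemma abs_powr_tangent_le:
  fixes a b q :: real
  assumes q: "1 \<le> q"
  shows "\<bar>b\<bar> powr q + q * signed_powr (q - 1) b * (a - b) \<le> \<bar>a\<bar> powr q"
proof -
  have "\<bar>b\<bar> powr q + q * \<bar>b\<bar> powr (q - 1) * (\<bar>a\<bar> - \<bar>b\<bar>) \<le> \<bar>a\<bar> powr q"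
    by (rule powr_tangent_le[OF q]) auto
  moreover have "signed_powr (q - 1) b * (a - b) \<le> \<bar>b\<bar> powr (q - 1) * (\<bar>a\<bar> - \<bar>b\<bar>)"
  proof (cases "0 \<le> b")
    case True
    then have "signed_powr (q - 1) b = \<bar>b\<bar> powr (q - 1)" by (simp add: signed_powr_def max_def)
    then show ?thesis using True by (simp add: mult_left_mono)
  next
    case False
    then have "signed_powr (q - 1) b * (a - b) = \<bar>b\<bar> powr (q - 1) * (b - a)"
      by (simp add: signed_powr_def max_def algebra_simps)
    then show ?thesis using False by (simp add: mult_left_mono)
  qed
  then have "q * (signed_powr (q - 1) b * (a - b)) \<le> q * (\<bar>b\<bar> powr (q - 1) * (\<bar>a\<bar> - \<bar>b\<bar>))"
    using q by (intro mult_left_mono) auto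
  ultimately show ?thesis by (simp add: mult.assoc)
qed

text \<open>Supplies integrable majorants: the powers q - 1 and 1 of a common bound combine to its
  q-th power.\<close>

lemma signed_powr_mult_le:
  assumes "1 \<le> q" "\<bar>a\<bar> \<le> c" "\<bar>b\<bar> \<le> c"
  shows "\<bar>signed_powr (q - 1) a * b\<bar> \<le> c powr q"
proof -
  have "\<bar>signed_powr (q - 1) a * b\<bar> \<le> c powr (q - 1) * c"
    unfolding abs_mult abs_signed_powr using assms by (intro mult_mono powr_mono2) auto
  also have "\<dots> = c powr q" using assms powr_add[of c "q - 1" 1] by (cases "c = 0") auto
  finally show ?thesis .
qed

lemma integrable_powr_add:
  fixes a b :: "'a \<Rightarrow> real"
  assumes [measurable]: "a \<in> borel_measurable M" "b \<in> borel_measurable M" and r: "0 < r"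
    and i: "integrable M (\<lambda>x. \<bar>a x\<bar> powr r)" "integrable M (\<lambda>x. \<bar>b x\<bar> powr r)"
  shows "integrable M (\<lambda>x. \<bar>a x + b x\<bar> powr r)"
proof (rule Bochner_Integration.integrable_bound)
  show "integrable M (\<lambda>x. 2 powr r * (\<bar>a x\<bar> powr r + \<bar>b x\<bar> powr r))" using i by simp
  show "AE x in M. norm (\<bar>a x + b x\<bar> powr r) \<le> norm (2 powr r * (\<bar>a x\<bar> powr r + \<bar>b x\<bar> powr r))"
    using abs_add_powr_le[OF r] by simp
qed measurable

lemma integrable_powr_cmult:
  fixes a :: "'a \<Rightarrow> real"
  assumes "integrable M (\<lambda>x. \<bar>a x\<bar> powr r)"
  shows "integrable M (\<lambda>x. \<bar>c * a x\<bar> powr r)"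
  using assms by (simp add: abs_mult powr_mult)

text \<open>Riesz--Fischer with a dominating function. Let R^q be the sum of (|g (n+1) - g n| / c
  n)^q, where c n = 2^-(n+1). In the hypothesis one factor pays for the division by c n, and the
  other makes the series of integrals converge. Then |g (n+1) - g n| <= c n R, so the sequence
  converges wherever the sum is finite and is bounded there by |g 0| + R.\<close>

lemma Lq_fast_Cauchy_converges:
  fixes g :: "nat \<Rightarrow> 'a \<Rightarrow> real"
  assumes [measurable]: "\<And>n. g n \<in> borel_measurable M" and q: "1 \<le> q"
    and gi: "\<And>n. integrable M (\<lambda>x. \<bar>g n x\<bar> powr q)"
    and d: "\<And>n. (\<integral>x. \<bar>g (Suc n) x - g n x\<bar> powr q \<partial>M) \<le> A * ((1/2) ^ Suc n * ((1/2) ^ Suc n) powr q)"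
  obtains g' B where "g' \<in> borel_measurable M" "B \<in> borel_measurable M" "integrable M (\<lambda>x. \<bar>B x\<bar> powr q)"
    "\<And>x. 0 \<le> B x" "AE x in M. (\<lambda>n. g n x) \<longlonglongrightarrow> g' x" "AE x in M. \<forall>n. \<bar>g n x\<bar> \<le> B x"
proof -
  define c where "c n = (1/2::real) ^ Suc n" for n
  have c: "0 < c n" for n by (simp add: c_def)
  have di: "integrable M (\<lambda>x. \<bar>g (Suc n) x - g n x\<bar> powr q)" for n
    using integrable_powr_add[of "g (Suc n)" M "\<lambda>x. (-1) * g n x" q] integrable_powr_cmult[OF gi, of "-1" n] gi q
    by simp
  define G where "G x = (\<Sum>n. ennreal ((\<bar>g (Suc n) x - g n x\<bar> / c n) powr q))" for x
  have Gm [measurable]: "G \<in> borel_measurable M" unfolding G_def by measurable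
  have A: "0 \<le> A"
  proof -
    have "0 \<le> (\<integral>x. \<bar>g (Suc 0) x - g 0 x\<bar> powr q \<partial>M)" by simp
    also have "\<dots> \<le> A * (c 0 * c 0 powr q)" using d[of 0] by (simp add: c_def)
    finally have "0 \<le> A * (c 0 * c 0 powr q)" .
    moreover have "0 < c 0 * c 0 powr q" using c[of 0] by simp
    ultimately show ?thesis by (meson mult_neg_pos not_le)
  qed
  have "(\<integral>\<^sup>+x. G x \<partial>M) = (\<Sum>n. (\<integral>\<^sup>+x. ennreal ((\<bar>g (Suc n) x - g n x\<bar> / c n) powr q) \<partial>M))"
    unfolding G_def by (rule nn_integral_suminf) measurable
  also have "\<dots> \<le> ennreal A"
  proof (rule suminf_le_const[OF summableI])
    fix N
    have "(\<integral>\<^sup>+x. ennreal ((\<bar>g (Suc n) x - g n x\<bar> / c n) powr q) \<partial>M) \<le> ennreal (A * c n)" for n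
    proof -
      have eq: "(\<bar>g (Suc n) x - g n x\<bar> / c n) powr q = (1 / c n powr q) * \<bar>g (Suc n) x - g n x\<bar> powr q" for x
        using c[of n] by (simp add: powr_divide)
      have ii: "integrable M (\<lambda>x. (\<bar>g (Suc n) x - g n x\<bar> / c n) powr q)"
        unfolding eq using di[of n] by simp
      have "(\<integral>x. (\<bar>g (Suc n) x - g n x\<bar> / c n) powr q \<partial>M) \<le> (1 / c n powr q) * (A * (c n * c n powr q))"
        unfolding eq integral_mult_right_zero by (rule mult_left_mono[OF d[of n, folded c_def]]) simp
      also have "\<dots> = A * c n" using c[of n] by simp
      finally show ?thesis by (subst nn_integral_eq_integral[OF ii]) (auto intro: ennreal_leI)
    qed
    then have "(\<Sum>n<N. \<integral>\<^sup>+x. ennreal ((\<bar>g (Suc n) x - g n x\<bar> / c n) powr q) \<partial>M) \<le> (\<Sum>n<N. ennreal (A * c n))"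
      by (intro sum_mono)
    also have "\<dots> = ennreal (A * (\<Sum>n<N. c n))"
      using A c by (subst sum_ennreal) (auto simp: sum_distrib_left less_imp_le)
    also have "\<dots> \<le> ennreal (A * 1)"
    proof (intro ennreal_leI mult_left_mono A)
      have "(\<Sum>n<N. c n) = 1 - (1/2) ^ N" by (induction N) (auto simp: c_def)
      then show "(\<Sum>n<N. c n) \<le> 1" by simp
    qed
    finally show "(\<Sum>n<N. \<integral>\<^sup>+x. ennreal ((\<bar>g (Suc n) x - g n x\<bar> / c n) powr q) \<partial>M) \<le> ennreal A" by simp
  qed
  finally have Gi: "(\<integral>\<^sup>+x. G x \<partial>M) < \<infinity>" by (rule le_less_trans) simp
  then have Gfin: "AE x in M. G x \<noteq> \<infinity>" by (intro nn_integral_noteq_infinite) auto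
  define S where "S x = enn2real (G x)" for x
  have [measurable]: "S \<in> borel_measurable M" unfolding S_def by measurable
  have Si: "integrable M S"
  proof (rule integrableI_nonneg)
    have "(\<integral>\<^sup>+x. ennreal (S x) \<partial>M) \<le> (\<integral>\<^sup>+x. G x \<partial>M)"
      by (intro nn_integral_mono) (simp add: S_def ennreal_enn2real_if)
    then show "(\<integral>\<^sup>+x. ennreal (S x) \<partial>M) < \<infinity>" using Gi by (rule le_less_trans)
  qed (auto simp: S_def)
  define R where "R x = S x powr (1 / q)" for x
  have Rq: "\<bar>R x\<bar> powr q = S x" for x using q by (simp add: R_def powr_powr S_def)
  have R0: "0 \<le> R x" for x by (simp add: R_def)
  define B where "B x = \<bar>g 0 x\<bar> + R x" for x
  have [measurable]: "R \<in> borel_measurable M" unfolding R_def by measurable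
  have Bm [measurable]: "B \<in> borel_measurable M" unfolding B_def by measurable
  have Bi: "integrable M (\<lambda>x. \<bar>B x\<bar> powr q)"
    unfolding B_def using gi[of 0] Si q by (intro integrable_powr_add) (auto simp: Rq)
  have key: "\<bar>g (Suc n) x - g n x\<bar> \<le> c n * R x" if "G x \<noteq> \<infinity>" for x n
  proof -
    have "ennreal ((\<bar>g (Suc n) x - g n x\<bar> / c n) powr q) \<le> G x"
    proof -
      define F where "F = (\<lambda>n. ennreal ((\<bar>g (Suc n) x - g n x\<bar> / c n) powr q))"
      have "sum F {n} \<le> suminf F" by (rule sum_le_suminf) auto
      then have "F n \<le> suminf F" by simp
      then show ?thesis unfolding F_def G_def .
    qed
    also have "G x = ennreal (S x)" unfolding S_def by (rule ennreal_enn2real[symmetric]) (use that in \<open>simp add: less_top\<close>)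
    finally have "(\<bar>g (Suc n) x - g n x\<bar> / c n) powr q \<le> S x" by (rule ennreal_le_iff[THEN iffD1, rotated]) (simp add: S_def)
    then have "((\<bar>g (Suc n) x - g n x\<bar> / c n) powr q) powr (1/q) \<le> R x"
      unfolding R_def using q by (intro powr_mono2) auto
    then show ?thesis using q c[of n] by (simp add: powr_powr pos_divide_le_eq mult.commute)
  qed
  have csum: "summable c" "(\<Sum>n<N. c n) \<le> 1" for N
  proof -
    show "summable c" unfolding c_def by (simp add: summable_mult summable_geometric)
    have "(\<Sum>n<N. c n) = 1 - (1/2) ^ N" by (induction N) (auto simp: c_def)
    then show "(\<Sum>n<N. c n) \<le> 1" by simp
  qed
  have conv: "convergent (\<lambda>n. g n x)" if "G x \<noteq> \<infinity>" for x
  proof -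
    have "summable (\<lambda>n. g (Suc n) x - g n x)"
      by (rule summable_comparison_test'[where g = "\<lambda>n. c n * R x" and N = 0])
        (use key[OF that] csum(1) in \<open>auto intro: summable_mult2\<close>)
    then have "convergent (\<lambda>n. \<Sum>i<n. g (Suc i) x - g i x)" by (simp add: summable_iff_convergent)
    then have "convergent (\<lambda>n. g n x - g 0 x)" by (simp add: sum_lessThan_telescope[of "\<lambda>i. g i x"])
    then show ?thesis by (simp add: convergent_diff_const_right_iff)
  qed
  have bound: "\<bar>g n x\<bar> \<le> B x" if "G x \<noteq> \<infinity>" for x n
  proof -
    have "\<bar>g n x - g 0 x\<bar> = \<bar>\<Sum>i<n. g (Suc i) x - g i x\<bar>" by (simp add: sum_lessThan_telescope[of "\<lambda>i. g i x"])
    also have "\<dots> \<le> (\<Sum>i<n. c i * R x)" by (intro order_trans[OF sum_abs] sum_mono key that)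
    also have "\<dots> = (\<Sum>i<n. c i) * R x" by (simp add: sum_distrib_right)
    also have "\<dots> \<le> 1 * R x" by (intro mult_right_mono csum R0)
    finally show ?thesis by (simp add: B_def)
  qed
  show thesis
  proof (rule that[of "\<lambda>x. lim (\<lambda>n. g n x)" B])
    show "AE x in M. (\<lambda>n. g n x) \<longlonglongrightarrow> lim (\<lambda>n. g n x)"
      using Gfin conv by (auto simp: convergent_LIMSEQ_iff elim!: eventually_mono)
    show "AE x in M. \<forall>n. \<bar>g n x\<bar> \<le> B x" using Gfin bound by (auto elim!: eventually_mono)
    show "0 \<le> B x" for x by (simp add: B_def R0)
  qed (use Bi in auto)
qed

text \<open>The bipolar theorem in \<open>L\<^sub>q\<close>. If \<open>g\<close> is the element of minimal norm in the closure of
  \<open>f - K\<close>, then \<open>\<bar>g\<bar> powr (q - 1) * sgn g\<close> separates \<open>f\<close> from \<open>K\<close>.\<close>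

lemma Lq_bipolar:
  fixes M :: "'a measure" and K :: "('a \<Rightarrow> real) set" and q :: real
  assumes q: "2 \<le> q" and K0: "K \<noteq> {}"
    and Km: "\<And>k. k \<in> K \<Longrightarrow> k \<in> borel_measurable M" and Ki: "\<And>k. k \<in> K \<Longrightarrow> integrable M (\<lambda>x. \<bar>k x\<bar> powr q)"
    and Kc: "\<And>k l t. k \<in> K \<Longrightarrow> l \<in> K \<Longrightarrow> 0 \<le> t \<Longrightarrow> t \<le> 1 \<Longrightarrow> (\<lambda>x. (1 - t) * k x + t * l x) \<in> K"
    and fm: "f \<in> borel_measurable M" and fi: "integrable M (\<lambda>x. \<bar>f x\<bar> powr q)"
    and sep: "\<And>u s. u \<in> borel_measurable M \<Longrightarrow> integrable M (\<lambda>x. \<bar>u x\<bar> powr (q / (q - 1))) \<Longrightarrow>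
        (\<And>k. k \<in> K \<Longrightarrow> (\<integral>x. u x * k x \<partial>M) \<le> s) \<Longrightarrow> (\<integral>x. u x * f x \<partial>M) \<le> s"
    and e: "0 < e"
  shows "\<exists>k\<in>K. (\<integral>x. \<bar>f x - k x\<bar> powr q \<partial>M) < e"
proof (rule ccontr)
  assume "\<not> ?thesis"
  then have far: "e \<le> (\<integral>x. \<bar>f x - k x\<bar> powr q \<partial>M)" if "k \<in> K" for k using that by (auto simp: not_less)
  have q0: "0 < q" "1 \<le> q" using q by auto
  define I where "I k = (\<integral>x. \<bar>f x - k x\<bar> powr q \<partial>M)" for k
  define D where "D = Inf (I ` K)"
  have bdd: "bdd_below (I ` K)" using far by (intro bdd_belowI2[of _ e]) (simp add: I_def)
  have D: "D \<le> I k" if "k \<in> K" for k unfolding D_def using that by (intro cInf_lower bdd) auto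
  have "e \<le> D" unfolding D_def using far K0 by (intro cInf_greatest) (auto simp: I_def)
  then have D0: "0 < D" using e by simp
  note [measurable] = fm
  have fki: "integrable M (\<lambda>x. \<bar>f x - k x\<bar> powr q)" if "k \<in> K" for k
    using integrable_powr_add[OF fm, of "\<lambda>x. (-1) * k x" q] Km[OF that] fi q0
      integrable_powr_cmult[OF Ki[OF that], of "-1"] by simp
  define c where "c n = (1/2::real) ^ Suc n" for n
  have c: "0 < c n" "c (Suc n) \<le> c n" "c n \<le> 1" for n
    by (auto simp: c_def) (rule order_trans[OF power_le_one], auto)
  \<comment> \<open>The excess over the infimum \<open>D\<close> decays at the rate that
    \<open>Lq_fast_Cauchy_converges\<close> asks for.\<close>
  define \<epsilon> where "\<epsilon> n = c n * c n powr q" for n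
  have \<epsilon>: "0 < \<epsilon> n" "\<epsilon> (Suc n) \<le> \<epsilon> n" "\<epsilon> n \<le> c n" for n
  proof -
    show "0 < \<epsilon> n" using c(1)[of n] by (simp add: \<epsilon>_def)
    show "\<epsilon> (Suc n) \<le> \<epsilon> n"
      unfolding \<epsilon>_def using c(1)[of n] c(1)[of "Suc n"] c(2)[of n] q0 by (intro mult_mono powr_mono2) auto
    have "c n powr q \<le> 1 powr q" using c(1,3)[of n] q0 by (intro powr_mono2) auto
    then show "\<epsilon> n \<le> c n" unfolding \<epsilon>_def using c(1)[of n] by (simp add: mult_left_le)
  qed
  have "\<exists>k\<in>K. I k < D + \<epsilon> n" for n
  proof -
    have "Inf (I ` K) < D + \<epsilon> n" using \<epsilon>(1)[of n] by (simp add: D_def)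
    then show ?thesis using cInf_lessD[of "I ` K"] K0 by auto
  qed
  then obtain k where k: "\<And>n. k n \<in> K" "\<And>n. I (k n) < D + \<epsilon> n" by metis
  define g where "g n x = f x - k n x" for n x
  have gm [measurable]: "g n \<in> borel_measurable M" for n unfolding g_def using Km[OF k(1)] by measurable
  have gi: "integrable M (\<lambda>x. \<bar>g n x\<bar> powr q)" for n unfolding g_def by (rule fki[OF k(1)])
  have gI: "(\<integral>x. \<bar>g n x\<bar> powr q \<partial>M) = I (k n)" for n by (simp add: g_def I_def)
  have gd: "(\<integral>x. \<bar>g (Suc n) x - g n x\<bar> powr q \<partial>M) \<le> 2 powr q * (c n * c n powr q)" for n
  proof -
    \<comment> \<open>Clarkson's inequality for consecutive members: the mean \<open>?a\<close> is
      \<open>f\<close> minus an element of the convex \<open>K\<close>, so its integral is at least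
      \<open>D\<close>, which leaves at most \<open>\<epsilon> n\<close> for half the
      difference.\<close>
    let ?a = "\<lambda>x. (g (Suc n) x + g n x) / 2" and ?b = "\<lambda>x. (g (Suc n) x - g n x) / 2"
    have ai: "integrable M (\<lambda>x. \<bar>?a x\<bar> powr q)"
      using integrable_powr_cmult[OF integrable_powr_add[OF gm gm q0(1) gi gi], of "1/2" "Suc n" n] by simp
    have bi0: "integrable M (\<lambda>x. \<bar>g (Suc n) x - g n x\<bar> powr q)"
      using integrable_powr_add[of "g (Suc n)" M "\<lambda>x. (-1) * g n x" q] integrable_powr_cmult[OF gi, of "-1" n] gi q0
      by simp
    then have bi: "integrable M (\<lambda>x. \<bar>?b x\<bar> powr q)" using integrable_powr_cmult[of M _ q "1/2"] by simp
    have mid: "(\<lambda>x. (1 - 1/2) * k (Suc n) x + 1/2 * k n x) \<in> K" by (rule Kc[OF k(1) k(1)]) auto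
    have "(\<integral>x. \<bar>?a x\<bar> powr q \<partial>M) = I (\<lambda>x. (1 - 1/2) * k (Suc n) x + 1/2 * k n x)"
      unfolding I_def by (intro Bochner_Integration.integral_cong) (auto simp: g_def field_simps)
    then have aD: "D \<le> (\<integral>x. \<bar>?a x\<bar> powr q \<partial>M)" using D[OF mid] by simp
    have "(\<integral>x. \<bar>?a x\<bar> powr q \<partial>M) + (\<integral>x. \<bar>?b x\<bar> powr q \<partial>M) = (\<integral>x. \<bar>?a x\<bar> powr q + \<bar>?b x\<bar> powr q \<partial>M)"
      using ai bi by simp
    also have "\<dots> \<le> (\<integral>x. (\<bar>g (Suc n) x\<bar> powr q + \<bar>g n x\<bar> powr q) / 2 \<partial>M)"
      using gi by (intro integral_mono Clarkson_inequality[OF q] Bochner_Integration.integrable_add ai bi) auto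
    also have "\<dots> = (I (k (Suc n)) + I (k n)) / 2" using gi by (simp add: gI)
    also have "\<dots> \<le> D + \<epsilon> n" using k(2)[of n] k(2)[of "Suc n"] \<epsilon>(2)[of n] by simp
    finally have "(\<integral>x. \<bar>?b x\<bar> powr q \<partial>M) \<le> \<epsilon> n" using aD by simp
    moreover have "\<bar>g (Suc n) x - g n x\<bar> powr q = 2 powr q * \<bar>?b x\<bar> powr q" for x
      by (simp add: powr_mult[symmetric])
    ultimately show ?thesis by (simp add: \<epsilon>_def)
  qed
  obtain g' B where g'm [measurable]: "g' \<in> borel_measurable M" and Bm [measurable]: "B \<in> borel_measurable M"
    and Bi: "integrable M (\<lambda>x. \<bar>B x\<bar> powr q)" and B0: "\<And>x. 0 \<le> B x"
    and lim: "AE x in M. (\<lambda>n. g n x) \<longlonglongrightarrow> g' x" and bnd: "AE x in M. \<forall>n. \<bar>g n x\<bar> \<le> B x"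
    using Lq_fast_Cauchy_converges[OF gm q0(2) gi gd[unfolded c_def]] by blast
  have bnd': "AE x in M. \<bar>g' x\<bar> \<le> B x"
    using lim bnd
  proof eventually_elim
    case (elim x)
    show ?case by (rule LIMSEQ_le_const2[OF tendsto_rabs[OF elim(1)]]) (use elim(2) in auto)
  qed
  \<comment> \<open>The limit \<open>g'\<close> need not have the form f - k, but the segment from
    it to f - l is a limit of segments inside f - K, so \<open>D\<close> remains a lower bound along
    it.\<close>
  have mini: "D \<le> (\<integral>x. \<bar>(1 - t) * g' x + t * (f x - l x)\<bar> powr q \<partial>M)"
    if l: "l \<in> K" and t: "0 \<le> t" "t \<le> 1" for l t
  proof -
    note [measurable] = Km[OF l]
    have "(\<lambda>n. \<integral>x. \<bar>(1 - t) * g n x + t * (f x - l x)\<bar> powr q \<partial>M)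
        \<longlonglongrightarrow> (\<integral>x. \<bar>(1 - t) * g' x + t * (f x - l x)\<bar> powr q \<partial>M)"
    proof (rule integral_dominated_convergence)
      show "integrable M (\<lambda>x. \<bar>B x + \<bar>f x - l x\<bar>\<bar> powr q)"
        using fki[OF l] by (intro integrable_powr_add Bi q0) auto
      show "AE x in M. (\<lambda>n. \<bar>(1 - t) * g n x + t * (f x - l x)\<bar> powr q)
          \<longlonglongrightarrow> \<bar>(1 - t) * g' x + t * (f x - l x)\<bar> powr q"
        using lim
      proof eventually_elim
        case (elim x)
        show ?case using q0 by (intro tendsto_powr' tendsto_intros elim) auto
      qed
      show "AE x in M. norm (\<bar>(1 - t) * g n x + t * (f x - l x)\<bar> powr q) \<le> \<bar>B x + \<bar>f x - l x\<bar>\<bar> powr q" for n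
        using bnd
      proof eventually_elim
        case (elim x)
        have "\<bar>(1 - t) * g n x + t * (f x - l x)\<bar> \<le> (1 - t) * \<bar>g n x\<bar> + t * \<bar>f x - l x\<bar>"
          using t by (intro order_trans[OF abs_triangle_ineq]) (simp add: abs_mult)
        also have "\<dots> \<le> 1 * B x + 1 * \<bar>f x - l x\<bar>"
          using t elim B0[of x] by (intro add_mono mult_mono) auto
        finally show ?case using B0[of x] q0 by (auto intro!: powr_mono2)
      qed
    qed measurable
    moreover have "D \<le> (\<integral>x. \<bar>(1 - t) * g n x + t * (f x - l x)\<bar> powr q \<partial>M)" for n
    proof -
      have "D \<le> I (\<lambda>x. (1 - t) * k n x + t * l x)" by (intro D Kc k l t)
      also have "\<dots> = (\<integral>x. \<bar>(1 - t) * g n x + t * (f x - l x)\<bar> powr q \<partial>M)"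
        unfolding I_def by (intro Bochner_Integration.integral_cong) (auto simp: g_def algebra_simps)
      finally show ?thesis .
    qed
    ultimately show ?thesis by (intro LIMSEQ_le_const) auto
  qed
  have g'i: "integrable M (\<lambda>x. \<bar>g' x\<bar> powr q)"
    by (rule Bochner_Integration.integrable_bound[OF Bi])
      (use bnd' B0 q0 in \<open>auto elim!: eventually_mono intro!: powr_mono2\<close>)
  have g'D: "(\<integral>x. \<bar>g' x\<bar> powr q \<partial>M) \<le> D"
  proof -
    have "(\<lambda>n. \<integral>x. \<bar>g n x\<bar> powr q \<partial>M) \<longlonglongrightarrow> (\<integral>x. \<bar>g' x\<bar> powr q \<partial>M)"
    proof (rule integral_dominated_convergence[OF _ _ Bi])
      show "AE x in M. (\<lambda>n. \<bar>g n x\<bar> powr q) \<longlonglongrightarrow> \<bar>g' x\<bar> powr q"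
        using lim
      proof eventually_elim
        case (elim x)
        show ?case using q0 by (intro tendsto_powr' tendsto_intros elim) auto
      qed
      show "AE x in M. norm (\<bar>g n x\<bar> powr q) \<le> \<bar>B x\<bar> powr q" for n
        using bnd B0 q0 by (auto elim!: eventually_mono intro!: powr_mono2)
    qed measurable
    moreover have "(\<lambda>n. D + c n) \<longlonglongrightarrow> D + 0"
      unfolding c_def by (intro tendsto_intros LIMSEQ_Suc LIMSEQ_power_zero) auto
    moreover have "I (k n) \<le> D + c n" for n using k(2)[of n] \<epsilon>(3)[of n] by linarith
    then have "\<exists>N. \<forall>n\<ge>N. (\<integral>x. \<bar>g n x\<bar> powr q \<partial>M) \<le> D + c n" by (simp add: gI)
    ultimately have "(\<integral>x. \<bar>g' x\<bar> powr q \<partial>M) \<le> D + 0" by (rule LIMSEQ_le)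
    then show ?thesis by simp
  qed
  define u where "u x = signed_powr (q - 1) (g' x)" for x
  have um [measurable]: "u \<in> borel_measurable M" unfolding u_def by measurable
  have ui: "integrable M (\<lambda>x. \<bar>u x\<bar> powr (q / (q - 1)))"
    unfolding u_def abs_signed_powr powr_powr using g'i q by simp
  have uint: "integrable M (\<lambda>x. u x * b x)"
    if [measurable]: "b \<in> borel_measurable M" and "integrable M (\<lambda>x. \<bar>b x\<bar> powr q)" for b
  proof (rule Bochner_Integration.integrable_bound[where f = "\<lambda>x. \<bar>\<bar>g' x\<bar> + \<bar>b x\<bar>\<bar> powr q"])
    show "integrable M (\<lambda>x. \<bar>\<bar>g' x\<bar> + \<bar>b x\<bar>\<bar> powr q)" using that(2) g'i q0 by (intro integrable_powr_add) auto
    have "\<bar>u x * b x\<bar> \<le> (\<bar>g' x\<bar> + \<bar>b x\<bar>) powr q" for x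
      unfolding u_def by (rule signed_powr_mult_le[OF q0(2)]) auto
    then show "AE x in M. norm (u x * b x) \<le> norm (\<bar>\<bar>g' x\<bar> + \<bar>b x\<bar>\<bar> powr q)" by auto
  qed measurable
  \<comment> \<open>First-order condition at the minimizer in the direction of f - l. The tangent
    inequality at \<open>g' + t * h\<close> gives the sign of the slope for every small t > 0, and
    the limit t -> 0 is taken by dominated convergence.\<close>
  have first: "0 \<le> (\<integral>x. u x * (f x - l x - g' x) \<partial>M)" if l: "l \<in> K" for l
  proof -
    note [measurable] = Km[OF l]
    define h where "h x = f x - l x - g' x" for x
    have hm [measurable]: "h \<in> borel_measurable M" unfolding h_def by measurable
    have hi: "integrable M (\<lambda>x. \<bar>h x\<bar> powr q)"
      using integrable_powr_add[of "\<lambda>x. f x - l x" M "\<lambda>x. (-1) * g' x" q] fki[OF l] q0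
        integrable_powr_cmult[OF g'i, of "-1"] by (simp add: h_def)
    define W where "W x = \<bar>\<bar>g' x\<bar> + \<bar>h x\<bar>\<bar> powr q" for x
    have Wi: "integrable M W" unfolding W_def using g'i hi q0 by (intro integrable_powr_add) auto
    have le: "\<bar>signed_powr (q - 1) (g' x + t * h x) * h x\<bar> \<le> W x" if t: "0 \<le> t" "t \<le> 1" for t x
    proof -
      have "\<bar>t * h x\<bar> \<le> \<bar>h x\<bar>" using t by (simp add: abs_mult mult_left_le_one_le)
      then have "\<bar>g' x + t * h x\<bar> \<le> \<bar>g' x\<bar> + \<bar>h x\<bar>" by linarith
      then show ?thesis unfolding W_def using signed_powr_mult_le[OF q0(2)] by simp
    qed
    have pos: "0 \<le> (\<integral>x. signed_powr (q - 1) (g' x + t * h x) * h x \<partial>M)" if t: "0 < t" "t \<le> 1" for t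
    proof -
      have j: "integrable M (\<lambda>x. signed_powr (q - 1) (g' x + t * h x) * h x)"
        by (rule Bochner_Integration.integrable_bound[OF Wi]) (use le[of t] t in \<open>auto intro: order_trans[OF _ abs_ge_self]\<close>)
      have i2: "integrable M (\<lambda>x. \<bar>g' x + t * h x\<bar> powr q)"
        using integrable_powr_add[of g' M "\<lambda>x. t * h x" q] g'i integrable_powr_cmult[OF hi, of t] q0 by simp
      have "D \<le> (\<integral>x. \<bar>(1 - t) * g' x + t * (f x - l x)\<bar> powr q \<partial>M)" using t by (intro mini l) auto
      also have "\<dots> = (\<integral>x. \<bar>g' x + t * h x\<bar> powr q \<partial>M)"
        by (intro Bochner_Integration.integral_cong) (auto simp: h_def algebra_simps)
      also have "\<dots> \<le> (\<integral>x. \<bar>g' x\<bar> powr q + (q * t) * (signed_powr (q - 1) (g' x + t * h x) * h x) \<partial>M)"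
      proof (rule integral_mono[OF i2])
        show "\<bar>g' x + t * h x\<bar> powr q \<le> \<bar>g' x\<bar> powr q + (q * t) * (signed_powr (q - 1) (g' x + t * h x) * h x)" for x
          using abs_powr_tangent_le[OF q0(2), of "g' x + t * h x" "g' x"] by (simp add: algebra_simps)
      qed (use g'i j in auto)
      also have "\<dots> = (\<integral>x. \<bar>g' x\<bar> powr q \<partial>M) + (q * t) * (\<integral>x. signed_powr (q - 1) (g' x + t * h x) * h x \<partial>M)"
        using g'i j by simp
      finally have "0 \<le> (q * t) * (\<integral>x. signed_powr (q - 1) (g' x + t * h x) * h x \<partial>M)" using g'D by linarith
      moreover have "0 < q * t" using t q0 by simp
      ultimately show ?thesis by (meson mult_pos_neg not_le)
    qed
    have "(\<lambda>n. \<integral>x. signed_powr (q - 1) (g' x + c n * h x) * h x \<partial>M) \<longlonglongrightarrow> (\<integral>x. u x * h x \<partial>M)"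
    proof (rule integral_dominated_convergence[OF _ _ Wi])
      show "AE x in M. (\<lambda>n. signed_powr (q - 1) (g' x + c n * h x) * h x) \<longlonglongrightarrow> u x * h x"
      proof (rule AE_I2)
        fix x
        have "(\<lambda>n. g' x + c n * h x) \<longlonglongrightarrow> g' x + 0 * h x"
          unfolding c_def by (intro tendsto_intros LIMSEQ_Suc LIMSEQ_power_zero) auto
        then show "(\<lambda>n. signed_powr (q - 1) (g' x + c n * h x) * h x) \<longlonglongrightarrow> u x * h x"
          unfolding u_def using q by (intro tendsto_mult tendsto_const tendsto_signed_powr) auto
      qed
      show "AE x in M. norm (signed_powr (q - 1) (g' x + c n * h x) * h x) \<le> W x" for n
        using le[of "c n"] c(1)[of n] c(3)[of n] by auto
    qed measurable
    then have "0 \<le> (\<integral>x. u x * h x \<partial>M)"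
      by (rule LIMSEQ_le_const) (use pos c in auto)
    then show ?thesis by (simp add: h_def)
  qed
  have ug: "(\<integral>x. u x * g' x \<partial>M) = (\<integral>x. \<bar>g' x\<bar> powr q \<partial>M)"
    unfolding u_def signed_powr_mult_self by simp
  have g'D2: "D \<le> (\<integral>x. \<bar>g' x\<bar> powr q \<partial>M)" using mini[of "k 0" 0] k(1) by simp
  \<comment> \<open>The integral of u g' is at least \<open>D\<close>, so under \<open>u\<close> the
    function \<open>f\<close> exceeds all of \<open>K\<close> by at least \<open>D\<close>,
    contradicting \<open>sep\<close>.\<close>
  have "(\<integral>x. u x * l x \<partial>M) \<le> (\<integral>x. u x * f x \<partial>M) - D" if l: "l \<in> K" for l
  proof -
    have "(\<integral>x. u x * (f x - l x - g' x) \<partial>M)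
        = (\<integral>x. u x * f x \<partial>M) - (\<integral>x. u x * l x \<partial>M) - (\<integral>x. u x * g' x \<partial>M)"
      using uint[OF fm fi] uint[OF Km[OF l] Ki[OF l]] uint[OF g'm g'i]
      by (simp add: right_diff_distrib)
    then show ?thesis using first[OF l] ug g'D2 by simp
  qed
  then have "(\<integral>x. u x * f x \<partial>M) \<le> (\<integral>x. u x * f x \<partial>M) - D" by (rule sep[OF um ui])
  then show False using D0 by simp
qed

section \<open>The Poincare inequality for functions of bounded variation\<close>

lemma conj_exponent:
  fixes p q :: real
  assumes "1 < p" "1 / p + 1 / q = 1"
  shows "1 < q" "q / (q - 1) = p" "p / (p - 1) = q"
proof -
  have q0: "q \<noteq> 0" using assms by auto
  then have *: "q + p = p * q" using assms by (simp add: field_simps)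
  have "q * (p - 1) = p" using * by (simp add: algebra_simps)
  then have q: "q = p / (p - 1)" using assms by (simp add: field_simps)
  then show "p / (p - 1) = q" by simp
  show q1: "1 < q" unfolding q using assms by (simp add: less_divide_eq_1)
  have "p * (q - 1) = q" using * by (simp add: algebra_simps)
  then show "q / (q - 1) = p" using q1 by (simp add: divide_eq_eq)
qed

lemma Lp_spaceD:
  assumes "u \<in> Lp_space p \<Omega>"
  shows "u \<in> borel_measurable (lebesgue_on \<Omega>)" "integrable (lebesgue_on \<Omega>) (\<lambda>x. \<bar>u x\<bar> powr p)"
  using assms by (auto simp: Lp_space_def)

lemma Lp_space_lincomb:
  assumes p: "0 < p" and u: "u \<in> Lp_space p \<Omega>" and w: "w \<in> Lp_space p \<Omega>"
  shows "(\<lambda>x. a * u x + b * w x) \<in> Lp_space p \<Omega>"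
proof -
  note [measurable] = Lp_spaceD(1)[OF u] Lp_spaceD(1)[OF w]
  show ?thesis unfolding Lp_space_def
    using integrable_powr_add[of "\<lambda>x. a * u x" "lebesgue_on \<Omega>" "\<lambda>x. b * w x" p]
      integrable_powr_cmult[OF Lp_spaceD(2)[OF u], of a] integrable_powr_cmult[OF Lp_spaceD(2)[OF w], of b] p
    by simp
qed

lemma Lp_space_diff:
  "0 < p \<Longrightarrow> u \<in> Lp_space p \<Omega> \<Longrightarrow> w \<in> Lp_space p \<Omega> \<Longrightarrow> (\<lambda>x. u x - w x) \<in> Lp_space p \<Omega>"
  using Lp_space_lincomb[of p u \<Omega> w 1 "-1"] by simp

lemma Lp_space_cong_AE:
  assumes "u \<in> Lp_space p \<Omega>" "w \<in> borel_measurable (lebesgue_on \<Omega>)" "AE x in lebesgue_on \<Omega>. u x = w x"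
  shows "w \<in> Lp_space p \<Omega>"
proof -
  note [measurable] = Lp_spaceD(1)[OF assms(1)] assms(2)
  have "integrable (lebesgue_on \<Omega>) (\<lambda>x. \<bar>w x\<bar> powr p) \<longleftrightarrow> integrable (lebesgue_on \<Omega>) (\<lambda>x. \<bar>u x\<bar> powr p)"
    using assms(3) by (intro integrable_cong_AE) auto
  then show ?thesis using Lp_spaceD(2)[OF assms(1)] assms(2) by (simp add: Lp_space_def)
qed

lemma Holder_inequality:
  assumes p: "1 < p" and pq: "1 / p + 1 / q = 1" and u: "u \<in> Lp_space p \<Omega>" and g: "g \<in> Lp_space q \<Omega>"
  shows "integrable (lebesgue_on \<Omega>) (\<lambda>x. u x * g x)"
    and "\<bar>\<integral>x. u x * g x \<partial>lebesgue_on \<Omega>\<bar> \<le> Lp_norm p \<Omega> u * Lp_norm q \<Omega> g"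
proof -
  let ?M = "lebesgue_on \<Omega>"
  have q: "1 < q" using conj_exponent[OF p pq] by simp
  note [measurable] = Lp_spaceD(1)[OF u] Lp_spaceD(1)[OF g]
  note ui = Lp_spaceD(2)[OF u] and gi = Lp_spaceD(2)[OF g]
  have young: "\<bar>u x * g x\<bar> \<le> \<bar>u x\<bar> powr p / p + \<bar>g x\<bar> powr q / q" for x
    using Youngs_inequality[OF p q pq, of "\<bar>u x\<bar>" "\<bar>g x\<bar>"] by (simp add: abs_mult)
  show i: "integrable ?M (\<lambda>x. u x * g x)"
    by (rule Bochner_Integration.integrable_bound[where f = "\<lambda>x. \<bar>u x\<bar> powr p / p + \<bar>g x\<bar> powr q / q"])
      (use ui gi young p q in \<open>auto intro: order_trans[OF _ abs_ge_self]\<close>)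
  define a where "a = Lp_norm p \<Omega> u"
  define b where "b = Lp_norm q \<Omega> g"
  have ab0: "0 \<le> a" "0 \<le> b" by (simp_all add: a_def b_def Lp_norm_def)
  have ap: "a powr p = (\<integral>x. \<bar>u x\<bar> powr p \<partial>?M)" using p by (simp add: a_def Lp_norm_def powr_powr)
  have bq: "b powr q = (\<integral>x. \<bar>g x\<bar> powr q \<partial>?M)" using q by (simp add: b_def Lp_norm_def powr_powr)
  have "\<bar>\<integral>x. u x * g x \<partial>?M\<bar> \<le> a * b"
  \<comment> \<open>Young's inequality is applied to the functions divided by their norms; if a norm
    vanishes, the product is zero almost everywhere.\<close>
  proof (cases "a = 0 \<or> b = 0")
    case True
    have "AE x in ?M. u x * g x = 0"
    proof (cases "a = 0")
      case True
      then have "(\<integral>x. \<bar>u x\<bar> powr p \<partial>?M) = 0" using ap by simp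
      then have "AE x in ?M. \<bar>u x\<bar> powr p = 0" using integral_nonneg_eq_0_iff_AE[OF ui] by simp
      then show ?thesis by (auto elim!: eventually_mono)
    next
      case False
      then have "(\<integral>x. \<bar>g x\<bar> powr q \<partial>?M) = 0" using bq True by simp
      then have "AE x in ?M. \<bar>g x\<bar> powr q = 0" using integral_nonneg_eq_0_iff_AE[OF gi] by simp
      then show ?thesis by (auto elim!: eventually_mono)
    qed
    then have "(\<integral>x. u x * g x \<partial>?M) = (\<integral>x. 0 \<partial>?M)" by (intro integral_cong_AE) auto
    then show ?thesis using ab0 by simp
  next
    case False
    then have ab: "0 < a" "0 < b" using ab0 by auto
    have le: "\<bar>u x * g x\<bar> \<le> a * b * (\<bar>u x\<bar> powr p / (p * a powr p) + \<bar>g x\<bar> powr q / (q * b powr q))" for x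
    proof -
      have "(\<bar>u x\<bar> / a) * (\<bar>g x\<bar> / b) \<le> (\<bar>u x\<bar> / a) powr p / p + (\<bar>g x\<bar> / b) powr q / q"
        using ab by (intro Youngs_inequality p q pq) auto
      then have "a * b * ((\<bar>u x\<bar> / a) * (\<bar>g x\<bar> / b)) \<le> a * b * ((\<bar>u x\<bar> / a) powr p / p + (\<bar>g x\<bar> / b) powr q / q)"
        using ab by (intro mult_left_mono) auto
      then show ?thesis using ab by (simp add: abs_mult powr_divide mult.commute)
    qed
    have "norm (\<integral>x. u x * g x \<partial>?M)
        \<le> (\<integral>x. a * b * (\<bar>u x\<bar> powr p / (p * a powr p) + \<bar>g x\<bar> powr q / (q * b powr q)) \<partial>?M)"
      by (rule Bochner_Integration.integral_norm_bound_integral[OF i]) (use ui gi le in auto)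
    also have "\<dots> = a * b * (a powr p / (p * a powr p) + b powr q / (q * b powr q))"
      using ui gi by (simp add: ap bq)
    also have "\<dots> = a * b * (1 / p + 1 / q)" using ab p q by simp
    finally show ?thesis using pq by simp
  qed
  then show "\<bar>\<integral>x. u x * g x \<partial>?M\<bar> \<le> Lp_norm p \<Omega> u * Lp_norm q \<Omega> g" by (simp add: a_def b_def)
qed

lemma const_in_Lp_space:
  assumes "open \<Omega>" "(\<lambda>_. c) \<in> Lp_space p \<Omega>"
  shows "c = 0 \<or> emeasure lebesgue \<Omega> < \<infinity>"
proof (rule disjCI)
  assume inf: "\<not> emeasure lebesgue \<Omega> < \<infinity>"
  show "c = 0"
  proof (rule ccontr)
    assume "c \<noteq> 0"
    then have "inverse (\<bar>c\<bar> powr p) * \<bar>c\<bar> powr p = 1" by simp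
    then have "integrable (lebesgue_on \<Omega>) (\<lambda>_. 1 :: real)"
      using integrable_mult_right[OF Lp_spaceD(2)[OF assms(2)], of "inverse (\<bar>c\<bar> powr p)"] by simp
    then have "integrable (lebesgue_on \<Omega>) (indicator \<Omega> :: _ \<Rightarrow> real)"
      by (rule Bochner_Integration.integrable_cong[OF refl, THEN iffD1, rotated]) simp
    then have "emeasure (lebesgue_on \<Omega>) \<Omega> < \<infinity>" by (simp add: integrable_indicator_iff)
    then show False using inf assms(1) by (simp add: emeasure_restrict_space)
  qed
qed

lemma finite_lebesgue_on:
  assumes "open \<Omega>" "emeasure lebesgue \<Omega> < \<infinity>"
  shows "finite_measure (lebesgue_on \<Omega>)"
  by (rule finite_measureI) (use assms in \<open>simp add: emeasure_restrict_space\<close>)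

lemma const_Lp_space:
  assumes "open \<Omega>" "emeasure lebesgue \<Omega> < \<infinity>"
  shows "(\<lambda>_. c) \<in> Lp_space p \<Omega>"
  unfolding Lp_space_def using finite_measure.integrable_const[OF finite_lebesgue_on[OF assms]] by simp

text \<open>A nonzero constant in L_p forces finite measure, and then \<open>g\<close> has mean
  zero. This covers both cases of \<open>Lq_sharp\<close> at once and makes the pairing well defined
  on classes.\<close>

lemma integral_mult_const_Lq_sharp:
  assumes \<Omega>: "open \<Omega>" and p: "1 < p" and pq: "1 / p + 1 / q = 1"
    and y: "(\<lambda>_. y) \<in> Lp_space p \<Omega>" and g: "g \<in> Lq_sharp q \<Omega>"
  shows "(\<integral>x. y * g x \<partial>lebesgue_on \<Omega>) = 0"
  using const_in_Lp_space[OF \<Omega> y] g by (auto simp: Lq_sharp_def)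

text \<open>Links the integrals over \<open>\<Omega>\<close> of the definitions with
  \<open>lborel\<close>, over which convolutions and Fubini are used.\<close>

lemma lebesgue_on_borel_zero:
  fixes F :: "real^'n \<Rightarrow> real"
  assumes \<Omega>: "open \<Omega>" and F: "F \<in> borel_measurable borel" and 0: "\<And>x. x \<notin> \<Omega> \<Longrightarrow> F x = 0"
  shows "integrable (lebesgue_on \<Omega>) F \<longleftrightarrow> integrable lborel F"
    and "(\<integral>x. F x \<partial>lebesgue_on \<Omega>) = (\<integral>x. F x \<partial>lborel)"
    and "F \<in> borel_measurable (lebesgue_on \<Omega>)"
proof -
  have \<Omega>': "\<Omega> \<inter> space lebesgue \<in> sets lebesgue" using \<Omega> by auto
  have eq: "(\<lambda>x. indicator \<Omega> x *\<^sub>R F x) = F"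
    using 0 by (intro ext) (auto simp: indicator_def)
  show "integrable (lebesgue_on \<Omega>) F \<longleftrightarrow> integrable lborel F"
    using F by (simp add: integrable_restrict_space[OF \<Omega>'] eq integrable_completion del: real_scaleR_def)
  show "(\<integral>x. F x \<partial>lebesgue_on \<Omega>) = (\<integral>x. F x \<partial>lborel)"
    using F by (simp add: integral_restrict_space[OF \<Omega>'] eq integral_completion del: real_scaleR_def)
  show "F \<in> borel_measurable (lebesgue_on \<Omega>)"
    using F by (intro measurable_restrict_space1 measurable_completion) simp
qed

text \<open>The mollification argument needs Borel functions on the whole space, whereas members of
  \<open>Lp_space\<close> are Lebesgue measurable and arbitrary off \<open>\<Omega>\<close>.\<close>

lemma borel_version:
  fixes u :: "real^'n \<Rightarrow> real"
  assumes \<Omega>: "open \<Omega>" and u: "u \<in> borel_measurable (lebesgue_on \<Omega>)"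
  obtains u' where "u' \<in> borel_measurable borel" "\<And>x. x \<notin> \<Omega> \<Longrightarrow> u' x = 0"
    "AE x in lebesgue_on \<Omega>. u x = u' x"
proof -
  have \<Omega>': "\<Omega> \<in> sets lebesgue" using \<Omega> by auto
  have "(\<lambda>x. if x \<in> \<Omega> then u x else 0) \<in> borel_measurable lebesgue"
    using u \<Omega>' by (simp add: borel_measurable_if)
  then obtain g where g: "g \<in> borel_measurable lborel" "AE x in lborel. (if x \<in> \<Omega> then u x else 0) = g x"
    using completion_ex_borel_measurable_real by blast
  have "AE x in lebesgue. (if x \<in> \<Omega> then u x else 0) = g x" using g(2) by (rule AE_completion)
  then have "AE x in lebesgue_on \<Omega>. u x = indicator \<Omega> x * g x"
    using \<Omega>' by (subst AE_restrict_space_iff) (auto elim!: eventually_mono)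
  moreover have "(\<lambda>x. indicator \<Omega> x * g x) \<in> borel_measurable borel"
    using g(1) \<Omega> by (intro borel_measurable_times borel_measurable_indicator) auto
  ultimately show thesis using that[of "\<lambda>x. indicator \<Omega> x * g x"] by simp
qed

text \<open>\<open>sup_norm\<close> is a real supremum, informative when the set is nonempty and the
  field bounded. A test field vanishes off \<open>\<Omega>\<close>, so the bound extends to all
  points.\<close>

lemma sup_norm_test_field_le_iff:
  fixes v :: "real^'n \<Rightarrow> real^'n"
  assumes v: "v \<in> test_fields \<Omega>" and ne: "\<Omega> \<noteq> {}" and B: "0 \<le> B"
  shows "sup_norm \<Omega> v \<le> B \<longleftrightarrow> (\<forall>x. norm (v x) \<le> B)"
proof -
  have "\<exists>M. \<forall>x. \<bar>v x $ i\<bar> \<le> M" for i using test_function_bounded[OF test_fieldD[OF v]] by metis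
  then obtain M where M: "\<And>i x. \<bar>v x $ i\<bar> \<le> M i" by metis
  have "norm (v x) \<le> (\<Sum>i\<in>UNIV. M i)" for x
    using norm_le_l1_cart[of "v x"] M by (meson order_trans sum_mono)
  then have bdd: "bdd_above ((\<lambda>x. norm (v x)) ` \<Omega>)" by (intro bdd_aboveI2)
  have "v x = 0" if "x \<notin> \<Omega>" for x
    using test_functionsD(2)[OF test_fieldD[OF v] that] by (simp add: vec_eq_iff)
  then show ?thesis using cSUP_le_iff[OF ne bdd, of B] B unfolding sup_norm_def
    by (metis norm_zero)
qed

section \<open>Total variation and smooth functions\<close>

lemma total_variation_le_iff:
  fixes \<Omega> :: "(real^'n) set"
  assumes "\<Omega> \<noteq> {}"
  shows "total_variation \<Omega> u \<le> ereal T \<longleftrightarrow>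
    (\<forall>v\<in>test_fields \<Omega>. (\<forall>x. norm (v x) \<le> 1) \<longrightarrow> (\<integral>x. u x * classical_div v x \<partial>lebesgue_on \<Omega>) \<le> T)"
  using sup_norm_test_field_le_iff[OF _ assms, of _ 1]
  by (auto simp: total_variation_def SUP_le_iff)

lemma test_field_zero: "(\<lambda>_. 0) \<in> test_fields \<Omega>"
  by (simp add: test_fields_def test_functions_0)

lemma classical_div_zero: "classical_div (\<lambda>_. 0) x = 0"
  by (simp add: classical_div_def)

lemma total_variation_bound_nonneg:
  fixes \<Omega> :: "(real^'n) set"
  assumes "\<Omega> \<noteq> {}" "total_variation \<Omega> u \<le> ereal T"
  shows "0 \<le> T"
  using assms(2) unfolding total_variation_le_iff[OF assms(1)]
  by (auto simp: test_field_zero classical_div_zero dest!: bspec[OF _ test_field_zero])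

text \<open>The product of \<open>w\<close> and \<phi> has compact support in
  \<open>\<Omega>\<close>, so each of its partial derivatives integrates to zero.\<close>

lemma integration_by_parts_test_function:
  fixes w :: "real^'n \<Rightarrow> real"
  assumes \<Omega>: "open \<Omega>" and w: "smooth_fun_on \<Omega> w" and \<phi>: "\<phi> \<in> test_functions \<Omega>"
  shows "(\<integral>x. w x * partial_deriv i \<phi> x \<partial>lborel) = - (\<integral>x. partial_deriv i w x * \<phi> x \<partial>lborel)"
proof -
  have t1: "(\<lambda>x. w x * \<phi> x) \<in> test_functions \<Omega>" by (rule test_functions_smooth_mult[OF \<Omega> w \<phi>])
  have t2: "(\<lambda>x. w x * partial_deriv i \<phi> x) \<in> test_functions \<Omega>"
    by (rule test_functions_smooth_mult[OF \<Omega> w test_functions_partial_deriv[OF \<phi>]])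
  have t3: "(\<lambda>x. partial_deriv i w x * \<phi> x) \<in> test_functions \<Omega>"
    by (rule test_functions_smooth_mult[OF \<Omega> smooth_fun_on_partial_deriv[OF w] \<phi>])
  have eq: "partial_deriv i (\<lambda>x. w x * \<phi> x) x = partial_deriv i w x * \<phi> x + w x * partial_deriv i \<phi> x" for x
  proof (cases "x \<in> \<Omega>")
    case True
    then show ?thesis
      using smooth_fun_on_differentiable[OF w True] smooth_fun_on_differentiable[OF test_functionsD(1)[OF \<phi>], of x]
      by (simp add: partial_deriv_mult)
  next
    case False
    then show ?thesis
      using test_functionsD(2)[OF test_functions_partial_deriv[OF t1]] test_functionsD(2)[OF \<phi>]
        test_functionsD(2)[OF test_functions_partial_deriv[OF \<phi>]] by simp
  qed
  have "0 = (\<integral>x. partial_deriv i (\<lambda>x. w x * \<phi> x) x \<partial>lborel)"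
    by (rule integral_partial_deriv_test_function[OF t1, symmetric])
  also have "\<dots> = (\<integral>x. partial_deriv i w x * \<phi> x \<partial>lborel) + (\<integral>x. w x * partial_deriv i \<phi> x \<partial>lborel)"
    unfolding eq by (rule Bochner_Integration.integral_add[OF test_function_integrable[OF t3] test_function_integrable[OF t2]])
  finally show ?thesis by simp
qed

lemma test_function_integral_lebesgue_on:
  assumes "open \<Omega>" "\<phi> \<in> test_functions \<Omega>"
  shows "(\<integral>x. \<phi> x \<partial>lebesgue_on \<Omega>) = (\<integral>x. \<phi> x \<partial>lborel)" "integrable (lebesgue_on \<Omega>) \<phi>"
  using lebesgue_on_borel_zero[OF assms(1) test_function_measurable[OF assms(2)] test_functionsD(2)[OF assms(2)]]
    test_function_integrable[OF assms(2)] by auto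

lemma integral_smooth_classical_div:
  fixes w :: "real^'n \<Rightarrow> real"
  assumes \<Omega>: "open \<Omega>" and w: "smooth_fun_on \<Omega> w" and v: "v \<in> test_fields \<Omega>"
  shows "(\<integral>x. w x * classical_div v x \<partial>lebesgue_on \<Omega>) = - (\<integral>x. grad w x \<bullet> v x \<partial>lebesgue_on \<Omega>)"
    and "(\<lambda>x. grad w x \<bullet> v x) \<in> test_functions \<Omega>"
proof -
  have t2: "(\<lambda>x. w x * partial_deriv i (\<lambda>x. v x $ i) x) \<in> test_functions \<Omega>" for i
    by (rule test_functions_smooth_mult[OF \<Omega> w test_functions_partial_deriv[OF test_fieldD[OF v]]])
  have t3: "(\<lambda>x. partial_deriv i w x * v x $ i) \<in> test_functions \<Omega>" for i
    by (rule test_functions_smooth_mult[OF \<Omega> smooth_fun_on_partial_deriv[OF w] test_fieldD[OF v]])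
  have eq: "(\<lambda>x. grad w x \<bullet> v x) = (\<lambda>x. \<Sum>i\<in>UNIV. partial_deriv i w x * v x $ i)"
    by (simp add: inner_vec_def grad_def)
  show "(\<lambda>x. grad w x \<bullet> v x) \<in> test_functions \<Omega>"
    unfolding eq by (intro test_functions_sum t3) auto
  have "(\<integral>x. w x * classical_div v x \<partial>lebesgue_on \<Omega>) = (\<Sum>i\<in>UNIV. \<integral>x. w x * partial_deriv i (\<lambda>x. v x $ i) x \<partial>lborel)"
    using test_function_integral_lebesgue_on[OF \<Omega> t2] by (simp add: classical_div_def sum_distrib_left)
  also have "\<dots> = (\<Sum>i\<in>UNIV. - (\<integral>x. partial_deriv i w x * v x $ i \<partial>lborel))"
    by (intro sum.cong refl integration_by_parts_test_function[OF \<Omega> w test_fieldD[OF v]])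
  also have "\<dots> = - (\<integral>x. grad w x \<bullet> v x \<partial>lebesgue_on \<Omega>)"
    unfolding eq using test_function_integral_lebesgue_on[OF \<Omega> t3] by (simp add: sum_negf)
  finally show "(\<integral>x. w x * classical_div v x \<partial>lebesgue_on \<Omega>) = - (\<integral>x. grad w x \<bullet> v x \<partial>lebesgue_on \<Omega>)" .
qed

lemma smooth_fun_on_measurable:
  fixes w :: "real^'n \<Rightarrow> real"
  assumes "open \<Omega>" "smooth_fun_on \<Omega> w"
  shows "w \<in> borel_measurable (lebesgue_on \<Omega>)"
  using assms by (intro continuous_imp_measurable_on_sets_lebesgue smooth_fun_on_continuous) auto

lemma grad_measurable:
  fixes w :: "real^'n \<Rightarrow> real"
  assumes "open \<Omega>" "smooth_fun_on \<Omega> w"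
  shows "grad w \<in> borel_measurable (lebesgue_on \<Omega>)"
proof -
  have "continuous_on \<Omega> (\<lambda>x. \<chi> i. partial_deriv i w x)"
    by (intro continuous_intros smooth_fun_on_continuous smooth_fun_on_partial_deriv assms)
  then show ?thesis unfolding grad_def[abs_def] using assms(1)
    by (intro continuous_imp_measurable_on_sets_lebesgue) auto
qed

text \<open>The total variation is tested with smooth approximations of \<open>- \<nabla>w / \<bar>\<nabla>w\<bar>\<close>.\<close>

lemma grad_integral_le_total_variation:
  fixes w :: "real^'n \<Rightarrow> real"
  assumes \<Omega>: "open \<Omega>" "\<Omega> \<noteq> {}" and w: "smooth_fun_on \<Omega> w" and TV: "total_variation \<Omega> w \<le> ereal T"
  shows "(\<integral>\<^sup>+x. ennreal (norm (grad w x)) \<partial>lebesgue_on \<Omega>) \<le> ennreal T"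
proof -
  obtain C \<zeta> where C: "\<And>n::nat. C n \<subseteq> interior (C (Suc n))" "\<And>n. C n \<subseteq> \<Omega>"
    "\<And>K. compact K \<Longrightarrow> K \<subseteq> \<Omega> \<Longrightarrow> \<exists>m. K \<subseteq> C m"
    and \<zeta>: "\<And>n. \<zeta> n \<in> test_functions (interior (C (Suc n)))" "\<And>n x. 0 \<le> \<zeta> n x"
    "\<And>N x. (\<Sum>n<N. \<zeta> n x) \<le> 1" "\<And>N m x. x \<in> C m \<Longrightarrow> m < N \<Longrightarrow> (\<Sum>n<N. \<zeta> n x) = 1"
    using smooth_partition[OF \<Omega>(1)] by metis
  \<comment> \<open>These cutoffs equal 1 on \<open>C m\<close> as soon as N > m and give the fields
    compact support in \<open>\<Omega>\<close>.\<close>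
  define \<kappa> where "\<kappa> N x = (\<Sum>n<N. \<zeta> n x)" for N x
  define d where "d N = inverse (real (Suc N))" for N
  have d: "0 < d N" for N by (simp add: d_def)
  \<comment> \<open>The positive \<open>d N\<close> regularizes 1 / |grad w| at the zeros of the
    gradient, so that the field stays smooth.\<close>
  define r where "r N x = ((d N)\<^sup>2 + (norm (grad w x))\<^sup>2) powr (- (1/2))" for N x
  define v where "v N x = (- \<kappa> N x * r N x) *\<^sub>R grad w x" for N x
  have base: "0 < (d N)\<^sup>2 + (norm (grad w x))\<^sup>2" for N x using d[of N] by (simp add: add_pos_nonneg)
  have r: "r N x = 1 / sqrt ((d N)\<^sup>2 + (norm (grad w x))\<^sup>2)" for N x
  proof -
    define b where "b = (d N)\<^sup>2 + (norm (grad w x))\<^sup>2"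
    have "b powr (- (1/2)) = inverse (b powr (1/2))" by (rule powr_minus)
    also have "\<dots> = inverse (sqrt b)" using base[of N x] by (subst powr_half_sqrt) (auto simp: b_def)
    finally show ?thesis by (simp add: r_def b_def inverse_eq_divide)
  qed
  have \<kappa>t: "\<kappa> N \<in> test_functions \<Omega>" for N
    unfolding \<kappa>_def
    by (intro test_functions_sum test_functions_mono[OF \<zeta>(1)])
      (use C(2) interior_subset in blast)+
  have \<kappa>b: "0 \<le> \<kappa> N x" "\<kappa> N x \<le> 1" for N x by (auto simp: \<kappa>_def intro: sum_nonneg \<zeta>)
  have vt: "v N \<in> test_fields \<Omega>" for N
  proof -
    have "smooth_fun_on \<Omega> (\<lambda>x. (d N)\<^sup>2 + (\<Sum>i\<in>UNIV. partial_deriv i w x * partial_deriv i w x))"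
      by (intro smooth_fun_on_add smooth_fun_on_const smooth_fun_on_sum smooth_fun_on_mult
          smooth_fun_on_partial_deriv w \<Omega>(1)) auto
    moreover have "(\<Sum>i\<in>UNIV. partial_deriv i w x * partial_deriv i w x) = (norm (grad w x))\<^sup>2" for x
      by (simp add: dot_square_norm[symmetric] inner_vec_def grad_def)
    ultimately have "smooth_fun_on \<Omega> (\<lambda>x. (d N)\<^sup>2 + (norm (grad w x))\<^sup>2)" by simp
    then have "smooth_fun_on \<Omega> (r N)"
      unfolding r_def[abs_def] using base by (intro smooth_fun_on_powr \<Omega>(1)) auto
    then have "smooth_fun_on \<Omega> (\<lambda>x. (-1) * (r N x * partial_deriv i w x))" for i
      by (intro smooth_fun_on_mult \<Omega>(1) smooth_fun_on_const smooth_fun_on_partial_deriv w)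
    then have "(\<lambda>x. ((-1) * (r N x * partial_deriv i w x)) * \<kappa> N x) \<in> test_functions \<Omega>" for i
      by (intro test_functions_smooth_mult \<Omega>(1) \<kappa>t)
    then show ?thesis by (simp add: test_fields_def v_def grad_def mult_ac)
  qed
  have vn: "norm (v N x) \<le> 1" for N x
  proof -
    have "norm (grad w x) \<le> sqrt ((d N)\<^sup>2 + (norm (grad w x))\<^sup>2)" by (rule real_le_rsqrt) simp
    moreover have "0 < sqrt ((d N)\<^sup>2 + (norm (grad w x))\<^sup>2)" using base[of N x] by simp
    ultimately have "norm (grad w x) / sqrt ((d N)\<^sup>2 + (norm (grad w x))\<^sup>2) \<le> 1" by simp
    then have "\<kappa> N x * (norm (grad w x) / sqrt ((d N)\<^sup>2 + (norm (grad w x))\<^sup>2)) \<le> 1 * 1"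
      using \<kappa>b[of N x] by (intro mult_mono) auto
    then show ?thesis using \<kappa>b[of N x] by (simp add: v_def r)
  qed
  define F where "F N x = \<kappa> N x * ((norm (grad w x))\<^sup>2 / sqrt ((d N)\<^sup>2 + (norm (grad w x))\<^sup>2))" for N x
  have F0: "0 \<le> F N x" for N x using \<kappa>b[of N x] by (simp add: F_def)
  have Fv: "grad w x \<bullet> v N x = - F N x" for N x by (simp add: v_def F_def r dot_square_norm)
  have Fle: "(\<integral>\<^sup>+x. ennreal (F N x) \<partial>lebesgue_on \<Omega>) \<le> ennreal T" for N
  proof -
    have t: "(\<lambda>x. - F N x) \<in> test_functions \<Omega>"
      using integral_smooth_classical_div(2)[OF \<Omega>(1) w vt[of N]] by (simp add: Fv)
    have i: "integrable (lebesgue_on \<Omega>) (F N)"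
      using test_function_integral_lebesgue_on(2)[OF \<Omega>(1) t] by simp
    have "(\<integral>x. w x * classical_div (v N) x \<partial>lebesgue_on \<Omega>) \<le> T"
      using TV vt vn unfolding total_variation_le_iff[OF \<Omega>(2)] by blast
    then have "(\<integral>x. F N x \<partial>lebesgue_on \<Omega>) \<le> T"
      using integral_smooth_classical_div(1)[OF \<Omega>(1) w vt[of N]] by (simp add: Fv)
    then show ?thesis using F0 by (subst nn_integral_eq_integral[OF i]) (auto intro: ennreal_leI)
  qed
  have lim: "(\<lambda>N. F N x) \<longlonglongrightarrow> norm (grad w x)" if "x \<in> \<Omega>" for x
  proof -
    obtain m where m: "x \<in> C m" using C(3)[of "{x}"] \<open>x \<in> \<Omega>\<close> by auto
    have "(\<lambda>N. (norm (grad w x))\<^sup>2 / sqrt ((d N)\<^sup>2 + (norm (grad w x))\<^sup>2)) \<longlonglongrightarrow> norm (grad w x)"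
    proof (cases "grad w x = 0")
      case False
      have "d \<longlonglongrightarrow> 0" unfolding d_def by (rule LIMSEQ_inverse_real_of_nat)
      then have "(\<lambda>N. (norm (grad w x))\<^sup>2 / sqrt ((d N)\<^sup>2 + (norm (grad w x))\<^sup>2))
          \<longlonglongrightarrow> (norm (grad w x))\<^sup>2 / sqrt (0\<^sup>2 + (norm (grad w x))\<^sup>2)"
        using False by (intro tendsto_intros) auto
      then show ?thesis using False by (simp add: power2_eq_square)
    qed simp
    moreover have "\<forall>\<^sub>F N in sequentially. (norm (grad w x))\<^sup>2 / sqrt ((d N)\<^sup>2 + (norm (grad w x))\<^sup>2) = F N x"
      using \<zeta>(4)[OF m] by (auto simp: eventually_sequentially F_def \<kappa>_def intro!: exI[of _ "Suc m"])
    ultimately show ?thesis by (rule Lim_transform_eventually)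
  qed
  have Fm [measurable]: "F N \<in> borel_measurable (lebesgue_on \<Omega>)" for N
  proof -
    note [measurable] = grad_measurable[OF \<Omega>(1) w] lebesgue_on_borel_zero(3)[OF \<Omega>(1) test_function_measurable[OF \<kappa>t] test_functionsD(2)[OF \<kappa>t]]
    show ?thesis unfolding F_def by measurable
  qed
  have "(\<integral>\<^sup>+x. ennreal (norm (grad w x)) \<partial>lebesgue_on \<Omega>)
      = (\<integral>\<^sup>+x. liminf (\<lambda>N. ennreal (F N x)) \<partial>lebesgue_on \<Omega>)"
  proof (rule nn_integral_cong)
    fix x assume "x \<in> space (lebesgue_on \<Omega>)"
    then have "(\<lambda>N. ennreal (F N x)) \<longlonglongrightarrow> ennreal (norm (grad w x))"
      by (intro tendsto_ennrealI lim) simp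
    then show "ennreal (norm (grad w x)) = liminf (\<lambda>N. ennreal (F N x))"
      by (simp add: lim_imp_Liminf)
  qed
  also have "\<dots> \<le> liminf (\<lambda>N. \<integral>\<^sup>+x. ennreal (F N x) \<partial>lebesgue_on \<Omega>)"
    by (rule nn_integral_liminf) measurable
  also have "\<dots> \<le> liminf (\<lambda>N::nat. ennreal T)" by (intro Liminf_mono always_eventually allI Fle)
  also have "\<dots> = ennreal T" by (simp add: Liminf_const)
  finally show ?thesis .
qed

text \<open>Reduction to \<open>smooth_approximation_borel\<close> by a Borel version of
  \<open>u\<close> that vanishes off \<open>\<Omega>\<close>; neither the L_p distance nor the
  tested integrals see the difference.\<close>

lemma smooth_approximation:
  fixes \<Omega> :: "(real^'n) set"
  assumes \<Omega>: "open \<Omega>" "\<Omega> \<noteq> {}" and p: "1 \<le> p" and u: "u \<in> Lp_space p \<Omega>"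
    and TV: "total_variation \<Omega> u \<le> ereal T" and e: "0 < e"
  obtains w where "w \<in> Lp_space p \<Omega>" "smooth_fun_on \<Omega> w" "total_variation \<Omega> w \<le> ereal (T + e)"
    "(\<integral>x. \<bar>w x - u x\<bar> powr p \<partial>lebesgue_on \<Omega>) \<le> e"
proof -
  let ?M = "lebesgue_on \<Omega>"
  note um [measurable] = Lp_spaceD(1)[OF u]
  obtain u' where u': "u' \<in> borel_measurable borel" "\<And>x. x \<notin> \<Omega> \<Longrightarrow> u' x = 0" "AE x in ?M. u x = u' x"
    using borel_version[OF \<Omega>(1) um] by metis
  note u'm [measurable] = lebesgue_on_borel_zero(3)[OF \<Omega>(1) u'(1,2)]
  have u'L: "u' \<in> Lp_space p \<Omega>" by (rule Lp_space_cong_AE[OF u u'm u'(3)])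
  have u'i: "integrable lborel (\<lambda>x. \<bar>u' x\<bar> powr p)"
    using Lp_spaceD(2)[OF u'L] lebesgue_on_borel_zero(1)[OF \<Omega>(1), of "\<lambda>x. \<bar>u' x\<bar> powr p"] u'(1,2) p by auto
  have divt: "classical_div v \<in> test_functions \<Omega>" if "v \<in> test_fields \<Omega>" for v
    unfolding classical_div_def[abs_def] by (intro test_functions_sum test_functions_partial_deriv test_fieldD[OF that]) auto
  have eqdiv: "(\<integral>x. h x * classical_div v x \<partial>?M) = (\<integral>x. h x * classical_div v x \<partial>lborel)"
    if "v \<in> test_fields \<Omega>" "h \<in> borel_measurable borel" for v h
  proof (rule lebesgue_on_borel_zero(2)[OF \<Omega>(1)])
    show "(\<lambda>x. h x * classical_div v x) \<in> borel_measurable borel"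
      using that(2) test_function_measurable[OF divt[OF that(1)]] by (intro borel_measurable_times)
  qed (use test_functionsD(2)[OF divt[OF that(1)]] in simp)
  have TV': "(\<integral>x. u' x * classical_div v x \<partial>lborel) \<le> T" if v: "v \<in> test_fields \<Omega>" "\<And>x. norm (v x) \<le> 1" for v
  proof -
    note [measurable] = lebesgue_on_borel_zero(3)[OF \<Omega>(1) test_function_measurable[OF divt[OF v(1)]] test_functionsD(2)[OF divt[OF v(1)]]]
    have "(\<integral>x. u' x * classical_div v x \<partial>lborel) = (\<integral>x. u' x * classical_div v x \<partial>?M)"
      using eqdiv[OF v(1) u'(1)] by simp
    also have "\<dots> = (\<integral>x. u x * classical_div v x \<partial>?M)"
      using u'(3) by (intro integral_cong_AE) (auto elim!: eventually_mono)
    also have "\<dots> \<le> T" using TV v unfolding total_variation_le_iff[OF \<Omega>(2)] by blast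
    finally show ?thesis .
  qed
  obtain w where w: "smooth_fun_on \<Omega> w" "w \<in> borel_measurable borel" "\<And>x. x \<notin> \<Omega> \<Longrightarrow> w x = 0"
    "integrable lborel (\<lambda>x. \<bar>w x - u' x\<bar> powr p)" "(\<integral>x. \<bar>w x - u' x\<bar> powr p \<partial>lborel) \<le> e"
    "\<And>v. v \<in> test_fields \<Omega> \<Longrightarrow> (\<And>x. norm (v x) \<le> 1) \<Longrightarrow> (\<integral>x. w x * classical_div v x \<partial>lborel) \<le> T + e"
    using smooth_approximation_borel[OF \<Omega>(1) p u'(1,2) u'i TV' e] by blast
  note wm [measurable] = lebesgue_on_borel_zero(3)[OF \<Omega>(1) w(2,3)]
  have wu: "integrable ?M (\<lambda>x. \<bar>w x - u' x\<bar> powr p)" "(\<integral>x. \<bar>w x - u' x\<bar> powr p \<partial>?M) \<le> e"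
    using lebesgue_on_borel_zero(1,2)[OF \<Omega>(1), of "\<lambda>x. \<bar>w x - u' x\<bar> powr p"] w u' p by auto
  have "(\<lambda>x. w x - u' x) \<in> Lp_space p \<Omega>" using wu(1) by (simp add: Lp_space_def)
  then have "(\<lambda>x. 1 * (w x - u' x) + 1 * u' x) \<in> Lp_space p \<Omega>" using u'L p by (intro Lp_space_lincomb) auto
  then have wL: "w \<in> Lp_space p \<Omega>" by simp
  have "(\<integral>x. \<bar>w x - u x\<bar> powr p \<partial>?M) = (\<integral>x. \<bar>w x - u' x\<bar> powr p \<partial>?M)"
    using u'(3) by (intro integral_cong_AE) (auto elim!: eventually_mono)
  then have 1: "(\<integral>x. \<bar>w x - u x\<bar> powr p \<partial>?M) \<le> e" using wu by simp
  have "total_variation \<Omega> w \<le> ereal (T + e)"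
    unfolding total_variation_le_iff[OF \<Omega>(2)] using w(6) eqdiv[OF _ w(2)] by auto
  from that[OF wL w(1) this 1] show thesis .
qed

lemma Lp_norm_le:
  assumes "1 \<le> p" "(\<integral>x. \<bar>u x\<bar> powr p \<partial>lebesgue_on \<Omega>) \<le> d powr p" "0 \<le> d"
  shows "Lp_norm p \<Omega> u \<le> d"
proof -
  have "Lp_norm p \<Omega> u \<le> (d powr p) powr (1 / p)"
    unfolding Lp_norm_def using assms by (intro powr_mono2) auto
  then show ?thesis using assms by (simp add: powr_powr)
qed

lemma Lp_norm_nonneg: "0 \<le> Lp_norm p \<Omega> u"
  by (simp add: Lp_norm_def)

text \<open>Hoelder's inequality turns closeness in L_p into closeness of the pairing with
  \<open>g\<close>; this error and the increase of the variation are tuned to the same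
  \<open>e\<close>.\<close>

lemma smooth_approximation_pairing:
  fixes \<Omega> :: "(real^'n) set"
  assumes \<Omega>: "open \<Omega>" "\<Omega> \<noteq> {}" and p: "1 < p" and pq: "1 / p + 1 / q = 1" and u: "u \<in> Lp_space p \<Omega>"
    and TV: "total_variation \<Omega> u \<le> ereal T" and g: "g \<in> Lp_space q \<Omega>" and e: "0 < e"
  obtains w where "w \<in> Lp_space p \<Omega>" "smooth_fun_on \<Omega> w" "total_variation \<Omega> w \<le> ereal (T + e)"
    "\<bar>(\<integral>x. w x * g x \<partial>lebesgue_on \<Omega>) - (\<integral>x. u x * g x \<partial>lebesgue_on \<Omega>)\<bar> \<le> e"
proof -
  \<comment> \<open>The summand 1 covers the case of a vanishing norm of \<open>g\<close>.\<close>
  define d where "d = e / (Lp_norm q \<Omega> g + 1)"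
  have n0: "0 < Lp_norm q \<Omega> g + 1" using Lp_norm_nonneg[of q \<Omega> g] by simp
  have d: "0 < d" using e n0 by (simp add: d_def)
  have m: "0 < min e (d powr p)" using e d by simp
  obtain w where w: "w \<in> Lp_space p \<Omega>" "smooth_fun_on \<Omega> w"
    "total_variation \<Omega> w \<le> ereal (T + min e (d powr p))"
    "(\<integral>x. \<bar>w x - u x\<bar> powr p \<partial>lebesgue_on \<Omega>) \<le> min e (d powr p)"
    using smooth_approximation[OF \<Omega> less_imp_le[OF p] u TV m] by blast
  have "total_variation \<Omega> w \<le> ereal (T + e)" using w(3) by (rule order_trans) simp
  moreover have "\<bar>(\<integral>x. w x * g x \<partial>lebesgue_on \<Omega>) - (\<integral>x. u x * g x \<partial>lebesgue_on \<Omega>)\<bar> \<le> e"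
  proof -
    have dL: "(\<lambda>x. w x - u x) \<in> Lp_space p \<Omega>" using w(1) u p by (intro Lp_space_diff) auto
    have "\<bar>\<integral>x. (w x - u x) * g x \<partial>lebesgue_on \<Omega>\<bar> \<le> Lp_norm p \<Omega> (\<lambda>x. w x - u x) * Lp_norm q \<Omega> g"
      by (rule Holder_inequality(2)[OF p pq dL g])
    also have "\<dots> \<le> d * (Lp_norm q \<Omega> g + 1)"
    proof (rule mult_mono)
      show "Lp_norm p \<Omega> (\<lambda>x. w x - u x) \<le> d" using w(4) p d by (intro Lp_norm_le) auto
    qed (use d in \<open>auto simp: Lp_norm_nonneg\<close>)
    also have "\<dots> = e" using n0 by (simp add: d_def)
    finally show ?thesis
      using Holder_inequality(1)[OF p pq w(1) g] Holder_inequality(1)[OF p pq u g] by (simp add: left_diff_distrib)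
  qed
  ultimately show thesis using that w(1,2) by blast
qed

text \<open>The Poincare inequality applies to a smooth approximation \<open>w\<close> of
  \<open>u\<close>; subtracting the constant \<open>y\<close> does not change the pairing with
  \<open>g\<close>, and Hoelder's inequality gives the bound. Thus \<open>c\<close> times the L_q
  norm dominates the norm of \<open>g\<close> as a form.\<close>

lemma Poincare_pairing_bound:
  fixes \<Omega> :: "(real^'n) set"
  assumes \<Omega>: "open \<Omega>" "\<Omega> \<noteq> {}" and p: "1 < p" and pq: "1 / p + 1 / q = 1" and P: "poincare_ineq p \<Omega> c"
    and u: "u \<in> Lp_space p \<Omega>" and TV: "total_variation \<Omega> u \<le> ereal T" and g: "g \<in> Lq_sharp q \<Omega>"
  shows "\<bar>\<integral>x. u x * g x \<partial>lebesgue_on \<Omega>\<bar> \<le> c * Lp_norm q \<Omega> g * T"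
proof (rule field_le_epsilon)
  fix e :: real assume e: "0 < e"
  have c: "0 < c" using P by (simp add: poincare_ineq_def)
  have gL: "g \<in> Lp_space q \<Omega>" using g by (simp add: Lq_sharp_def)
  have T: "0 \<le> T" by (rule total_variation_bound_nonneg[OF \<Omega>(2) TV])
  define G where "G = Lp_norm q \<Omega> g"
  have G: "0 \<le> G" by (simp add: G_def Lp_norm_nonneg)
  \<comment> \<open>The errors are \<open>d\<close> from the pairing and c G d from the total
    variation, together \<open>e\<close>.\<close>
  define d where "d = e / (1 + c * G)"
  have cG: "0 < 1 + c * G" using c G by (simp add: add_pos_nonneg)
  have d: "0 < d" using e cG by (simp add: d_def)
  obtain w where w: "w \<in> Lp_space p \<Omega>" "smooth_fun_on \<Omega> w" "total_variation \<Omega> w \<le> ereal (T + d)"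
    "\<bar>(\<integral>x. w x * g x \<partial>lebesgue_on \<Omega>) - (\<integral>x. u x * g x \<partial>lebesgue_on \<Omega>)\<bar> \<le> d"
    using smooth_approximation_pairing[OF \<Omega> p pq u TV gL d] by blast
  obtain y where y: "(\<lambda>x. w x - y) \<in> Lp_space p \<Omega>"
    "ennreal (Lp_norm p \<Omega> (\<lambda>x. w x - y)) \<le> ennreal c * (\<integral>\<^sup>+x. ennreal (norm (grad w x)) \<partial>lebesgue_on \<Omega>)"
    using P w(1,2) by (auto simp: poincare_ineq_def)
  have "ennreal (Lp_norm p \<Omega> (\<lambda>x. w x - y)) \<le> ennreal c * ennreal (T + d)"
    using y(2) grad_integral_le_total_variation[OF \<Omega> w(2,3)] by (meson order_trans mult_left_mono zero_le)
  also have "\<dots> = ennreal (c * (T + d))" using c T d by (simp add: ennreal_mult)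
  finally have yn: "Lp_norm p \<Omega> (\<lambda>x. w x - y) \<le> c * (T + d)" using c T d by (simp add: ennreal_le_iff)
  \<comment> \<open>Both \<open>w\<close> and w - y are in L_p, hence so is the constant
    \<open>y\<close>, and \<open>integral_mult_const_Lq_sharp\<close> removes it.\<close>
  have "(\<lambda>x. w x - (w x - y)) \<in> Lp_space p \<Omega>" using p by (intro Lp_space_diff w(1) y(1)) auto
  then have yL: "(\<lambda>_. y) \<in> Lp_space p \<Omega>" by simp
  have "(\<integral>x. w x * g x \<partial>lebesgue_on \<Omega>) = (\<integral>x. (w x - y) * g x + y * g x \<partial>lebesgue_on \<Omega>)"
    by (simp add: algebra_simps)
  also have "\<dots> = (\<integral>x. (w x - y) * g x \<partial>lebesgue_on \<Omega>)"
    using Holder_inequality(1)[OF p pq y(1) gL] Holder_inequality(1)[OF p pq yL gL]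
      integral_mult_const_Lq_sharp[OF \<Omega>(1) p pq yL g] by (subst Bochner_Integration.integral_add) auto
  also have "\<bar>\<dots>\<bar> \<le> Lp_norm p \<Omega> (\<lambda>x. w x - y) * G"
    unfolding G_def by (rule Holder_inequality(2)[OF p pq y(1) gL])
  also have "\<dots> \<le> c * (T + d) * G" by (intro mult_right_mono yn G)
  finally have "\<bar>\<integral>x. u x * g x \<partial>lebesgue_on \<Omega>\<bar> \<le> c * (T + d) * G + d" using w(4) by linarith
  also have "\<dots> = c * G * T + d * (1 + c * G)" by (simp add: algebra_simps)
  also have "\<dots> = c * G * T + e" using cG by (simp add: d_def)
  finally show "\<bar>\<integral>x. u x * g x \<partial>lebesgue_on \<Omega>\<bar> \<le> c * Lp_norm q \<Omega> g * T + e" by (simp add: G_def)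
qed

section \<open>Integration against signed measures\<close>

lemma borel_subsets_sigma_algebra: "sigma_algebra \<Omega> (borel_subsets \<Omega>)"
  using sets.sigma_algebra_axioms[of "restrict_space borel \<Omega>"] by (simp add: borel_subsets_def space_restrict_space)

lemma borel_subsets_rules:
  shows borel_subsets_empty: "{} \<in> borel_subsets \<Omega>"
    and borel_subsets_space: "\<Omega> \<in> borel_subsets \<Omega>"
    and borel_subsets_Un: "A \<in> borel_subsets \<Omega> \<Longrightarrow> B \<in> borel_subsets \<Omega> \<Longrightarrow> A \<union> B \<in> borel_subsets \<Omega>"
    and borel_subsets_Int: "A \<in> borel_subsets \<Omega> \<Longrightarrow> B \<in> borel_subsets \<Omega> \<Longrightarrow> A \<inter> B \<in> borel_subsets \<Omega>"
    and borel_subsets_Diff: "A \<in> borel_subsets \<Omega> \<Longrightarrow> B \<in> borel_subsets \<Omega> \<Longrightarrow> A - B \<in> borel_subsets \<Omega>"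
    and borel_subsets_UN: "range F \<subseteq> borel_subsets \<Omega> \<Longrightarrow> (\<Union>i::nat. F i) \<in> borel_subsets \<Omega>"
    and borel_subsets_subset: "A \<in> borel_subsets \<Omega> \<Longrightarrow> A \<subseteq> \<Omega>"
  using sets.sets_into_space[of A "restrict_space borel \<Omega>"] sets.top[of "restrict_space borel \<Omega>"]
  unfolding borel_subsets_def by (auto simp: space_restrict_space)

section \<open>Boundedness and Jordan decomposition of signed measures\<close>

lemma signed_measure_sums:
  "signed_borel_measure \<Omega> \<nu> \<Longrightarrow> range F \<subseteq> borel_subsets \<Omega> \<Longrightarrow> disjoint_family F \<Longrightarrow>
    (\<lambda>i::nat. \<nu> (F i)) sums \<nu> (\<Union>i. F i)"
  by (simp add: signed_borel_measure_def)

lemma signed_measure_Un: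
  assumes \<nu>: "signed_borel_measure \<Omega> \<nu>" and A: "A \<in> borel_subsets \<Omega>" and B: "B \<in> borel_subsets \<Omega>" and "A \<inter> B = {}"
  shows "\<nu> (A \<union> B) = \<nu> A + \<nu> B"
proof -
  have "(\<lambda>i. \<nu> (binaryset A B i)) sums \<nu> (\<Union>i. binaryset A B i)"
    using A B assms(4) borel_subsets_empty
    by (intro signed_measure_sums[OF \<nu>]) (auto simp: range_binaryset_eq disjoint_family_on_def binaryset_def)
  moreover have "(\<lambda>i. \<nu> (binaryset A B i)) sums (\<nu> A + \<nu> B)"
    using \<nu> by (intro binaryset_sums) (simp add: signed_borel_measure_def)
  ultimately show ?thesis by (simp add: UN_binaryset_eq sums_unique2)
qed

lemma signed_measure_Diff:
  assumes \<nu>: "signed_borel_measure \<Omega> \<nu>" and A: "A \<in> borel_subsets \<Omega>" and B: "B \<in> borel_subsets \<Omega>" and "B \<subseteq> A"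
  shows "\<nu> (A - B) = \<nu> A - \<nu> B"
  using signed_measure_Un[OF \<nu> B borel_subsets_Diff[OF A B]] assms(4) by (simp add: Un_absorb1)

lemma signed_measure_uminus: "signed_borel_measure \<Omega> \<nu> \<Longrightarrow> signed_borel_measure \<Omega> (\<lambda>A. - \<nu> A)"
  by (auto simp: signed_borel_measure_def intro: sums_minus)

lemma signed_measure_lincomb:
  "signed_borel_measure \<Omega> \<nu> \<Longrightarrow> signed_borel_measure \<Omega> \<mu> \<Longrightarrow> signed_borel_measure \<Omega> (\<lambda>A. a * \<nu> A + b * \<mu> A)"
  by (auto simp: signed_borel_measure_def intro!: sums_add sums_mult)

text \<open>If the values on subsets of \<open>E\<close> are unbounded, some \<open>B\<close> in
  \<open>E\<close> has |\<nu> B| > |\<nu> E| + 1. Then \<open>B\<close> and \<open>E - B\<close>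
  both have measure above 1 in modulus, and one of them is again unbounded in this sense. Repetition
  yields disjoint sets whose measures do not tend to 0, against countable additivity.\<close>

lemma signed_measure_bounded:
  assumes \<nu>: "signed_borel_measure \<Omega> \<nu>"
  obtains B where "\<And>A. A \<in> borel_subsets \<Omega> \<Longrightarrow> \<bar>\<nu> A\<bar> \<le> B"
proof (rule ccontr)
  assume "\<not> thesis"
  define unb where "unb E \<longleftrightarrow> E \<in> borel_subsets \<Omega> \<and> (\<forall>b. \<exists>A\<in>borel_subsets \<Omega>. A \<subseteq> E \<and> \<bar>\<nu> A\<bar> > b)" for E
  have unb\<Omega>: "unb \<Omega>"
    using \<open>\<not> thesis\<close> that borel_subsets_space borel_subsets_subset unfolding unb_def by (meson not_le)
  have step: "\<exists>E'. unb E' \<and> E' \<subseteq> E \<and> \<bar>\<nu> (E - E')\<bar> > 1" if E: "unb E" for E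
  proof -
    have Em: "E \<in> borel_subsets \<Omega>" using E by (simp add: unb_def)
    obtain B where B: "B \<in> borel_subsets \<Omega>" "B \<subseteq> E" "\<bar>\<nu> B\<bar> > \<bar>\<nu> E\<bar> + 1" using E unfolding unb_def by blast
    have EB: "E - B \<in> borel_subsets \<Omega>" by (rule borel_subsets_Diff[OF Em B(1)])
    have "\<bar>\<nu> (E - B)\<bar> > 1" using signed_measure_Diff[OF \<nu> Em B(1,2)] B(3) by linarith
    moreover have "unb B \<or> unb (E - B)"
    proof (rule ccontr)
      assume "\<not> (unb B \<or> unb (E - B))"
      then obtain b1 b2 where b: "\<And>A. A \<in> borel_subsets \<Omega> \<Longrightarrow> A \<subseteq> B \<Longrightarrow> \<bar>\<nu> A\<bar> \<le> b1"
        "\<And>A. A \<in> borel_subsets \<Omega> \<Longrightarrow> A \<subseteq> E - B \<Longrightarrow> \<bar>\<nu> A\<bar> \<le> b2"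
        using B(1) EB unfolding unb_def by (meson not_le)
      obtain A where A: "A \<in> borel_subsets \<Omega>" "A \<subseteq> E" "\<bar>\<nu> A\<bar> > b1 + b2" using E unfolding unb_def by blast
      have "\<nu> A = \<nu> (A \<inter> B) + \<nu> (A - B)"
        using signed_measure_Un[OF \<nu> borel_subsets_Int[OF A(1) B(1)] borel_subsets_Diff[OF A(1) B(1)]]
        by (simp add: Int_Diff_Un) (metis Diff_disjoint Int_Diff inf_commute inf_left_commute Int_empty_right)
      moreover have "\<bar>\<nu> (A \<inter> B)\<bar> \<le> b1" by (intro b borel_subsets_Int A B) auto
      moreover have "\<bar>\<nu> (A - B)\<bar> \<le> b2" using A(2) by (intro b borel_subsets_Diff A B) auto
      ultimately show False using A(3) by linarith
    qed
    moreover have "E - (E - B) = B" "\<bar>\<nu> B\<bar> > 1" using B(2,3) abs_ge_zero[of "\<nu> E"] by auto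
    ultimately show ?thesis using B(2) by (metis Diff_subset)
  qed
  obtain E where E: "unb (E 0)" "\<And>n. unb (E n) \<and> E (Suc n) \<subseteq> E n \<and> \<bar>\<nu> (E n - E (Suc n))\<bar> > 1"
  proof -
    obtain E where "\<And>n. unb (E n)" "\<And>n. E (Suc n) \<subseteq> E n \<and> \<bar>\<nu> (E n - E (Suc n))\<bar> > 1"
      using dependent_nat_choice[of "\<lambda>_. unb" "\<lambda>_ E E'. E' \<subseteq> E \<and> \<bar>\<nu> (E - E')\<bar> > 1"] unb\<Omega> step by metis
    then show ?thesis using that by blast
  qed
  define D where "D n = E n - E (Suc n)" for n
  have Dm: "D n \<in> borel_subsets \<Omega>" for n
    unfolding D_def using E(2) unb_def by (intro borel_subsets_Diff) blast+
  have mono: "E n \<subseteq> E m" if "m \<le> n" for m n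
    using that by (rule lift_Suc_antimono_le[of E, rotated]) (use E(2) in blast)
  have "D m \<inter> D n = {}" if "m < n" for m n
    using mono[of "Suc m" n] that by (auto simp: D_def)
  then have "disjoint_family D" unfolding disjoint_family_on_def by (metis Int_commute linorder_neqE_nat)
  then have "(\<lambda>n. \<nu> (D n)) sums \<nu> (\<Union>n. D n)" using Dm by (intro signed_measure_sums[OF \<nu>]) auto
  then have "(\<lambda>n. \<nu> (D n)) \<longlonglongrightarrow> 0" using summable_LIMSEQ_zero sums_summable by blast
  then have "\<forall>\<^sub>F n in sequentially. \<bar>\<nu> (D n)\<bar> < 1"
    using tendsto_rabs_zero order_tendstoD(2) zero_less_one by blast
  then obtain n where "\<bar>\<nu> (D n)\<bar> < 1" by (auto simp: eventually_sequentially)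
  then show False using E(2)[of n] by (simp add: D_def)
qed

text \<open>The real counterpart of the set function in \<open>pos_variation\<close>; for a signed
  measure the supremum is finite on account of \<open>signed_measure_bounded\<close>.\<close>

definition pos_var :: "(real^'n) set \<Rightarrow> ((real^'n) set \<Rightarrow> real) \<Rightarrow> (real^'n) set \<Rightarrow> real" where
  "pos_var \<Omega> \<nu> A = (SUP B\<in>{B \<in> borel_subsets \<Omega>. B \<subseteq> A}. \<nu> B)"

lemma pos_var_upper:
  assumes \<nu>: "signed_borel_measure \<Omega> \<nu>" and "B \<in> borel_subsets \<Omega>" "B \<subseteq> A"
  shows "\<nu> B \<le> pos_var \<Omega> \<nu> A"
proof -
  obtain b where b: "\<And>A. A \<in> borel_subsets \<Omega> \<Longrightarrow> \<bar>\<nu> A\<bar> \<le> b" using signed_measure_bounded[OF \<nu>] by metis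
  have "\<nu> B \<le> b" if "B \<in> borel_subsets \<Omega>" for B using b[OF that] by linarith
  then show ?thesis unfolding pos_var_def using assms by (intro cSUP_upper bdd_aboveI2[of _ _ b]) auto
qed

lemma pos_var_least:
  assumes "\<And>B. B \<in> borel_subsets \<Omega> \<Longrightarrow> B \<subseteq> A \<Longrightarrow> \<nu> B \<le> b"
  shows "pos_var \<Omega> \<nu> A \<le> b"
  unfolding pos_var_def using assms borel_subsets_empty by (intro cSUP_least) auto

lemma pos_var_nonneg: "signed_borel_measure \<Omega> \<nu> \<Longrightarrow> 0 \<le> pos_var \<Omega> \<nu> A"
  using pos_var_upper[of \<Omega> \<nu> "{}" A] borel_subsets_empty by (auto simp: signed_borel_measure_def)

text \<open>Passing from \<open>B\<close> to \<open>A - B\<close> matches the competitors for \<nu>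
  with those for -\<nu>, shifted by \<open>\<nu> A\<close>. This replaces a Hahn
  decomposition.\<close>

lemma pos_var_minus:
  assumes \<nu>: "signed_borel_measure \<Omega> \<nu>" and A: "A \<in> borel_subsets \<Omega>"
  shows "pos_var \<Omega> \<nu> A - pos_var \<Omega> (\<lambda>A. - \<nu> A) A = \<nu> A"
proof -
  note \<nu>' = signed_measure_uminus[OF \<nu>]
  have "pos_var \<Omega> \<nu> A \<le> \<nu> A + pos_var \<Omega> (\<lambda>A. - \<nu> A) A"
  proof (rule pos_var_least)
    fix B assume B: "B \<in> borel_subsets \<Omega>" "B \<subseteq> A"
    show "\<nu> B \<le> \<nu> A + pos_var \<Omega> (\<lambda>A. - \<nu> A) A"
      using signed_measure_Diff[OF \<nu> A B] pos_var_upper[OF \<nu>' borel_subsets_Diff[OF A B(1)], of A] by simp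
  qed
  moreover have "pos_var \<Omega> (\<lambda>A. - \<nu> A) A \<le> pos_var \<Omega> \<nu> A - \<nu> A"
  proof (rule pos_var_least)
    fix B assume B: "B \<in> borel_subsets \<Omega>" "B \<subseteq> A"
    show "- \<nu> B \<le> pos_var \<Omega> \<nu> A - \<nu> A"
      using signed_measure_Diff[OF \<nu> A B] pos_var_upper[OF \<nu> borel_subsets_Diff[OF A B(1)], of A] by simp
  qed
  ultimately show ?thesis by simp
qed

lemma pos_var_superadditive:
  assumes \<nu>: "signed_borel_measure \<Omega> \<nu>" and "A \<inter> B = {}"
  shows "pos_var \<Omega> \<nu> A + pos_var \<Omega> \<nu> B \<le> pos_var \<Omega> \<nu> (A \<union> B)"
proof -
  have *: "\<nu> A' + \<nu> B' \<le> pos_var \<Omega> \<nu> (A \<union> B)"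
    if "A' \<in> borel_subsets \<Omega>" "A' \<subseteq> A" "B' \<in> borel_subsets \<Omega>" "B' \<subseteq> B" for A' B'
  proof -
    have "A' \<inter> B' = {}" using that assms(2) by auto
    then show ?thesis
      using signed_measure_Un[OF \<nu> that(1,3)] pos_var_upper[OF \<nu> borel_subsets_Un[OF that(1,3)], of "A \<union> B"] that
      by auto
  qed
  have "pos_var \<Omega> \<nu> A \<le> pos_var \<Omega> \<nu> (A \<union> B) - \<nu> B'" if "B' \<in> borel_subsets \<Omega>" "B' \<subseteq> B" for B'
    using *[OF _ _ that] by (intro pos_var_least) (simp add: algebra_simps)
  then have "pos_var \<Omega> \<nu> B \<le> pos_var \<Omega> \<nu> (A \<union> B) - pos_var \<Omega> \<nu> A"
    by (intro pos_var_least) (simp add: algebra_simps)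
  then show ?thesis by simp
qed

lemma pos_var_mono: "signed_borel_measure \<Omega> \<nu> \<Longrightarrow> A \<subseteq> B \<Longrightarrow> pos_var \<Omega> \<nu> A \<le> pos_var \<Omega> \<nu> B"
  by (intro pos_var_least pos_var_upper) auto

text \<open>Superadditivity bounds the partial sums by the value of the union; conversely, a
  competitor \<open>B\<close> for the union splits into its pieces
  \<open>B \<inter> F i\<close>.\<close>

lemma pos_var_sums:
  fixes F :: "nat \<Rightarrow> (real^'n) set"
  assumes \<nu>: "signed_borel_measure \<Omega> \<nu>" and F: "range F \<subseteq> borel_subsets \<Omega>" "disjoint_family F"
  shows "(\<lambda>i. pos_var \<Omega> \<nu> (F i)) sums pos_var \<Omega> \<nu> (\<Union>i. F i)"
proof -
  have part: "(\<Sum>i<n. pos_var \<Omega> \<nu> (F i)) \<le> pos_var \<Omega> \<nu> (\<Union>i<n. F i)" for n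
  proof (induction n)
    case (Suc n)
    have "(\<Union>i<n. F i) \<inter> F n = {}"
      using F(2) by (auto simp: disjoint_family_on_def) (metis IntI empty_iff nat_neq_iff)
    then have "pos_var \<Omega> \<nu> (\<Union>i<n. F i) + pos_var \<Omega> \<nu> (F n) \<le> pos_var \<Omega> \<nu> ((\<Union>i<n. F i) \<union> F n)"
      by (rule pos_var_superadditive[OF \<nu>])
    also have "(\<Union>i<n. F i) \<union> F n = (\<Union>i<Suc n. F i)" by (auto simp: lessThan_Suc)
    finally show ?case using Suc by simp
  qed (simp add: pos_var_nonneg[OF \<nu>])
  have le: "(\<Sum>i<n. pos_var \<Omega> \<nu> (F i)) \<le> pos_var \<Omega> \<nu> (\<Union>i. F i)" for n
    by (rule order_trans[OF part pos_var_mono[OF \<nu>]]) auto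
  have su: "summable (\<lambda>i. pos_var \<Omega> \<nu> (F i))"
    by (rule summableI_nonneg_bounded[OF pos_var_nonneg[OF \<nu>] le])
  have "pos_var \<Omega> \<nu> (\<Union>i. F i) \<le> (\<Sum>i. pos_var \<Omega> \<nu> (F i))"
  proof (rule pos_var_least)
    fix B assume B: "B \<in> borel_subsets \<Omega>" "B \<subseteq> (\<Union>i. F i)"
    have m: "B \<inter> F i \<in> borel_subsets \<Omega>" for i using F(1) B(1) by (intro borel_subsets_Int) auto
    have "(\<lambda>i. \<nu> (B \<inter> F i)) sums \<nu> (\<Union>i. B \<inter> F i)"
      using m F(2) by (intro signed_measure_sums[OF \<nu>]) (auto simp: disjoint_family_on_def)
    moreover have "(\<Union>i. B \<inter> F i) = B" using B(2) by auto
    ultimately have s: "(\<lambda>i. \<nu> (B \<inter> F i)) sums \<nu> B" by simp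
    show "\<nu> B \<le> (\<Sum>i. pos_var \<Omega> \<nu> (F i))"
      by (rule sums_le[OF _ s summable_sums[OF su]]) (intro pos_var_upper[OF \<nu>] m, auto)
  qed
  moreover have "(\<Sum>i. pos_var \<Omega> \<nu> (F i)) \<le> pos_var \<Omega> \<nu> (\<Union>i. F i)" by (rule suminf_le_const[OF su le])
  ultimately have "pos_var \<Omega> \<nu> (\<Union>i. F i) = (\<Sum>i. pos_var \<Omega> \<nu> (F i))" by (rule antisym)
  then show ?thesis using summable_sums[OF su] by simp
qed

lemma sets_pos_variation: "sets (pos_variation \<Omega> \<nu>) = borel_subsets \<Omega>"
  and space_pos_variation: "space (pos_variation \<Omega> \<nu>) = \<Omega>"
proof -
  interpret sigma_algebra \<Omega> "borel_subsets \<Omega>" by (rule borel_subsets_sigma_algebra)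
  show "sets (pos_variation \<Omega> \<nu>) = borel_subsets \<Omega>" "space (pos_variation \<Omega> \<nu>) = \<Omega>"
    unfolding pos_variation_def by (simp_all add: sets_measure_of_eq space_measure_of_eq)
qed

text \<open>The truncation of negative values by \<open>ennreal\<close> does not affect the
  supremum, which is nonnegative because the empty set competes.\<close>

lemma emeasure_pos_variation:
  assumes \<nu>: "signed_borel_measure \<Omega> \<nu>" and A: "A \<in> borel_subsets \<Omega>"
  shows "emeasure (pos_variation \<Omega> \<nu>) A = ennreal (pos_var \<Omega> \<nu> A)"
proof -
  interpret sigma_algebra \<Omega> "borel_subsets \<Omega>" by (rule borel_subsets_sigma_algebra)
  have eq: "(SUP B\<in>{B \<in> borel_subsets \<Omega>. B \<subseteq> A}. ennreal (\<nu> B)) = ennreal (pos_var \<Omega> \<nu> A)" for A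
  proof (rule antisym)
    show "(SUP B\<in>{B \<in> borel_subsets \<Omega>. B \<subseteq> A}. ennreal (\<nu> B)) \<le> ennreal (pos_var \<Omega> \<nu> A)"
      by (intro SUP_least ennreal_leI pos_var_upper[OF \<nu>]) auto
    show "ennreal (pos_var \<Omega> \<nu> A) \<le> (SUP B\<in>{B \<in> borel_subsets \<Omega>. B \<subseteq> A}. ennreal (\<nu> B))"
    proof (rule ennreal_le_epsilon)
      fix e :: real assume e: "0 < e"
      have "\<exists>B\<in>{B \<in> borel_subsets \<Omega>. B \<subseteq> A}. pos_var \<Omega> \<nu> A - e < \<nu> B"
      proof (rule ccontr)
        assume "\<not> ?thesis"
        then have "pos_var \<Omega> \<nu> A \<le> pos_var \<Omega> \<nu> A - e" by (intro pos_var_least) (auto simp: not_less)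
        then show False using e by simp
      qed
      then obtain B where B: "B \<in> borel_subsets \<Omega>" "B \<subseteq> A" "pos_var \<Omega> \<nu> A \<le> \<nu> B + e" by force
      have "ennreal (pos_var \<Omega> \<nu> A) \<le> ennreal (\<nu> B + e)" using B(3) by (rule ennreal_leI)
      also have "\<dots> \<le> ennreal (\<nu> B) + ennreal e"
        by (cases "0 \<le> \<nu> B") (use e in \<open>auto simp: ennreal_plus ennreal_neg intro!: ennreal_leI\<close>)
      also have "\<dots> \<le> (SUP B\<in>{B \<in> borel_subsets \<Omega>. B \<subseteq> A}. ennreal (\<nu> B)) + ennreal e"
        using B by (intro add_right_mono SUP_upper) auto
      finally show "ennreal (pos_var \<Omega> \<nu> A)
        \<le> (SUP B\<in>{B \<in> borel_subsets \<Omega>. B \<subseteq> A}. ennreal (\<nu> B)) + ennreal e" .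
    qed
  qed
  have p0: "pos_var \<Omega> \<nu> {} = 0"
  proof (rule antisym)
    show "pos_var \<Omega> \<nu> {} \<le> 0" using \<nu> by (intro pos_var_least) (auto simp: signed_borel_measure_def)
  qed (rule pos_var_nonneg[OF \<nu>])
  show ?thesis
    unfolding pos_variation_def eq
  proof (rule emeasure_measure_of_sigma[OF sigma_algebra_axioms _ _ A])
    show "positive (borel_subsets \<Omega>) (\<lambda>A. ennreal (pos_var \<Omega> \<nu> A))" by (simp add: positive_def p0)
    show "countably_additive (borel_subsets \<Omega>) (\<lambda>A. ennreal (pos_var \<Omega> \<nu> A))"
      unfolding countably_additive_def
      using suminf_ennreal_eq[OF pos_var_nonneg[OF \<nu>] pos_var_sums[OF \<nu>]] by auto
  qed
qed

lemma finite_measure_pos_variation: "signed_borel_measure \<Omega> \<nu> \<Longrightarrow> finite_measure (pos_variation \<Omega> \<nu>)"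
  by (rule finite_measureI) (simp add: space_pos_variation emeasure_pos_variation borel_subsets_space)

section \<open>Bounded integrands\<close>

lemma measurable_pos_variation:
  "g \<in> borel_measurable (pos_variation \<Omega> \<nu>) \<longleftrightarrow> g \<in> borel_measurable (restrict_space borel \<Omega>)"
  by (rule arg_cong2[of _ _ _ _ "(\<in>)"], rule refl, rule measurable_cong_sets)
    (simp_all add: sets_pos_variation borel_subsets_def)

lemma integrable_pos_variation:
  fixes g :: "real^'n \<Rightarrow> real"
  assumes \<nu>: "signed_borel_measure \<Omega> \<nu>" and g: "g \<in> borel_measurable (restrict_space borel \<Omega>)"
    and s: "\<And>x. x \<in> \<Omega> \<Longrightarrow> \<bar>g x\<bar> \<le> s"
  shows "integrable (pos_variation \<Omega> \<nu>) g"
    and "\<bar>\<integral>x. g x \<partial>pos_variation \<Omega> \<nu>\<bar> \<le> s * pos_var \<Omega> \<nu> \<Omega>"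
proof -
  interpret finite_measure "pos_variation \<Omega> \<nu>" by (rule finite_measure_pos_variation[OF \<nu>])
  show i: "integrable (pos_variation \<Omega> \<nu>) g"
    by (rule integrable_const_bound[where B = s])
      (use s g in \<open>auto simp: measurable_pos_variation space_pos_variation intro!: AE_I2\<close>)
  have "norm (\<integral>x. g x \<partial>pos_variation \<Omega> \<nu>) \<le> (\<integral>x. s \<partial>pos_variation \<Omega> \<nu>)"
    by (rule Bochner_Integration.integral_norm_bound_integral[OF i]) (use s in \<open>auto simp: space_pos_variation\<close>)
  also have "\<dots> = s * pos_var \<Omega> \<nu> \<Omega>"
    by (simp add: measure_def space_pos_variation emeasure_pos_variation[OF \<nu> borel_subsets_space] pos_var_nonneg[OF \<nu>] mult.commute)
  finally show "\<bar>\<integral>x. g x \<partial>pos_variation \<Omega> \<nu>\<bar> \<le> s * pos_var \<Omega> \<nu> \<Omega>" by simp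
qed

lemma signed_integral_lincomb:
  assumes \<nu>: "signed_borel_measure \<Omega> \<nu>"
    and g: "g \<in> borel_measurable (restrict_space borel \<Omega>)" "\<And>x. x \<in> \<Omega> \<Longrightarrow> \<bar>g x\<bar> \<le> s"
    and h: "h \<in> borel_measurable (restrict_space borel \<Omega>)" "\<And>x. x \<in> \<Omega> \<Longrightarrow> \<bar>h x\<bar> \<le> t"
  shows "signed_integral \<Omega> \<nu> (\<lambda>x. a * g x + b * h x) = a * signed_integral \<Omega> \<nu> g + b * signed_integral \<Omega> \<nu> h"
  using integrable_pos_variation(1)[OF \<nu> g] integrable_pos_variation(1)[OF \<nu> h]
    integrable_pos_variation(1)[OF signed_measure_uminus[OF \<nu>] g] integrable_pos_variation(1)[OF signed_measure_uminus[OF \<nu>] h]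
  by (simp add: signed_integral_def algebra_simps)

lemma signed_integral_bound:
  assumes \<nu>: "signed_borel_measure \<Omega> \<nu>"
  obtains B where "0 \<le> B" "\<And>g s. g \<in> borel_measurable (restrict_space borel \<Omega>) \<Longrightarrow> (\<And>x. x \<in> \<Omega> \<Longrightarrow> \<bar>g x\<bar> \<le> s) \<Longrightarrow>
    \<bar>signed_integral \<Omega> \<nu> g\<bar> \<le> s * B"
proof -
  note \<nu>' = signed_measure_uminus[OF \<nu>]
  define B where "B = pos_var \<Omega> \<nu> \<Omega> + pos_var \<Omega> (\<lambda>A. - \<nu> A) \<Omega>"
  have "\<bar>signed_integral \<Omega> \<nu> g\<bar> \<le> s * B"
    if "g \<in> borel_measurable (restrict_space borel \<Omega>)" "\<And>x. x \<in> \<Omega> \<Longrightarrow> \<bar>g x\<bar> \<le> s" for g s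
    using integrable_pos_variation(2)[OF \<nu> that] integrable_pos_variation(2)[OF \<nu>' that]
    unfolding signed_integral_def B_def by (simp add: distrib_left)
  then show thesis using that[of B] pos_var_nonneg[OF \<nu>] pos_var_nonneg[OF \<nu>'] by (simp add: B_def)
qed

lemma signed_integral_indicator:
  assumes \<nu>: "signed_borel_measure \<Omega> \<nu>" and A: "A \<in> borel_subsets \<Omega>"
  shows "signed_integral \<Omega> \<nu> (indicator A) = \<nu> A"
proof -
  note \<nu>' = signed_measure_uminus[OF \<nu>]
  have "A \<inter> \<Omega> = A" using borel_subsets_subset[OF A] by auto
  then have "(\<integral>x. indicator A x \<partial>pos_variation \<Omega> \<nu>) = pos_var \<Omega> \<nu> A"
    if "signed_borel_measure \<Omega> \<nu>" for \<nu>
    using A that by (simp add: sets_pos_variation measure_def space_pos_variation emeasure_pos_variation pos_var_nonneg)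
  then show ?thesis using \<nu> \<nu>' pos_var_minus[OF \<nu> A] by (simp add: signed_integral_def)
qed

text \<open>Rounding down to multiples of \<open>e\<close>. The coefficients have the fixed form e *
  k, so that only the finite index set and the level sets remain to be quantified in
  \<open>signed_integral_eqI\<close>.\<close>

lemma bounded_simple_approximation:
  fixes g :: "real^'n \<Rightarrow> real"
  assumes g: "g \<in> borel_measurable (restrict_space borel \<Omega>)" and s: "\<And>x. x \<in> \<Omega> \<Longrightarrow> \<bar>g x\<bar> \<le> s" and e: "0 < e"
  obtains I :: "int set" and A where "finite I" "\<And>k. A k \<in> borel_subsets \<Omega>"
    "\<And>x. x \<in> \<Omega> \<Longrightarrow> \<bar>g x - (\<Sum>k\<in>I. (e * of_int k) * indicator (A k) x)\<bar> \<le> e"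
proof -
  define A where "A k = {x \<in> \<Omega>. \<lfloor>g x / e\<rfloor> = k}" for k :: int
  define I where "I = {\<lfloor>- s / e\<rfloor>..\<lfloor>s / e\<rfloor>}"
  have Am: "A k \<in> borel_subsets \<Omega>" for k
  proof -
    have "(\<lambda>x. g x / e) -` {real_of_int k..<real_of_int k + 1} \<inter> space (restrict_space borel \<Omega>) \<in> sets (restrict_space borel \<Omega>)"
      using g by (intro measurable_sets[of _ _ borel]) auto
    moreover have "(\<lambda>x. g x / e) -` {real_of_int k..<real_of_int k + 1} \<inter> space (restrict_space borel \<Omega>) = A k"
      by (auto simp: A_def space_restrict_space floor_eq_iff)
    ultimately show ?thesis by (simp add: borel_subsets_def)
  qed
  have "\<bar>g x - (\<Sum>k\<in>I. (e * of_int k) * indicator (A k) x)\<bar> \<le> e" if x: "x \<in> \<Omega>" for x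
  proof -
    let ?k = "\<lfloor>g x / e\<rfloor>"
    have gs: "- s \<le> g x" "g x \<le> s" using s[OF x] by (auto simp: abs_le_iff)
    have "- s / e \<le> g x / e" "g x / e \<le> s / e"
      using divide_right_mono[OF gs(1), of e] divide_right_mono[OF gs(2), of e] e by simp_all
    then have "?k \<in> I" unfolding I_def by (auto intro: floor_mono)
    then have "(\<Sum>k\<in>I. (e * of_int k) * indicator (A k) x) = (\<Sum>k\<in>I. if k = ?k then e * of_int k else 0)"
      using x by (intro sum.cong) (auto simp: A_def)
    also have "\<dots> = e * of_int ?k" using \<open>?k \<in> I\<close> by (simp add: I_def)
    finally have eq: "(\<Sum>k\<in>I. (e * of_int k) * indicator (A k) x) = e * of_int ?k" .
    have "e * of_int ?k \<le> g x" "g x < e * of_int ?k + e"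
      using floor_divide_lower[OF e, of "g x"] floor_divide_upper[OF e, of "g x"] by (simp_all add: algebra_simps)
    then show ?thesis unfolding eq by linarith
  qed
  then show thesis using that[of I A] Am by (simp add: I_def)
qed

lemma simple_measurable_bounded:
  fixes A :: "int \<Rightarrow> (real^'n) set"
  assumes "finite I" "\<And>k. A k \<in> borel_subsets \<Omega>"
  shows "(\<lambda>x. \<Sum>k\<in>I. c k * indicator (A k) x :: real) \<in> borel_measurable (restrict_space borel \<Omega>)"
    and "\<bar>\<Sum>k\<in>I. c k * indicator (A k) x\<bar> \<le> (\<Sum>k\<in>I. \<bar>c k\<bar>)"
proof -
  show "(\<lambda>x. \<Sum>k\<in>I. c k * indicator (A k) x :: real) \<in> borel_measurable (restrict_space borel \<Omega>)"
    using assms by (intro borel_measurable_sum borel_measurable_times borel_measurable_indicator) (auto simp: borel_subsets_def)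
  show "\<bar>\<Sum>k\<in>I. c k * indicator (A k) x\<bar> \<le> (\<Sum>k\<in>I. \<bar>c k\<bar>)"
    by (intro order_trans[OF sum_abs] sum_mono) (auto simp: indicator_def)
qed

lemma signed_integral_simple:
  fixes A :: "int \<Rightarrow> (real^'n) set"
  assumes \<nu>: "signed_borel_measure \<Omega> \<nu>" and I: "finite I" and A: "\<And>k. A k \<in> borel_subsets \<Omega>"
  shows "signed_integral \<Omega> \<nu> (\<lambda>x. \<Sum>k\<in>I. c k * indicator (A k) x) = (\<Sum>k\<in>I. c k * \<nu> (A k))"
  using I
proof (induction rule: finite_induct)
  case (insert j I)
  have ind: "(indicator (A j) :: _ \<Rightarrow> real) \<in> borel_measurable (restrict_space borel \<Omega>)"
    using A[of j] by (intro borel_measurable_indicator) (simp add: borel_subsets_def)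
  have "signed_integral \<Omega> \<nu> (\<lambda>x. c j * indicator (A j) x + 1 * (\<Sum>k\<in>I. c k * indicator (A k) x))
      = c j * signed_integral \<Omega> \<nu> (indicator (A j)) + 1 * signed_integral \<Omega> \<nu> (\<lambda>x. \<Sum>k\<in>I. c k * indicator (A k) x)"
    by (rule signed_integral_lincomb[OF \<nu> ind _ simple_measurable_bounded[OF insert(1) A], of 1]) (auto simp: indicator_def)
  then show ?case
    by (simp only: mult_1_left sum.insert[OF insert(1,2)] insert(3) signed_integral_indicator[OF \<nu> A])
qed (simp add: signed_integral_def)

text \<open>An integral is recognized by its values on uniform approximations of the integrand by simple
  functions. This gives linearity in the measure.\<close>

lemma signed_integral_eqI:
  assumes \<nu>: "signed_borel_measure \<Omega> \<nu>"
    and g: "g \<in> borel_measurable (restrict_space borel \<Omega>)" "\<And>x. x \<in> \<Omega> \<Longrightarrow> \<bar>g x\<bar> \<le> s"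
    and L: "\<And>e I A. 0 < e \<Longrightarrow> finite I \<Longrightarrow> (\<And>k::int. A k \<in> borel_subsets \<Omega>) \<Longrightarrow>
      (\<And>x. x \<in> \<Omega> \<Longrightarrow> \<bar>g x - (\<Sum>k\<in>I. (e * of_int k) * indicator (A k) x)\<bar> \<le> e) \<Longrightarrow>
      \<bar>L - (\<Sum>k\<in>I. (e * of_int k) * \<nu> (A k))\<bar> \<le> e * C"
  shows "signed_integral \<Omega> \<nu> g = L"
proof -
  obtain B where B: "0 \<le> B" "\<And>g s. g \<in> borel_measurable (restrict_space borel \<Omega>) \<Longrightarrow> (\<And>x. x \<in> \<Omega> \<Longrightarrow> \<bar>g x\<bar> \<le> s) \<Longrightarrow>
    \<bar>signed_integral \<Omega> \<nu> g\<bar> \<le> s * B" using signed_integral_bound[OF \<nu>] by blast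
  have le: "\<bar>signed_integral \<Omega> \<nu> g - L\<bar> \<le> e * (B + \<bar>C\<bar>)" if e: "0 < e" for e
  proof -
    obtain I :: "int set" and A where I: "finite I" and A: "\<And>k. A k \<in> borel_subsets \<Omega>"
      and ap: "\<And>x. x \<in> \<Omega> \<Longrightarrow> \<bar>g x - (\<Sum>k\<in>I. (e * of_int k) * indicator (A k) x)\<bar> \<le> e"
      using bounded_simple_approximation[OF g e] by blast
    note sm = simple_measurable_bounded[OF I A, of "\<lambda>k. e * of_int k"]
    have "signed_integral \<Omega> \<nu> (\<lambda>x. 1 * g x + (-1) * (\<Sum>k\<in>I. (e * of_int k) * indicator (A k) x))
        = 1 * signed_integral \<Omega> \<nu> g + (-1) * signed_integral \<Omega> \<nu> (\<lambda>x. \<Sum>k\<in>I. (e * of_int k) * indicator (A k) x)"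
      by (rule signed_integral_lincomb[OF \<nu> g sm])
    then have "signed_integral \<Omega> \<nu> g - (\<Sum>k\<in>I. (e * of_int k) * \<nu> (A k))
        = signed_integral \<Omega> \<nu> (\<lambda>x. g x - (\<Sum>k\<in>I. (e * of_int k) * indicator (A k) x))"
      by (simp add: signed_integral_simple[OF \<nu> I A])
    also have "\<bar>\<dots>\<bar> \<le> e * B"
      by (intro B(2) ap borel_measurable_diff g sm(1))
    finally have "\<bar>signed_integral \<Omega> \<nu> g - (\<Sum>k\<in>I. (e * of_int k) * \<nu> (A k))\<bar> \<le> e * B" .
    moreover have "\<bar>L - (\<Sum>k\<in>I. (e * of_int k) * \<nu> (A k))\<bar> \<le> e * C" by (rule L[OF e I A ap])
    moreover have "e * C \<le> e * \<bar>C\<bar>" using e by (intro mult_left_mono) auto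
    ultimately show ?thesis by (simp add: distrib_left)
  qed
  have "\<bar>signed_integral \<Omega> \<nu> g - L\<bar> \<le> 0"
  proof (rule field_le_epsilon)
    fix e :: real assume e: "0 < e"
    have p: "0 < B + \<bar>C\<bar> + 1" using B(1) by simp
    have "\<bar>signed_integral \<Omega> \<nu> g - L\<bar> \<le> e / (B + \<bar>C\<bar> + 1) * (B + \<bar>C\<bar>)" using e p by (intro le) simp
    also have "\<dots> \<le> e / (B + \<bar>C\<bar> + 1) * (B + \<bar>C\<bar> + 1)" using e p by (intro mult_left_mono) auto
    finally show "\<bar>signed_integral \<Omega> \<nu> g - L\<bar> \<le> 0 + e" using p by simp
  qed
  then show ?thesis by simp
qed

text \<open>The positive variation is not additive in the measure, so linearity cannot be read off
  the definition. On simple functions, however, the integral is a combination of values of the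
  measure.\<close>

lemma signed_integral_add_measure:
  assumes \<nu>: "signed_borel_measure \<Omega> \<nu>" and \<mu>: "signed_borel_measure \<Omega> \<mu>"
    and g: "g \<in> borel_measurable (restrict_space borel \<Omega>)" "\<And>x. x \<in> \<Omega> \<Longrightarrow> \<bar>g x\<bar> \<le> s"
  shows "signed_integral \<Omega> (\<lambda>A. a * \<nu> A + b * \<mu> A) g = a * signed_integral \<Omega> \<nu> g + b * signed_integral \<Omega> \<mu> g"
proof -
  obtain B where B: "0 \<le> B" "\<And>g s. g \<in> borel_measurable (restrict_space borel \<Omega>) \<Longrightarrow> (\<And>x. x \<in> \<Omega> \<Longrightarrow> \<bar>g x\<bar> \<le> s) \<Longrightarrow>
    \<bar>signed_integral \<Omega> \<nu> g\<bar> \<le> s * B" using signed_integral_bound[OF \<nu>] by blast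
  obtain D where D: "0 \<le> D" "\<And>g s. g \<in> borel_measurable (restrict_space borel \<Omega>) \<Longrightarrow> (\<And>x. x \<in> \<Omega> \<Longrightarrow> \<bar>g x\<bar> \<le> s) \<Longrightarrow>
    \<bar>signed_integral \<Omega> \<mu> g\<bar> \<le> s * D" using signed_integral_bound[OF \<mu>] by blast
  show ?thesis
  proof (rule signed_integral_eqI[OF signed_measure_lincomb[OF \<nu> \<mu>] g, where C = "\<bar>a\<bar> * B + \<bar>b\<bar> * D"])
    fix e :: real and I :: "int set" and A :: "int \<Rightarrow> (real^'a) set"
    assume e: "0 < e" and I: "finite I" and A: "\<And>k. A k \<in> borel_subsets \<Omega>"
      and ap: "\<And>x. x \<in> \<Omega> \<Longrightarrow> \<bar>g x - (\<Sum>k\<in>I. (e * of_int k) * indicator (A k) x)\<bar> \<le> e"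
    let ?S = "\<lambda>x. \<Sum>k\<in>I. (e * of_int k) * indicator (A k) x"
    note sm = simple_measurable_bounded[OF I A, of "\<lambda>k. e * of_int k"]
    have key: "\<bar>signed_integral \<Omega> \<rho> g - (\<Sum>k\<in>I. (e * of_int k) * \<rho> (A k))\<bar> \<le> e * b"
      if \<rho>: "signed_borel_measure \<Omega> \<rho>" and b: "\<And>g s. g \<in> borel_measurable (restrict_space borel \<Omega>) \<Longrightarrow>
        (\<And>x. x \<in> \<Omega> \<Longrightarrow> \<bar>g x\<bar> \<le> s) \<Longrightarrow> \<bar>signed_integral \<Omega> \<rho> g\<bar> \<le> s * b" for \<rho> b
    proof -
      have "signed_integral \<Omega> \<rho> (\<lambda>x. 1 * g x + (-1) * ?S x) = 1 * signed_integral \<Omega> \<rho> g + (-1) * signed_integral \<Omega> \<rho> ?S"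
        by (rule signed_integral_lincomb[OF \<rho> g sm])
      then have "signed_integral \<Omega> \<rho> g - (\<Sum>k\<in>I. (e * of_int k) * \<rho> (A k)) = signed_integral \<Omega> \<rho> (\<lambda>x. g x - ?S x)"
        by (simp add: signed_integral_simple[OF \<rho> I A])
      also have "\<bar>\<dots>\<bar> \<le> e * b" by (intro b ap borel_measurable_diff g sm(1))
      finally show ?thesis .
    qed
    have "a * signed_integral \<Omega> \<nu> g + b * signed_integral \<Omega> \<mu> g - (\<Sum>k\<in>I. (e * of_int k) * (a * \<nu> (A k) + b * \<mu> (A k)))
        = a * (signed_integral \<Omega> \<nu> g - (\<Sum>k\<in>I. (e * of_int k) * \<nu> (A k)))
          + b * (signed_integral \<Omega> \<mu> g - (\<Sum>k\<in>I. (e * of_int k) * \<mu> (A k)))"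
      by (simp add: algebra_simps sum.distrib sum_distrib_left)
    also have "\<bar>\<dots>\<bar> \<le> \<bar>a\<bar> * (e * B) + \<bar>b\<bar> * (e * D)"
      using key[OF \<nu> B(2)] key[OF \<mu> D(2)]
      by (intro order_trans[OF abs_triangle_ineq] add_mono) (auto simp: abs_mult intro!: mult_left_mono)
    finally show "\<bar>a * signed_integral \<Omega> \<nu> g + b * signed_integral \<Omega> \<mu> g
        - (\<Sum>k\<in>I. (e * of_int k) * (a * \<nu> (A k) + b * \<mu> (A k)))\<bar> \<le> e * (\<bar>a\<bar> * B + \<bar>b\<bar> * D)"
      by (simp add: algebra_simps)
  qed
qed

lemma restrict_borel_lebesgue_on:
  fixes g :: "real^'n \<Rightarrow> real"
  assumes "open \<Omega>" "g \<in> borel_measurable (restrict_space borel \<Omega>)"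
  shows "g \<in> borel_measurable (lebesgue_on \<Omega>)"
proof -
  have "(\<lambda>x. indicator \<Omega> x *\<^sub>R g x) \<in> borel_measurable borel"
    using assms by (simp add: borel_measurable_restrict_space_iff)
  then have "(\<lambda>x. indicator \<Omega> x *\<^sub>R g x) \<in> borel_measurable lebesgue" by (intro measurable_completion) simp
  then show ?thesis using assms(1) by (subst borel_measurable_restrict_space_iff) auto
qed

text \<open>The Jordan decomposition of the measure with density \<open>h\<close> need not be
  computed: the integral of \<open>g\<close> is identified through simple approximations, with error
  at most \<open>e\<close> times the L_1 norm of \<open>h\<close>.\<close>

lemma density_signed_measure:
  fixes h :: "real^'n \<Rightarrow> real"
  assumes \<Omega>: "open \<Omega>" and h: "integrable (lebesgue_on \<Omega>) h"
  defines "\<nu> \<equiv> \<lambda>A. \<integral>x. h x * indicator A x \<partial>lebesgue_on \<Omega>"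
  shows "signed_borel_measure \<Omega> \<nu>"
    and "g \<in> borel_measurable (restrict_space borel \<Omega>) \<Longrightarrow> (\<And>x. x \<in> \<Omega> \<Longrightarrow> \<bar>g x\<bar> \<le> s) \<Longrightarrow>
      signed_integral \<Omega> \<nu> g = (\<integral>x. h x * g x \<partial>lebesgue_on \<Omega>)"
proof -
  have im: "(indicator A :: _ \<Rightarrow> real) \<in> borel_measurable (lebesgue_on \<Omega>)" if "A \<in> borel_subsets \<Omega>" for A
    using that by (intro restrict_borel_lebesgue_on[OF \<Omega>] borel_measurable_indicator) (simp add: borel_subsets_def)
  have ii: "integrable (lebesgue_on \<Omega>) (\<lambda>x. h x * indicator A x)" if "A \<in> borel_subsets \<Omega>" for A
    by (rule integrable_mult_bounded[OF h im[OF that], of 1]) (auto simp: indicator_def)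
  show \<nu>: "signed_borel_measure \<Omega> \<nu>"
    unfolding signed_borel_measure_def
  proof (intro conjI allI impI)
    show "\<nu> {} = 0" by (simp add: \<nu>_def)
    fix A :: "nat \<Rightarrow> (real^'n) set" assume A: "range A \<subseteq> borel_subsets \<Omega>" "disjoint_family A"
    have Am: "A i \<in> borel_subsets \<Omega>" for i using A(1) by auto
    have UA: "(\<Union>i. A i) \<in> borel_subsets \<Omega>" by (rule borel_subsets_UN[OF A(1)])
    have isum: "(\<lambda>i. indicator (A i) x :: real) sums indicator (\<Union>i. A i) x" for x
      using A(2) by (intro indicator_sums) (auto simp: disjoint_family_on_def)
    note [measurable] = im[OF Am] im[OF UA] borel_measurable_integrable[OF h]
    \<comment> \<open>Countable additivity is dominated convergence with majorant |h|.\<close>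
    have "(\<lambda>n. \<integral>x. h x * (\<Sum>i<n. indicator (A i) x) \<partial>lebesgue_on \<Omega>) \<longlonglongrightarrow> (\<integral>x. h x * indicator (\<Union>i. A i) x \<partial>lebesgue_on \<Omega>)"
    proof (rule integral_dominated_convergence[where w = "\<lambda>x. \<bar>h x\<bar>"])
      show "AE x in lebesgue_on \<Omega>. (\<lambda>n. h x * (\<Sum>i<n. indicator (A i) x)) \<longlonglongrightarrow> h x * indicator (\<Union>i. A i) x"
        using isum by (intro AE_I2 tendsto_mult_left) (simp add: sums_def)
      show "AE x in lebesgue_on \<Omega>. norm (h x * (\<Sum>i<n. indicator (A i) x)) \<le> \<bar>h x\<bar>" for n
      proof (rule AE_I2)
        fix x
        have "(\<Sum>i<n. indicator (A i) x :: real) \<le> (\<Sum>i. indicator (A i) x)"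
          using isum[of x] by (intro sum_le_suminf) (auto simp: sums_iff)
        also have "\<dots> \<le> 1" using isum[of x] by (simp add: sums_iff indicator_def)
        finally have "(\<Sum>i<n. indicator (A i) x :: real) \<le> 1" .
        moreover have "0 \<le> (\<Sum>i<n. indicator (A i) x :: real)" by (intro sum_nonneg) auto
        ultimately show "norm (h x * (\<Sum>i<n. indicator (A i) x)) \<le> \<bar>h x\<bar>" by (simp add: abs_mult mult_left_le)
      qed
    qed (use h in auto)
    moreover have "(\<integral>x. h x * (\<Sum>i<n. indicator (A i) x) \<partial>lebesgue_on \<Omega>) = (\<Sum>i<n. \<nu> (A i))" for n
      unfolding \<nu>_def sum_distrib_left by (rule Bochner_Integration.integral_sum) (rule ii[OF Am])
    ultimately show "(\<lambda>i. \<nu> (A i)) sums \<nu> (\<Union>i. A i)" by (simp add: sums_def \<nu>_def)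
  qed
  assume g: "g \<in> borel_measurable (restrict_space borel \<Omega>)" "\<And>x. x \<in> \<Omega> \<Longrightarrow> \<bar>g x\<bar> \<le> s"
  note gm = restrict_borel_lebesgue_on[OF \<Omega> g(1)]
  have hg: "integrable (lebesgue_on \<Omega>) (\<lambda>x. h x * g x)"
  proof (rule Bochner_Integration.integrable_bound[where f = "\<lambda>x. s * h x"])
    have "\<bar>h x * g x\<bar> \<le> \<bar>s * h x\<bar>" if "x \<in> \<Omega>" for x
      using mult_left_mono[OF g(2)[OF that], of "\<bar>h x\<bar>"] g(2)[OF that] by (simp add: abs_mult mult.commute)
    then show "AE x in lebesgue_on \<Omega>. norm (h x * g x) \<le> norm (s * h x)" by (intro AE_I2) simp
  qed (use h gm in auto)
  show "signed_integral \<Omega> \<nu> g = (\<integral>x. h x * g x \<partial>lebesgue_on \<Omega>)"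
  proof (rule signed_integral_eqI[OF \<nu> g, where C = "\<integral>x. \<bar>h x\<bar> \<partial>lebesgue_on \<Omega>"])
    fix e :: real and I :: "int set" and A :: "int \<Rightarrow> (real^'n) set"
    assume e: "0 < e" and I: "finite I" and A: "\<And>k. A k \<in> borel_subsets \<Omega>"
      and ap: "\<And>x. x \<in> \<Omega> \<Longrightarrow> \<bar>g x - (\<Sum>k\<in>I. (e * of_int k) * indicator (A k) x)\<bar> \<le> e"
    have j: "integrable (lebesgue_on \<Omega>) (\<lambda>x. \<Sum>k\<in>I. (e * of_int k) * (h x * indicator (A k) x))" using ii[OF A] by auto
    have "(\<integral>x. h x * g x \<partial>lebesgue_on \<Omega>) - (\<Sum>k\<in>I. (e * of_int k) * \<nu> (A k))
        = (\<integral>x. h x * g x - (\<Sum>k\<in>I. (e * of_int k) * (h x * indicator (A k) x)) \<partial>lebesgue_on \<Omega>)"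
      using hg ii[OF A] by (simp add: \<nu>_def)
    also have "norm \<dots> \<le> (\<integral>x. e * \<bar>h x\<bar> \<partial>lebesgue_on \<Omega>)"
    proof (rule Bochner_Integration.integral_norm_bound_integral)
      show "norm (h x * g x - (\<Sum>k\<in>I. (e * of_int k) * (h x * indicator (A k) x))) \<le> e * \<bar>h x\<bar>"
        if "x \<in> space (lebesgue_on \<Omega>)" for x
      proof -
        have "h x * g x - (\<Sum>k\<in>I. (e * of_int k) * (h x * indicator (A k) x))
            = (g x - (\<Sum>k\<in>I. (e * of_int k) * indicator (A k) x)) * h x"
          unfolding left_diff_distrib sum_distrib_right
          by (intro arg_cong2[where f = minus] sum.cong) (simp_all only: mult_ac)
        then show ?thesis using ap[of x] that by (simp add: abs_mult mult_right_mono)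
      qed
    qed (use hg j h in auto)
    finally show "\<bar>(\<integral>x. h x * g x \<partial>lebesgue_on \<Omega>) - (\<Sum>k\<in>I. (e * of_int k) * \<nu> (A k))\<bar>
        \<le> e * (\<integral>x. \<bar>h x\<bar> \<partial>lebesgue_on \<Omega>)" by simp
  qed
qed

section \<open>The divergence operator\<close>

lemma test_function_Lp_space:
  fixes \<phi> :: "real^'n \<Rightarrow> real"
  assumes \<Omega>: "open \<Omega>" and \<phi>: "\<phi> \<in> test_functions \<Omega>" and q: "0 < q"
  shows "\<phi> \<in> Lp_space q \<Omega>"
proof -
  obtain M where M: "0 \<le> M" "\<And>x. \<bar>\<phi> x\<bar> \<le> M" using test_function_bounded[OF \<phi>] by metis
  obtain K where K: "compact K" "\<And>x. x \<notin> K \<Longrightarrow> \<phi> x = 0" using \<phi> by (auto simp: test_functions_def)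
  note [measurable] = test_function_measurable[OF \<phi>]
  have "integrable lborel (\<lambda>x. \<bar>\<phi> x\<bar> powr q)"
  proof (rule Bochner_Integration.integrable_bound[where f = "\<lambda>x. M powr q * indicator K x"])
    show "integrable lborel (\<lambda>x. M powr q * indicator K x :: real)"
      using K(1) by (auto intro!: integrable_real_indicator emeasure_compact_finite simp: compact_imp_closed)
    have "\<bar>\<phi> x\<bar> powr q \<le> M powr q * indicator K x" for x
      using M K(2)[of x] q by (cases "x \<in> K") (auto intro: powr_mono2)
    then show "AE x in lborel. norm (\<bar>\<phi> x\<bar> powr q) \<le> norm (M powr q * indicator K x :: real)" by simp
  qed measurable
  then show ?thesis
    using lebesgue_on_borel_zero(1)[OF \<Omega>, of "\<lambda>x. \<bar>\<phi> x\<bar> powr q"] test_functionsD(2)[OF \<phi>]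
      lebesgue_on_borel_zero(3)[OF \<Omega> test_function_measurable[OF \<phi>] test_functionsD(2)[OF \<phi>]] q
    by (simp add: Lp_space_def)
qed

lemma Lp_test_integrable:
  assumes "open \<Omega>" "1 < p" "u \<in> Lp_space p \<Omega>" "\<phi> \<in> test_functions \<Omega>"
  shows "integrable (lebesgue_on \<Omega>) (\<lambda>x. u x * \<phi> x)"
proof -
  have "1 / p + 1 / (p / (p - 1)) = 1" "0 < p / (p - 1)" using assms(2) by (auto simp: field_simps)
  then show ?thesis using Holder_inequality(1)[OF assms(2) _ assms(3) test_function_Lp_space[OF assms(1,4)]] by blast
qed

lemma test_function_restrict_borel: "\<phi> \<in> test_functions U \<Longrightarrow> \<phi> \<in> borel_measurable (restrict_space borel \<Omega>)"
  by (intro measurable_restrict_space1) (rule test_function_measurable)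

section \<open>Weak partial derivatives and the space BV\<close>

lemma is_weak_partialD:
  assumes "is_weak_partial \<Omega> i u \<nu>"
  shows "signed_borel_measure \<Omega> \<nu>"
    "\<And>\<phi>. \<phi> \<in> test_functions \<Omega> \<Longrightarrow> (\<integral>x. u x * partial_deriv i \<phi> x \<partial>lebesgue_on \<Omega>) = - signed_integral \<Omega> \<nu> \<phi>"
  using assms by (auto simp: is_weak_partial_def)

lemma BV_spaceD:
  assumes "u \<in> BV_space p \<Omega>"
  shows "u \<in> Lp_space p \<Omega>" "is_weak_partial \<Omega> i u (weak_partial \<Omega> i u)"
  using assms someI_ex[of "is_weak_partial \<Omega> i u"] by (auto simp: BV_space_def weak_partial_def)

lemma BV_space_lincomb:
  assumes \<Omega>: "open \<Omega>" and p: "1 < p" and u: "u \<in> BV_space p \<Omega>" and w: "w \<in> BV_space p \<Omega>"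
  shows "(\<lambda>x. a * u x + b * w x) \<in> BV_space p \<Omega>"
proof -
  have "\<exists>\<rho>. is_weak_partial \<Omega> i (\<lambda>x. a * u x + b * w x) \<rho>" for i
  proof -
    define \<nu> where "\<nu> = weak_partial \<Omega> i u"
    define \<mu> where "\<mu> = weak_partial \<Omega> i w"
    have \<nu>: "is_weak_partial \<Omega> i u \<nu>" and \<mu>: "is_weak_partial \<Omega> i w \<mu>"
      using BV_spaceD(2)[OF u] BV_spaceD(2)[OF w] by (auto simp: \<nu>_def \<mu>_def)
    have "(\<integral>x. (a * u x + b * w x) * partial_deriv i \<phi> x \<partial>lebesgue_on \<Omega>)
        = - signed_integral \<Omega> (\<lambda>A. a * \<nu> A + b * \<mu> A) \<phi>" if \<phi>: "\<phi> \<in> test_functions \<Omega>" for \<phi>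
    proof -
      obtain M where M: "\<And>x. \<bar>\<phi> x\<bar> \<le> M" using test_function_bounded[OF \<phi>] by metis
      note i1 = Lp_test_integrable[OF \<Omega> p BV_spaceD(1)[OF u] test_functions_partial_deriv[OF \<phi>, of i]]
      note i2 = Lp_test_integrable[OF \<Omega> p BV_spaceD(1)[OF w] test_functions_partial_deriv[OF \<phi>, of i]]
      have "(\<integral>x. (a * u x + b * w x) * partial_deriv i \<phi> x \<partial>lebesgue_on \<Omega>)
          = (\<integral>x. a * (u x * partial_deriv i \<phi> x) + b * (w x * partial_deriv i \<phi> x) \<partial>lebesgue_on \<Omega>)"
        by (intro Bochner_Integration.integral_cong) (auto simp: algebra_simps)
      also have "\<dots> = a * (\<integral>x. u x * partial_deriv i \<phi> x \<partial>lebesgue_on \<Omega>) + b * (\<integral>x. w x * partial_deriv i \<phi> x \<partial>lebesgue_on \<Omega>)"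
        using i1 i2 by simp
      also have "\<dots> = - signed_integral \<Omega> (\<lambda>A. a * \<nu> A + b * \<mu> A) \<phi>"
        using signed_integral_add_measure[OF is_weak_partialD(1)[OF \<nu>] is_weak_partialD(1)[OF \<mu>]
            test_function_restrict_borel[OF \<phi>] M, of a b]
          is_weak_partialD(2)[OF \<nu> \<phi>] is_weak_partialD(2)[OF \<mu> \<phi>] by simp
      finally show ?thesis .
    qed
    then have "is_weak_partial \<Omega> i (\<lambda>x. a * u x + b * w x) (\<lambda>A. a * \<nu> A + b * \<mu> A)"
      using signed_measure_lincomb[OF is_weak_partialD(1)[OF \<nu>] is_weak_partialD(1)[OF \<mu>]]
      by (simp add: is_weak_partial_def)
    then show ?thesis by blast
  qed
  then show ?thesis
    using Lp_space_lincomb[OF _ BV_spaceD(1)[OF u] BV_spaceD(1)[OF w]] p by (simp add: BV_space_def)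
qed

lemma integral_add_const_test:
  assumes \<Omega>: "open \<Omega>" and p: "1 < p" and u: "u \<in> Lp_space p \<Omega>" and w: "w \<in> Lp_space p \<Omega>"
    and c: "AE x in lebesgue_on \<Omega>. w x = u x + c" and \<phi>: "\<phi> \<in> test_functions \<Omega>"
    and 0: "(\<integral>x. \<phi> x \<partial>lborel) = 0"
  shows "(\<integral>x. w x * \<phi> x \<partial>lebesgue_on \<Omega>) = (\<integral>x. u x * \<phi> x \<partial>lebesgue_on \<Omega>)"
proof -
  note i = Lp_test_integrable[OF \<Omega> p u \<phi>]
  note t = test_function_integral_lebesgue_on[OF \<Omega> \<phi>]
  note [measurable] = Lp_spaceD(1)[OF u] Lp_spaceD(1)[OF w] borel_measurable_integrable[OF t(2)]
  have "(\<integral>x. w x * \<phi> x \<partial>lebesgue_on \<Omega>) = (\<integral>x. u x * \<phi> x + c * \<phi> x \<partial>lebesgue_on \<Omega>)"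
    using c by (intro integral_cong_AE) (auto elim!: eventually_mono simp: algebra_simps)
  also have "\<dots> = (\<integral>x. u x * \<phi> x \<partial>lebesgue_on \<Omega>)" using i t 0 by simp
  finally show ?thesis .
qed

text \<open>Partial derivatives of test functions integrate to zero, so adding a constant leaves the
  weak derivatives unchanged.\<close>

lemma BV_space_add_const:
  assumes \<Omega>: "open \<Omega>" and p: "1 < p" and u: "u \<in> BV_space p \<Omega>" and w: "w \<in> Lp_space p \<Omega>"
    and c: "AE x in lebesgue_on \<Omega>. w x = u x + c"
  shows "w \<in> BV_space p \<Omega>"
proof -
  have "is_weak_partial \<Omega> i w (weak_partial \<Omega> i u)" for i
    unfolding is_weak_partial_def
    using is_weak_partialD[OF BV_spaceD(2)[OF u]]
      integral_add_const_test[OF \<Omega> p BV_spaceD(1)[OF u] w c test_functions_partial_deriv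
        integral_partial_deriv_test_function] by simp
  then show ?thesis using w by (auto simp: BV_space_def)
qed

text \<open>Finite variation makes the gradient integrable, so the partial derivatives are measures
  with densities. Hence smooth approximations lie in \<open>BV_space\<close> even when only the
  total variation of the approximated function is known to be finite.\<close>

lemma smooth_BV_space:
  fixes w :: "real^'n \<Rightarrow> real"
  assumes \<Omega>: "open \<Omega>" "\<Omega> \<noteq> {}" and w: "w \<in> Lp_space p \<Omega>" "smooth_fun_on \<Omega> w" "total_variation \<Omega> w \<le> ereal T"
  shows "w \<in> BV_space p \<Omega>"
proof -
  have "\<exists>\<nu>. is_weak_partial \<Omega> i w \<nu>" for i
  proof -
    let ?h = "partial_deriv i w"
    note hm = smooth_fun_on_measurable[OF \<Omega>(1) smooth_fun_on_partial_deriv[OF w(2), of i]]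
    have "(\<integral>\<^sup>+x. ennreal (norm (?h x)) \<partial>lebesgue_on \<Omega>) \<le> (\<integral>\<^sup>+x. ennreal (norm (grad w x)) \<partial>lebesgue_on \<Omega>)"
      using component_le_norm_cart[of "grad w _" i] by (intro nn_integral_mono ennreal_leI) (simp add: grad_def)
    also have "\<dots> < \<infinity>" by (rule le_less_trans[OF grad_integral_le_total_variation[OF \<Omega> w(2,3)]]) simp
    finally have hi: "integrable (lebesgue_on \<Omega>) ?h" by (intro integrableI_bounded hm)
    define \<nu> where "\<nu> A = (\<integral>x. ?h x * indicator A x \<partial>lebesgue_on \<Omega>)" for A
    have \<nu>: "signed_borel_measure \<Omega> \<nu>" unfolding \<nu>_def by (rule density_signed_measure(1)[OF \<Omega>(1) hi])
    have "(\<integral>x. w x * partial_deriv i \<phi> x \<partial>lebesgue_on \<Omega>) = - signed_integral \<Omega> \<nu> \<phi>"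
      if \<phi>: "\<phi> \<in> test_functions \<Omega>" for \<phi>
    proof -
      obtain M where M: "\<And>x. \<bar>\<phi> x\<bar> \<le> M" using test_function_bounded[OF \<phi>] by metis
      have "(\<integral>x. w x * partial_deriv i \<phi> x \<partial>lebesgue_on \<Omega>) = (\<integral>x. w x * partial_deriv i \<phi> x \<partial>lborel)"
        by (rule test_function_integral_lebesgue_on(1)[OF \<Omega>(1)
              test_functions_smooth_mult[OF \<Omega>(1) w(2) test_functions_partial_deriv[OF \<phi>]]])
      also have "\<dots> = - (\<integral>x. ?h x * \<phi> x \<partial>lborel)" by (rule integration_by_parts_test_function[OF \<Omega>(1) w(2) \<phi>])
      also have "(\<integral>x. ?h x * \<phi> x \<partial>lborel) = (\<integral>x. ?h x * \<phi> x \<partial>lebesgue_on \<Omega>)"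
        by (rule test_function_integral_lebesgue_on(1)[OF \<Omega>(1)
              test_functions_smooth_mult[OF \<Omega>(1) smooth_fun_on_partial_deriv[OF w(2)] \<phi>], symmetric])
      also have "\<dots> = signed_integral \<Omega> \<nu> \<phi>"
        unfolding \<nu>_def by (rule density_signed_measure(2)[OF \<Omega>(1) hi test_function_restrict_borel[OF \<phi>] M, symmetric])
      finally show ?thesis .
    qed
    then show ?thesis using \<nu> unfolding is_weak_partial_def by blast
  qed
  then show ?thesis using w(1) by (simp add: BV_space_def)
qed

lemma integral_classical_div_weak_partial:
  fixes u :: "real^'n \<Rightarrow> real"
  assumes \<Omega>: "open \<Omega>" and p: "1 < p" and u: "u \<in> BV_space p \<Omega>" and v: "v \<in> test_fields \<Omega>"
  shows "(\<integral>x. u x * classical_div v x \<partial>lebesgue_on \<Omega>)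
    = - (\<Sum>i\<in>UNIV. signed_integral \<Omega> (weak_partial \<Omega> i u) (\<lambda>x. v x $ i))"
proof -
  have "(\<integral>x. u x * classical_div v x \<partial>lebesgue_on \<Omega>)
      = (\<Sum>i\<in>UNIV. \<integral>x. u x * partial_deriv i (\<lambda>x. v x $ i) x \<partial>lebesgue_on \<Omega>)"
    using Lp_test_integrable[OF \<Omega> p BV_spaceD(1)[OF u] test_functions_partial_deriv[OF test_fieldD[OF v]]]
    by (simp add: classical_div_def sum_distrib_left)
  then show ?thesis using is_weak_partialD(2)[OF BV_spaceD(2)[OF u] test_fieldD[OF v]] by (simp add: sum_negf)
qed

lemma weak_partial_integral_bound:
  fixes u :: "real^'n \<Rightarrow> real"
  assumes u: "u \<in> BV_space p \<Omega>"
  obtains B where "0 \<le> B" "\<And>v s. (\<And>i. (\<lambda>x. v x $ i) \<in> borel_measurable (restrict_space borel \<Omega>)) \<Longrightarrow>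
    (\<And>x. x \<in> \<Omega> \<Longrightarrow> norm (v x) \<le> s) \<Longrightarrow>
    \<bar>\<Sum>i\<in>UNIV. signed_integral \<Omega> (weak_partial \<Omega> i u) (\<lambda>x. v x $ i)\<bar> \<le> s * B"
proof -
  have "\<exists>b\<ge>0. \<forall>g s. g \<in> borel_measurable (restrict_space borel \<Omega>) \<longrightarrow> (\<forall>x\<in>\<Omega>. \<bar>g x\<bar> \<le> s) \<longrightarrow>
      \<bar>signed_integral \<Omega> (weak_partial \<Omega> i u) g\<bar> \<le> s * b" for i
    using signed_integral_bound[OF is_weak_partialD(1)[OF BV_spaceD(2)[OF u, of i]]] by metis
  then obtain b where b: "\<And>i. 0 \<le> b i" "\<And>i g s. g \<in> borel_measurable (restrict_space borel \<Omega>) \<Longrightarrow>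
    (\<And>x. x \<in> \<Omega> \<Longrightarrow> \<bar>g x\<bar> \<le> s) \<Longrightarrow> \<bar>signed_integral \<Omega> (weak_partial \<Omega> i u) g\<bar> \<le> s * b i" by metis
  show thesis
  proof (rule that[of "\<Sum>i\<in>UNIV. b i"])
    fix v :: "real^'n \<Rightarrow> real^'n" and s
    assume v: "\<And>i. (\<lambda>x. v x $ i) \<in> borel_measurable (restrict_space borel \<Omega>)" "\<And>x. x \<in> \<Omega> \<Longrightarrow> norm (v x) \<le> s"
    have "\<bar>signed_integral \<Omega> (weak_partial \<Omega> i u) (\<lambda>x. v x $ i)\<bar> \<le> s * b i" for i
      using v(2) order_trans[OF component_le_norm_cart] by (intro b v(1)) blast
    then show "\<bar>\<Sum>i\<in>UNIV. signed_integral \<Omega> (weak_partial \<Omega> i u) (\<lambda>x. v x $ i)\<bar> \<le> s * (\<Sum>i\<in>UNIV. b i)"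
      unfolding sum_distrib_left by (intro order_trans[OF sum_abs] sum_mono)
  qed (simp add: sum_nonneg b)
qed

lemma BV_space_total_variation_finite:
  fixes u :: "real^'n \<Rightarrow> real"
  assumes \<Omega>: "open \<Omega>" "\<Omega> \<noteq> {}" and p: "1 < p" and u: "u \<in> BV_space p \<Omega>"
  obtains T where "0 \<le> T" "total_variation \<Omega> u \<le> ereal T"
proof -
  obtain B where B: "0 \<le> B" "\<And>v s. (\<And>i. (\<lambda>x. v x $ i) \<in> borel_measurable (restrict_space borel \<Omega>)) \<Longrightarrow>
    (\<And>x. x \<in> \<Omega> \<Longrightarrow> norm (v x) \<le> s) \<Longrightarrow>
    \<bar>\<Sum>i\<in>UNIV. signed_integral \<Omega> (weak_partial \<Omega> i u) (\<lambda>x. v x $ i)\<bar> \<le> s * B"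
    using weak_partial_integral_bound[OF u] by blast
  have "(\<integral>x. u x * classical_div v x \<partial>lebesgue_on \<Omega>) \<le> B" if v: "v \<in> test_fields \<Omega>" "\<forall>x. norm (v x) \<le> 1" for v
    using B(2)[of v 1] test_function_restrict_borel[OF test_fieldD[OF v(1)]] v(2)
    unfolding integral_classical_div_weak_partial[OF \<Omega>(1) p u v(1)] by (simp add: abs_le_iff)
  then have "total_variation \<Omega> u \<le> ereal B" unfolding total_variation_le_iff[OF \<Omega>(2)] by blast
  then show thesis using that B(1) by blast
qed

section \<open>Divergences of test fields\<close>

lemma test_fields_add: "v \<in> test_fields U \<Longrightarrow> w \<in> test_fields U \<Longrightarrow> (\<lambda>x. v x + w x) \<in> test_fields U"
  by (simp add: test_fields_def test_functions_add)

lemma test_fields_scaleR: "v \<in> test_fields U \<Longrightarrow> (\<lambda>x. c *\<^sub>R v x) \<in> test_fields U"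
  by (simp add: test_fields_def test_functions_cmult)

lemma classical_div_add:
  assumes "v \<in> test_fields U" "w \<in> test_fields U"
  shows "classical_div (\<lambda>x. v x + w x) x = classical_div v x + classical_div w x"
  using smooth_fun_on_differentiable[OF test_functionsD(1)[OF test_fieldD[OF assms(1)]], of x]
    smooth_fun_on_differentiable[OF test_functionsD(1)[OF test_fieldD[OF assms(2)]], of x]
  by (simp add: classical_div_def partial_deriv_add sum.distrib)

lemma classical_div_scaleR:
  assumes "v \<in> test_fields U"
  shows "classical_div (\<lambda>x. c *\<^sub>R v x) x = c * classical_div v x"
  using smooth_fun_on_differentiable[OF test_functionsD(1)[OF test_fieldD[OF assms]], of x]
  by (simp add: classical_div_def partial_deriv_cmult sum_distrib_left)

lemma classical_div_test_function: "v \<in> test_fields U \<Longrightarrow> classical_div v \<in> test_functions U"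
  unfolding classical_div_def[abs_def]
  by (intro test_functions_sum test_functions_partial_deriv test_fieldD) auto

lemma test_field_pairing_bound:
  fixes v :: "real^'n \<Rightarrow> real^'n"
  assumes \<Omega>: "\<Omega> \<noteq> {}" and v: "v \<in> test_fields \<Omega>" and s: "0 < s" "\<And>x. norm (v x) \<le> s"
    and TV: "total_variation \<Omega> u \<le> ereal T"
  shows "\<bar>\<integral>x. u x * classical_div v x \<partial>lebesgue_on \<Omega>\<bar> \<le> s * T"
proof -
  \<comment> \<open>Testing with v / s and with -v / s bounds the integral from both sides.\<close>
  have le: "(\<integral>x. u x * classical_div (\<lambda>x. (a / s) *\<^sub>R v x) x \<partial>lebesgue_on \<Omega>) \<le> T" if a: "\<bar>a\<bar> = 1" for a
  proof -
    have "norm ((a / s) *\<^sub>R v x) \<le> 1" for x using s(2)[of x] s(1) a by simp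
    then show ?thesis
      by (rule TV[unfolded total_variation_le_iff[OF \<Omega>], rule_format, OF test_fields_scaleR[OF v]])
  qed
  have eq: "(\<integral>x. u x * classical_div (\<lambda>x. (a / s) *\<^sub>R v x) x \<partial>lebesgue_on \<Omega>)
      = (a / s) * (\<integral>x. u x * classical_div v x \<partial>lebesgue_on \<Omega>)" for a
    unfolding classical_div_scaleR[OF v] by (subst mult.left_commute) (rule integral_mult_right_zero)
  show ?thesis using le[of 1] le[of "-1"] s(1) unfolding eq by (simp add: abs_le_iff field_simps)
qed

section \<open>Approximation of fields vanishing at infinity by test fields\<close>

lemma C0_field_small_off_compact:
  assumes "v \<in> C0_fields \<Omega>" "0 < e"
  obtains K where "compact K" "K \<subseteq> \<Omega>" "\<And>x. x \<in> \<Omega> - K \<Longrightarrow> norm (v x) < e"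
proof -
  have "\<exists>K. compact K \<and> K \<subseteq> \<Omega> \<and> (\<forall>x\<in>\<Omega> - K. norm (v x) < e)"
    using assms by (simp add: C0_fields_def)
  then show thesis using that by blast
qed

lemma C0_field_compact_approx:
  fixes v :: "real^'n \<Rightarrow> real^'n"
  assumes \<Omega>: "open \<Omega>" and v: "v \<in> C0_fields \<Omega>" and e: "0 < e"
  obtains g K where "continuous_on UNIV g" "compact K" "K \<subseteq> \<Omega>" "\<And>x. x \<notin> K \<Longrightarrow> g x = 0"
    "\<And>x. x \<in> \<Omega> \<Longrightarrow> norm (v x - g x) \<le> e"
proof -
  have vc: "continuous_on \<Omega> v" using v by (simp add: C0_fields_def)
  obtain K where K: "compact K" "K \<subseteq> \<Omega>" "\<And>x. x \<in> \<Omega> - K \<Longrightarrow> norm (v x) < e"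
    using C0_field_small_off_compact[OF v e] by blast
  \<comment> \<open>The length of \<open>v x\<close> is reduced by \<open>e\<close>, and to 0 where
    it is at most \<open>e\<close>; this is continuous and leaves a compact support.\<close>
  define h where "h x = (1 - e / max e (norm (v x))) *\<^sub>R v x" for x
  define g where "g x = (if x \<in> \<Omega> then h x else 0)" for x
  have g0: "g x = 0" if "x \<notin> K" for x
    using K(3)[of x] that e by (auto simp: g_def h_def max_def)
  have "continuous_on \<Omega> h"
    unfolding h_def using e by (intro continuous_intros vc) (auto simp: max_def)
  then have "continuous_on \<Omega> g" by (rule continuous_on_eq) (simp add: g_def)
  moreover have "continuous_on (- K) g"
    by (rule continuous_on_eq[of _ "\<lambda>_. 0"]) (auto simp: g0)
  ultimately have "continuous_on (\<Omega> \<union> - K) g"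
    using \<Omega> K(1) by (intro continuous_on_open_Un) (auto simp: compact_imp_closed open_Compl)
  moreover have "\<Omega> \<union> - K = UNIV" using K(2) by auto
  ultimately have gc: "continuous_on UNIV g" by simp
  have "norm (v x - g x) \<le> e" if "x \<in> \<Omega>" for x
  proof (cases "norm (v x) \<le> e")
    case True
    then have "max e (norm (v x)) = e" by simp
    then show ?thesis using that True e by (simp add: g_def h_def)
  next
    case False
    then have m: "max e (norm (v x)) = norm (v x)" by simp
    have "v x - g x = (e / norm (v x)) *\<^sub>R v x" using that by (simp add: g_def h_def m algebra_simps)
    then show ?thesis using False e by simp
  qed
  then show thesis using that[OF gc K(1,2) g0] by blast
qed

lemma C0_field_test_approx:
  fixes v :: "real^'n \<Rightarrow> real^'n"
  assumes \<Omega>: "open \<Omega>" and v: "v \<in> C0_fields \<Omega>" and e: "0 < e"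
  shows "\<exists>\<phi>\<in>test_fields \<Omega>. \<forall>x\<in>\<Omega>. norm (v x - \<phi> x) \<le> e"
proof -
  have e2: "0 < e / 2" using e by simp
  obtain g K where g: "continuous_on UNIV g" and K: "compact K" "K \<subseteq> \<Omega>" "\<And>x. x \<notin> K \<Longrightarrow> g x = 0"
    and gv: "\<And>x. x \<in> \<Omega> \<Longrightarrow> norm (v x - g x) \<le> e / 2"
    using C0_field_compact_approx[OF \<Omega> v e2] by metis
  obtain a where a: "0 < a" "(\<Union>x\<in>K. cball x a) \<subseteq> \<Omega>"
    using compact_subset_open_imp_cball_epsilon_subset[OF K(1) \<Omega> K(2)] by metis
  obtain R where "\<forall>x\<in>K. norm x \<le> R" using compact_imp_bounded[OF K(1)] by (auto simp: bounded_iff)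
  then have R: "K \<subseteq> cball 0 R" by auto
  define h where "h i x = g x $ i" for i x
  have hc: "continuous_on UNIV (h i)" for i unfolding h_def by (intro continuous_intros g)
  have h0: "h i x = 0" if "x \<notin> K" for i x using K(3)[OF that] by (simp add: h_def)
  have hi: "integrable lborel (h i)" for i by (rule integrable_compact_support[OF hc K(1) h0])
  \<comment> \<open>Half of \<open>e\<close> is spent on the compactly supported \<open>g\<close>;
    the other half is shared by the components.\<close>
  define c where "c = e / 2 / real CARD('n)"
  have c: "0 < c" using e by (simp add: c_def)
  have "\<exists>d0>0. \<forall>d x. 0 < d \<longrightarrow> d < d0 \<longrightarrow> \<bar>conv (moll d) (h i) x - h i x\<bar> \<le> c" for i
  proof -
    have h0': "h i x = 0" if "x \<notin> cball 0 R" for x using that R h0 by blast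
    show ?thesis using conv_moll_continuous_approx[OF hc h0' c] by metis
  qed
  then obtain d0 where d0: "\<And>i. 0 < d0 i" "\<And>i d x. 0 < d \<Longrightarrow> d < d0 i \<Longrightarrow> \<bar>conv (moll d) (h i) x - h i x\<bar> \<le> c"
    by metis
  define d where "d = min a (Min (range d0)) / 2"
  have m: "0 < Min (range d0)" using d0(1) by (subst Min_gr_iff) auto
  have d: "0 < d" "d \<le> a" using m a(1) unfolding d_def by linarith+
  have dd: "d < d0 i" for i
  proof -
    have "Min (range d0) \<le> d0 i" by (intro Min_le) auto
    then show ?thesis using m a(1) unfolding d_def by linarith
  qed
  define \<phi> where "\<phi> x = (\<chi> i. conv (moll d) (h i) x)" for x
  have "conv (moll d) (h i) \<in> test_functions \<Omega>" for i
  proof -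
    have "conv (moll d) (h i) x = 0" if "x \<notin> (\<Union>x\<in>K. cball x a)" for x
    proof (rule conv_eq_0)
      fix y assume "h i y \<noteq> 0"
      then have "y \<in> K" using h0 by blast
      then have "a < dist y x" using that by auto
      then show "moll d (x - y) = 0" using d by (intro moll_eq_0) (auto simp: dist_norm norm_minus_commute)
    qed
    then show ?thesis
      using smooth_fun_on_conv[OF hi moll_test_function[OF d(1)]] compact_UN_cball[OF K(1), of a] a(2)
      unfolding test_functions_def by blast
  qed
  then have \<phi>t: "\<phi> \<in> test_fields \<Omega>" by (simp add: test_fields_def \<phi>_def)
  have "norm (v x - \<phi> x) \<le> e" if x: "x \<in> \<Omega>" for x
  proof -
    have "norm (g x - \<phi> x) \<le> (\<Sum>i\<in>UNIV. \<bar>(g x - \<phi> x) $ i\<bar>)" by (rule norm_le_l1_cart)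
    also have "\<dots> \<le> (\<Sum>i\<in>(UNIV::'n set). c)"
      using d0(2)[OF d(1) dd] by (intro sum_mono) (simp add: \<phi>_def h_def[symmetric] abs_minus_commute)
    also have "\<dots> = e / 2" by (simp add: c_def)
    finally show ?thesis using gv[OF x] norm_triangle_ineq[of "v x - g x" "g x - \<phi> x"] by simp
  qed
  then show ?thesis using \<phi>t by blast
qed

lemma C0_field_restrict_borel:
  fixes v :: "real^'n \<Rightarrow> real^'n"
  assumes "v \<in> C0_fields \<Omega>"
  shows "(\<lambda>x. v x $ i) \<in> borel_measurable (restrict_space borel \<Omega>)"
  using assms by (intro borel_measurable_continuous_on_restrict continuous_intros) (simp add: C0_fields_def)

lemma C0_field_bounded:
  fixes v :: "real^'n \<Rightarrow> real^'n"
  assumes "v \<in> C0_fields \<Omega>"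
  obtains M where "0 \<le> M" "\<And>x. x \<in> \<Omega> \<Longrightarrow> norm (v x) \<le> M"
proof -
  obtain K where K: "compact K" "K \<subseteq> \<Omega>" "\<And>x. x \<in> \<Omega> - K \<Longrightarrow> norm (v x) < 1"
    using C0_field_small_off_compact[OF assms zero_less_one] by blast
  have "continuous_on K v" using assms K(2) continuous_on_subset by (auto simp: C0_fields_def)
  then have "bounded (v ` K)" by (intro compact_imp_bounded compact_continuous_image K)
  then obtain M where M: "\<And>x. x \<in> K \<Longrightarrow> norm (v x) \<le> M" by (auto simp: bounded_iff)
  have "norm (v x) \<le> max 1 M" if "x \<in> \<Omega>" for x
    using M[of x] K(3)[of x] that by (cases "x \<in> K") (auto simp: le_max_iff_disj less_imp_le)
  then show thesis using that[of "max 1 M"] by simp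
qed

lemma cst_class_self: "u \<in> Lp_space p \<Omega> \<Longrightarrow> u \<in> cst_class p \<Omega> u"
  by (auto simp: cst_class_def intro!: exI[of _ 0])

lemma representative_cst_class:
  assumes "u \<in> Lp_space p \<Omega>"
  obtains c where "representative (cst_class p \<Omega> u) \<in> Lp_space p \<Omega>"
    "AE x in lebesgue_on \<Omega>. representative (cst_class p \<Omega> u) x = u x + c"
proof -
  have "representative (cst_class p \<Omega> u) \<in> cst_class p \<Omega> u"
    unfolding representative_def by (rule someI[of "\<lambda>w. w \<in> cst_class p \<Omega> u"]) (rule cst_class_self[OF assms])
  then show thesis using that by (auto simp: cst_class_def)
qed

text \<open>\<open>div_op\<close> is defined through a chosen representative and chosen derivative
  measures. Here it becomes a limit of integrals of \<open>u\<close> itself against classical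
  divergences, and its linearity and continuity are later derived from this description.\<close>

lemma div_op_limit:
  fixes v :: "real^'n \<Rightarrow> real^'n"
  assumes \<Omega>: "open \<Omega>" and p: "1 < p" and v: "v \<in> C0_fields \<Omega>" and u: "u \<in> BV_space p \<Omega>"
    and \<phi>: "\<And>n::nat. \<phi> n \<in> test_fields \<Omega>" and s: "\<And>n x. x \<in> \<Omega> \<Longrightarrow> norm (v x - \<phi> n x) \<le> s n" "s \<longlonglongrightarrow> 0"
  shows "(\<lambda>n. \<integral>x. u x * classical_div (\<phi> n) x \<partial>lebesgue_on \<Omega>) \<longlonglongrightarrow> div_op p \<Omega> v (cst_class p \<Omega> u)"
proof -
  define w where "w = representative (cst_class p \<Omega> u)"
  obtain c where w: "w \<in> Lp_space p \<Omega>" "AE x in lebesgue_on \<Omega>. w x = u x + c"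
    using representative_cst_class[OF BV_spaceD(1)[OF u]] unfolding w_def by metis
  have wBV: "w \<in> BV_space p \<Omega>" by (rule BV_space_add_const[OF \<Omega> p u w])
  define \<nu> where "\<nu> i = weak_partial \<Omega> i w" for i
  have \<nu>: "signed_borel_measure \<Omega> (\<nu> i)" for i
    unfolding \<nu>_def by (rule is_weak_partialD(1)[OF BV_spaceD(2)[OF wBV]])
  obtain B where B: "0 \<le> B" "\<And>v s. (\<And>i. (\<lambda>x. v x $ i) \<in> borel_measurable (restrict_space borel \<Omega>)) \<Longrightarrow>
    (\<And>x. x \<in> \<Omega> \<Longrightarrow> norm (v x) \<le> s) \<Longrightarrow>
    \<bar>\<Sum>i\<in>UNIV. signed_integral \<Omega> (\<nu> i) (\<lambda>x. v x $ i)\<bar> \<le> s * B"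
    using weak_partial_integral_bound[OF wBV] unfolding \<nu>_def by blast
  obtain M where M: "\<And>x. x \<in> \<Omega> \<Longrightarrow> norm (v x) \<le> M" using C0_field_bounded[OF v] by metis
  have vM: "\<bar>v x $ i\<bar> \<le> M" if "x \<in> \<Omega>" for x i
    using M[OF that] component_le_norm_cart[of "v x" i] by linarith
  have op: "div_op p \<Omega> v (cst_class p \<Omega> u) = - (\<Sum>i\<in>UNIV. signed_integral \<Omega> (\<nu> i) (\<lambda>x. v x $ i))"
    using u by (simp add: div_op_def BV_cst_def \<nu>_def w_def)
  have eq: "(\<integral>x. u x * classical_div (\<phi> n) x \<partial>lebesgue_on \<Omega>)
      = - (\<Sum>i\<in>UNIV. signed_integral \<Omega> (\<nu> i) (\<lambda>x. \<phi> n x $ i))" for n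
  proof -
    \<comment> \<open>A divergence of a test field has integral zero, so the constant by which the
      representative differs from \<open>u\<close> disappears.\<close>
    have "(\<integral>x. classical_div (\<phi> n) x \<partial>lborel) = 0"
      using classical_div_test_field[OF \<Omega> \<phi>] test_function_integral_lebesgue_on(1)[OF \<Omega> classical_div_test_function[OF \<phi>]]
      by metis
    then show ?thesis
      using integral_add_const_test[OF \<Omega> p BV_spaceD(1)[OF u] w classical_div_test_function[OF \<phi>], of n]
        integral_classical_div_weak_partial[OF \<Omega> p wBV \<phi>, of n] by (simp add: \<nu>_def)
  qed
  have diff: "\<bar>(\<integral>x. u x * classical_div (\<phi> n) x \<partial>lebesgue_on \<Omega>) - div_op p \<Omega> v (cst_class p \<Omega> u)\<bar> \<le> s n * B" for n
  proof -
    have "signed_integral \<Omega> (\<nu> i) (\<lambda>x. 1 * v x $ i + (-1) * \<phi> n x $ i)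
        = 1 * signed_integral \<Omega> (\<nu> i) (\<lambda>x. v x $ i) + (-1) * signed_integral \<Omega> (\<nu> i) (\<lambda>x. \<phi> n x $ i)" for i
    proof -
      obtain N where N: "\<And>x. \<bar>\<phi> n x $ i\<bar> \<le> N" using test_function_bounded[OF test_fieldD[OF \<phi>]] by metis
      show ?thesis
        by (rule signed_integral_lincomb[OF \<nu> C0_field_restrict_borel[OF v] vM
              test_function_restrict_borel[OF test_fieldD[OF \<phi>]] N])
    qed
    then have "(\<integral>x. u x * classical_div (\<phi> n) x \<partial>lebesgue_on \<Omega>) - div_op p \<Omega> v (cst_class p \<Omega> u)
        = (\<Sum>i\<in>UNIV. signed_integral \<Omega> (\<nu> i) (\<lambda>x. (v x - \<phi> n x) $ i))"
      unfolding eq op by (simp add: sum_subtractf)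
    also have "\<bar>\<dots>\<bar> \<le> s n * B"
    proof (rule B(2)[OF _ s(1)])
      fix i
      show "(\<lambda>x. (v x - \<phi> n x) $ i) \<in> borel_measurable (restrict_space borel \<Omega>)"
        using C0_field_restrict_borel[OF v] test_function_restrict_borel[OF test_fieldD[OF \<phi>]] by simp
    qed
    finally show ?thesis .
  qed
  show ?thesis
  proof (rule Lim_null[THEN iffD2], rule Lim_null_comparison)
    show "\<forall>\<^sub>F n in sequentially. norm ((\<integral>x. u x * classical_div (\<phi> n) x \<partial>lebesgue_on \<Omega>) - div_op p \<Omega> v (cst_class p \<Omega> u)) \<le> s n * B"
      using diff by simp
    show "(\<lambda>n. s n * B) \<longlonglongrightarrow> 0" using s(2) by (rule tendsto_mult_left_zero)
  qed
qed

text \<open>The representative differs from \<open>u\<close> by a constant in L_p, which elements of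
  \<open>Lq_sharp\<close> annihilate.\<close>

lemma pairing_cst_class:
  assumes \<Omega>: "open \<Omega>" and p: "1 < p" and pq: "1 / p + 1 / q = 1"
    and u: "u \<in> Lp_space p \<Omega>" and f: "f \<in> Lq_sharp q \<Omega>"
  shows "pairing \<Omega> (cst_class p \<Omega> u) f = (\<integral>x. u x * f x \<partial>lebesgue_on \<Omega>)"
proof -
  define w where "w = representative (cst_class p \<Omega> u)"
  obtain c where w: "w \<in> Lp_space p \<Omega>" "AE x in lebesgue_on \<Omega>. w x = u x + c"
    using representative_cst_class[OF u] unfolding w_def by metis
  have fL: "f \<in> Lp_space q \<Omega>" using f by (simp add: Lq_sharp_def)
  have "(\<lambda>x. w x - u x) \<in> Lp_space p \<Omega>" using p by (intro Lp_space_diff w u) auto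
  then have cL: "(\<lambda>_. c) \<in> Lp_space p \<Omega>"
    by (rule Lp_space_cong_AE) (use w(2) in \<open>auto elim!: eventually_mono\<close>)
  note [measurable] = Lp_spaceD(1)[OF u] Lp_spaceD(1)[OF w(1)] Lp_spaceD(1)[OF fL]
  have "(\<integral>x. w x * f x \<partial>lebesgue_on \<Omega>) = (\<integral>x. u x * f x + c * f x \<partial>lebesgue_on \<Omega>)"
    using w(2) by (intro integral_cong_AE) (auto elim!: eventually_mono simp: algebra_simps)
  also have "\<dots> = (\<integral>x. u x * f x \<partial>lebesgue_on \<Omega>)"
    using Holder_inequality(1)[OF p pq u fL] Holder_inequality(1)[OF p pq cL fL]
      integral_mult_const_Lq_sharp[OF \<Omega> p pq cL f] by (subst Bochner_Integration.integral_add) auto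
  finally show ?thesis by (simp add: pairing_def w_def)
qed

section \<open>Forms continuous for the localized topology\<close>

lemma continuous_map_real_uniform_approx:
  assumes "\<And>e. 0 < e \<Longrightarrow> \<exists>g. continuous_map X euclideanreal g \<and> (\<forall>x\<in>topspace X. \<bar>f x - g x\<bar> \<le> e)"
  shows "continuous_map X euclideanreal f"
  unfolding continuous_map_def
proof (intro conjI allI impI)
  fix U :: "real set" assume "openin euclidean U"
  then have U: "open U" by simp
  show "openin X {x \<in> topspace X. f x \<in> U}"
  proof (subst openin_subopen, intro ballI)
    fix x assume x: "x \<in> {x \<in> topspace X. f x \<in> U}"
    then obtain r where r: "0 < r" "ball (f x) r \<subseteq> U" using U by (auto simp: open_contains_ball)
    have "0 < r / 3" using r by simp
    then obtain g where g: "continuous_map X euclideanreal g" "\<And>x. x \<in> topspace X \<Longrightarrow> \<bar>f x - g x\<bar> \<le> r / 3"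
      using assms by blast
    define W where "W = {y \<in> topspace X. g y \<in> ball (g x) (r / 3)}"
    have "openin X W" unfolding W_def by (rule openin_continuous_map_preimage[OF g(1)]) simp
    moreover have "x \<in> W" using x r by (simp add: W_def)
    moreover have "f y \<in> U" if "y \<in> W" for y
    proof -
      have "\<bar>g x - g y\<bar> < r / 3" "y \<in> topspace X" using that by (auto simp: W_def dist_real_def)
      moreover have "\<bar>f x - g x\<bar> \<le> r / 3" "\<bar>f y - g y\<bar> \<le> r / 3"
        using g(2)[of x] g(2)[of y] x calculation by auto
      ultimately have "\<bar>f x - f y\<bar> < r" by linarith
      then show ?thesis using r(2) by (auto simp: dist_real_def)
    qed
    ultimately show "\<exists>T. openin X T \<and> x \<in> T \<and> T \<subseteq> {x \<in> topspace X. f x \<in> U}"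
      by (intro exI[of _ W]) (auto simp: W_def)
  qed
qed auto

text \<open>The induction follows the generation of the topology: a subbasic set needs a single
  pairing, and an intersection joins the two sets \<open>E\<close> and takes the smaller
  \<delta>.\<close>

lemma weak_top_neighbourhood:
  fixes \<Omega> :: "(real^'n) set"
  assumes "openin (weak_top p q \<Omega>) U" "Y \<in> U"
  shows "\<exists>E \<delta>. finite E \<and> E \<subseteq> Lq_sharp q \<Omega> \<and> 0 < \<delta> \<and>
    (\<forall>X\<in>Lp_cst p \<Omega>. (\<forall>f\<in>E. \<bar>pairing \<Omega> X f - pairing \<Omega> Y f\<bar> < \<delta>) \<longrightarrow> X \<in> U)"
proof -
  let ?S = "{{X \<in> Lp_cst p \<Omega>. pairing \<Omega> X f \<in> V} | f V. f \<in> Lq_sharp q \<Omega> \<and> open V}"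
  have "generate_topology_on ?S U"
    using assms(1) unfolding weak_top_def by (rule openin_topology_generated_by)
  then show ?thesis using assms(2)
  proof (induction U rule: generate_topology_on.induct)
    case (Int a b)
    obtain E \<delta> where E: "finite E" "E \<subseteq> Lq_sharp q \<Omega>" "0 < \<delta>"
      "\<forall>X\<in>Lp_cst p \<Omega>. (\<forall>f\<in>E. \<bar>pairing \<Omega> X f - pairing \<Omega> Y f\<bar> < \<delta>) \<longrightarrow> X \<in> a"
      using Int.IH(1) Int.prems by auto
    obtain E' \<delta>' where E': "finite E'" "E' \<subseteq> Lq_sharp q \<Omega>" "0 < \<delta>'"
      "\<forall>X\<in>Lp_cst p \<Omega>. (\<forall>f\<in>E'. \<bar>pairing \<Omega> X f - pairing \<Omega> Y f\<bar> < \<delta>') \<longrightarrow> X \<in> b"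
      using Int.IH(2) Int.prems by auto
    show ?case
      by (intro exI[of _ "E \<union> E'"] exI[of _ "min \<delta> \<delta>'"]) (use E E' in auto)
  next
    case (UN K)
    then obtain k where k: "k \<in> K" "Y \<in> k" by blast
    then obtain E \<delta> where E: "finite E" "E \<subseteq> Lq_sharp q \<Omega>" "0 < \<delta>"
      "\<forall>X\<in>Lp_cst p \<Omega>. (\<forall>f\<in>E. \<bar>pairing \<Omega> X f - pairing \<Omega> Y f\<bar> < \<delta>) \<longrightarrow> X \<in> k"
      using UN.IH[OF k] by auto
    show ?case by (intro exI[of _ E] exI[of _ \<delta>]) (use E k(1) in auto)
  next
    case (Basis s)
    then obtain f V where s: "s = {X \<in> Lp_cst p \<Omega>. pairing \<Omega> X f \<in> V}" "f \<in> Lq_sharp q \<Omega>" "open V" by blast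
    then obtain r where r: "0 < r" "ball (pairing \<Omega> Y f) r \<subseteq> V" using Basis by (auto simp: open_contains_ball)
    show ?case
      by (intro exI[of _ "{f}"] exI[of _ r])
        (use r s in \<open>auto simp: subset_iff dist_real_def abs_minus_commute\<close>)
  qed simp
qed

lemma Lq_sharp_zero: "(\<lambda>_. 0) \<in> Lq_sharp q \<Omega>"
  by (simp add: Lq_sharp_def Lp_space_def)

lemma topspace_weak_top: "topspace (weak_top p q \<Omega>) = Lp_cst p \<Omega>"
proof -
  let ?S = "{{X \<in> Lp_cst p \<Omega>. pairing \<Omega> X f \<in> V} | f V. f \<in> Lq_sharp q \<Omega> \<and> open V}"
  have "Lp_cst p \<Omega> \<in> ?S"
    using Lq_sharp_zero by (intro CollectI exI[of _ "\<lambda>_. 0"] exI[of _ UNIV]) auto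
  then have "\<Union>?S = Lp_cst p \<Omega>" by blast
  then show ?thesis unfolding weak_top_def topology_generated_by_topspace .
qed

lemma BV_cst_subset: "BV_cst p \<Omega> \<subseteq> Lp_cst p \<Omega>"
  by (auto simp: BV_cst_def Lp_cst_def BV_space_def)

lemma TV_ball_subset: "TV_ball p \<Omega> k \<subseteq> BV_cst p \<Omega>"
  by (auto simp: TV_ball_def BV_cst_def)

lemma topspace_weak_BV_top: "topspace (weak_BV_top p q \<Omega>) = BV_cst p \<Omega>"
  unfolding weak_BV_top_def topspace_subtopology topspace_weak_top using BV_cst_subset by blast

lemma topspace_W_top:
  assumes "open \<Omega>" "1 \<le> p" "0 < q"
  shows "topspace (W_top p q \<Omega>) = BV_cst p \<Omega>"
proof -
  have "openin (W_top p q \<Omega>) (BV_cst p \<Omega>)"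
    using openin_W_top[OF assms, of "BV_cst p \<Omega>"] by simp
  then show ?thesis
    using openin_W_top[OF assms] openin_subset openin_topspace by (metis subset_antisym)
qed

lemma continuous_map_pairing:
  assumes "f \<in> Lq_sharp q \<Omega>"
  shows "continuous_map (weak_BV_top p q \<Omega>) euclideanreal (\<lambda>X. pairing \<Omega> X f)"
  unfolding weak_BV_top_def
proof (rule continuous_map_from_subtopology)
  show "continuous_map (weak_top p q \<Omega>) euclideanreal (\<lambda>X. pairing \<Omega> X f)"
    unfolding continuous_map_def topspace_weak_top
  proof (intro conjI allI impI)
    fix U :: "real set" assume "openin euclidean U"
    then show "openin (weak_top p q \<Omega>) {X \<in> Lp_cst p \<Omega>. pairing \<Omega> X f \<in> U}"
      unfolding weak_top_def using assms by (intro topology_generated_by_Basis) auto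
  qed auto
qed

lemma Lq_sharp_lincomb:
  assumes \<Omega>: "open \<Omega>" and p: "1 < p" and pq: "1 / p + 1 / q = 1"
    and f: "f \<in> Lq_sharp q \<Omega>" and g: "g \<in> Lq_sharp q \<Omega>"
  shows "(\<lambda>x. a * f x + b * g x) \<in> Lq_sharp q \<Omega>"
proof -
  have q: "1 < q" using conj_exponent[OF p pq] by simp
  have L: "f \<in> Lp_space q \<Omega>" "g \<in> Lp_space q \<Omega>" using f g by (auto simp: Lq_sharp_def)
  have "(\<integral>x. a * f x + b * g x \<partial>lebesgue_on \<Omega>) = 0" if fin: "emeasure lebesgue \<Omega> < \<infinity>"
  proof -
    have "integrable (lebesgue_on \<Omega>) h" if "h \<in> Lp_space q \<Omega>" for h
      using Holder_inequality(1)[OF p pq const_Lp_space[OF \<Omega> fin, of 1] that] by simp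
    then show ?thesis using L f g fin by (simp add: Lq_sharp_def)
  qed
  then show ?thesis using Lp_space_lincomb[OF _ L, of a b] q by (simp add: Lq_sharp_def)
qed

lemma Lq_sharp_sum:
  assumes \<Omega>: "open \<Omega>" and p: "1 < p" and pq: "1 / p + 1 / q = 1"
    and E: "finite E" "E \<subseteq> Lq_sharp q \<Omega>"
  shows "(\<lambda>x. \<Sum>f\<in>E. c f * f x) \<in> Lq_sharp q \<Omega>"
  using E
proof (induction rule: finite_induct)
  case (insert f E)
  then show ?case using Lq_sharp_lincomb[OF \<Omega> p pq, of f "\<lambda>x. \<Sum>f\<in>E. c f * f x" "c f" 1] by simp
qed (simp add: Lq_sharp_zero)

text \<open>Functionals act on functions instead of classes, so that integration against some
  \<open>f\<close> and a form composed with \<open>cst_class\<close> are treated alike. Closure of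
  \<open>V\<close> under linear combinations is assumed separately.\<close>

definition linear_on_funs :: "('a \<Rightarrow> real) set \<Rightarrow> (('a \<Rightarrow> real) \<Rightarrow> real) \<Rightarrow> bool" where
  "linear_on_funs V F \<longleftrightarrow>
     (\<forall>u\<in>V. \<forall>w\<in>V. \<forall>a b. F (\<lambda>x. a * u x + b * w x) = a * F u + b * F w)"

definition seminorm_on_funs :: "('a \<Rightarrow> real) set \<Rightarrow> (('a \<Rightarrow> real) \<Rightarrow> real) \<Rightarrow> bool" where
  "seminorm_on_funs V N \<longleftrightarrow>
     (\<forall>u\<in>V. \<forall>w\<in>V. \<forall>a b. N (\<lambda>x. a * u x + b * w x) \<le> \<bar>a\<bar> * N u + \<bar>b\<bar> * N w)"

lemma linear_on_funsD:
  "linear_on_funs V F \<Longrightarrow> u \<in> V \<Longrightarrow> w \<in> V \<Longrightarrow> F (\<lambda>x. a * u x + b * w x) = a * F u + b * F w"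
  by (simp add: linear_on_funs_def)

lemma seminorm_on_funsD:
  "seminorm_on_funs V N \<Longrightarrow> u \<in> V \<Longrightarrow> w \<in> V \<Longrightarrow>
    N (\<lambda>x. a * u x + b * w x) \<le> \<bar>a\<bar> * N u + \<bar>b\<bar> * N w"
  by (simp add: seminorm_on_funs_def)

text \<open>Hahn--Banach for one additional functional, and then for finitely many.\<close>

lemma linear_form_split_one:
  assumes V: "\<And>u w a b. u \<in> V \<Longrightarrow> w \<in> V \<Longrightarrow> (\<lambda>x. a * u x + b * w x) \<in> V"
    and F: "linear_on_funs V F" and L: "linear_on_funs V L" and N: "seminorm_on_funs V N"
    and le: "\<And>u. u \<in> V \<Longrightarrow> \<bar>F u\<bar> \<le> A * \<bar>L u\<bar> + N u"
  shows "\<exists>c. \<forall>u\<in>V. \<bar>F u - c * L u\<bar> \<le> N u"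
proof (cases "\<forall>u\<in>V. L u = 0")
  case True
  then show ?thesis using le by (intro exI[of _ 0]) auto
next
  case False
  then obtain v where v: "v \<in> V" "L v \<noteq> 0" by auto
  have scale: "(\<lambda>x. a * u x) \<in> V" "F (\<lambda>x. a * u x) = a * F u" "L (\<lambda>x. a * u x) = a * L u"
    "N (\<lambda>x. a * u x) \<le> \<bar>a\<bar> * N u" if "u \<in> V" for u a
    using V[OF that that, of a 0] linear_on_funsD[OF F that that, of a 0] linear_on_funsD[OF L that that, of a 0]
      seminorm_on_funsD[OF N that that, of a 0] by auto
  define S where "S = {F u - N u | u. u \<in> V \<and> L u = 1}"
  \<comment> \<open>The wanted \<open>c\<close> has to lie between F u - N u and F w + N w for all
    \<open>u\<close> and \<open>w\<close> with L = 1. This is possible since u - w is in the kernel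
    of \<open>L\<close>, where the hypothesis gives |F| <= N.\<close>
  have cross: "F u - N u \<le> F w + N w" if "u \<in> V" "w \<in> V" "L u = 1" "L w = 1" for u w
  proof -
    let ?d = "\<lambda>x. 1 * u x + (-1) * w x"
    have d: "?d \<in> V" by (rule V[OF that(1,2)])
    have "L ?d = 0" using linear_on_funsD[OF L that(1,2), of 1 "-1"] that by simp
    then have "\<bar>F ?d\<bar> \<le> N ?d" using le[OF d] by simp
    also have "N ?d \<le> N u + N w" using seminorm_on_funsD[OF N that(1,2), of 1 "-1"] by simp
    finally show ?thesis using linear_on_funsD[OF F that(1,2), of 1 "-1"] by simp
  qed
  define e where "e = (\<lambda>x. (1 / L v) * v x)"
  have e: "e \<in> V" "L e = 1" using scale[OF v(1), of "1 / L v"] v(2) by (auto simp: e_def)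
  have bdd: "bdd_above S" using cross e by (intro bdd_aboveI[of _ "F e + N e"]) (auto simp: S_def)
  have ne: "S \<noteq> {}" using e by (auto simp: S_def)
  define c where "c = Sup S"
  have c1: "F u - N u \<le> c" if "u \<in> V" "L u = 1" for u
    unfolding c_def using that by (intro cSup_upper bdd) (auto simp: S_def)
  have c2: "c \<le> F u + N u" if "u \<in> V" "L u = 1" for u
    unfolding c_def using that cross by (intro cSup_least ne) (auto simp: S_def)
  have "\<bar>F u - c * L u\<bar> \<le> N u" if u: "u \<in> V" for u
  proof (cases "L u = 0")
    case True then show ?thesis using le[OF u] by simp
  next
    case False
    define w where "w = (\<lambda>x. (1 / L u) * u x)"
    have w: "w \<in> V" "L w = 1" "F w = (1 / L u) * F u" "N w \<le> \<bar>1 / L u\<bar> * N u"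
      using scale[OF u, of "1 / L u"] False by (auto simp: w_def)
    have "\<bar>F w - c\<bar> \<le> N w" using c1[OF w(1,2)] c2[OF w(1,2)] by (simp add: abs_le_iff)
    then have "\<bar>L u\<bar> * \<bar>F w - c\<bar> \<le> \<bar>L u\<bar> * (\<bar>1 / L u\<bar> * N u)"
      using w(4) by (intro mult_left_mono) auto
    also have "\<dots> = N u" using False by simp
    also have "\<bar>L u\<bar> * \<bar>F w - c\<bar> = \<bar>F u - c * L u\<bar>"
      using False w(3) by (simp add: abs_mult[symmetric] right_diff_distrib mult.commute)
    finally show ?thesis .
  qed
  then show ?thesis by blast
qed

lemma linear_form_split:
  assumes V: "\<And>u w a b. u \<in> V \<Longrightarrow> w \<in> V \<Longrightarrow> (\<lambda>x. a * u x + b * w x) \<in> V"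
    and N: "seminorm_on_funs V N" and A: "0 \<le> A"
    and E: "finite E" and L: "\<And>f. f \<in> E \<Longrightarrow> linear_on_funs V (L f)"
    and F: "linear_on_funs V F" and le: "\<And>u. u \<in> V \<Longrightarrow> \<bar>F u\<bar> \<le> A * (\<Sum>f\<in>E. \<bar>L f u\<bar>) + N u"
  shows "\<exists>c. \<forall>u\<in>V. \<bar>F u - (\<Sum>f\<in>E. c f * L f u)\<bar> \<le> N u"
  using E L F le
proof (induction E arbitrary: F rule: finite_induct)
  case empty
  then show ?case by simp
next
  case (insert g E)
  \<comment> \<open>The terms of the other functionals are absorbed into the seminorm;
    \<open>linear_form_split_one\<close> removes \<open>g\<close>, and the induction hypothesis
    treats what remains.\<close>
  let ?N = "\<lambda>u. A * (\<Sum>f\<in>E. \<bar>L f u\<bar>) + N u"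
  have N': "seminorm_on_funs V ?N"
    unfolding seminorm_on_funs_def
  proof (intro ballI allI)
    fix u w a b assume uw: "u \<in> V" "w \<in> V"
    have "(\<Sum>f\<in>E. \<bar>L f (\<lambda>x. a * u x + b * w x)\<bar>) \<le> (\<Sum>f\<in>E. \<bar>a\<bar> * \<bar>L f u\<bar> + \<bar>b\<bar> * \<bar>L f w\<bar>)"
      using linear_on_funsD[OF insert.prems(1) uw, of _ a b]
      by (intro sum_mono) (auto simp: abs_mult[symmetric] intro: order_trans[OF abs_triangle_ineq])
    then have "A * (\<Sum>f\<in>E. \<bar>L f (\<lambda>x. a * u x + b * w x)\<bar>) \<le> A * (\<Sum>f\<in>E. \<bar>a\<bar> * \<bar>L f u\<bar> + \<bar>b\<bar> * \<bar>L f w\<bar>)"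
      by (intro mult_left_mono A)
    then show "?N (\<lambda>x. a * u x + b * w x) \<le> \<bar>a\<bar> * ?N u + \<bar>b\<bar> * ?N w"
      using seminorm_on_funsD[OF N uw, of a b] by (simp add: sum.distrib sum_distrib_left[symmetric] algebra_simps)
  qed
  have "\<exists>c. \<forall>u\<in>V. \<bar>F u - c * L g u\<bar> \<le> ?N u"
    by (rule linear_form_split_one[OF V insert.prems(2) insert.prems(1) N', where A = A])
      (use insert.prems(3) insert.hyps in \<open>auto simp: algebra_simps\<close>)
  then obtain b where b: "\<And>u. u \<in> V \<Longrightarrow> \<bar>F u - b * L g u\<bar> \<le> ?N u" by blast
  have F': "linear_on_funs V (\<lambda>u. F u - b * L g u)"
    using linear_on_funsD[OF insert.prems(2)] linear_on_funsD[OF insert.prems(1), of g]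
    unfolding linear_on_funs_def by (simp add: algebra_simps)
  have "\<exists>c. \<forall>u\<in>V. \<bar>(F u - b * L g u) - (\<Sum>f\<in>E. c f * L f u)\<bar> \<le> N u"
    by (rule insert.IH[OF _ F' b]) (use insert.prems(1) in auto)
  then obtain c where c: "\<And>u. u \<in> V \<Longrightarrow> \<bar>(F u - b * L g u) - (\<Sum>f\<in>E. c f * L f u)\<bar> \<le> N u" by blast
  show ?case
  proof (intro exI[of _ "c(g := b)"] ballI)
    fix u assume u: "u \<in> V"
    have "(\<Sum>f\<in>E. (c(g := b)) f * L f u) = (\<Sum>f\<in>E. c f * L f u)"
      using insert.hyps by (intro sum.cong) auto
    then have "F u - (\<Sum>f\<in>insert g E. (c(g := b)) f * L f u) = (F u - b * L g u) - (\<Sum>f\<in>E. c f * L f u)"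
      using insert.hyps by simp
    then show "\<bar>F u - (\<Sum>f\<in>insert g E. (c(g := b)) f * L f u)\<bar> \<le> N u" using c[OF u] by simp
  qed
qed

section \<open>Approximation of continuous forms by elements of L_q\<close>

lemma total_variation_lincomb:
  fixes \<Omega> :: "(real^'n) set"
  assumes \<Omega>: "open \<Omega>" "\<Omega> \<noteq> {}" and p: "1 < p" and u: "u \<in> Lp_space p \<Omega>" and w: "w \<in> Lp_space p \<Omega>"
    and T: "total_variation \<Omega> u \<le> ereal T" "total_variation \<Omega> w \<le> ereal S"
  shows "total_variation \<Omega> (\<lambda>x. a * u x + b * w x) \<le> ereal (\<bar>a\<bar> * T + \<bar>b\<bar> * S)"
  unfolding total_variation_le_iff[OF \<Omega>(2)]
proof (intro ballI impI)
  fix v :: "real^'n \<Rightarrow> real^'n" assume v: "v \<in> test_fields \<Omega>" "\<forall>x. norm (v x) \<le> 1"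
  note t = classical_div_test_function[OF v(1)]
  have b1: "\<bar>\<integral>x. u x * classical_div v x \<partial>lebesgue_on \<Omega>\<bar> \<le> T" "\<bar>\<integral>x. w x * classical_div v x \<partial>lebesgue_on \<Omega>\<bar> \<le> S"
    using test_field_pairing_bound[OF \<Omega>(2) v(1) zero_less_one _ T(1)]
      test_field_pairing_bound[OF \<Omega>(2) v(1) zero_less_one _ T(2)] v(2) by auto
  have "(\<integral>x. (a * u x + b * w x) * classical_div v x \<partial>lebesgue_on \<Omega>)
      = (\<integral>x. a * (u x * classical_div v x) + b * (w x * classical_div v x) \<partial>lebesgue_on \<Omega>)"
    by (intro Bochner_Integration.integral_cong) (auto simp: algebra_simps)
  also have "\<dots> = a * (\<integral>x. u x * classical_div v x \<partial>lebesgue_on \<Omega>) + b * (\<integral>x. w x * classical_div v x \<partial>lebesgue_on \<Omega>)"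
    using Lp_test_integrable[OF \<Omega>(1) p u t] Lp_test_integrable[OF \<Omega>(1) p w t] by simp
  also have "\<dots> \<le> \<bar>a\<bar> * \<bar>\<integral>x. u x * classical_div v x \<partial>lebesgue_on \<Omega>\<bar> + \<bar>b\<bar> * \<bar>\<integral>x. w x * classical_div v x \<partial>lebesgue_on \<Omega>\<bar>"
    unfolding abs_mult[symmetric] by (intro add_mono abs_ge_self)
  also have "\<dots> \<le> \<bar>a\<bar> * T + \<bar>b\<bar> * S" by (intro add_mono mult_left_mono b1) auto
  finally show "(\<integral>x. (a * u x + b * w x) * classical_div v x \<partial>lebesgue_on \<Omega>) \<le> \<bar>a\<bar> * T + \<bar>b\<bar> * S" .
qed

lemma BV_total_variation_real:
  fixes \<Omega> :: "(real^'n) set"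
  assumes \<Omega>: "open \<Omega>" "\<Omega> \<noteq> {}" and p: "1 < p" and u: "u \<in> BV_space p \<Omega>"
  shows "total_variation \<Omega> u = ereal (real_of_ereal (total_variation \<Omega> u))"
    and "total_variation \<Omega> u \<le> ereal S \<Longrightarrow> real_of_ereal (total_variation \<Omega> u) \<le> S"
proof -
  obtain T where T: "total_variation \<Omega> u \<le> ereal T"
    using BV_space_total_variation_finite[OF \<Omega> p u] by metis
  have "0 \<le> total_variation \<Omega> u"
  proof -
    have "ereal (\<integral>x. u x * classical_div (\<lambda>_. 0) x \<partial>lebesgue_on \<Omega>) \<le> total_variation \<Omega> u"
      unfolding total_variation_def using sup_norm_test_field_le_iff[OF test_field_zero \<Omega>(2), of 1]
      by (intro SUP_upper) (auto simp: test_field_zero)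
    then show ?thesis by (simp add: classical_div_zero zero_ereal_def)
  qed
  then show "total_variation \<Omega> u = ereal (real_of_ereal (total_variation \<Omega> u))"
    "total_variation \<Omega> u \<le> ereal S \<Longrightarrow> real_of_ereal (total_variation \<Omega> u) \<le> S"
    using T by (cases "total_variation \<Omega> u"; auto)+
qed

text \<open>The set where |F| >= e meets the ball of variation 1 in a weakly closed set that misses
  0. So finitely many pairings below some \<delta> force |F| < e on that ball, and homogeneity turns
  this into a linear bound with A = e / \<delta>.\<close>

lemma W_continuous_bound:
  fixes \<Omega> :: "(real^'n) set"
  assumes \<Omega>: "open \<Omega>" "\<Omega> \<noteq> {}" and p: "1 < p" and pq: "1 / p + 1 / q = 1"
    and F: "F \<in> W_dual p q \<Omega>" and e: "0 < e"
  obtains E A where "finite E" "E \<subseteq> Lq_sharp q \<Omega>" "0 \<le> A"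
    "\<And>u T. u \<in> BV_space p \<Omega> \<Longrightarrow> total_variation \<Omega> u \<le> ereal T \<Longrightarrow>
      \<bar>F (cst_class p \<Omega> u)\<bar> \<le> A * (\<Sum>f\<in>E. \<bar>\<integral>x. u x * f x \<partial>lebesgue_on \<Omega>\<bar>) + e * T"
proof -
  have q: "1 < q" "1 \<le> p" "0 < q" using conj_exponent[OF p pq] p by auto
  have lin: "F (cst_class p \<Omega> (\<lambda>x. a * u x + b * w x)) = a * F (cst_class p \<Omega> u) + b * F (cst_class p \<Omega> w)"
    if "u \<in> BV_space p \<Omega>" "w \<in> BV_space p \<Omega>" for u w a b
    using F that by (auto simp: W_dual_def linear_form_on_BV_cst_def)
  have cont: "continuous_map (W_top p q \<Omega>) euclideanreal F" using F by (simp add: W_dual_def)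
  have ts: "topspace (W_top p q \<Omega>) = BV_cst p \<Omega>" by (rule topspace_W_top[OF \<Omega>(1) q(2,3)])
  define C where "C = {X \<in> BV_cst p \<Omega>. F X \<in> {x. e \<le> \<bar>x\<bar>}}"
  have "closed {x::real. e \<le> \<bar>x\<bar>}" by (intro closed_Collect_le continuous_intros)
  then have "closedin (W_top p q \<Omega>) C"
    using closedin_continuous_map_preimage[OF cont, of "{x. e \<le> \<bar>x\<bar>}"] by (simp add: C_def ts)
  then have "closedin (weak_BV_top p q \<Omega>) (C \<inter> TV_ball p \<Omega> 1)"
    unfolding closedin_W_top[OF \<Omega>(1) q(2,3)] by blast
  then have "openin (weak_BV_top p q \<Omega>) (BV_cst p \<Omega> - C \<inter> TV_ball p \<Omega> 1)"
    by (simp add: closedin_def topspace_weak_BV_top)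
  then obtain U where U: "openin (weak_top p q \<Omega>) U" "BV_cst p \<Omega> - C \<inter> TV_ball p \<Omega> 1 = U \<inter> BV_cst p \<Omega>"
    unfolding weak_BV_top_def openin_subtopology by blast
  define Z where "Z = cst_class p \<Omega> (\<lambda>_::real^'n. 0)"
  have z: "(\<lambda>_::real^'n. 0) \<in> BV_space p \<Omega>"
  proof (rule smooth_BV_space[OF \<Omega>])
    show "(\<lambda>_::real^'n. 0) \<in> Lp_space p \<Omega>" by (simp add: Lp_space_def)
    show "total_variation \<Omega> (\<lambda>_. 0) \<le> ereal 0" by (simp add: total_variation_le_iff[OF \<Omega>(2)])
  qed simp
  have "F Z = 0" using lin[OF z z, of 0 0] by (simp add: Z_def)
  then have "Z \<notin> C" using e by (simp add: C_def)
  moreover have ZB: "Z \<in> BV_cst p \<Omega>" using z by (auto simp: Z_def BV_cst_def)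
  ultimately have ZU: "Z \<in> U" using U(2) by blast
  obtain E \<delta> where E: "finite E" "E \<subseteq> Lq_sharp q \<Omega>" "0 < \<delta>"
    "\<forall>X\<in>Lp_cst p \<Omega>. (\<forall>f\<in>E. \<bar>pairing \<Omega> X f - pairing \<Omega> Z f\<bar> < \<delta>) \<longrightarrow> X \<in> U"
    using weak_top_neighbourhood[OF U(1) ZU] by auto
  have small: "\<bar>F (cst_class p \<Omega> u)\<bar> < e"
    if u: "u \<in> BV_space p \<Omega>" "total_variation \<Omega> u \<le> ereal 1"
      and f: "\<And>f. f \<in> E \<Longrightarrow> \<bar>\<integral>x. u x * f x \<partial>lebesgue_on \<Omega>\<bar> < \<delta>" for u
  proof -
    let ?X = "cst_class p \<Omega> u"
    have XB: "?X \<in> BV_cst p \<Omega>" using u by (auto simp: BV_cst_def)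
    have "?X \<in> U"
    proof (rule E(4)[rule_format])
      fix f assume fE: "f \<in> E"
      then have fL: "f \<in> Lq_sharp q \<Omega>" using E(2) by blast
      show "\<bar>pairing \<Omega> ?X f - pairing \<Omega> Z f\<bar> < \<delta>"
        using f[OF fE] pairing_cst_class[OF \<Omega>(1) p pq BV_spaceD(1)[OF u(1)] fL]
          pairing_cst_class[OF \<Omega>(1) p pq BV_spaceD(1)[OF z] fL] by (simp add: Z_def)
    qed (use XB BV_cst_subset in blast)
    then have "?X \<notin> C \<inter> TV_ball p \<Omega> 1" using U(2) XB by blast
    moreover have "?X \<in> TV_ball p \<Omega> 1" using u by (auto simp: TV_ball_def)
    ultimately show ?thesis using XB by (auto simp: C_def)
  qed
  have "\<bar>F (cst_class p \<Omega> u)\<bar> \<le> (e / \<delta>) * (\<Sum>f\<in>E. \<bar>\<integral>x. u x * f x \<partial>lebesgue_on \<Omega>\<bar>) + e * T"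
    if u: "u \<in> BV_space p \<Omega>" and T: "total_variation \<Omega> u \<le> ereal T" for u T
  proof (rule field_le_epsilon)
    fix r :: real assume r: "0 < r"
    have T0: "0 \<le> T" by (rule total_variation_bound_nonneg[OF \<Omega>(2) T])
    define s where "s = (\<Sum>f\<in>E. \<bar>\<integral>x. u x * f x \<partial>lebesgue_on \<Omega>\<bar>)"
    have s0: "0 \<le> s" by (simp add: s_def sum_nonneg)
    \<comment> \<open>Division by \<open>t\<close> brings \<open>u\<close> into the ball and its
      pairings strictly below \<delta>. The summand r / e makes the inequalities strict and
      contributes only \<open>r\<close> after multiplication by \<open>e\<close>.\<close>
    define t where "t = T + s / \<delta> + r / e"
    have re: "0 < r / e" using r e by simp
    have sd: "0 \<le> s / \<delta>" using s0 E(3) by simp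
    have t: "0 < t" "T \<le> t" "s < \<delta> * t"
    proof -
      show "0 < t" "T \<le> t" using T0 sd re by (auto simp: t_def)
      have "s / \<delta> < t" using T0 re by (simp add: t_def)
      then show "s < \<delta> * t" using E(3) by (simp add: pos_divide_less_eq mult.commute)
    qed
    \<comment> \<open>The vanishing summand gives the shape of the lemmas on linear
      combinations.\<close>
    let ?w = "\<lambda>x. (1 / t) * u x + 0 * u x"
    have wB: "?w \<in> BV_space p \<Omega>" by (rule BV_space_lincomb[OF \<Omega>(1) p u u])
    have "total_variation \<Omega> ?w \<le> ereal (\<bar>1 / t\<bar> * T + \<bar>0\<bar> * T)"
      by (rule total_variation_lincomb[OF \<Omega> p BV_spaceD(1)[OF u] BV_spaceD(1)[OF u] T T])
    also have "\<dots> \<le> ereal 1" using t by (simp add: abs_of_pos)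
    finally have wT: "total_variation \<Omega> ?w \<le> ereal 1" .
    have "\<bar>F (cst_class p \<Omega> ?w)\<bar> < e"
    proof (rule small[OF wB wT])
      fix f assume f: "f \<in> E"
      have "\<bar>\<integral>x. u x * f x \<partial>lebesgue_on \<Omega>\<bar> \<le> s" unfolding s_def by (rule member_le_sum[OF f]) (use E(1) in auto)
      then have "\<bar>\<integral>x. u x * f x \<partial>lebesgue_on \<Omega>\<bar> < \<delta> * t" using t(3) by simp
      moreover have "(\<integral>x. ?w x * f x \<partial>lebesgue_on \<Omega>) = (1 / t) * (\<integral>x. u x * f x \<partial>lebesgue_on \<Omega>)"
        unfolding integral_mult_right_zero[symmetric] by (intro Bochner_Integration.integral_cong) auto
      ultimately show "\<bar>\<integral>x. ?w x * f x \<partial>lebesgue_on \<Omega>\<bar> < \<delta>"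
        using t(1) by (simp add: abs_mult pos_divide_less_eq)
    qed
    then have "\<bar>F (cst_class p \<Omega> u)\<bar> < e * t"
      using lin[OF u u, of "1 / t" 0] t(1) by (simp add: abs_mult pos_divide_less_eq)
    also have "e * t = (e / \<delta>) * s + e * T + r" using e by (simp add: t_def algebra_simps)
    finally show "\<bar>F (cst_class p \<Omega> u)\<bar>
        \<le> (e / \<delta>) * (\<Sum>f\<in>E. \<bar>\<integral>x. u x * f x \<partial>lebesgue_on \<Omega>\<bar>) + e * T + r" by (simp add: s_def)
  qed
  then show thesis using that[OF E(1,2), of "e / \<delta>"] e E(3) by simp
qed

text \<open>\<open>W_continuous_bound\<close> dominates \<open>F\<close> by finitely many
  functionals plus the seminorm \<open>e\<close> times the total variation. By
  \<open>linear_form_split\<close> a suitable linear combination of the members of \<open>E\<close>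
  then differs from \<open>F\<close> by at most this seminorm.\<close>

lemma W_dual_approx:
  fixes \<Omega> :: "(real^'n) set"
  assumes \<Omega>: "open \<Omega>" "\<Omega> \<noteq> {}" and p: "1 < p" and pq: "1 / p + 1 / q = 1"
    and F: "F \<in> W_dual p q \<Omega>" and e: "0 < e"
  shows "\<exists>f\<in>Lq_sharp q \<Omega>. \<forall>u\<in>BV_space p \<Omega>. \<forall>T. total_variation \<Omega> u \<le> ereal T \<longrightarrow>
    \<bar>F (cst_class p \<Omega> u) - (\<integral>x. u x * f x \<partial>lebesgue_on \<Omega>)\<bar> \<le> e * T"
proof -
  obtain E A where E: "finite E" "E \<subseteq> Lq_sharp q \<Omega>" "0 \<le> A"
    and bd: "\<And>u T. u \<in> BV_space p \<Omega> \<Longrightarrow> total_variation \<Omega> u \<le> ereal T \<Longrightarrow>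
      \<bar>F (cst_class p \<Omega> u)\<bar> \<le> A * (\<Sum>f\<in>E. \<bar>\<integral>x. u x * f x \<partial>lebesgue_on \<Omega>\<bar>) + e * T"
    using W_continuous_bound[OF \<Omega> p pq F e] by blast
  define N where "N u = e * real_of_ereal (total_variation \<Omega> u)" for u
  define L :: "(real^'n \<Rightarrow> real) \<Rightarrow> (real^'n \<Rightarrow> real) \<Rightarrow> real" where "L f u = (\<integral>x. u x * f x \<partial>lebesgue_on \<Omega>)" for f u
  note tv = BV_total_variation_real[OF \<Omega> p]
  have int: "integrable (lebesgue_on \<Omega>) (\<lambda>x. u x * f x)" if "u \<in> BV_space p \<Omega>" "f \<in> E" for u f
    using Holder_inequality(1)[OF p pq BV_spaceD(1)[OF that(1)], of f] that(2) E(2) by (auto simp: Lq_sharp_def)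
  have "\<exists>c. \<forall>u\<in>BV_space p \<Omega>. \<bar>F (cst_class p \<Omega> u) - (\<Sum>f\<in>E. c f * L f u)\<bar> \<le> N u"
  proof (rule linear_form_split[OF BV_space_lincomb[OF \<Omega>(1) p] _ E(3,1), where F = "\<lambda>u. F (cst_class p \<Omega> u)"])
    show "seminorm_on_funs (BV_space p \<Omega>) N"
      unfolding seminorm_on_funs_def
    proof (intro ballI allI)
      fix u w a b assume uw: "u \<in> BV_space p \<Omega>" "w \<in> BV_space p \<Omega>"
      let ?t = "\<lambda>u. real_of_ereal (total_variation \<Omega> u)"
      have "total_variation \<Omega> (\<lambda>x. a * u x + b * w x) \<le> ereal (\<bar>a\<bar> * ?t u + \<bar>b\<bar> * ?t w)"
        using tv(1)[OF uw(1)] tv(1)[OF uw(2)]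
        by (intro total_variation_lincomb[OF \<Omega> p] BV_spaceD(1) uw) auto
      then have "?t (\<lambda>x. a * u x + b * w x) \<le> \<bar>a\<bar> * ?t u + \<bar>b\<bar> * ?t w"
        by (rule tv(2)[OF BV_space_lincomb[OF \<Omega>(1) p uw, of a b]])
      then have "e * ?t (\<lambda>x. a * u x + b * w x) \<le> e * (\<bar>a\<bar> * ?t u + \<bar>b\<bar> * ?t w)"
        using e by (intro mult_left_mono) auto
      then show "N (\<lambda>x. a * u x + b * w x) \<le> \<bar>a\<bar> * N u + \<bar>b\<bar> * N w"
        by (simp add: N_def algebra_simps)
    qed
    show "linear_on_funs (BV_space p \<Omega>) (L f)" if f: "f \<in> E" for f
      unfolding linear_on_funs_def
    proof (intro ballI allI)
      fix u w a b assume uw: "u \<in> BV_space p \<Omega>" "w \<in> BV_space p \<Omega>"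
      have "L f (\<lambda>x. a * u x + b * w x) = (\<integral>x. a * (u x * f x) + b * (w x * f x) \<partial>lebesgue_on \<Omega>)"
        unfolding L_def by (intro Bochner_Integration.integral_cong) (auto simp: algebra_simps)
      then show "L f (\<lambda>x. a * u x + b * w x) = a * L f u + b * L f w"
        using int[OF uw(1) f] int[OF uw(2) f] by (simp add: L_def)
    qed
    show "linear_on_funs (BV_space p \<Omega>) (\<lambda>u. F (cst_class p \<Omega> u))"
      using F by (auto simp: W_dual_def linear_form_on_BV_cst_def linear_on_funs_def)
    show "\<bar>F (cst_class p \<Omega> u)\<bar> \<le> A * (\<Sum>f\<in>E. \<bar>L f u\<bar>) + N u" if u: "u \<in> BV_space p \<Omega>" for u
      unfolding L_def N_def by (rule bd[OF u]) (use tv(1)[OF u] in simp)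
  qed
  then obtain c where c: "\<And>u. u \<in> BV_space p \<Omega> \<Longrightarrow> \<bar>F (cst_class p \<Omega> u) - (\<Sum>f\<in>E. c f * L f u)\<bar> \<le> N u"
    by blast
  define g where "g x = (\<Sum>f\<in>E. c f * f x)" for x
  have "g \<in> Lq_sharp q \<Omega>" unfolding g_def by (rule Lq_sharp_sum[OF \<Omega>(1) p pq E(1,2)])
  moreover have "\<bar>F (cst_class p \<Omega> u) - (\<integral>x. u x * g x \<partial>lebesgue_on \<Omega>)\<bar> \<le> e * T"
    if u: "u \<in> BV_space p \<Omega>" and T: "total_variation \<Omega> u \<le> ereal T" for u T
  proof -
    have "(\<integral>x. u x * g x \<partial>lebesgue_on \<Omega>) = (\<integral>x. (\<Sum>f\<in>E. c f * (u x * f x)) \<partial>lebesgue_on \<Omega>)"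
      by (intro Bochner_Integration.integral_cong) (auto simp: g_def sum_distrib_left mult_ac)
    also have "\<dots> = (\<Sum>f\<in>E. c f * L f u)" using int[OF u] by (simp add: L_def)
    finally have "\<bar>F (cst_class p \<Omega> u) - (\<integral>x. u x * g x \<partial>lebesgue_on \<Omega>)\<bar> \<le> N u" using c[OF u] by simp
    also have "N u \<le> e * T"
      unfolding N_def using e by (intro mult_left_mono tv(2)[OF u T]) simp
    finally show ?thesis .
  qed
  ultimately show ?thesis by blast
qed

section \<open>Surjectivity of the divergence\<close>

lemma classical_div_diff:
  assumes "v \<in> test_fields U" "w \<in> test_fields U"
  shows "(\<lambda>x. v x - w x) \<in> test_fields U"
    and "classical_div (\<lambda>x. v x - w x) x = classical_div v x - classical_div w x"
  using test_fields_add[OF assms(1) test_fields_scaleR[OF assms(2), of "-1"]]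
    classical_div_add[OF assms(1) test_fields_scaleR[OF assms(2), of "-1"], of x] classical_div_scaleR[OF assms(2), of "-1" x]
  by simp_all

lemma integral_classical_div_diff:
  assumes \<Omega>: "open \<Omega>" and p: "1 < p" and u: "u \<in> Lp_space p \<Omega>" and v: "v \<in> test_fields \<Omega>" and w: "w \<in> test_fields \<Omega>"
  shows "(\<integral>x. u x * classical_div (\<lambda>x. v x - w x) x \<partial>lebesgue_on \<Omega>)
    = (\<integral>x. u x * classical_div v x \<partial>lebesgue_on \<Omega>) - (\<integral>x. u x * classical_div w x \<partial>lebesgue_on \<Omega>)"
  using Lp_test_integrable[OF \<Omega> p u classical_div_test_function[OF v]]
    Lp_test_integrable[OF \<Omega> p u classical_div_test_function[OF w]]
  by (simp add: classical_div_diff(2)[OF v w] right_diff_distrib)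

lemma test_field_norm_le:
  assumes "v \<in> test_fields \<Omega>" "\<And>x. x \<in> \<Omega> \<Longrightarrow> norm (v x) \<le> s" "0 \<le> s"
  shows "norm (v x) \<le> s"
proof (cases "x \<in> \<Omega>")
  case False
  then have "v x = 0" using test_functionsD(2)[OF test_fieldD[OF assms(1)] False] by (simp add: vec_eq_iff)
  then show ?thesis using assms(3) by simp
qed (use assms in simp)

lemma C0_field_test_sequence:
  fixes v :: "real^'n \<Rightarrow> real^'n"
  assumes \<Omega>: "open \<Omega>" and v: "v \<in> C0_fields \<Omega>"
  obtains \<phi> where "\<And>n::nat. \<phi> n \<in> test_fields \<Omega>"
    "\<And>n x. x \<in> \<Omega> \<Longrightarrow> norm (v x - \<phi> n x) \<le> inverse (real (Suc n))"
proof -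
  have "\<exists>\<phi>. \<phi> \<in> test_fields \<Omega> \<and> (\<forall>x\<in>\<Omega>. norm (v x - \<phi> x) \<le> inverse (real (Suc n)))" for n
    using C0_field_test_approx[OF \<Omega> v, of "inverse (real (Suc n))"] by auto
  then have "\<exists>\<phi>. \<forall>n. \<phi> n \<in> test_fields \<Omega> \<and> (\<forall>x\<in>\<Omega>. norm (v x - \<phi> n x) \<le> inverse (real (Suc n)))"
    by (intro choice allI)
  then show thesis using that by blast
qed

text \<open>For test fields the estimate is immediate from the definition of the total variation;
  the limit in \<open>div_op_limit\<close> carries it over to \<open>v\<close>.\<close>

lemma div_op_uniform_bound:
  fixes v :: "real^'n \<Rightarrow> real^'n"
  assumes \<Omega>: "open \<Omega>" "\<Omega> \<noteq> {}" and p: "1 < p" and v: "v \<in> C0_fields \<Omega>"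
    and u: "u \<in> BV_space p \<Omega>" and T: "total_variation \<Omega> u \<le> ereal T"
    and \<psi>: "\<psi> \<in> test_fields \<Omega>" and s: "\<And>x. x \<in> \<Omega> \<Longrightarrow> norm (v x - \<psi> x) \<le> s" "0 \<le> s"
  shows "\<bar>div_op p \<Omega> v (cst_class p \<Omega> u) - (\<integral>x. u x * classical_div \<psi> x \<partial>lebesgue_on \<Omega>)\<bar> \<le> s * T"
proof -
  obtain \<phi> where \<phi>: "\<And>n::nat. \<phi> n \<in> test_fields \<Omega>"
    "\<And>n x. x \<in> \<Omega> \<Longrightarrow> norm (v x - \<phi> n x) \<le> inverse (real (Suc n))"
    using C0_field_test_sequence[OF \<Omega>(1) v] by blast
  define t where "t n = inverse (real (Suc n))" for n
  have t: "0 < t n" for n by (simp add: t_def)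
  have tlim: "t \<longlonglongrightarrow> 0" unfolding t_def by (rule LIMSEQ_inverse_real_of_nat)
  have lim: "(\<lambda>n. \<integral>x. u x * classical_div (\<phi> n) x \<partial>lebesgue_on \<Omega>) \<longlonglongrightarrow> div_op p \<Omega> v (cst_class p \<Omega> u)"
    by (rule div_op_limit[OF \<Omega>(1) p v u \<phi>(1) \<phi>(2)[folded t_def] tlim])
  have le: "\<bar>(\<integral>x. u x * classical_div (\<phi> n) x \<partial>lebesgue_on \<Omega>) - (\<integral>x. u x * classical_div \<psi> x \<partial>lebesgue_on \<Omega>)\<bar>
      \<le> (t n + s) * T" for n
  proof -
    have loc: "norm (\<phi> n x - \<psi> x) \<le> t n + s" if "x \<in> \<Omega>" for x
      using \<phi>(2)[OF that, of n] s(1)[OF that] norm_triangle_ineq4[of "v x - \<psi> x" "v x - \<phi> n x"] by (simp add: t_def)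
    have ts: "0 < t n + s" using t[of n] s(2) by simp
    note td = classical_div_diff(1)[OF \<phi>(1)[of n] \<psi>]
    have "norm (\<phi> n x - \<psi> x) \<le> t n + s" for x
      by (rule test_field_norm_le[OF td loc less_imp_le[OF ts]])
    from test_field_pairing_bound[OF \<Omega>(2) td ts this T] show ?thesis
      unfolding integral_classical_div_diff[OF \<Omega>(1) p BV_spaceD(1)[OF u] \<phi>(1) \<psi>] .
  qed
  have "\<bar>div_op p \<Omega> v (cst_class p \<Omega> u) - (\<integral>x. u x * classical_div \<psi> x \<partial>lebesgue_on \<Omega>)\<bar> \<le> (0 + s) * T"
  proof (rule LIMSEQ_le)
    show "(\<lambda>n. \<bar>(\<integral>x. u x * classical_div (\<phi> n) x \<partial>lebesgue_on \<Omega>) - (\<integral>x. u x * classical_div \<psi> x \<partial>lebesgue_on \<Omega>)\<bar>)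
        \<longlonglongrightarrow> \<bar>div_op p \<Omega> v (cst_class p \<Omega> u) - (\<integral>x. u x * classical_div \<psi> x \<partial>lebesgue_on \<Omega>)\<bar>"
      by (intro tendsto_intros lim)
    show "(\<lambda>n. (t n + s) * T) \<longlonglongrightarrow> (0 + s) * T" by (intro tendsto_intros tlim)
  qed (use le in blast)
  then show ?thesis by simp
qed

text \<open>On each ball of bounded variation the divergence of \<open>v\<close> is a uniform limit
  of pairings with divergences of test fields, hence weakly continuous there. By the description of
  the closed sets of \<open>W_top\<close>, continuity on all balls suffices.\<close>

lemma div_op_in_W_dual:
  fixes v :: "real^'n \<Rightarrow> real^'n"
  assumes \<Omega>: "open \<Omega>" "\<Omega> \<noteq> {}" and p: "1 < p" and pq: "1 / p + 1 / q = 1" and v: "v \<in> C0_fields \<Omega>"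
  shows "div_op p \<Omega> v \<in> W_dual p q \<Omega>"
proof -
  have q: "1 < q" "1 \<le> p" "0 < q" using conj_exponent[OF p pq] p by auto
  obtain \<phi> where \<phi>: "\<And>n::nat. \<phi> n \<in> test_fields \<Omega>"
    "\<And>n x. x \<in> \<Omega> \<Longrightarrow> norm (v x - \<phi> n x) \<le> inverse (real (Suc n))"
    using C0_field_test_sequence[OF \<Omega>(1) v] by blast
  define I where "I n u = (\<integral>x. u x * classical_div (\<phi> n) x \<partial>lebesgue_on \<Omega>)" for n u
  have lim: "(\<lambda>n. I n u) \<longlonglongrightarrow> div_op p \<Omega> v (cst_class p \<Omega> u)" if "u \<in> BV_space p \<Omega>" for u
    unfolding I_def by (rule div_op_limit[OF \<Omega>(1) p v that \<phi>(1) \<phi>(2) LIMSEQ_inverse_real_of_nat])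
  have "linear_form_on_BV_cst p \<Omega> (div_op p \<Omega> v)"
    unfolding linear_form_on_BV_cst_def
  proof (intro ballI allI)
    fix u w a b assume uw: "u \<in> BV_space p \<Omega>" "w \<in> BV_space p \<Omega>"
    have "I n (\<lambda>x. a * u x + b * w x) = a * I n u + b * I n w" for n
    proof -
      note t = classical_div_test_function[OF \<phi>(1)]
      have "I n (\<lambda>x. a * u x + b * w x)
          = (\<integral>x. a * (u x * classical_div (\<phi> n) x) + b * (w x * classical_div (\<phi> n) x) \<partial>lebesgue_on \<Omega>)"
        unfolding I_def by (intro Bochner_Integration.integral_cong) (auto simp: algebra_simps)
      then show ?thesis
        using Lp_test_integrable[OF \<Omega>(1) p BV_spaceD(1)[OF uw(1)] t] Lp_test_integrable[OF \<Omega>(1) p BV_spaceD(1)[OF uw(2)] t]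
        by (simp add: I_def)
    qed
    then have "(\<lambda>n. a * I n u + b * I n w) \<longlonglongrightarrow> div_op p \<Omega> v (cst_class p \<Omega> (\<lambda>x. a * u x + b * w x))"
      using lim[OF BV_space_lincomb[OF \<Omega>(1) p uw, of a b]] by simp
    moreover have "(\<lambda>n. a * I n u + b * I n w)
        \<longlonglongrightarrow> a * div_op p \<Omega> v (cst_class p \<Omega> u) + b * div_op p \<Omega> v (cst_class p \<Omega> w)"
      by (intro tendsto_intros lim uw)
    ultimately show "div_op p \<Omega> v (cst_class p \<Omega> (\<lambda>x. a * u x + b * w x))
        = a * div_op p \<Omega> v (cst_class p \<Omega> u) + b * div_op p \<Omega> v (cst_class p \<Omega> w)"
      by (rule LIMSEQ_unique)
  qed
  moreover have "continuous_map (W_top p q \<Omega>) euclideanreal (div_op p \<Omega> v)"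
    unfolding continuous_map_closedin topspace_W_top[OF \<Omega>(1) q(2,3)]
  proof (intro conjI allI impI)
    fix S :: "real set" assume S: "closedin euclideanreal S"
    show "closedin (W_top p q \<Omega>) {X \<in> BV_cst p \<Omega>. div_op p \<Omega> v X \<in> S}"
      unfolding closedin_W_top[OF \<Omega>(1) q(2,3)]
    proof (intro conjI allI)
      fix k
      let ?B = "subtopology (weak_BV_top p q \<Omega>) (TV_ball p \<Omega> k)"
      have ts: "topspace ?B = TV_ball p \<Omega> k"
        using TV_ball_subset by (auto simp: topspace_weak_BV_top)
      have cm: "continuous_map ?B euclideanreal (div_op p \<Omega> v)"
      proof (rule continuous_map_real_uniform_approx)
        fix e :: real assume e: "0 < e"
        \<comment> \<open>The denominator is k + 1 because the ball with k = 0 is included.\<close>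
        obtain n where n: "inverse (real (Suc n)) < e / (real k + 1)"
          using reals_Archimedean[of "e / (real k + 1)"] e by auto
        show "\<exists>g. continuous_map ?B euclideanreal g \<and> (\<forall>X\<in>topspace ?B. \<bar>div_op p \<Omega> v X - g X\<bar> \<le> e)"
        proof (intro exI[of _ "\<lambda>X. pairing \<Omega> X (classical_div (\<phi> n))"] conjI ballI)
          show "continuous_map ?B euclideanreal (\<lambda>X. pairing \<Omega> X (classical_div (\<phi> n)))"
            by (intro continuous_map_from_subtopology continuous_map_pairing classical_div_in_Lq_sharp \<Omega> \<phi>(1) q(3))
          fix X assume "X \<in> topspace ?B"
          then obtain u where u: "u \<in> BV_space p \<Omega>" "X = cst_class p \<Omega> u" "total_variation \<Omega> u \<le> ereal (real k)"
            unfolding ts by (auto simp: TV_ball_def)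
          have "\<bar>div_op p \<Omega> v X - pairing \<Omega> X (classical_div (\<phi> n))\<bar> \<le> inverse (real (Suc n)) * real k"
            unfolding u(2) pairing_classical_div[OF \<Omega>(1) \<phi>(1) q(2) BV_spaceD(1)[OF u(1)]]
            by (rule div_op_uniform_bound[OF \<Omega> p v u(1,3) \<phi>]) auto
          also have "\<dots> \<le> (e / (real k + 1)) * (real k + 1)"
            using n e by (intro mult_mono) auto
          finally show "\<bar>div_op p \<Omega> v X - pairing \<Omega> X (classical_div (\<phi> n))\<bar> \<le> e" by simp
        qed
      qed
      have "closedin ?B {X \<in> TV_ball p \<Omega> k. div_op p \<Omega> v X \<in> S}"
        using closedin_continuous_map_preimage[OF cm S] unfolding ts .
      then have "closedin (weak_BV_top p q \<Omega>) {X \<in> TV_ball p \<Omega> k. div_op p \<Omega> v X \<in> S}"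
        using closedin_TV_ball[OF \<Omega>(1) q(2,3)] by (rule closedin_trans_full)
      moreover have "{X \<in> BV_cst p \<Omega>. div_op p \<Omega> v X \<in> S} \<inter> TV_ball p \<Omega> k = {X \<in> TV_ball p \<Omega> k. div_op p \<Omega> v X \<in> S}"
        using TV_ball_subset by auto
      ultimately show "closedin (weak_BV_top p q \<Omega>) ({X \<in> BV_cst p \<Omega>. div_op p \<Omega> v X \<in> S} \<inter> TV_ball p \<Omega> k)" by simp
    qed auto
  qed auto
  ultimately show ?thesis by (simp add: W_dual_def div_op_def)
qed

section \<open>Approximate solutions\<close>

lemma Lq_approx_by_divergences:
  fixes \<Omega> :: "(real^'n) set"
  assumes \<Omega>: "open \<Omega>" "\<Omega> \<noteq> {}" and p: "1 < p" "p \<le> 2" and pq: "1 / p + 1 / q = 1"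
    and g: "g \<in> Lp_space q \<Omega>" and M: "0 < M"
    and bd: "\<And>u T. u \<in> Lp_space p \<Omega> \<Longrightarrow> total_variation \<Omega> u \<le> ereal T \<Longrightarrow> (\<integral>x. u x * g x \<partial>lebesgue_on \<Omega>) \<le> M * T"
    and d: "0 < d"
  shows "\<exists>v\<in>test_fields \<Omega>. (\<forall>x. norm (v x) \<le> M) \<and> Lp_norm q \<Omega> (\<lambda>x. g x - classical_div v x) \<le> d"
proof -
  note ce = conj_exponent[OF p(1) pq]
  \<comment> \<open>The conjugate of an exponent at most 2 is at least 2, as Clarkson's inequality
    demands.\<close>
  have q2: "2 \<le> q"
  proof -
    have "2 * (p - 1) \<le> p" using p by simp
    then have "2 \<le> p / (p - 1)" using p(1) by (simp add: le_divide_eq)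
    then show ?thesis using ce(3) by simp
  qed
  define K where "K = classical_div ` {v \<in> test_fields \<Omega>. \<forall>x. norm (v x) \<le> M}"
  have KL: "k \<in> Lp_space q \<Omega>" if "k \<in> K" for k
    using that q2 test_function_Lp_space[OF \<Omega>(1) classical_div_test_function] by (auto simp: K_def)
  have "0 < d powr q" using d by simp
  have "\<exists>k\<in>K. (\<integral>x. \<bar>g x - k x\<bar> powr q \<partial>lebesgue_on \<Omega>) < d powr q"
  proof (rule Lq_bipolar[OF q2])
    show "K \<noteq> {}" using M by (auto simp: K_def intro!: exI[of _ "\<lambda>_. 0"] test_field_zero)
    show "k \<in> borel_measurable (lebesgue_on \<Omega>)" "integrable (lebesgue_on \<Omega>) (\<lambda>x. \<bar>k x\<bar> powr q)" if "k \<in> K" for k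
      using Lp_spaceD[OF KL[OF that]] by auto
    show "g \<in> borel_measurable (lebesgue_on \<Omega>)" "integrable (lebesgue_on \<Omega>) (\<lambda>x. \<bar>g x\<bar> powr q)"
      using Lp_spaceD[OF g] by auto
    show "(\<lambda>x. (1 - t) * k x + t * l x) \<in> K" if kl: "k \<in> K" "l \<in> K" and t: "0 \<le> t" "t \<le> 1" for k l t
    proof -
      obtain v w where v: "v \<in> test_fields \<Omega>" "\<And>x. norm (v x) \<le> M" "k = classical_div v"
        and w: "w \<in> test_fields \<Omega>" "\<And>x. norm (w x) \<le> M" "l = classical_div w"
        using kl by (auto simp: K_def)
      let ?z = "\<lambda>x. (1 - t) *\<^sub>R v x + t *\<^sub>R w x"
      have z: "?z \<in> test_fields \<Omega>" by (intro test_fields_add test_fields_scaleR v w)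
      have "norm (?z x) \<le> M" for x
      proof -
        have "norm (?z x) \<le> (1 - t) * norm (v x) + t * norm (w x)"
          using norm_triangle_ineq[of "(1 - t) *\<^sub>R v x" "t *\<^sub>R w x"] t by simp
        also have "\<dots> \<le> (1 - t) * M + t * M" using t v(2) w(2) by (intro add_mono mult_left_mono) auto
        finally show ?thesis by (simp add: algebra_simps)
      qed
      moreover have "classical_div ?z = (\<lambda>x. (1 - t) * k x + t * l x)"
        using classical_div_add[OF test_fields_scaleR[OF v(1)] test_fields_scaleR[OF w(1)]]
          classical_div_scaleR[OF v(1)] classical_div_scaleR[OF w(1)] by (auto simp: v(3) w(3))
      moreover have "classical_div ?z \<in> K" using z calculation(1) unfolding K_def by blast
      ultimately show ?thesis by simp
    qed
    fix u s assume um: "u \<in> borel_measurable (lebesgue_on \<Omega>)"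
      and ui: "integrable (lebesgue_on \<Omega>) (\<lambda>x. \<bar>u x\<bar> powr (q / (q - 1)))"
      and uk: "\<And>k. k \<in> K \<Longrightarrow> (\<integral>x. u x * k x \<partial>lebesgue_on \<Omega>) \<le> s"
    have uL: "u \<in> Lp_space p \<Omega>" using um ui by (simp add: Lp_space_def ce(2))
    \<comment> \<open>If the pairings of \<open>u\<close> with all of \<open>K\<close> are at most
      \<open>s\<close>, scaling fields by \<open>M\<close> bounds its variation by s / M; then
      \<open>bd\<close> gives the bound \<open>s\<close> for the pairing with
      \<open>g\<close>.\<close>
    have "total_variation \<Omega> u \<le> ereal (s / M)"
      unfolding total_variation_le_iff[OF \<Omega>(2)]
    proof (intro ballI impI)
      fix v :: "real^'n \<Rightarrow> real^'n" assume v: "v \<in> test_fields \<Omega>" "\<forall>x. norm (v x) \<le> 1"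
      have "classical_div (\<lambda>x. M *\<^sub>R v x) \<in> K"
        using v M test_fields_scaleR[OF v(1), of M] by (auto simp: K_def intro!: imageI)
      then have "(\<integral>x. u x * classical_div (\<lambda>x. M *\<^sub>R v x) x \<partial>lebesgue_on \<Omega>) \<le> s" by (rule uk)
      moreover have "(\<integral>x. u x * classical_div (\<lambda>x. M *\<^sub>R v x) x \<partial>lebesgue_on \<Omega>)
          = M * (\<integral>x. u x * classical_div v x \<partial>lebesgue_on \<Omega>)"
        unfolding classical_div_scaleR[OF v(1)] by (subst mult.left_commute) (rule integral_mult_right_zero)
      ultimately show "(\<integral>x. u x * classical_div v x \<partial>lebesgue_on \<Omega>) \<le> s / M"
        using M by (simp add: le_divide_eq mult.commute)
    qed
    from bd[OF uL this] show "(\<integral>x. u x * g x \<partial>lebesgue_on \<Omega>) \<le> s" using M by simp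
  qed fact
  then obtain v where v: "v \<in> test_fields \<Omega>" "\<And>x. norm (v x) \<le> M"
    "(\<integral>x. \<bar>g x - classical_div v x\<bar> powr q \<partial>lebesgue_on \<Omega>) < d powr q"
    unfolding K_def by auto
  have "Lp_norm q \<Omega> (\<lambda>x. g x - classical_div v x) \<le> d"
    using v(3) q2 d by (intro Lp_norm_le) auto
  then show ?thesis using v(1,2) by blast
qed

text \<open>The closure of \<open>Lq_sharp\<close> in the norm dual to the total variation. Real
  bounds \<open>T\<close> take the place of the extended real variation itself.\<close>

definition Lq_limit_form :: "real \<Rightarrow> real \<Rightarrow> (real^'n) set \<Rightarrow> ((real^'n \<Rightarrow> real) \<Rightarrow> real) \<Rightarrow> bool" where
  "Lq_limit_form p q \<Omega> \<Phi> \<longleftrightarrow> (\<forall>e>0. \<exists>f\<in>Lq_sharp q \<Omega>. \<forall>u\<in>BV_space p \<Omega>. \<forall>T. total_variation \<Omega> u \<le> ereal T \<longrightarrow>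
    \<bar>\<Phi> u - (\<integral>x. u x * f x \<partial>lebesgue_on \<Omega>)\<bar> \<le> e * T)"

text \<open>Needed for the iteration: after each step the residual is again a form of this
  kind.\<close>

lemma Lq_limit_form_minus_divergence:
  fixes \<Omega> :: "(real^'n) set"
  assumes \<Omega>: "open \<Omega>" and p: "1 < p" and pq: "1 / p + 1 / q = 1"
    and \<Phi>: "Lq_limit_form p q \<Omega> \<Phi>" and v: "v \<in> test_fields \<Omega>"
  shows "Lq_limit_form p q \<Omega> (\<lambda>u. \<Phi> u - (\<integral>x. u x * classical_div v x \<partial>lebesgue_on \<Omega>))"
  unfolding Lq_limit_form_def
proof (intro allI impI)
  fix e :: real assume "0 < e"
  then obtain f where f: "f \<in> Lq_sharp q \<Omega>" "\<And>u T. u \<in> BV_space p \<Omega> \<Longrightarrow> total_variation \<Omega> u \<le> ereal T \<Longrightarrow>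
    \<bar>\<Phi> u - (\<integral>x. u x * f x \<partial>lebesgue_on \<Omega>)\<bar> \<le> e * T"
    using \<Phi> unfolding Lq_limit_form_def by meson
  have q: "0 < q" using conj_exponent[OF p pq] by simp
  let ?g = "\<lambda>x. 1 * f x + (-1) * classical_div v x"
  have g: "?g \<in> Lq_sharp q \<Omega>"
    by (rule Lq_sharp_lincomb[OF \<Omega> p pq f(1) classical_div_in_Lq_sharp[OF \<Omega> v q]])
  have "\<bar>\<Phi> u - (\<integral>x. u x * classical_div v x \<partial>lebesgue_on \<Omega>) - (\<integral>x. u x * ?g x \<partial>lebesgue_on \<Omega>)\<bar> \<le> e * T"
    if u: "u \<in> BV_space p \<Omega>" "total_variation \<Omega> u \<le> ereal T" for u T
  proof -
    have "f \<in> Lp_space q \<Omega>" using f(1) by (simp add: Lq_sharp_def)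
    then have "(\<integral>x. u x * ?g x \<partial>lebesgue_on \<Omega>)
        = (\<integral>x. u x * f x \<partial>lebesgue_on \<Omega>) - (\<integral>x. u x * classical_div v x \<partial>lebesgue_on \<Omega>)"
      using Holder_inequality(1)[OF p pq BV_spaceD(1)[OF u(1)], of f]
        Lp_test_integrable[OF \<Omega> p BV_spaceD(1)[OF u(1)] classical_div_test_function[OF v]]
      by (simp add: right_diff_distrib)
    then show ?thesis using f(2)[OF u] by simp
  qed
  then show "\<exists>f\<in>Lq_sharp q \<Omega>. \<forall>u\<in>BV_space p \<Omega>. \<forall>T. total_variation \<Omega> u \<le> ereal T \<longrightarrow>
    \<bar>\<Phi> u - (\<integral>x. u x * classical_div v x \<partial>lebesgue_on \<Omega>) - (\<integral>x. u x * f x \<partial>lebesgue_on \<Omega>)\<bar> \<le> e * T"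
    by (intro bexI[OF _ g] ballI allI impI)
qed

lemma Lq_limit_form_approx_divergence:
  fixes \<Omega> :: "(real^'n) set"
  assumes \<Omega>: "open \<Omega>" "\<Omega> \<noteq> {}" and p: "1 < p" "p \<le> 2" and pq: "1 / p + 1 / q = 1" and P: "poincare_ineq p \<Omega> c"
    and \<Phi>: "Lq_limit_form p q \<Omega> \<Phi>" and M: "0 \<le> M"
    and bd: "\<And>u T. u \<in> BV_space p \<Omega> \<Longrightarrow> total_variation \<Omega> u \<le> ereal T \<Longrightarrow> \<bar>\<Phi> u\<bar> \<le> M * T"
    and e: "0 < e"
  shows "\<exists>v\<in>test_fields \<Omega>. (\<forall>x. norm (v x) \<le> M + e) \<and>
    (\<forall>u\<in>BV_space p \<Omega>. \<forall>T. total_variation \<Omega> u \<le> ereal T \<longrightarrow>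
      \<bar>\<Phi> u - (\<integral>x. u x * classical_div v x \<partial>lebesgue_on \<Omega>)\<bar> \<le> e * T)"
proof -
  have e2: "0 < e / 2" using e by simp
  obtain f where f: "f \<in> Lq_sharp q \<Omega>" "\<And>u T. u \<in> BV_space p \<Omega> \<Longrightarrow> total_variation \<Omega> u \<le> ereal T \<Longrightarrow>
    \<bar>\<Phi> u - (\<integral>x. u x * f x \<partial>lebesgue_on \<Omega>)\<bar> \<le> e / 2 * T"
    using \<Phi> e2 unfolding Lq_limit_form_def by meson
  have fL: "f \<in> Lp_space q \<Omega>" using f(1) by (simp add: Lq_sharp_def)
  have c: "0 < c" using P by (simp add: poincare_ineq_def)
  have q: "0 < q" using conj_exponent[OF p(1) pq] by simp
  \<comment> \<open>\<open>f\<close> differs from \<Phi> by at most e/2 in the dual norm, hence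
    obeys the bound M + e/2.\<close>
  define N where "N = M + e / 2"
  have N: "0 < N" using M e by (simp add: N_def)
  \<comment> \<open>The bound on \<Phi> is known on \<open>BV_space\<close>, but separation needs it
    for every L_p function of finite variation. Smooth approximations, which lie in
    \<open>BV_space\<close>, transfer it.\<close>
  have bdN: "(\<integral>x. u x * f x \<partial>lebesgue_on \<Omega>) \<le> N * T" if u: "u \<in> Lp_space p \<Omega>" "total_variation \<Omega> u \<le> ereal T" for u T
  proof (rule field_le_epsilon)
    fix r :: real assume r: "0 < r"
    define s where "s = r / (N + 1)"
    have s: "0 < s" using r N by (simp add: s_def)
    obtain w where w: "w \<in> Lp_space p \<Omega>" "smooth_fun_on \<Omega> w" "total_variation \<Omega> w \<le> ereal (T + s)"
      "\<bar>(\<integral>x. w x * f x \<partial>lebesgue_on \<Omega>) - (\<integral>x. u x * f x \<partial>lebesgue_on \<Omega>)\<bar> \<le> s"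
      using smooth_approximation_pairing[OF \<Omega> p(1) pq u fL s] by blast
    have wB: "w \<in> BV_space p \<Omega>" by (rule smooth_BV_space[OF \<Omega> w(1-3)])
    have "(\<integral>x. w x * f x \<partial>lebesgue_on \<Omega>) \<le> M * (T + s) + e / 2 * (T + s)"
      using bd[OF wB w(3)] f(2)[OF wB w(3)] by linarith
    also have "\<dots> = N * (T + s)" by (simp add: N_def algebra_simps)
    finally have "(\<integral>x. u x * f x \<partial>lebesgue_on \<Omega>) \<le> N * (T + s) + s" using w(4) by linarith
    also have "\<dots> = N * T + s * (N + 1)" by (simp add: algebra_simps)
    also have "\<dots> = N * T + r" using N by (simp add: s_def)
    finally show "(\<integral>x. u x * f x \<partial>lebesgue_on \<Omega>) \<le> N * T + r" .
  qed
  \<comment> \<open>The Poincare inequality multiplies the L_q error by \<open>c\<close>, which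
    leaves e/2 in the dual norm.\<close>
  have d: "0 < e / 2 / c" using e c by simp
  obtain v where v: "v \<in> test_fields \<Omega>" "\<And>x. norm (v x) \<le> N"
    "Lp_norm q \<Omega> (\<lambda>x. f x - classical_div v x) \<le> e / 2 / c"
    using Lq_approx_by_divergences[OF \<Omega> p pq fL N bdN d] by blast
  have "\<bar>\<Phi> u - (\<integral>x. u x * classical_div v x \<partial>lebesgue_on \<Omega>)\<bar> \<le> e * T"
    if u: "u \<in> BV_space p \<Omega>" "total_variation \<Omega> u \<le> ereal T" for u T
  proof -
    have T: "0 \<le> T" by (rule total_variation_bound_nonneg[OF \<Omega>(2) u(2)])
    have g: "(\<lambda>x. f x - classical_div v x) \<in> Lq_sharp q \<Omega>"
      using Lq_sharp_lincomb[OF \<Omega>(1) p(1) pq f(1) classical_div_in_Lq_sharp[OF \<Omega>(1) v(1) q], of 1 "-1"] by simp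
    have "\<bar>\<integral>x. u x * (f x - classical_div v x) \<partial>lebesgue_on \<Omega>\<bar> \<le> c * Lp_norm q \<Omega> (\<lambda>x. f x - classical_div v x) * T"
      by (rule Poincare_pairing_bound[OF \<Omega> p(1) pq P BV_spaceD(1)[OF u(1)] u(2) g])
    also have "\<dots> \<le> c * (e / 2 / c) * T" using c T v(3) by (intro mult_right_mono mult_left_mono) auto
    also have "\<dots> = e / 2 * T" using c by simp
    finally have "\<bar>(\<integral>x. u x * f x \<partial>lebesgue_on \<Omega>) - (\<integral>x. u x * classical_div v x \<partial>lebesgue_on \<Omega>)\<bar> \<le> e / 2 * T"
      using Holder_inequality(1)[OF p(1) pq BV_spaceD(1)[OF u(1)] fL]
        Lp_test_integrable[OF \<Omega>(1) p(1) BV_spaceD(1)[OF u(1)] classical_div_test_function[OF v(1)]]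
      by (simp add: right_diff_distrib)
    moreover have "e / 2 * T + e / 2 * T = e * T" by simp
    ultimately show ?thesis using f(2)[OF u] by linarith
  qed
  moreover have "norm (v x) \<le> M + e" for x using v(2)[of x] e by (simp add: N_def)
  ultimately show ?thesis using v(1) by blast
qed

section \<open>Removing the errors\<close>

lemma uniform_limit_test_fields:
  fixes V :: "nat \<Rightarrow> real^'n \<Rightarrow> real^'n"
  assumes V: "\<And>n. V n \<in> test_fields \<Omega>" and step: "\<And>n x. norm (V (Suc n) x - V n x) \<le> a * (1/2) ^ n"
  obtains v where "v \<in> C0_fields \<Omega>" "\<And>n x. norm (v x - V n x) \<le> 2 * a * (1/2) ^ n"
proof -
  have sm: "summable (\<lambda>n. a * (1/2::real) ^ n)" by (intro summable_mult summable_geometric) simp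
  have conv: "convergent (\<lambda>n. V n x)" for x
  proof -
    have "summable (\<lambda>n. V (Suc n) x - V n x)"
      by (rule summable_comparison_test'[OF sm, of 0]) (rule step)
    then have "convergent (\<lambda>n. \<Sum>i<n. V (Suc i) x - V i x)" by (simp add: summable_iff_convergent)
    then have "convergent (\<lambda>n. V n x - V 0 x)" by (simp add: sum_lessThan_telescope[of "\<lambda>i. V i x"])
    then show ?thesis by (simp add: convergent_diff_const_right_iff)
  qed
  define v where "v x = lim (\<lambda>n. V n x)" for x
  have lim: "(\<lambda>n. V n x) \<longlonglongrightarrow> v x" for x using conv by (simp add: v_def convergent_LIMSEQ_iff)
  \<comment> \<open>The exact geometric sum, with its subtracted remainder, is what the induction on
    \<open>m\<close> reproduces.\<close>
  have tail: "norm (V (n + m) x - V n x) \<le> 2 * a * (1/2) ^ n - 2 * a * (1/2) ^ (n + m)" for n m x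
  proof (induction m)
    case (Suc m)
    have "norm (V (n + Suc m) x - V n x) \<le> norm (V (Suc (n + m)) x - V (n + m) x) + norm (V (n + m) x - V n x)"
      using norm_triangle_ineq[of "V (Suc (n + m)) x - V (n + m) x" "V (n + m) x - V n x"] by simp
    also have "\<dots> \<le> a * (1/2) ^ (n + m) + (2 * a * (1/2) ^ n - 2 * a * (1/2) ^ (n + m))"
      by (intro add_mono step Suc)
    finally show ?case by simp
  qed simp
  have "norm (V (Suc 0) undefined - V 0 undefined) \<le> a" using step[of 0 undefined] by simp
  then have a: "0 \<le> a" by (rule order_trans[OF norm_ge_zero])
  have vV: "norm (v x - V n x) \<le> 2 * a * (1/2) ^ n" for n x
  proof (rule LIMSEQ_le_const2)
    show "(\<lambda>m. norm (V (n + m) x - V n x)) \<longlonglongrightarrow> norm (v x - V n x)"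
      using LIMSEQ_ignore_initial_segment[OF lim[of x], of n] by (intro tendsto_intros) (simp add: add.commute)
    have "norm (V (n + m) x - V n x) \<le> 2 * a * (1/2) ^ n" for m
    proof -
      have "0 \<le> 2 * a * (1/2) ^ (n + m)" using a by simp
      then show ?thesis using tail[of n m x] by linarith
    qed
    then show "\<exists>N. \<forall>m\<ge>N. norm (V (n + m) x - V n x) \<le> 2 * a * (1/2) ^ n" by blast
  qed
  have small: "\<exists>n. 2 * a * (1/2) ^ n < e" if "0 < e" for e :: real
  proof -
    have "(\<lambda>n. 2 * a * (1/2::real) ^ n) \<longlonglongrightarrow> 2 * a * 0" by (intro tendsto_intros LIMSEQ_power_zero) simp
    then have "\<forall>\<^sub>F n in sequentially. 2 * a * (1/2::real) ^ n < e" using that by (intro order_tendstoD) auto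
    then show ?thesis by (auto simp: eventually_sequentially)
  qed
  have Vc: "continuous_on \<Omega> (V n)" for n
  proof -
    have "continuous_on \<Omega> (\<lambda>x. \<chi> i. V n x $ i)"
      by (intro continuous_intros test_function_continuous[OF test_fieldD[OF V]])
    then show ?thesis by simp
  qed
  have "uniform_limit \<Omega> V v sequentially"
  proof (rule uniform_limitI)
    fix e :: real assume "0 < e"
    then obtain n where n: "2 * a * (1/2) ^ n < e" using small by blast
    have "dist (V m x) (v x) < e" if "n \<le> m" for m x
    proof -
      have "dist (V m x) (v x) \<le> 2 * a * (1/2) ^ m" using vV[of x m] by (simp add: dist_norm norm_minus_commute)
      also have "\<dots> \<le> 2 * a * (1/2) ^ n" using a that by (intro mult_left_mono power_decreasing) auto
      finally show ?thesis using n by simp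
    qed
    then show "\<forall>\<^sub>F m in sequentially. \<forall>x\<in>\<Omega>. dist (V m x) (v x) < e" by (auto simp: eventually_sequentially)
  qed
  then have "continuous_on \<Omega> v" by (rule uniform_limit_theorem[rotated]) (auto simp: Vc)
  moreover have "\<exists>K. compact K \<and> K \<subseteq> \<Omega> \<and> (\<forall>x\<in>\<Omega> - K. norm (v x) < e)" if e: "0 < e" for e
  proof -
    obtain n where n: "2 * a * (1/2) ^ n < e" using small[OF e] by blast
    obtain K where K: "compact K" "K \<subseteq> \<Omega>" "\<And>x i. x \<notin> K \<Longrightarrow> V n x $ i = 0"
      using test_field_support[OF V[of n]] by metis
    have "norm (v x) < e" if "x \<notin> K" for x
    proof -
      have "V n x = 0" using K(3)[OF that] by (simp add: vec_eq_iff)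
      then show ?thesis using vV[of x n] n by simp
    qed
    then show ?thesis using K by blast
  qed
  ultimately have "v \<in> C0_fields \<Omega>" by (simp add: C0_fields_def)
  then show thesis using that vV by blast
qed

text \<open>The iteration in the proof of the open mapping theorem.\<close>

lemma Lq_limit_form_is_divergence:
  fixes \<Omega> :: "(real^'n) set"
  assumes \<Omega>: "open \<Omega>" "\<Omega> \<noteq> {}" and p: "1 < p" "p \<le> 2" and pq: "1 / p + 1 / q = 1" and P: "poincare_ineq p \<Omega> c"
    and \<Phi>: "Lq_limit_form p q \<Omega> \<Phi>" and M: "0 \<le> M"
    and bd: "\<And>u T. u \<in> BV_space p \<Omega> \<Longrightarrow> total_variation \<Omega> u \<le> ereal T \<Longrightarrow> \<bar>\<Phi> u\<bar> \<le> M * T"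
    and e: "0 < e"
  shows "\<exists>v\<in>C0_fields \<Omega>. (\<forall>x. norm (v x) \<le> M + e) \<and>
    (\<forall>u\<in>BV_space p \<Omega>. div_op p \<Omega> v (cst_class p \<Omega> u) = \<Phi> u)"
proof -
  \<comment> \<open>The first field costs \<open>a\<close> beyond \<open>M\<close>, and the later
    corrections, of size at most 2 a 2^-n, add up to 4 a.\<close>
  define a where "a = e / 5"
  have a: "0 < a" using e by (simp add: a_def)
  define I where "I v u = (\<integral>x. u x * classical_div v x \<partial>lebesgue_on \<Omega>)" for v and u :: "real^'n \<Rightarrow> real"
  define Q where "Q n v \<longleftrightarrow> v \<in> test_fields \<Omega> \<and> (\<forall>u\<in>BV_space p \<Omega>. \<forall>T. total_variation \<Omega> u \<le> ereal T \<longrightarrow>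
    \<bar>\<Phi> u - I v u\<bar> \<le> a * (1/2) ^ n * T)" for n :: nat and v
  have "\<exists>v\<in>test_fields \<Omega>. (\<forall>x. norm (v x) \<le> M + a) \<and>
    (\<forall>u\<in>BV_space p \<Omega>. \<forall>T. total_variation \<Omega> u \<le> ereal T \<longrightarrow> \<bar>\<Phi> u - I v u\<bar> \<le> a * T)"
    unfolding I_def by (rule Lq_limit_form_approx_divergence[OF \<Omega> p pq P \<Phi> M bd a])
  then obtain v0 where v0: "Q 0 v0" "\<And>x. norm (v0 x) \<le> M + a" by (auto simp: Q_def)
  \<comment> \<open>The residual after step \<open>n\<close> has dual norm at most a 2^-n. Solving
    it up to half of that takes a field of size at most a 2^-n + a 2^-(n+1), which is below 2 a
    2^-n.\<close>
  have next_field: "\<exists>w. Q (Suc n) w \<and> (\<forall>x. norm (w x - v x) \<le> 2 * a * (1/2) ^ n)" if Q: "Q n v" for n v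
  proof -
    have vt: "v \<in> test_fields \<Omega>" using Q by (simp add: Q_def)
    have b0: "0 \<le> a * (1/2) ^ n" and b1: "0 < a * (1/2) ^ Suc n" using a by auto
    have qb: "\<bar>\<Phi> u - I v u\<bar> \<le> a * (1/2) ^ n * T" if "u \<in> BV_space p \<Omega>" "total_variation \<Omega> u \<le> ereal T" for u T
      using Q that by (simp add: Q_def)
    have "\<exists>z\<in>test_fields \<Omega>. (\<forall>x. norm (z x) \<le> a * (1/2) ^ n + a * (1/2) ^ Suc n) \<and>
      (\<forall>u\<in>BV_space p \<Omega>. \<forall>T. total_variation \<Omega> u \<le> ereal T \<longrightarrow>
        \<bar>(\<Phi> u - I v u) - I z u\<bar> \<le> a * (1/2) ^ Suc n * T)"
      unfolding I_def
      by (rule Lq_limit_form_approx_divergence[OF \<Omega> p pq P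
            Lq_limit_form_minus_divergence[OF \<Omega>(1) p(1) pq \<Phi> vt] b0 qb[unfolded I_def] b1])
    then obtain z where z: "z \<in> test_fields \<Omega>" "\<And>x. norm (z x) \<le> a * (1/2) ^ n + a * (1/2) ^ Suc n"
      "\<And>u T. u \<in> BV_space p \<Omega> \<Longrightarrow> total_variation \<Omega> u \<le> ereal T \<Longrightarrow>
        \<bar>(\<Phi> u - I v u) - I z u\<bar> \<le> a * (1/2) ^ Suc n * T" by blast
    let ?w = "\<lambda>x. v x + z x"
    have "I ?w u = I v u + I z u" if "u \<in> BV_space p \<Omega>" for u
      using Lp_test_integrable[OF \<Omega>(1) p(1) BV_spaceD(1)[OF that] classical_div_test_function[OF vt]]
        Lp_test_integrable[OF \<Omega>(1) p(1) BV_spaceD(1)[OF that] classical_div_test_function[OF z(1)]]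
      by (simp add: I_def classical_div_add[OF vt z(1)] distrib_left)
    then have "Q (Suc n) ?w"
      using z(3) test_fields_add[OF vt z(1)] by (simp add: Q_def diff_diff_eq)
    moreover have "norm (?w x - v x) \<le> 2 * a * (1/2) ^ n" for x
    proof -
      have "a * (1/2) ^ Suc n \<le> a * (1/2) ^ n" using a by simp
      then show ?thesis using z(2)[of x] by simp
    qed
    ultimately show ?thesis by blast
  qed
  obtain V where V: "V 0 = v0" "\<And>n. Q n (V n)" "\<And>n x. norm (V (Suc n) x - V n x) \<le> 2 * a * (1/2) ^ n"
  proof -
    define G where "G n v = (SOME w. Q (Suc n) w \<and> (\<forall>x. norm (w x - v x) \<le> 2 * a * (1/2) ^ n))" for n v
    define V where "V = rec_nat v0 G"
    have G: "Q (Suc n) (G n v) \<and> (\<forall>x. norm (G n v x - v x) \<le> 2 * a * (1/2) ^ n)" if "Q n v" for n v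
      unfolding G_def by (rule someI_ex[OF next_field[OF that]])
    have Vs: "V 0 = v0" "V (Suc n) = G n (V n)" for n by (simp_all add: V_def)
    have VQ: "Q n (V n)" for n
    proof (induction n)
      case (Suc n)
      then show ?case using G[of n "V n"] by (simp add: Vs)
    qed (simp add: Vs v0)
    have "norm (V (Suc n) x - V n x) \<le> 2 * a * (1/2) ^ n" for n x
      using G[OF VQ, of n] by (simp add: Vs)
    then show ?thesis using that Vs(1) VQ by blast
  qed
  have Vt: "V n \<in> test_fields \<Omega>" for n using V(2) by (simp add: Q_def)
  obtain v where v: "v \<in> C0_fields \<Omega>" "\<And>n x. norm (v x - V n x) \<le> 2 * (2 * a) * (1/2) ^ n"
    using uniform_limit_test_fields[OF Vt V(3)] by blast
  have vn: "norm (v x) \<le> M + e" for x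
  proof -
    have "norm (v x) \<le> norm (v x - V 0 x) + norm (V 0 x)" using norm_triangle_ineq[of "v x - V 0 x" "V 0 x"] by simp
    also have "\<dots> \<le> 2 * (2 * a) * (1/2) ^ 0 + (M + a)" by (intro add_mono v(2)) (simp add: V(1) v0(2))
    also have "\<dots> = M + e" by (simp add: a_def)
    finally show ?thesis .
  qed
  have half: "(\<lambda>n. b * (1/2::real) ^ n) \<longlonglongrightarrow> 0" for b
    using tendsto_mult[OF tendsto_const LIMSEQ_power_zero[of "1/2::real"], of b] by simp
  have "div_op p \<Omega> v (cst_class p \<Omega> u) = \<Phi> u" if u: "u \<in> BV_space p \<Omega>" for u
  proof -
    have "(\<lambda>n. I (V n) u) \<longlonglongrightarrow> div_op p \<Omega> v (cst_class p \<Omega> u)"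
      unfolding I_def by (rule div_op_limit[OF \<Omega>(1) p(1) v(1) u Vt v(2) half])
    moreover have "(\<lambda>n. I (V n) u) \<longlonglongrightarrow> \<Phi> u"
    proof -
      obtain T where T: "total_variation \<Omega> u \<le> ereal T"
        using BV_space_total_variation_finite[OF \<Omega> p(1) u] by metis
      have "(\<lambda>n. I (V n) u - \<Phi> u) \<longlonglongrightarrow> 0"
      proof (rule Lim_null_comparison)
        have "\<bar>\<Phi> u - I (V n) u\<bar> \<le> a * (1/2) ^ n * T" for n using V(2)[of n] u T unfolding Q_def by blast
        then show "\<forall>\<^sub>F n in sequentially. norm (I (V n) u - \<Phi> u) \<le> (a * T) * (1/2) ^ n"
          by (simp add: abs_minus_commute mult_ac)
      qed (rule half)
      then show ?thesis by (rule Lim_null[THEN iffD2])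
    qed
    ultimately show ?thesis by (rule LIMSEQ_unique)
  qed
  then show ?thesis using v(1) vn by blast
qed

lemma Lq_sharp_limit_form:
  fixes \<Omega> :: "(real^'n) set"
  assumes f: "f \<in> Lq_sharp q \<Omega>" and \<Omega>: "\<Omega> \<noteq> {}"
  shows "Lq_limit_form p q \<Omega> (\<lambda>u. \<integral>x. u x * f x \<partial>lebesgue_on \<Omega>)"
  unfolding Lq_limit_form_def
proof (intro allI impI bexI[OF _ f] ballI)
  fix e T :: real and u assume "0 < e" "total_variation \<Omega> u \<le> ereal T"
  then have "0 \<le> e * T" using total_variation_bound_nonneg[OF \<Omega>] by simp
  then show "\<bar>(\<integral>x. u x * f x \<partial>lebesgue_on \<Omega>) - (\<integral>x. u x * f x \<partial>lebesgue_on \<Omega>)\<bar> \<le> e * T" by simp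
qed

lemma sup_norm_le: "\<Omega> \<noteq> {} \<Longrightarrow> (\<And>x. norm (v x) \<le> B) \<Longrightarrow> sup_norm \<Omega> v \<le> B"
  unfolding sup_norm_def by (intro cSUP_least)

theorem theoremC:
  fixes \<Omega> :: "(real^'n) set" and p q c :: real
  assumes "CARD('n) \<ge> 2"
    and "open \<Omega>" and "\<Omega> \<noteq> {}"
    and "1 < p" and "p \<le> real CARD('n) / (real CARD('n) - 1)"
    and "1 / p + 1 / q = 1"
    and "poincare_ineq p \<Omega> c"
  shows "div_op p \<Omega> ` C0_fields \<Omega> = W_dual p q \<Omega> \<and>
    (\<forall>f\<in>Lq_sharp q \<Omega>. \<forall>\<epsilon>>0. \<exists>v\<in>C0_fields \<Omega>.
       div_op p \<Omega> v = form_of p \<Omega> f \<and>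
       sup_norm \<Omega> v \<le> (1 + \<epsilon>) * c * Lp_norm q \<Omega> f)"
proof -
  note \<Omega> = assms(2,3) and p1 = assms(4) and pq = assms(6) and P = assms(7)
  \<comment> \<open>This is where the dimension enters: m >= 2 gives m / (m - 1) <= 2.\<close>
  have "real CARD('n) / (real CARD('n) - 1) \<le> 2" using assms(1) by (simp add: divide_le_eq)
  then have p2: "p \<le> 2" using assms(5) by simp
  have c: "0 < c" using P by (simp add: poincare_ineq_def)
  have form_bound: "\<bar>\<integral>x. u x * f x \<partial>lebesgue_on \<Omega>\<bar> \<le> c * Lp_norm q \<Omega> f * T"
    if "f \<in> Lq_sharp q \<Omega>" "u \<in> BV_space p \<Omega>" "total_variation \<Omega> u \<le> ereal T" for f u T
    by (rule Poincare_pairing_bound[OF \<Omega> p1 pq P BV_spaceD(1)[OF that(2)] that(3,1)])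
  have surj: "\<exists>v\<in>C0_fields \<Omega>. div_op p \<Omega> v = F" if F: "F \<in> W_dual p q \<Omega>" for F
  proof -
    have \<Phi>: "Lq_limit_form p q \<Omega> (\<lambda>u. F (cst_class p \<Omega> u))"
      unfolding Lq_limit_form_def using W_dual_approx[OF \<Omega> p1 pq F] by blast
    \<comment> \<open>Any finite bound for the norm of \<open>F\<close> serves here; an
      approximation with error 1 supplies one.\<close>
    obtain f where f: "f \<in> Lq_sharp q \<Omega>" "\<And>u T. u \<in> BV_space p \<Omega> \<Longrightarrow> total_variation \<Omega> u \<le> ereal T \<Longrightarrow>
      \<bar>F (cst_class p \<Omega> u) - (\<integral>x. u x * f x \<partial>lebesgue_on \<Omega>)\<bar> \<le> 1 * T"
      using W_dual_approx[OF \<Omega> p1 pq F zero_less_one] by blast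
    have M: "0 \<le> c * Lp_norm q \<Omega> f + 1" using c Lp_norm_nonneg[of q \<Omega> f] by simp
    have bd: "\<bar>F (cst_class p \<Omega> u)\<bar> \<le> (c * Lp_norm q \<Omega> f + 1) * T"
      if u: "u \<in> BV_space p \<Omega>" "total_variation \<Omega> u \<le> ereal T" for u T
      using f(2)[OF u] form_bound[OF f(1) u] by (simp add: distrib_right)
    obtain v where v: "v \<in> C0_fields \<Omega>" "\<And>u. u \<in> BV_space p \<Omega> \<Longrightarrow> div_op p \<Omega> v (cst_class p \<Omega> u) = F (cst_class p \<Omega> u)"
      using Lq_limit_form_is_divergence[OF \<Omega> p1 p2 pq P \<Phi> M bd zero_less_one] by blast
    \<comment> \<open>Off \<open>BV_cst\<close> both sides are \<open>undefined\<close>, so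
      agreement on classes is equality of forms.\<close>
    have "div_op p \<Omega> v X = F X" for X
    proof (cases "X \<in> BV_cst p \<Omega>")
      case True
      then show ?thesis using v(2) by (auto simp: BV_cst_def)
    next
      case False
      then show ?thesis using F by (auto simp: W_dual_def div_op_def extensional_def)
    qed
    then show ?thesis using v(1) by blast
  qed
  have "\<exists>v\<in>C0_fields \<Omega>. div_op p \<Omega> v = form_of p \<Omega> f \<and> sup_norm \<Omega> v \<le> (1 + \<epsilon>) * c * Lp_norm q \<Omega> f"
    if f: "f \<in> Lq_sharp q \<Omega>" and \<epsilon>: "0 < \<epsilon>" for f \<epsilon>
  proof -
    define M where "M = c * Lp_norm q \<Omega> f"
    have M: "0 \<le> M" using c Lp_norm_nonneg[of q \<Omega> f] by (simp add: M_def)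
    have "\<exists>v\<in>C0_fields \<Omega>. (\<forall>x. norm (v x) \<le> (1 + \<epsilon>) * M) \<and>
      (\<forall>u\<in>BV_space p \<Omega>. div_op p \<Omega> v (cst_class p \<Omega> u) = (\<integral>x. u x * f x \<partial>lebesgue_on \<Omega>))"
    \<comment> \<open>The iteration requires a positive additive error. For M > 0 it is taken to be
      \<epsilon> M, which gives the factor 1 + \<epsilon>; for M = 0 the form vanishes and the zero
      field is a solution.\<close>
    proof (cases "M = 0")
      case True
      have C0: "(\<lambda>_. 0) \<in> C0_fields \<Omega>" by (auto simp: C0_fields_def intro!: exI[of _ "{}"])
      have "div_op p \<Omega> (\<lambda>_. 0) (cst_class p \<Omega> u) = (\<integral>x. u x * f x \<partial>lebesgue_on \<Omega>)" if u: "u \<in> BV_space p \<Omega>" for u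
      proof -
        obtain T where T: "total_variation \<Omega> u \<le> ereal T"
          using BV_space_total_variation_finite[OF \<Omega> p1 u] by metis
        have "\<bar>div_op p \<Omega> (\<lambda>_. 0) (cst_class p \<Omega> u) - (\<integral>x. u x * classical_div (\<lambda>_. 0) x \<partial>lebesgue_on \<Omega>)\<bar> \<le> 0 * T"
          by (rule div_op_uniform_bound[OF \<Omega> p1 C0 u T test_field_zero]) auto
        moreover have "\<bar>\<integral>x. u x * f x \<partial>lebesgue_on \<Omega>\<bar> \<le> 0"
          using form_bound[OF f u T] True unfolding M_def[symmetric] by simp
        ultimately show ?thesis by (simp add: classical_div_zero)
      qed
      then show ?thesis using C0 True by (intro bexI[of _ "\<lambda>_. 0"]) auto
    next
      case False
      then have "0 < \<epsilon> * M" using M \<epsilon> by simp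
      from Lq_limit_form_is_divergence[OF \<Omega> p1 p2 pq P Lq_sharp_limit_form[OF f \<Omega>(2)] M _ this] form_bound[OF f]
      show ?thesis by (simp add: M_def distrib_right)
    qed
    then obtain v where v: "v \<in> C0_fields \<Omega>" "\<And>x. norm (v x) \<le> (1 + \<epsilon>) * M"
      "\<And>u. u \<in> BV_space p \<Omega> \<Longrightarrow> div_op p \<Omega> v (cst_class p \<Omega> u) = (\<integral>x. u x * f x \<partial>lebesgue_on \<Omega>)" by blast
    have "div_op p \<Omega> v X = form_of p \<Omega> f X" for X
    proof (cases "X \<in> BV_cst p \<Omega>")
      case True
      then show ?thesis using v(3) pairing_cst_class[OF \<Omega>(1) p1 pq BV_spaceD(1) f]
        by (auto simp: BV_cst_def form_of_def)
    next
      case False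
      then show ?thesis by (simp add: div_op_def form_of_def)
    qed
    moreover have "sup_norm \<Omega> v \<le> (1 + \<epsilon>) * c * Lp_norm q \<Omega> f"
      using sup_norm_le[OF \<Omega>(2) v(2)] by (simp add: M_def mult.assoc)
    ultimately show ?thesis using v(1) by blast
  qed
  moreover have "div_op p \<Omega> ` C0_fields \<Omega> = W_dual p q \<Omega>"
    using div_op_in_W_dual[OF \<Omega> p1 pq] surj by blast
  ultimately show ?thesis by blast
qed

end
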